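(* Let $\pi$ and $\pi'$ be smooth $\overline{\mathbf F}_p$-representations of $G=\mathrm{GL}_2(F)$, and suppose $\pi$ is irreducible and admits a central character. Then: (i) if $\pi$ is in the principal series, then $\pi|_P$ has length $2$ as a representation of $P$; otherwise $\pi|_P$ is an irreducible representation of $P$. (ii) Restriction of maps to $P$ induces an isomorphism $\mathrm{Hom}_P(\mathrm{Sp},\pi')\cong \mathrm{Hom}_G(\mathrm{Ind}_P^G\mathbf 1,\pi')$ (where a $G$-map $\mathrm{Ind}_P^G\mathbf 1\to\pi'$ is restricted to the $P$-stable complement of $\mathbf 1$ identified with $\mathrm{Sp}|_P$), and if $\pi$ is not in the special series then $\mathrm{Hom}_P(\pi,\pi')\cong\mathrm{Hom}_G(\pi,\pi')$.
   Context: $F$ is a non-Archimedean local field with ring of integers $\mathfrak o$, maximal ideal $\mathfrak p$, uniformizer $\varpi$, residue field $\mathbf F_q$ of characteristic $p$. $G=\mathrm{GL}_2(F)$, $P$ the subgroup of upper triangular matrices, $T$ the diagonal torus, $U$ the upper unipotent subgroup. All representations are on $\overline{\mathbf F}_p$-vector spaces and smooth (every vector has open stabilizer). For a smooth character $\chi:T\to\overline{\mathbf F}_p^\times$, viewed as a character of $P$ via $P\to P/U\cong T$, $\mathrm{Ind}_P^G\chi$ is the space of locally constant $f:G\to\overline{\mathbf F}_p$ with $f(bg)=\chi(b)f(g)$ for $b\in P$, with $G$ acting by right translation. $\chi^s$ denotes the character $\chi^s(\mathrm{diag}(a,d))=\chi(\mathrm{diag}(d,a))$. $\mathrm{Sp}$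 is defined by the exact sequence $0\to\mathbf 1\to\mathrm{Ind}_P^G\mathbf 1\to\mathrm{Sp}\to 0$. An irreducible smooth representation of $G$ with central character is: a character $\psi\circ\det$; in the principal series if it is $\mathrm{Ind}_P^G\chi$ with $\chi\neq\chi^s$; in the special series if it is $\mathrm{Sp}\otimes\psi\circ\det$ for a smooth character $\psi:F^\times\to\overline{\mathbf F}_p^\times$; supersingular if it is not isomorphic to a subquotient of $\mathrm{Ind}_P^G\chi$ for any smooth character $\chi$ of $T$. (Every irreducible smooth representation with central character is of exactly one of these four types.) *)

theory Defs
  imports "HOL-Computational_Algebra.Polynomial" "HOL-Computational_Algebra.Primes"
          "HOL-Library.Function_Algebras"
begin

type_synonym 'f mat2 = "'f \<times> 'f \<times> 'f \<times> 'f"  \<comment> \<open>(a,b,c,d) is the matrix [[a,b],[c,d]]\<close>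

definition mmul :: "'f::comm_ring_1 mat2 \<Rightarrow> 'f mat2 \<Rightarrow> 'f mat2" where
  "mmul x y = (case x of (a,b,c,d) \<Rightarrow> case y of (a',b',c',d') \<Rightarrow>
      (a*a' + b*c', a*b' + b*d', c*a' + d*c', c*b' + d*d'))"

definition mdet :: "'f::comm_ring_1 mat2 \<Rightarrow> 'f" where
  "mdet x = (case x of (a,b,c,d) \<Rightarrow> a*d - b*c)"

definition mone :: "'f::comm_ring_1 mat2" where "mone = (1,0,0,1)"

definition GL2 :: "'f::field mat2 set" where "GL2 = {g. mdet g \<noteq> 0}"

definition Bor :: "'f::field mat2 set" where
  "Bor = {(a,b,c,d). c = 0 \<and> a \<noteq> 0 \<and> d \<noteq> 0}"

definition in_pow :: "('f::field \<Rightarrow> int) \<Rightarrow> int \<Rightarrow> 'f \<Rightarrow> bool" where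
  "in_pow v n x \<longleftrightarrow> x = 0 \<or> n \<le> v x"

definition nonarch_local_field :: "('f::field \<Rightarrow> int) \<Rightarrow> nat \<Rightarrow> bool" where
  "nonarch_local_field v p \<longleftrightarrow> prime p \<and>
     (\<forall>x y. x \<noteq> 0 \<longrightarrow> y \<noteq> 0 \<longrightarrow> v (x*y) = v x + v y) \<and>
     (\<forall>x y. x \<noteq> 0 \<longrightarrow> y \<noteq> 0 \<longrightarrow> x + y \<noteq> 0 \<longrightarrow> min (v x) (v y) \<le> v (x+y)) \<and>
     (\<exists>w. w \<noteq> 0 \<and> v w = 1) \<and>
     (\<forall>s::nat \<Rightarrow> 'f. (\<forall>n. \<exists>N. \<forall>i\<ge>N. \<forall>j\<ge>N. in_pow v n (s i - s j))
          \<longrightarrow> (\<exists>l. \<forall>n. \<exists>N. \<forall>i\<ge>N. in_pow v n (s i - l))) \<and>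
     finite ({x. in_pow v 0 x} // {(x,y). in_pow v 0 x \<and> in_pow v 0 y \<and> in_pow v 1 (x - y)}) \<and>
     in_pow v 1 (of_nat p)"

definition alg_closure_Fp :: "nat \<Rightarrow> 'k::field itself \<Rightarrow> bool" where
  "alg_closure_Fp p _ \<longleftrightarrow> prime p \<and> of_nat p = (0::'k) \<and>
     (\<forall>q::'k poly. 0 < degree q \<longrightarrow> (\<exists>x. poly q x = 0)) \<and>
     (\<forall>x::'k. \<exists>n>0. x ^ (p ^ n) = x)"

text \<open>Principal congruence subgroups K_n = 1 + M_2(p^n), n >= 1: a basis of open
  neighbourhoods of 1 in G.\<close>
definition Kcong :: "('f::field \<Rightarrow> int) \<Rightarrow> nat \<Rightarrow> 'f mat2 set" where
  "Kcong v n = {(a,b,c,d). in_pow v (int n) (a - 1) \<and> in_pow v (int n) b \<and>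
                            in_pow v (int n) c \<and> in_pow v (int n) (d - 1)}"

definition lin_subspace :: "('k::field \<Rightarrow> 'v::ab_group_add \<Rightarrow> 'v) \<Rightarrow> 'v set \<Rightarrow> bool" where
  "lin_subspace sc W \<longleftrightarrow> 0 \<in> W \<and> (\<forall>x\<in>W. \<forall>y\<in>W. x + y \<in> W) \<and> (\<forall>c. \<forall>x\<in>W. sc c x \<in> W)"

definition lin_on :: "('k::field \<Rightarrow> 'v::ab_group_add \<Rightarrow> 'v) \<Rightarrow> 'v set \<Rightarrow> ('v \<Rightarrow> 'v) \<Rightarrow> bool" where
  "lin_on sc V f \<longleftrightarrow> (\<forall>x\<in>V. \<forall>y\<in>V. f (x + y) = f x + f y) \<and> (\<forall>c. \<forall>x\<in>V. f (sc c x) = sc c (f x))"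

definition is_rep :: "('k::field \<Rightarrow> 'v::ab_group_add \<Rightarrow> 'v) \<Rightarrow> 'f::field mat2 set \<Rightarrow> 'v set
     \<Rightarrow> ('f mat2 \<Rightarrow> 'v \<Rightarrow> 'v) \<Rightarrow> bool" where
  "is_rep sc H V act \<longleftrightarrow> vector_space sc \<and> lin_subspace sc V \<and>
     (\<forall>g\<in>H. \<forall>x\<in>V. act g x \<in> V) \<and> (\<forall>g\<in>H. lin_on sc V (act g)) \<and>
     (\<forall>x\<in>V. act mone x = x) \<and>
     (\<forall>g\<in>H. \<forall>h\<in>H. \<forall>x\<in>V. act (mmul g h) x = act g (act h x))"

definition smooth_rep :: "('f::field \<Rightarrow> int) \<Rightarrow> ('k::field \<Rightarrow> 'v::ab_group_add \<Rightarrow> 'v) \<Rightarrow> 'v set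
     \<Rightarrow> ('f mat2 \<Rightarrow> 'v \<Rightarrow> 'v) \<Rightarrow> bool" where
  "smooth_rep v sc V act \<longleftrightarrow> is_rep sc GL2 V act \<and>
     (\<forall>x\<in>V. \<exists>n>0. \<forall>g\<in>Kcong v n. act g x = x)"

definition stable_sub :: "('k::field \<Rightarrow> 'v::ab_group_add \<Rightarrow> 'v) \<Rightarrow> 'f::field mat2 set
     \<Rightarrow> ('f mat2 \<Rightarrow> 'v \<Rightarrow> 'v) \<Rightarrow> 'v set \<Rightarrow> bool" where
  "stable_sub sc H act W \<longleftrightarrow> lin_subspace sc W \<and> (\<forall>g\<in>H. \<forall>x\<in>W. act g x \<in> W)"

definition irred :: "('k::field \<Rightarrow> 'v::ab_group_add \<Rightarrow> 'v) \<Rightarrow> 'f::field mat2 set \<Rightarrow> 'v set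
     \<Rightarrow> ('f mat2 \<Rightarrow> 'v \<Rightarrow> 'v) \<Rightarrow> bool" where
  "irred sc H V act \<longleftrightarrow> V \<noteq> {0} \<and>
     (\<forall>W. W \<subseteq> V \<longrightarrow> stable_sub sc H act W \<longrightarrow> W = {0} \<or> W = V)"

definition rep_length :: "('k::field \<Rightarrow> 'v::ab_group_add \<Rightarrow> 'v) \<Rightarrow> 'f::field mat2 set \<Rightarrow> 'v set
     \<Rightarrow> ('f mat2 \<Rightarrow> 'v \<Rightarrow> 'v) \<Rightarrow> nat \<Rightarrow> bool" where
  "rep_length sc H V act n \<longleftrightarrow> (\<exists>W :: nat \<Rightarrow> 'v set. W 0 = {0} \<and> W n = V \<and>
     (\<forall>i\<le>n. stable_sub sc H act (W i)) \<and>
     (\<forall>i<n. W i \<subset> W (Suc i) \<and>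
        (\<forall>U. stable_sub sc H act U \<longrightarrow> W i \<subseteq> U \<longrightarrow> U \<subseteq> W (Suc i) \<longrightarrow> U = W i \<or> U = W (Suc i))))"

definition has_central_char :: "('k::field \<Rightarrow> 'v::ab_group_add \<Rightarrow> 'v) \<Rightarrow> 'v set
     \<Rightarrow> ('f::field mat2 \<Rightarrow> 'v \<Rightarrow> 'v) \<Rightarrow> bool" where
  "has_central_char sc V act \<longleftrightarrow> (\<exists>\<omega>::'f \<Rightarrow> 'k. \<forall>z. z \<noteq> 0 \<longrightarrow> (\<forall>x\<in>V. act (z,0,0,z) x = sc (\<omega> z) x))"

definition hom :: "('k::field \<Rightarrow> 'v::ab_group_add \<Rightarrow> 'v) \<Rightarrow> 'f::field mat2 set \<Rightarrow> 'v set
     \<Rightarrow> ('f mat2 \<Rightarrow> 'v \<Rightarrow> 'v) \<Rightarrow> ('k \<Rightarrow> 'w::ab_group_add \<Rightarrow> 'w) \<Rightarrow> 'w set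
     \<Rightarrow> ('f mat2 \<Rightarrow> 'w \<Rightarrow> 'w) \<Rightarrow> ('v \<Rightarrow> 'w) set" where
  "hom sc H V act sc' V' act' = {\<phi>. (\<forall>x\<in>V. \<phi> x \<in> V') \<and>
     (\<forall>x\<in>V. \<forall>y\<in>V. \<phi> (x + y) = \<phi> x + \<phi> y) \<and> (\<forall>c. \<forall>x\<in>V. \<phi> (sc c x) = sc' c (\<phi> x)) \<and>
     (\<forall>g\<in>H. \<forall>x\<in>V. \<phi> (act g x) = act' g (\<phi> x)) \<and> (\<forall>x. x \<notin> V \<longrightarrow> \<phi> x = 0)}"

definition iso_rep :: "('k::field \<Rightarrow> 'v::ab_group_add \<Rightarrow> 'v) \<Rightarrow> 'f::field mat2 set \<Rightarrow> 'v set
     \<Rightarrow> ('f mat2 \<Rightarrow> 'v \<Rightarrow> 'v) \<Rightarrow> ('k \<Rightarrow> 'w::ab_group_add \<Rightarrow> 'w) \<Rightarrow> 'w set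
     \<Rightarrow> ('f mat2 \<Rightarrow> 'w \<Rightarrow> 'w) \<Rightarrow> bool" where
  "iso_rep sc H V act sc' V' act' \<longleftrightarrow> (\<exists>\<phi>\<in>hom sc H V act sc' V' act'. bij_betw \<phi> V V')"

definition restrict0 :: "'v set \<Rightarrow> ('v \<Rightarrow> 'w::zero) \<Rightarrow> 'v \<Rightarrow> 'w" where
  "restrict0 K \<phi> = (\<lambda>x. if x \<in> K then \<phi> x else 0)"

definition smooth_char1 :: "('f::field \<Rightarrow> int) \<Rightarrow> ('f \<Rightarrow> 'k::field) \<Rightarrow> bool" where
  "smooth_char1 v \<psi> \<longleftrightarrow> (\<forall>x y. x \<noteq> 0 \<longrightarrow> y \<noteq> 0 \<longrightarrow> \<psi> (x*y) = \<psi> x * \<psi> y) \<and>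
     (\<forall>x. x \<noteq> 0 \<longrightarrow> \<psi> x \<noteq> 0) \<and>
     (\<exists>n>0. \<forall>x. x \<noteq> 0 \<longrightarrow> in_pow v (int n) (x - 1) \<longrightarrow> \<psi> x = 1)"

text \<open>A character of T, chi a d = chi(diag(a,d)).\<close>
definition smooth_charT :: "('f::field \<Rightarrow> int) \<Rightarrow> ('f \<Rightarrow> 'f \<Rightarrow> 'k::field) \<Rightarrow> bool" where
  "smooth_charT v \<chi> \<longleftrightarrow>
     (\<forall>a d a' d'. a \<noteq> 0 \<longrightarrow> d \<noteq> 0 \<longrightarrow> a' \<noteq> 0 \<longrightarrow> d' \<noteq> 0 \<longrightarrow> \<chi> (a*a') (d*d') = \<chi> a d * \<chi> a' d') \<and>
     (\<forall>a d. a \<noteq> 0 \<longrightarrow> d \<noteq> 0 \<longrightarrow> \<chi> a d \<noteq> 0) \<and>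
     (\<exists>n>0. \<forall>a d. a \<noteq> 0 \<longrightarrow> d \<noteq> 0 \<longrightarrow> in_pow v (int n) (a - 1) \<longrightarrow> in_pow v (int n) (d - 1)
            \<longrightarrow> \<chi> a d = 1)"

definition loc_const_G :: "('f::field \<Rightarrow> int) \<Rightarrow> ('f mat2 \<Rightarrow> 'k) \<Rightarrow> bool" where
  "loc_const_G v f \<longleftrightarrow> (\<forall>g\<in>GL2. \<exists>n>0. \<forall>k\<in>Kcong v n. f (mmul g k) = f g)"

definition Ind :: "('f::field \<Rightarrow> int) \<Rightarrow> ('f \<Rightarrow> 'f \<Rightarrow> 'k::field) \<Rightarrow> ('f mat2 \<Rightarrow> 'k) set" where
  "Ind v \<chi> = {f. (\<forall>g. g \<notin> GL2 \<longrightarrow> f g = 0) \<and> loc_const_G v f \<and>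
     (\<forall>a b d. \<forall>g\<in>GL2. a \<noteq> 0 \<longrightarrow> d \<noteq> 0 \<longrightarrow> f (mmul (a,b,0,d) g) = \<chi> a d * f g)}"

definition ind_act :: "'f::field mat2 \<Rightarrow> ('f mat2 \<Rightarrow> 'k::field) \<Rightarrow> ('f mat2 \<Rightarrow> 'k)" where
  "ind_act g f = (\<lambda>x. if x \<in> GL2 then f (mmul x g) else 0)"

definition fscale :: "'k::field \<Rightarrow> ('a \<Rightarrow> 'k) \<Rightarrow> ('a \<Rightarrow> 'k)" where
  "fscale c f = (\<lambda>x. c * f x)"

definition triv_char :: "'f \<Rightarrow> 'f \<Rightarrow> 'k::field" where "triv_char a d = 1"

definition tw_act :: "('f::field \<Rightarrow> 'k::field) \<Rightarrow> 'f mat2 \<Rightarrow> ('f mat2 \<Rightarrow> 'k) \<Rightarrow> ('f mat2 \<Rightarrow> 'k)" where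
  "tw_act \<psi> g f = (\<lambda>x. if x \<in> GL2 then \<psi> (mdet g) * f (mmul x g) else 0)"

definition principal_series :: "('f::field \<Rightarrow> int) \<Rightarrow> ('k::field \<Rightarrow> 'v::ab_group_add \<Rightarrow> 'v) \<Rightarrow> 'v set
     \<Rightarrow> ('f mat2 \<Rightarrow> 'v \<Rightarrow> 'v) \<Rightarrow> bool" where
  "principal_series v sc V act \<longleftrightarrow> (\<exists>\<chi>. smooth_charT v \<chi> \<and>
     (\<exists>a d. a \<noteq> 0 \<and> d \<noteq> 0 \<and> \<chi> a d \<noteq> \<chi> d a) \<and>
     iso_rep fscale GL2 (Ind v \<chi>) ind_act sc V act)"

text \<open>Sp (x) psi o det = (Ind_P^G 1 (x) psi o det) / (1 (x) psi o det): V is isomorphic to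
  it iff there is a surjective G-map from Ind_P^G 1 (x) psi o det onto V whose kernel is
  exactly the constant functions.\<close>
definition special_series :: "('f::field \<Rightarrow> int) \<Rightarrow> ('k::field \<Rightarrow> 'v::ab_group_add \<Rightarrow> 'v) \<Rightarrow> 'v set
     \<Rightarrow> ('f mat2 \<Rightarrow> 'v \<Rightarrow> 'v) \<Rightarrow> bool" where
  "special_series v sc V act \<longleftrightarrow> (\<exists>\<psi>. smooth_char1 v \<psi> \<and>
     (\<exists>\<Phi>\<in>hom fscale GL2 (Ind v triv_char) (tw_act \<psi>) sc V act.
        \<Phi> ` Ind v triv_char = V \<and>
        {f\<in>Ind v triv_char. \<Phi> f = 0} = {f\<in>Ind v triv_char. \<exists>c. \<forall>g\<in>GL2. f g = c}))"

end

theory Submission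
  imports Defs "HOL-Library.Product_Plus"
begin

text \<open>
  The pro-\<open>p\<close> Iwahori group \<open>I1\<close> satisfies \<open>G = P I1 \<union> P sm I1\<close>, and every nonzero \<open>P\<close>-stable subspace of a
  smooth representation contains a nonzero \<open>I1\<close>-fixed vector \<open>z\<close>. For the operator \<open>U\<close> on \<open>I1\<close>-fixed vectors,
  \<open>sm (U z)\<close> is congruent to \<open>dm 1 \<pi> (sm z)\<close> modulo the \<open>P\<close>-span of \<open>z\<close>. So if \<open>U z = 0\<close>, the \<open>P\<close>-span of \<open>z\<close> is
  \<open>G\<close>-stable, and if \<open>U z = \<alpha> z\<close> with \<open>\<alpha> \<noteq> 0\<close>, it is a hyperplane in (or equal to) the \<open>G\<close>-span, which yields a
  \<open>G\<close>-map to a principal series by Frobenius reciprocity.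

  An eigenvector of \<open>U\<close> need not exist a priori. Either some nonzero polynomial in \<open>U\<close> annihilates \<open>U z\<close>, which
  gives one, or the \<open>P\<close>-translates of a certain finite-dimensional space are linearly independent, in which case
  a \<open>P\<close>-equivariant functional can be written down directly. In both cases an irreducible representation with a
  proper nonzero \<open>P\<close>-stable subspace is \<open>Ind \<chi>\<close>, and \<open>\<chi>\<close> is not fixed by the Weyl group because \<open>Ind \<chi>\<close> is irreducible.

  For homomorphisms, the same arguments apply to the graph of a \<open>P\<close>-map inside the product of the two
  representations: the graph is \<open>G\<close>-stable exactly when the map is \<open>G\<close>-equivariant. The only obstruction is a
  principal series containing the graph as a hyperplane, which makes \<open>V\<close> the quotient of a principal series by
  a character, hence special.
\<close>

subsection \<open>Valuations and residue classes\<close>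

text \<open>Without admissibility the \<open>I1\<close>-fixed vectors may span an
  infinite-dimensional space; this is why \<open>U\<close> need not have an eigenvector. What
  replaces finite dimension is characteristic p: an operator T with T^(p^m) = 1 satisfies (T -
  1)^(p^m) = 0, so finitely many commuting operators of this kind fix a common nonzero vector in
  every nonzero stable space, of whatever dimension. This single fact produces the
  \<open>I1\<close>-fixed vectors, makes linear relations translation-invariant, and yields
  invariant linear forms. \<open>P\<close> permutes the discs of the field transitively, and the
  stabilizer of the ring of integers is \<open>P0\<close>. A subspace \<open>\<sigma>\<close> stable
  under \<open>P0\<close> has one \<open>P\<close>-translate for each disc, and a functional on
  \<open>\<sigma>\<close> with the right behaviour under \<open>P0\<close> extends equivariantly to
  their span once these translates are independent. The finite-dimensional space of the overview is
  chosen so that a dependence among its translates is a polynomial relation for \<open>U\<close>.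
  The target of a homomorphism has no central character in general, so graphs are placed in the part
  of the product on which the centre acts through \<omega>.\<close>

locale local_field =
  fixes v :: "'f::field \<Rightarrow> int" and p :: nat and \<pi> :: 'f
  assumes local_field: "nonarch_local_field v p"
    and uniformizer_nonzero [simp]: "\<pi> \<noteq> 0" and v_uniformizer [simp]: "v \<pi> = 1"
begin

abbreviation ip :: "int \<Rightarrow> 'f \<Rightarrow> bool" where "ip \<equiv> in_pow v"

text \<open>Nonvanishing is demanded separately because the value of \<open>v\<close> at 0 is
  unspecified; \<open>in_pow\<close> treats 0 as lying in every ideal for the same reason.\<close>

definition unt :: "'f \<Rightarrow> bool" where "unt a \<longleftrightarrow> a \<noteq> 0 \<and> v a = 0"

lemma prime_p: "prime p"
  using local_field unfolding nonarch_local_field_def by blast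

lemma p_pos [simp]: "p > 0"
  using prime_p prime_gt_0_nat by blast

lemma v_mult: "x \<noteq> 0 \<Longrightarrow> y \<noteq> 0 \<Longrightarrow> v (x * y) = v x + v y"
  using local_field unfolding nonarch_local_field_def by blast

lemma v_add: "x \<noteq> 0 \<Longrightarrow> y \<noteq> 0 \<Longrightarrow> x + y \<noteq> 0 \<Longrightarrow> min (v x) (v y) \<le> v (x + y)"
  using local_field unfolding nonarch_local_field_def by blast

lemma ip_p: "ip 1 (of_nat p)"
  using local_field unfolding nonarch_local_field_def by blast

lemma complete:
  assumes "\<And>n. \<exists>N. \<forall>i\<ge>N. \<forall>j\<ge>N. ip n (s i - s j)"
  shows "\<exists>l. \<forall>n. \<exists>N. \<forall>i\<ge>N. ip n (s (i::nat) - l)"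
  using local_field assms unfolding nonarch_local_field_def by blast

lemma v_1 [simp]: "v 1 = 0"
  using v_mult[of 1 1] by simp

lemma v_minus [simp]: "v (- x) = v x"
proof (cases "x = 0")
  case False
  have "v (-1) = 0"
    using v_mult[of "-1" "-1"] by simp
  then show ?thesis
    using v_mult[of "-1" x] False by simp
qed simp

lemma v_inverse: "x \<noteq> 0 \<Longrightarrow> v (inverse x) = - v x"
  using v_mult[of x "inverse x"] by simp

lemma v_divide: "x \<noteq> 0 \<Longrightarrow> y \<noteq> 0 \<Longrightarrow> v (x / y) = v x - v y"
  by (simp add: divide_inverse v_mult v_inverse)

lemma v_power: "x \<noteq> 0 \<Longrightarrow> v (x ^ n) = int n * v x"
  by (induction n) (auto simp: v_mult algebra_simps)

lemma v_powi [simp]: "v (\<pi> powi n) = n"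
  by (simp add: power_int_def v_power v_inverse)

lemma ip_0 [simp]: "ip n 0"
  by (simp add: in_pow_def)

lemma ip_1 [simp]: "ip n 1 \<longleftrightarrow> n \<le> 0"
  by (simp add: in_pow_def)

lemma ip_minus [simp]: "ip n (- x) \<longleftrightarrow> ip n x"
  by (simp add: in_pow_def)

lemma ip_add: "ip n x \<Longrightarrow> ip n y \<Longrightarrow> ip n (x + y)"
  using v_add[of x y] unfolding in_pow_def by fastforce

lemma ip_diff: "ip n x \<Longrightarrow> ip n y \<Longrightarrow> ip n (x - y)"
  using ip_add[of n x "- y"] by simp

lemma ip_mult: "ip m x \<Longrightarrow> ip n y \<Longrightarrow> ip (m + n) (x * y)"
  unfolding in_pow_def by (cases "x = 0"; cases "y = 0") (auto simp: v_mult)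

lemma ip_mono: "ip n x \<Longrightarrow> m \<le> n \<Longrightarrow> ip m x"
  unfolding in_pow_def by auto

lemma ip_mult_ge: "ip m x \<Longrightarrow> ip n y \<Longrightarrow> k \<le> m + n \<Longrightarrow> ip k (x * y)"
  using ip_mult ip_mono by blast

lemma ip_diff_commute: "ip n (x - y) \<longleftrightarrow> ip n (y - x)"
  using ip_minus[of n "x - y"] by simp

lemma ip_diff_trans: "ip n (x - y) \<Longrightarrow> ip n (y - z) \<Longrightarrow> ip n (x - z)"
  using ip_add[of n "x - y" "y - z"] by simp

lemma ip_powi_mult [simp]: "ip n (\<pi> powi m * x) \<longleftrightarrow> ip (n - m) x"
  unfolding in_pow_def by (cases "x = 0") (auto simp: v_mult)

lemma ip_pi_mult [simp]: "ip n (\<pi> * x) \<longleftrightarrow> ip (n - 1) x"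
  unfolding in_pow_def by (cases "x = 0") (auto simp: v_mult)

lemma ip_mult_pi [simp]: "ip n (x * \<pi>) \<longleftrightarrow> ip (n - 1) x"
  using ip_pi_mult by (simp add: mult.commute)

lemma ip_pi [simp]: "ip n \<pi> \<longleftrightarrow> n \<le> 1"
  by (simp add: in_pow_def)

lemma ip_divide_pi [simp]: "ip n (x / \<pi>) \<longleftrightarrow> ip (n + 1) x"
  unfolding in_pow_def by (cases "x = 0") (auto simp: v_divide)

lemma ip_divide_powi [simp]: "ip n (x / \<pi> powi m) \<longleftrightarrow> ip (n + m) x"
  unfolding in_pow_def by (cases "x = 0") (auto simp: v_divide)

lemma ip_powi [simp]: "ip n (\<pi> powi m) \<longleftrightarrow> n \<le> m"
  by (simp add: in_pow_def)

lemma ip_of_nat: "ip 0 (of_nat n)"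
  by (induction n) (auto intro!: ip_add simp: in_pow_def[of _ _ 1])

lemma ip_of_nat_mult: "ip n x \<Longrightarrow> ip n (of_nat m * x)"
  using ip_mult[OF ip_of_nat, of n x m] by simp

lemma ip_p_power: "ip (int n) (of_nat (p ^ n))"
  by (induction n) (use ip_mult[OF ip_p] in \<open>force simp: add.commute intro: ip_mult_ge ip_p\<close>)+

lemma exists_ip_power_p: "\<exists>n. ip m (of_nat (p ^ n) * x)"
proof (cases "x = 0")
  case False
  have "ip (int (nat (m - v x)) + v x) (of_nat (p ^ nat (m - v x)) * x)"
    by (intro ip_mult ip_p_power) (simp add: in_pow_def)
  then show ?thesis
    by (intro exI[of _ "nat (m - v x)"]) (rule ip_mono, auto)
qed simp

lemma unt_nonzero: "unt a \<Longrightarrow> a \<noteq> 0"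
  by (simp add: unt_def)

lemma unt_1 [simp]: "unt 1"
  by (simp add: unt_def)

lemma unt_minus [simp]: "unt (- a) \<longleftrightarrow> unt a"
  by (simp add: unt_def)

lemma unt_mult: "unt a \<Longrightarrow> unt b \<Longrightarrow> unt (a * b)"
  by (simp add: unt_def v_mult)

lemma unt_divide: "unt a \<Longrightarrow> unt b \<Longrightarrow> unt (a / b)"
  by (simp add: unt_def v_divide)

lemma unt_power: "unt a \<Longrightarrow> unt (a ^ n)"
  by (simp add: unt_def v_power)

lemma ip_unt_mult [simp]: "unt a \<Longrightarrow> ip n (a * x) \<longleftrightarrow> ip n x"
  unfolding in_pow_def unt_def by (cases "x = 0") (auto simp: v_mult)

lemma ip_mult_unt [simp]: "unt a \<Longrightarrow> ip n (x * a) \<longleftrightarrow> ip n x"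
  using ip_unt_mult by (simp add: mult.commute)

lemma ip_divide_unt [simp]: "unt a \<Longrightarrow> ip n (x / a) \<longleftrightarrow> ip n x"
  unfolding in_pow_def unt_def by (cases "x = 0") (auto simp: v_divide)

lemma unt_ip: "unt a \<Longrightarrow> ip 0 a"
  by (simp add: unt_def in_pow_def)

lemma unt_iff: "unt a \<longleftrightarrow> ip 0 a \<and> \<not> ip 1 a"
  by (auto simp: unt_def in_pow_def)

lemma unt_cong: "ip 1 (a - b) \<Longrightarrow> unt b \<Longrightarrow> unt a"
  using ip_add[of 1 "a - b" b] ip_add[of 0 "a - b" b] ip_add[of 1 "b - a" a]
    ip_diff_commute[of 1 a b] ip_mono[of 1 "a - b" 0]
  unfolding unt_iff by auto

lemma unt_one_plus: "ip 1 (a - 1) \<Longrightarrow> unt a"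
  using unt_cong unt_1 by blast

lemma unt_one_plus_ge: "ip n (a - 1) \<Longrightarrow> 1 \<le> n \<Longrightarrow> unt a"
  using unt_one_plus ip_mono by blast

lemma unt_decomp: "x \<noteq> 0 \<Longrightarrow> unt (x / \<pi> powi (v x))"
  by (simp add: unt_def v_divide)

section \<open>The pro-p group of units congruent to 1\<close>

lemma ip_one_mult: "ip n (a - 1) \<Longrightarrow> ip n (b - 1) \<Longrightarrow> 0 \<le> n \<Longrightarrow> ip n (a * b - 1)"
proof -
  assume *: "ip n (a - 1)" "ip n (b - 1)" "0 \<le> n"
  have eq: "a * b - 1 = (a - 1) * (b - 1) + (a - 1) + (b - 1)"
    by (simp add: algebra_simps)
  show ?thesis
    unfolding eq using * by (intro ip_add) (auto intro: ip_mult_ge)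
qed

lemma ip_one_divide: "ip n (a - 1) \<Longrightarrow> ip n (b - 1) \<Longrightarrow> 1 \<le> n \<Longrightarrow> ip n (a / b - 1)"
proof -
  assume *: "ip n (a - 1)" "ip n (b - 1)" "1 \<le> n"
  then have u: "unt b" by (meson ip_mono unt_one_plus)
  then have eq: "a / b - 1 = ((a - 1) - (b - 1)) / b"
    by (simp add: unt_def field_simps)
  show ?thesis
    unfolding eq ip_divide_unt[OF u] using *(1,2) by (rule ip_diff)
qed

text \<open>Writing \<open>a = 1 + x\<close>, the power is 1 + p x up to terms divisible by
  \<open>x * x\<close>. Since \<open>p\<close> lies in the maximal ideal and \<open>n\<close> is at
  least 1, both corrections have depth at least \<open>n + 1\<close>.\<close>

lemma ip_one_power_p:
  assumes "ip n (a - 1)" "1 \<le> n"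
  shows "ip (n + 1) (a ^ p - 1)"
proof -
  define x where "x = a - 1"
  have x: "ip n x" using assms by (simp add: x_def)
  have "ip (2 * n) ((1 + x) ^ m - 1 - of_nat m * x)" for m
  proof (induction m)
    case (Suc m)
    have eq: "(1 + x) ^ Suc m - 1 - of_nat (Suc m) * x
        = ((1 + x) ^ m - 1 - of_nat m * x) + ((1 + x) ^ m - 1 - of_nat m * x) * x + of_nat m * (x * x)"
      by (simp add: algebra_simps)
    moreover have "ip (2 * n) (x * x)"
      using ip_mult[OF x x] by simp
    ultimately show ?case
      unfolding eq using Suc x assms(2) by (intro ip_add ip_of_nat_mult ip_mult_ge[OF Suc x]) auto
  qed simp
  from this[of p] have "ip (n + 1) ((1 + x) ^ p - 1 - of_nat p * x)"
    using assms(2) by (auto intro: ip_mono)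
  moreover have "ip (n + 1) (of_nat p * x)"
    using ip_mult[OF ip_p x] by (simp add: add.commute)
  ultimately have "ip (n + 1) ((1 + x) ^ p - 1 - of_nat p * x + of_nat p * x)"
    by (rule ip_add)
  then show ?thesis by (simp add: x_def)
qed

lemma ip_one_power_p_power:
  assumes "ip 1 (a - 1)"
  shows "ip (1 + int m) (a ^ (p ^ m) - 1)"
proof (induction m)
  case (Suc m)
  have "a ^ p ^ Suc m = (a ^ p ^ m) ^ p"
    by (metis power_Suc2 power_mult)
  then show ?case
    using ip_one_power_p[OF Suc] by (simp add: add_ac)
qed (use assms in simp)

section \<open>Representatives of the residue field\<close>

lemma exists_residue_reps:
  "\<exists>R. finite R \<and> 0 \<in> R \<and> (\<forall>r\<in>R. ip 0 r) \<and> (\<forall>x. ip 0 x \<longrightarrow> (\<exists>!r. r \<in> R \<and> ip 1 (x - r)))"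
proof -
  define O' where "O' = {x. ip 0 x}"
  define E where "E = {(x,y). ip 0 x \<and> ip 0 y \<and> ip 1 (x - y)}"
  have eq: "equiv O' E"
    by (rule equivI) (auto simp: O'_def E_def refl_on_def sym_def trans_def
        dest: ip_diff_trans simp: ip_diff_commute)
  have fin: "finite (O' // E)"
    using local_field unfolding nonarch_local_field_def O'_def E_def by auto
  \<comment> \<open>The zero class is represented by 0 itself, so that the remaining representatives
    are all units; sums over \<open>Rep\<close> are split at 0 accordingly.\<close>
  define pick where "pick X = (if 0 \<in> X then 0 else SOME x. x \<in> X)" for X :: "'f set"
  have pick: "pick X \<in> X" if "X \<in> O' // E" for X
    using in_quotient_imp_non_empty[OF eq that] by (auto simp: pick_def some_in_eq)
  define R where "R = pick ` (O' // E)"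
  have "finite R" using fin by (simp add: R_def)
  moreover have "0 \<in> R"
  proof -
    have "E `` {0} \<in> O' // E" by (rule quotientI) (simp add: O'_def)
    moreover have "pick (E `` {0}) = 0" by (simp add: pick_def E_def)
    ultimately show ?thesis unfolding R_def by (metis image_eqI)
  qed
  moreover have "\<forall>r\<in>R. ip 0 r"
    using pick in_quotient_imp_subset[OF eq] unfolding R_def O'_def by blast
  moreover have "\<exists>!r. r \<in> R \<and> ip 1 (x - r)" if "ip 0 x" for x
  proof (rule ex_ex1I)
    have "E `` {x} \<in> O' // E" using that by (intro quotientI) (simp add: O'_def)
    then show "\<exists>r. r \<in> R \<and> ip 1 (x - r)"
      using pick[of "E `` {x}"] unfolding R_def E_def by fastforce
  next
    fix r r' assume *: "r \<in> R \<and> ip 1 (x - r)" "r' \<in> R \<and> ip 1 (x - r')"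
    then obtain X X' where X: "X \<in> O' // E" "r = pick X" "X' \<in> O' // E" "r' = pick X'"
      unfolding R_def by blast
    have "ip 1 (r - r')" using * ip_diff_trans ip_diff_commute by blast
    moreover have "ip 0 r" "ip 0 r'"
      using \<open>\<forall>r\<in>R. ip 0 r\<close> * by auto
    ultimately have "(r, r') \<in> E" unfolding E_def by auto
    then have "X = X'"
      using X pick quotient_eqI[OF eq] by metis
    then show "r = r'" using X by simp
  qed
  ultimately show ?thesis by blast
qed

definition Rep :: "'f set" where
  "Rep = (SOME R. finite R \<and> 0 \<in> R \<and> (\<forall>r\<in>R. ip 0 r) \<and> (\<forall>x. ip 0 x \<longrightarrow> (\<exists>!r. r \<in> R \<and> ip 1 (x - r))))"

lemma Rep:
  "finite Rep" "0 \<in> Rep" "r \<in> Rep \<Longrightarrow> ip 0 r" "ip 0 x \<Longrightarrow> \<exists>!r. r \<in> Rep \<and> ip 1 (x - r)"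
  using someI_ex[OF exists_residue_reps] unfolding Rep_def by blast+

definition rd :: "'f \<Rightarrow> 'f" where "rd x = (THE r. r \<in> Rep \<and> ip 1 (x - r))"

lemma rd: assumes "ip 0 x" shows "rd x \<in> Rep" "ip 1 (x - rd x)"
  using theI'[OF Rep(4)[OF assms]] unfolding rd_def by auto

lemma rd_eqI: "r \<in> Rep \<Longrightarrow> ip 1 (x - r) \<Longrightarrow> rd x = r"
  using Rep(3)[of r] Rep(4)[of x] ip_add[of 0 "x - r" r] ip_mono[of 1 "x - r" 0]
  unfolding rd_def by (intro the1_equality) auto

lemma Rep_eqI: "r \<in> Rep \<Longrightarrow> r' \<in> Rep \<Longrightarrow> ip 1 (r - r') \<Longrightarrow> r = r'"
  using rd_eqI[of r' r] rd_eqI[of r r] by simp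

lemma Rep_unt: "r \<in> Rep \<Longrightarrow> r \<noteq> 0 \<Longrightarrow> unt r"
  using Rep_eqI[of r 0] Rep(2,3) by (auto simp: unt_iff)

text \<open>A map that is injective modulo the maximal ideal permutes the finite residue field, and
  \<open>h\<close> only sees residue classes. Composition with \<open>rd\<close> brings the values
  of \<open>g\<close> back into \<open>Rep\<close>.\<close>

lemma sum_Rep_reindex:
  fixes h :: "'f \<Rightarrow> 'a::ab_group_add"
  assumes h: "\<And>x y. ip 0 x \<Longrightarrow> ip 1 y \<Longrightarrow> h (x + y) = h x"
    and g: "\<And>r. r \<in> Rep \<Longrightarrow> ip 0 (g r)"
    and inj: "\<And>r r'. r \<in> Rep \<Longrightarrow> r' \<in> Rep \<Longrightarrow> ip 1 (g r - g r') \<Longrightarrow> ip 1 (r - r')"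
  shows "(\<Sum>r\<in>Rep. h (g r)) = (\<Sum>r\<in>Rep. h r)"
proof -
  have "inj_on (\<lambda>r. rd (g r)) Rep"
  proof (rule inj_onI)
    fix r r' assume *: "r \<in> Rep" "r' \<in> Rep" "rd (g r) = rd (g r')"
    then have "ip 1 (g r - g r')"
      using rd(2)[OF g] ip_diff_trans ip_diff_commute by metis
    then show "r = r'" using * inj Rep_eqI by blast
  qed
  moreover have "(\<lambda>r. rd (g r)) ` Rep \<subseteq> Rep" using rd(1)[OF g] by blast
  ultimately have bij: "bij_betw (\<lambda>r. rd (g r)) Rep Rep"
    using Rep(1) endo_inj_surj unfolding bij_betw_def by metis
  have "(\<Sum>r\<in>Rep. h r) = (\<Sum>r\<in>Rep. h (rd (g r)))"
    by (rule sum.reindex_bij_betw[OF bij, symmetric])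
  also have "\<dots> = (\<Sum>r\<in>Rep. h (g r))"
  proof (rule sum.cong[OF refl])
    fix r assume "r \<in> Rep"
    then show "h (rd (g r)) = h (g r)"
      using h[OF Rep(3)[OF rd(1)[OF g]] rd(2)[OF g], of r r] by simp
  qed
  finally show ?thesis by simp
qed

lemma sum_Rep_shift:
  fixes h :: "'f \<Rightarrow> 'a::ab_group_add"
  assumes "\<And>x y. ip 0 x \<Longrightarrow> ip 1 y \<Longrightarrow> h (x + y) = h x" "ip 0 b"
  shows "(\<Sum>r\<in>Rep. h (r + b)) = (\<Sum>r\<in>Rep. h r)"
  by (rule sum_Rep_reindex) (use assms Rep(3) in \<open>auto intro: ip_add\<close>)

lemma sum_Rep_mult:
  fixes h :: "'f \<Rightarrow> 'a::ab_group_add"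
  assumes "\<And>x y. ip 0 x \<Longrightarrow> ip 1 y \<Longrightarrow> h (x + y) = h x" "unt a"
  shows "(\<Sum>r\<in>Rep. h (a * r)) = (\<Sum>r\<in>Rep. h r)"
  by (rule sum_Rep_reindex) (use assms Rep(3) in \<open>auto simp flip: right_diff_distrib\<close>)

text \<open>The prime field acts on the residue field by adding natural numbers, and every orbit has
  exactly \<open>p\<close> elements. In the coefficient field this makes sums of equal terms over
  \<open>Rep\<close> vanish.\<close>

lemma p_dvd_card_Rep: "p dvd card Rep"
proof -
  define E where "E = {(x,y). x \<in> Rep \<and> y \<in> Rep \<and> (\<exists>n::nat. ip 1 (x + of_nat n - y))}"
  have eq: "equiv Rep E"
  proof (rule equivI)
    show "refl_on Rep E" by (auto simp: refl_on_def E_def intro!: exI[of _ 0])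
    show "trans E"
    proof (rule transI)
      fix x y z assume "(x, y) \<in> E" "(y, z) \<in> E"
      then obtain n m where *: "x \<in> Rep" "z \<in> Rep" "ip 1 (x + of_nat n - y)" "ip 1 (y + of_nat m - z)"
        unfolding E_def by blast
      have "ip 1 ((x + of_nat n - y) + (y + of_nat m - z))" using * ip_add by blast
      then have "ip 1 (x + of_nat (n + m) - z)" by (simp add: algebra_simps)
      then show "(x, z) \<in> E" using * unfolding E_def by blast
    qed
    show "sym E"
    proof (rule symI)
      fix x y assume "(x, y) \<in> E"
      then obtain n where *: "x \<in> Rep" "y \<in> Rep" "ip 1 (x + of_nat n - y)"
        unfolding E_def by blast
      \<comment> \<open>Adding \<open>n * (p - 1)\<close> undoes adding \<open>n\<close>, because
        \<open>p\<close> is 0 in the residue field.\<close>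
      have "ip 1 (of_nat n * of_nat p :: 'f)" using ip_p by (rule ip_of_nat_mult)
      then have "ip 1 (of_nat n * of_nat p - (x + of_nat n - y))" using * ip_diff by blast
      moreover have "y + of_nat (n * (p - 1)) - x = of_nat n * of_nat p - (x + of_nat n - y)"
        by (simp add: of_nat_diff Suc_leI right_diff_distrib)
      ultimately have "ip 1 (y + of_nat (n * (p - 1)) - x)"
        by (simp only:)
      then show "(y, x) \<in> E" using * unfolding E_def by blast
    qed
    show "E \<subseteq> Rep \<times> Rep" by (auto simp: E_def)
  qed
  show ?thesis
  proof (rule equiv_imp_dvd_card[OF Rep(1) eq])
    fix X assume "X \<in> Rep // E"
    then obtain x where x: "x \<in> Rep" "X = E `` {x}" by (auto elim: quotientE)
    have X: "X = (\<lambda>n. rd (x + of_nat n)) ` {..<p}"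
    proof (intro equalityI subsetI)
      fix y assume "y \<in> X"
      then obtain n where n: "y \<in> Rep" "ip 1 (x + of_nat n - y)" using x by (auto simp: E_def)
      have "ip 1 (of_nat (n div p) * of_nat p :: 'f)" using ip_p by (rule ip_of_nat_mult)
      then have "ip 1 (x + of_nat n - y - of_nat (n div p) * of_nat p)" using n ip_diff by blast
      moreover have "(of_nat n :: 'f) = of_nat (n div p) * of_nat p + of_nat (n mod p)"
        by (metis of_nat_add of_nat_mult div_mult_mod_eq)
      ultimately have "ip 1 (x + of_nat (n mod p) - y)" by (simp add: algebra_simps)
      then have "rd (x + of_nat (n mod p)) = y" using n rd_eqI by blast
      then show "y \<in> (\<lambda>n. rd (x + of_nat n)) ` {..<p}"
        by (intro image_eqI[of _ _ "n mod p"]) auto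
    next
      fix y assume "y \<in> (\<lambda>n. rd (x + of_nat n)) ` {..<p}"
      then obtain n where "y = rd (x + of_nat n)" by blast
      then show "y \<in> X"
        using x rd[of "x + of_nat n"] ip_add[OF Rep(3)[OF x(1)] ip_of_nat[of n]]
        by (auto simp: E_def)
    qed
    have "inj_on (\<lambda>n. rd (x + of_nat n)) {..<p}"
    proof (rule linorder_inj_onI)
      fix m n assume mn: "m < n" "m \<in> {..<p}" "n \<in> {..<p}"
      define d where "d = n - m"
      have d: "0 < d" "d < p" using mn by (auto simp: d_def)
      show "rd (x + of_nat m) \<noteq> rd (x + of_nat n)"
      proof
        assume *: "rd (x + of_nat m) = rd (x + of_nat n)"
        have "ip 1 ((x + of_nat n) - (x + of_nat m))"
          using rd(2)[of "x + of_nat n"] rd(2)[of "x + of_nat m"] * ip_add[OF Rep(3)[OF x(1)] ip_of_nat]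
            ip_diff_trans ip_diff_commute by metis
        then have dp: "ip 1 (of_nat d :: 'f)" using mn by (simp add: d_def of_nat_diff)
        \<comment> \<open>A Bezout relation \<open>a * d = b * p + 1\<close> would put 1 into the
          maximal ideal.\<close>
        have "coprime d p"
          using d prime_p by (metis coprime_commute nat_dvd_not_less prime_imp_coprime_nat)
        then obtain a b where "a * d = b * p + 1"
          using d bezout_nat[of d p] by (metis coprime_iff_gcd_eq_1 less_numeral_extra(3) mult.commute)
        then have "(of_nat a * of_nat d :: 'f) = of_nat b * of_nat p + 1"
          by (metis of_nat_mult of_nat_add of_nat_1)
        then have "(1::'f) = of_nat a * of_nat d - of_nat b * of_nat p" by simp
        moreover have "ip 1 (of_nat a * of_nat d - of_nat b * of_nat p :: 'f)"
          using dp ip_p by (intro ip_diff ip_of_nat_mult)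
        ultimately have "ip 1 (1::'f)" by simp
        then show False by simp
      qed
    qed auto
    then show "p dvd card X" by (simp add: X card_image)
  qed
qed

end

subsection \<open>Eigenvectors over an algebraically closed field\<close>

text \<open>In characteristic p, \<open>a ^ (p ^ m) - 1\<close> is the \<open>p ^ m\<close>-th power
  of \<open>a - 1\<close>. This is the reason why smooth characters with values in this field are
  trivial on pro-p groups.\<close>

lemma p_power_root_unique:
  fixes a :: "'k::field"
  assumes alg: "alg_closure_Fp p TYPE('k)" and a: "a ^ (p ^ m) = 1"
  shows "a = 1"
proof -
  have pr: "prime p" "of_nat p = (0::'k)" using alg by (auto simp: alg_closure_Fp_def)
  have "CHAR('k) dvd p" using pr(2) by (simp add: of_nat_eq_0_iff_char_dvd)
  moreover have "CHAR('k) \<noteq> 1" by simp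
  ultimately have char: "CHAR('k) = p" using pr(1) prime_nat_iff by blast
  have "((a - 1) + 1) ^ (p ^ m) = (a - 1) ^ (p ^ m) + 1 ^ (p ^ m)"
    by (rule freshmans_dream') (simp_all add: char pr)
  then have "(a - 1) ^ (p ^ m) = 0" using a by simp
  then show "a = 1" by simp
qed

text \<open>\<open>T\<close> is a bare function: some of the operators to which this is applied,
  \<open>U\<close> among them, are known to be linear only on a subspace.\<close>

definition polyop :: "('a::field \<Rightarrow> 'b::ab_group_add \<Rightarrow> 'b) \<Rightarrow> 'a poly \<Rightarrow> ('b \<Rightarrow> 'b) \<Rightarrow> 'b \<Rightarrow> 'b" where
  "polyop sc q T x = (\<Sum>i\<le>degree q. sc (coeff q i) ((T ^^ i) x))"

context vector_space
begin

lemma polyop_altdef: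
  fixes q :: "'a poly"
  assumes "degree q \<le> n"
  shows "polyop scale q T x = (\<Sum>i\<le>n. scale (coeff q i) ((T ^^ i) x))"
  unfolding polyop_def
  by (rule sum.mono_neutral_left) (use assms in \<open>auto simp: coeff_eq_0\<close>)

lemma polyop_linear_factor:
  "polyop scale ([:- a, 1:] * q) T x = polyop scale q T (T x) - scale a (polyop scale q T x)"
proof -
  define n where "n = degree q"
  have "degree ([:- a, 1:] * q) \<le> Suc n"
    unfolding n_def by (rule order.trans[OF degree_mult_le]) simp
  then have "polyop scale ([:- a, 1:] * q) T x
      = (\<Sum>i\<le>Suc n. scale (coeff ([:- a, 1:] * q) i) ((T ^^ i) x))"
    by (rule polyop_altdef)
  also have "\<dots> = (\<Sum>i\<le>Suc n. scale (coeff (pCons 0 q) i) ((T ^^ i) x) - scale a (scale (coeff q i) ((T ^^ i) x)))"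
    by (simp add: scale_left_diff_distrib scale_left_distrib)
  also have "\<dots> = (\<Sum>i\<le>Suc n. scale (coeff (pCons 0 q) i) ((T ^^ i) x)) - scale a (polyop scale q T x)"
  proof -
    have "polyop scale q T x = (\<Sum>i\<le>Suc n. scale (coeff q i) ((T ^^ i) x))"
      by (rule polyop_altdef) (simp add: n_def)
    then show ?thesis by (simp only: sum_subtractf scale_sum_right)
  qed
  also have "(\<Sum>i\<le>Suc n. scale (coeff (pCons 0 q) i) ((T ^^ i) x)) = polyop scale q T (T x)"
    by (simp add: sum.atMost_Suc_shift polyop_def n_def funpow_swap1 del: sum.atMost_Suc)
  finally show ?thesis .
qed

lemma lin_on_funpow:
  assumes "lin_on scale S T" "\<And>x. x \<in> S \<Longrightarrow> T x \<in> S" "x \<in> S" "y \<in> S" "subspace S"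
  shows "(T ^^ i) x \<in> S \<and> (T ^^ i) (x + y) = (T ^^ i) x + (T ^^ i) y \<and> (T ^^ i) (scale c x) = scale c ((T ^^ i) x)"
proof -
  have st: "(T ^^ i) z \<in> S" if "z \<in> S" for z using that assms(2) by (induction i) auto
  have "(T ^^ i) (x + y) = (T ^^ i) x + (T ^^ i) y \<and> (T ^^ i) (scale c x) = scale c ((T ^^ i) x)"
  proof (induction i)
    case (Suc i)
    have "(T ^^ i) x \<in> S" "(T ^^ i) y \<in> S" using assms(2,3,4) by (induction i) auto
    then show ?case using Suc assms(1) by (simp add: lin_on_def)
  qed simp
  then show ?thesis using st assms(3) by blast
qed

lemma polyop_linear:
  assumes "lin_on scale S T" "\<And>x. x \<in> S \<Longrightarrow> T x \<in> S" "x \<in> S" "y \<in> S" "subspace S"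
  shows "polyop scale q T (x - scale a y) = polyop scale q T x - scale a (polyop scale q T y)"
proof -
  have "(T ^^ i) (x - scale a y) = (T ^^ i) x - scale a ((T ^^ i) y)" for i
    using lin_on_funpow[OF assms(1,2,3) _ assms(5), of "scale (- a) y" i 0]
      lin_on_funpow[OF assms(1,2,4,3,5), of i "- a"] subspace_neg[OF assms(5) subspace_scale[OF assms(5,4)]] by simp
  then show ?thesis
    by (simp add: polyop_def scale_right_diff_distrib sum_subtractf scale_sum_right mult.commute)
qed

text \<open>Let \<open>a\<close> be a root of \<open>q\<close>. If \<open>T - a\<close> kills no
  nonzero vector of \<open>S\<close>, its image on \<open>S\<close> is again a nonzero
  \<open>T\<close>-stable subspace, and there the cofactor of the linear factor already annihilates.
  Replacing \<open>S\<close> by this image lowers the degree without any bound on the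
  dimension.\<close>

lemma eigenvector_exists:
  assumes closed: "\<And>q::'a poly. 0 < degree q \<Longrightarrow> \<exists>x. poly q x = 0"
    and "q \<noteq> 0" "subspace S" "S \<noteq> {0}" "lin_on scale S T" "\<And>x. x \<in> S \<Longrightarrow> T x \<in> S"
    and "\<And>x. x \<in> S \<Longrightarrow> polyop scale q T x = 0"
  shows "\<exists>a x. poly q a = 0 \<and> x \<in> S \<and> x \<noteq> 0 \<and> T x = scale a x"
  using assms(2-)
proof (induction "degree q" arbitrary: q S)
  case 0
  obtain c where c: "q = [:c:]" using 0(1) degree_eq_zeroE by metis
  obtain x where "x \<in> S" "x \<noteq> 0" using 0(3,4) subspace_0 by blast
  then have "scale c x = 0" using 0(7)[of x] by (simp add: c polyop_def)
  then show ?case using \<open>x \<noteq> 0\<close> 0(2) c by simp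
next
  case (Suc n)
  obtain a where a: "poly q a = 0" using closed Suc(2) by fastforce
  then obtain q' where q': "q = [:- a, 1:] * q'" using poly_eq_0_iff_dvd dvdE by blast
  have "q' \<noteq> 0" using Suc(3) q' by auto
  then have "degree q = degree q' + 1" unfolding q' by (subst degree_mult_eq) auto
  then have dq': "n = degree q'" using Suc(2) by simp
  show ?case
  proof (cases "\<exists>x\<in>S. x \<noteq> 0 \<and> T x = scale a x")
    case True then show ?thesis using a by blast
  next
    case False
    note sub = \<open>subspace S\<close> and lin = \<open>lin_on scale S T\<close>
    define S' where "S' = (\<lambda>x. T x - scale a x) ` S"
    have "S' \<subseteq> S"
      using sub Suc(7) by (auto simp: S'_def intro!: subspace_diff subspace_scale)
    have "subspace S'"
    proof (rule subspaceI)
      show "0 \<in> S'" using lin subspace_0[OF sub]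
        by (auto simp: S'_def lin_on_def image_iff intro!: bexI[of _ 0]) (metis scale_zero_left)
    next
      fix x y assume "x \<in> S'" "y \<in> S'"
      then obtain x' y' where *: "x' \<in> S" "y' \<in> S" "x = T x' - scale a x'" "y = T y' - scale a y'"
        by (auto simp: S'_def)
      then have "x + y = T (x' + y') - scale a (x' + y')"
        using lin by (simp add: lin_on_def scale_right_distrib)
      then show "x + y \<in> S'" unfolding S'_def using * subspace_add[OF sub] by (intro image_eqI)
    next
      fix c x assume "x \<in> S'"
      then obtain x' where *: "x' \<in> S" "x = T x' - scale a x'" by (auto simp: S'_def)
      then have "scale c x = T (scale c x') - scale a (scale c x')"
        using lin by (simp add: lin_on_def scale_right_diff_distrib mult.commute)
      then show "scale c x \<in> S'" unfolding S'_def using * subspace_scale[OF sub] by (intro image_eqI)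
    qed
    moreover have "S' \<noteq> {0}"
    proof -
      obtain x where "x \<in> S" "x \<noteq> 0" using Suc(4,5) subspace_0 by blast
      then have "T x - scale a x \<in> S'" "T x - scale a x \<noteq> 0" using False by (auto simp: S'_def)
      then show ?thesis by blast
    qed
    moreover have "lin_on scale S' T" using lin \<open>S' \<subseteq> S\<close> unfolding lin_on_def by blast
    moreover have "T x \<in> S'" if x: "x \<in> S'" for x
    proof -
      obtain y where y: "y \<in> S" "x = T y - scale a y" using x by (auto simp: S'_def)
      have "T (T y + scale (- a) y) = T (T y) + T (scale (- a) y)"
        using lin Suc(7)[OF y(1)] subspace_scale[OF sub y(1)] unfolding lin_on_def by blast
      also have "T (scale (- a) y) = scale (- a) (T y)"
        using lin y unfolding lin_on_def by blast
      finally have "T x = T (T y) - scale a (T y)" by (simp add: y)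
      then show ?thesis using Suc(7) y by (auto simp: S'_def)
    qed
    moreover have "polyop scale q' T x = 0" if x: "x \<in> S'" for x
    proof -
      obtain y where y: "y \<in> S" "x = T y - scale a y" using x by (auto simp: S'_def)
      then have "polyop scale q' T x = polyop scale q T y"
        unfolding q' polyop_linear_factor by (simp add: polyop_linear[OF lin Suc(7) Suc(7) _ sub])
      then show ?thesis using y Suc(8) by simp
    qed
    ultimately obtain b x where "poly q' b = 0" "x \<in> S'" "x \<noteq> 0" "T x = scale b x"
      using Suc(1)[OF dq' \<open>q' \<noteq> 0\<close>, of S'] by metis
    then show ?thesis using \<open>S' \<subseteq> S\<close> q' by auto
  qed
qed

text \<open>Commuting operators preserve each other's eigenspaces, so \<open>S\<close> can be cut
  down one operator at a time. The predicate \<open>Q\<close> carries what is known about roots of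
  unity of the given order, so that one induction serves both arbitrary eigenvalues and the
  eigenvalue 1.\<close>

lemma common_eigenvector:
  assumes closed: "\<And>q::'a poly. 0 < degree q \<Longrightarrow> \<exists>x. poly q x = 0"
    and "finite F" "subspace S" "S \<noteq> {0}"
    and "\<And>i. i \<in> F \<Longrightarrow> lin_on scale S (T i)" "\<And>i x. i \<in> F \<Longrightarrow> x \<in> S \<Longrightarrow> T i x \<in> S"
    and "\<And>i j x. i \<in> F \<Longrightarrow> j \<in> F \<Longrightarrow> x \<in> S \<Longrightarrow> T i (T j x) = T j (T i x)"
    and "\<And>i. i \<in> F \<Longrightarrow> \<exists>n>0. (\<forall>x\<in>S. (T i ^^ n) x = x) \<and> (\<forall>a. a ^ n = 1 \<longrightarrow> Q a)"
  shows "\<exists>x\<in>S. x \<noteq> 0 \<and> (\<forall>i\<in>F. \<exists>a. Q a \<and> T i x = scale a x)"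
  using assms(2-)
proof (induction F arbitrary: S)
  case empty
  then show ?case using subspace_0 by fastforce
next
  case (insert i F)
  obtain n where n: "n > 0" "\<And>x. x \<in> S \<Longrightarrow> (T i ^^ n) x = x" "\<And>a. a ^ n = 1 \<Longrightarrow> Q a"
    using insert(9)[of i] by auto
  define q :: "'a poly" where "q = monom 1 n + [:- 1:]"
  have cq: "coeff q j = (if j = n then 1 else if j = 0 then -1 else 0)" for j
    using n(1) by (cases j) (auto simp: q_def coeff_pCons)
  have dq: "degree q \<le> n" by (rule degree_le) (auto simp: cq)
  have "q \<noteq> 0" using cq[of n] by auto
  moreover have "polyop scale q (T i) x = 0" if "x \<in> S" for x
  proof -
    have "polyop scale q (T i) x = (\<Sum>j\<le>n. scale (coeff q j) ((T i ^^ j) x))"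
      by (rule polyop_altdef[OF dq])
    also have "\<dots> = (\<Sum>j\<in>{0,n}. scale (coeff q j) ((T i ^^ j) x))"
      by (rule sum.mono_neutral_right) (auto simp: cq)
    also have "\<dots> = 0" using n(1,2) that by (simp add: cq)
    finally show ?thesis .
  qed
  ultimately obtain a x where a: "poly q a = 0" "x \<in> S" "x \<noteq> 0" "T i x = scale a x"
    using eigenvector_exists[OF closed _ insert(4,5) insert(6)[of i] insert(7)[of i], of q] by auto
  have "a ^ n = 1" using a(1) by (simp add: q_def poly_monom)
  then have "Q a" using n(3) by blast
  define S' where "S' = {x\<in>S. T i x = scale a x}"
  have lini: "T i (x + y) = T i x + T i y" "T i (scale c x) = scale c (T i x)" if "x \<in> S" "y \<in> S" for x y c
    using insert(6)[of i] that by (auto simp: lin_on_def)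
  have "subspace S'"
  proof (rule subspaceI)
    show "0 \<in> S'" using lini(2)[of x x 0] a subspace_0[OF insert(4)] by (simp add: S'_def)
  qed (use lini subspace_add[OF insert(4)] subspace_scale[OF insert(4)] in
      \<open>auto simp: S'_def scale_right_distrib mult.commute\<close>)
  moreover have "S' \<noteq> {0}" using a by (auto simp: S'_def)
  moreover have "\<And>j. j \<in> F \<Longrightarrow> lin_on scale S' (T j)"
    using insert(6) by (auto simp: S'_def lin_on_def)
  moreover have "T j x \<in> S'" if "j \<in> F" "x \<in> S'" for j x
  proof -
    have "T i (T j x) = T j (T i x)" using insert(8)[of i j x] that by (auto simp: S'_def)
    also have "\<dots> = scale a (T j x)"
      using that insert(6)[of j] by (auto simp: S'_def lin_on_def)
    finally show ?thesis using that insert(7) by (auto simp: S'_def)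
  qed
  moreover have "\<And>j k x. j \<in> F \<Longrightarrow> k \<in> F \<Longrightarrow> x \<in> S' \<Longrightarrow> T j (T k x) = T k (T j x)"
    using insert(8) by (auto simp: S'_def)
  moreover have "\<exists>n>0. (\<forall>x\<in>S'. (T j ^^ n) x = x) \<and> (\<forall>a. a ^ n = 1 \<longrightarrow> Q a)" if "j \<in> F" for j
    using insert(9)[of j] that by (auto simp: S'_def)
  ultimately obtain x where "x \<in> S'" "x \<noteq> 0" "\<forall>j\<in>F. \<exists>a. Q a \<and> T j x = scale a x"
    using insert(3)[of S'] by blast
  then show ?case using \<open>Q a\<close> by (auto simp: S'_def)
qed

text \<open>The eigenvalues of an operator of \<open>p\<close>-power order are
  \<open>p\<close>-power roots of unity, hence equal to 1. This serves as the fixed point theorem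
  for p-groups on spaces of arbitrary dimension.\<close>

lemma common_fixed_vector:
  assumes alg: "alg_closure_Fp p TYPE('a)"
    and F: "finite F" "subspace S" "S \<noteq> {0}"
      "\<And>i. i \<in> F \<Longrightarrow> lin_on scale S (T i)" "\<And>i x. i \<in> F \<Longrightarrow> x \<in> S \<Longrightarrow> T i x \<in> S"
      "\<And>i j x. i \<in> F \<Longrightarrow> j \<in> F \<Longrightarrow> x \<in> S \<Longrightarrow> T i (T j x) = T j (T i x)"
    and m: "\<And>i. i \<in> F \<Longrightarrow> \<exists>m. \<forall>x\<in>S. (T i ^^ (p ^ m)) x = x"
  shows "\<exists>x\<in>S. x \<noteq> 0 \<and> (\<forall>i\<in>F. T i x = x)"
proof -
  have pr: "prime p" using alg by (auto simp: alg_closure_Fp_def)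
  have ex: "\<exists>n>0. (\<forall>x\<in>S. (T i ^^ n) x = x) \<and> (\<forall>a::'a. a ^ n = 1 \<longrightarrow> a = 1)" if i: "i \<in> F" for i
  proof -
    obtain m where "\<forall>x\<in>S. (T i ^^ (p ^ m)) x = x" using m[OF i] by blast
    moreover have "p ^ m > 0" using pr prime_gt_0_nat by simp
    ultimately show ?thesis using p_power_root_unique[OF alg] by blast
  qed
  have cl: "\<And>q::'a poly. 0 < degree q \<Longrightarrow> \<exists>x. poly q x = 0"
    using alg by (auto simp: alg_closure_Fp_def)
  have "\<exists>x\<in>S. x \<noteq> 0 \<and> (\<forall>i\<in>F. \<exists>a. a = 1 \<and> T i x = scale a x)"
    by (rule common_eigenvector[OF cl F]) (use ex in auto)
  then show ?thesis by simp
qed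

end

lemma lin_subspace_iff: "vector_space sc \<Longrightarrow> lin_subspace sc W \<longleftrightarrow> module.subspace sc W"
  by (auto simp: lin_subspace_def module.subspace_def module_iff_vector_space)

subsection \<open>Matrices\<close>

abbreviation um :: "'f::field \<Rightarrow> 'f mat2" where "um b \<equiv> (1,b,0,1)"
abbreviation dm :: "'f::field \<Rightarrow> 'f \<Rightarrow> 'f mat2" where "dm a d \<equiv> (a,0,0,d)"
abbreviation sm :: "'f::field mat2" where "sm \<equiv> (0,1,1,0)"

lemma mmul_simp [simp]:
  "mmul (a,b,c,d) (a',b',c',d') = (a*a' + b*c', a*b' + b*d', c*a' + d*c', c*b' + d*d')"
  by (simp add: mmul_def)

lemma mdet_simp [simp]: "mdet (a,b,c,d) = a*d - b*c"
  by (simp add: mdet_def)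

lemma in_GL2 [simp]: "(a,b,c,d) \<in> GL2 \<longleftrightarrow> a*d - b*c \<noteq> 0"
  by (simp add: GL2_def)

lemma in_Bor [simp]: "(a,b,c,d) \<in> Bor \<longleftrightarrow> c = 0 \<and> a \<noteq> 0 \<and> d \<noteq> 0"
  by (simp add: Bor_def)

lemma BorE: assumes "g \<in> Bor" obtains a b d where "g = (a,b,0,d)" "a \<noteq> 0" "d \<noteq> 0"
  using assms by (cases g) auto

lemma Bor_subset_GL2: "Bor \<subseteq> GL2"
  by (auto simp: Bor_def GL2_def)

lemma Bor_GL2 [simp]: "g \<in> Bor \<Longrightarrow> g \<in> GL2"
  using Bor_subset_GL2 by blast

lemma mmul_assoc: "mmul (mmul x y) z = mmul x (mmul y z)"
  by (cases x; cases y; cases z) (simp add: algebra_simps)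

lemma mdet_mmul: "mdet (mmul x y) = mdet x * mdet y"
  by (cases x; cases y) (simp add: algebra_simps)

lemma mmul_GL2 [simp]: "x \<in> GL2 \<Longrightarrow> y \<in> GL2 \<Longrightarrow> mmul x y \<in> GL2"
  by (simp add: GL2_def mdet_mmul)

lemma mmul_Bor [simp]: "x \<in> Bor \<Longrightarrow> y \<in> Bor \<Longrightarrow> mmul x y \<in> Bor"
  by (auto elim!: BorE)

lemma mone_mmul [simp]: "mmul mone x = x" "mmul x mone = x"
  by (cases x; simp add: mone_def)+

lemma mone_in [simp]: "mone \<in> GL2" "mone \<in> Bor"
  by (simp_all add: mone_def)

definition minv :: "'f::field mat2 \<Rightarrow> 'f mat2" where
  "minv g = (case g of (a,b,c,d) \<Rightarrow> (d / (a*d - b*c), - b / (a*d - b*c), - c / (a*d - b*c), a / (a*d - b*c)))"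

lemma minv: assumes "g \<in> GL2" shows "mmul g (minv g) = mone" "mmul (minv g) g = mone"
proof -
  obtain a b c d where g: "g = (a,b,c,d)" by (cases g)
  then have "a*d - b*c \<noteq> 0" using assms by simp
  then show "mmul g (minv g) = mone" "mmul (minv g) g = mone"
    by (simp_all add: g minv_def mone_def mult.commute flip: diff_divide_distrib add_divide_distrib)
qed

lemma minv_GL2 [simp]: assumes "g \<in> GL2" shows "minv g \<in> GL2"
proof -
  have "mdet g * mdet (minv g) = 1"
    using minv(1)[OF assms] by (metis mdet_mmul mdet_simp mone_def mult_1 mult_zero_left diff_zero)
  then show ?thesis unfolding GL2_def by auto
qed

lemma minv_Bor [simp]: "g \<in> Bor \<Longrightarrow> minv g \<in> Bor"
  by (auto elim!: BorE simp: minv_def)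

subsection \<open>Smooth representations\<close>

locale gl2_rep = local_field v p \<pi>
  for v :: "'f::field \<Rightarrow> int" and p :: nat and \<pi> :: 'f +
  fixes sc :: "'k::field \<Rightarrow> 'v::ab_group_add \<Rightarrow> 'v" and V :: "'v set"
    and act :: "'f mat2 \<Rightarrow> 'v \<Rightarrow> 'v"
  assumes alg_closure: "alg_closure_Fp p TYPE('k)" and smooth_rep: "smooth_rep v sc V act"

sublocale gl2_rep \<subseteq> vs: vector_space sc
  using smooth_rep by (simp add: smooth_rep_def is_rep_def)

context gl2_rep
begin

lemma alg_closed: "0 < degree (q::'k poly) \<Longrightarrow> \<exists>x. poly q x = 0"
  using alg_closure by (auto simp: alg_closure_Fp_def)

lemma of_nat_p: "of_nat p = (0::'k)"
  using alg_closure by (auto simp: alg_closure_Fp_def)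

lemma of_nat_card_Rep: "of_nat (card Rep) = (0::'k)"
  using p_dvd_card_Rep of_nat_p by (auto simp: dvd_def)

lemma subspace_V: "vs.subspace V"
  using smooth_rep lin_subspace_iff[OF vs.vector_space_axioms]
  by (simp add: smooth_rep_def is_rep_def)

lemma act_in [simp]: "g \<in> GL2 \<Longrightarrow> x \<in> V \<Longrightarrow> act g x \<in> V"
  using smooth_rep by (simp add: smooth_rep_def is_rep_def)

lemma act_add: "g \<in> GL2 \<Longrightarrow> x \<in> V \<Longrightarrow> y \<in> V \<Longrightarrow> act g (x + y) = act g x + act g y"
  using smooth_rep by (simp add: smooth_rep_def is_rep_def lin_on_def)

lemma act_sc: "g \<in> GL2 \<Longrightarrow> x \<in> V \<Longrightarrow> act g (sc c x) = sc c (act g x)"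
  using smooth_rep by (simp add: smooth_rep_def is_rep_def lin_on_def)

lemma act_mone [simp]: "x \<in> V \<Longrightarrow> act mone x = x"
  using smooth_rep by (simp add: smooth_rep_def is_rep_def)

lemma act_mmul: "g \<in> GL2 \<Longrightarrow> h \<in> GL2 \<Longrightarrow> x \<in> V \<Longrightarrow> act (mmul g h) x = act g (act h x)"
  using smooth_rep by (simp add: smooth_rep_def is_rep_def)

lemma act_act: "g \<in> GL2 \<Longrightarrow> h \<in> GL2 \<Longrightarrow> x \<in> V \<Longrightarrow> act g (act h x) = act (mmul g h) x"
  by (simp add: act_mmul)

lemma act_eqI: "mmul g h = mmul g' h' \<Longrightarrow> g \<in> GL2 \<Longrightarrow> h \<in> GL2 \<Longrightarrow> g' \<in> GL2 \<Longrightarrow> h' \<in> GL2 \<Longrightarrow> x \<in> V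
    \<Longrightarrow> act g (act h x) = act g' (act h' x)"
  by (simp add: act_act)

lemma act_0 [simp]: "g \<in> GL2 \<Longrightarrow> act g 0 = 0"
  using act_sc[of g 0 0] vs.subspace_0[OF subspace_V] by simp

lemma V_closed [simp]:
  "0 \<in> V" "x \<in> V \<Longrightarrow> y \<in> V \<Longrightarrow> x + y \<in> V" "x \<in> V \<Longrightarrow> sc c x \<in> V" "x \<in> V \<Longrightarrow> - x \<in> V"
  "x \<in> V \<Longrightarrow> y \<in> V \<Longrightarrow> x - y \<in> V"
  using subspace_V by (auto intro: vs.subspace_0 vs.subspace_add vs.subspace_scale vs.subspace_neg vs.subspace_diff)

lemma act_diff: "g \<in> GL2 \<Longrightarrow> x \<in> V \<Longrightarrow> y \<in> V \<Longrightarrow> act g (x - y) = act g x - act g y"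
  using act_add[of g "x - y" y] by simp

lemma sum_in_V: "(\<And>i. i \<in> I \<Longrightarrow> h i \<in> V) \<Longrightarrow> sum h I \<in> V"
  using vs.subspace_sum[OF subspace_V] by blast

lemma act_sum: "g \<in> GL2 \<Longrightarrow> (\<And>i. i \<in> I \<Longrightarrow> h i \<in> V) \<Longrightarrow> act g (sum h I) = (\<Sum>i\<in>I. act g (h i))"
  by (induction I rule: infinite_finite_induct) (auto simp: act_add sum_in_V)

lemma act_minv: "g \<in> GL2 \<Longrightarrow> x \<in> V \<Longrightarrow> act g (act (minv g) x) = x" "g \<in> GL2 \<Longrightarrow> x \<in> V \<Longrightarrow> act (minv g) (act g x) = x"
  by (simp_all add: act_act minv)

lemma act_eq_0: "g \<in> GL2 \<Longrightarrow> x \<in> V \<Longrightarrow> act g x = 0 \<longleftrightarrow> x = 0"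
  using act_minv(2)[of g x] by auto

lemma smooth: "x \<in> V \<Longrightarrow> \<exists>n>0. \<forall>g\<in>Kcong v n. act g x = x"
  using smooth_rep by (simp add: smooth_rep_def)

definition Gstable :: "'v set \<Rightarrow> bool" where
  "Gstable W \<longleftrightarrow> vs.subspace W \<and> W \<subseteq> V \<and> (\<forall>g\<in>GL2. \<forall>x\<in>W. act g x \<in> W)"

definition Pstable :: "'v set \<Rightarrow> bool" where
  "Pstable W \<longleftrightarrow> vs.subspace W \<and> W \<subseteq> V \<and> (\<forall>g\<in>Bor. \<forall>x\<in>W. act g x \<in> W)"

lemma stable_sub_iff: "W \<subseteq> V \<Longrightarrow> stable_sub sc GL2 act W \<longleftrightarrow> Gstable W"
  "W \<subseteq> V \<Longrightarrow> stable_sub sc Bor act W \<longleftrightarrow> Pstable W"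
  by (auto simp: stable_sub_def Gstable_def Pstable_def lin_subspace_iff[OF vs.vector_space_axioms])

lemma Gstable_Pstable: "Gstable W \<Longrightarrow> Pstable W"
  using Bor_GL2 by (auto simp: Gstable_def Pstable_def)

lemma Pstable_V: "Pstable V" and Gstable_V: "Gstable V"
  using subspace_V Bor_GL2 by (auto simp: Gstable_def Pstable_def)

lemma Pstable_subspace: "Pstable W \<Longrightarrow> vs.subspace W"
  and Pstable_act: "Pstable W \<Longrightarrow> g \<in> Bor \<Longrightarrow> x \<in> W \<Longrightarrow> act g x \<in> W"
  and Pstable_V_D: "Pstable W \<Longrightarrow> x \<in> W \<Longrightarrow> x \<in> V"
  by (auto simp: Pstable_def)

section \<open>Fixed vectors of congruence subgroups\<close>

definition fixed :: "'f mat2 set \<Rightarrow> 'v set" where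
  "fixed S = {x\<in>V. \<forall>g\<in>S. act g x = x}"

lemma fixedD: "x \<in> fixed S \<Longrightarrow> x \<in> V" "x \<in> fixed S \<Longrightarrow> g \<in> S \<Longrightarrow> act g x = x"
  by (auto simp: fixed_def)

lemma subspace_fixed: "S \<subseteq> GL2 \<Longrightarrow> vs.subspace (fixed S)"
  by (rule vs.subspaceI) (auto simp: fixed_def act_add act_sc subset_iff)

lemma lin_on_act: "g \<in> GL2 \<Longrightarrow> S \<subseteq> V \<Longrightarrow> lin_on sc S (act g)"
  by (auto simp: lin_on_def act_add act_sc subset_iff)

text \<open>The group \<open>I1\<close> is the pro-\<open>p\<close> Iwahori subgroup; \<open>cong i m\<close> interpolates between a group
  fixing a translate of an arbitrary vector and \<open>I1 = cong 1 0\<close>.\<close>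

definition cong :: "int \<Rightarrow> int \<Rightarrow> 'f mat2 set" where
  "cong i m = {(a,b,c,d). ip i (a - 1) \<and> ip m b \<and> ip 1 c \<and> ip i (d - 1)}"

definition I1 :: "'f mat2 set" where "I1 = cong 1 0"

lemma in_cong [simp]: "(a,b,c,d) \<in> cong i m \<longleftrightarrow> ip i (a - 1) \<and> ip m b \<and> ip 1 c \<and> ip i (d - 1)"
  by (simp add: cong_def)

lemma in_I1 [simp]: "(a,b,c,d) \<in> I1 \<longleftrightarrow> ip 1 (a - 1) \<and> ip 0 b \<and> ip 1 c \<and> ip 1 (d - 1)"
  by (simp add: I1_def)

lemma unt_det: "unt a \<Longrightarrow> unt d \<Longrightarrow> ip 0 b \<Longrightarrow> ip 1 c \<Longrightarrow> unt (a*d - b*c)"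
proof -
  assume *: "unt a" "unt d" "ip 0 b" "ip 1 c"
  have "ip 1 (- (b * c))" using * by (simp add: ip_mult_ge)
  then have "ip 1 ((a*d - b*c) - a*d)" by (simp add: algebra_simps)
  then show ?thesis using * unt_cong unt_mult by blast
qed

lemma cong_subset_GL2: "1 \<le> i \<Longrightarrow> 0 \<le> m \<Longrightarrow> cong i m \<subseteq> GL2"
proof
  fix g :: "'f mat2" assume i: "1 \<le> i" "0 \<le> m" and g: "g \<in> cong i m"
  obtain a b c d where abcd: "g = (a,b,c,d)" by (cases g)
  have "unt a" "unt d" "ip 0 b" "ip 1 c"
    using g i unt_one_plus_ge[of i] ip_mono[of m b 0] by (simp_all add: abcd)
  then show "g \<in> GL2" using unt_nonzero[OF unt_det] by (simp add: abcd)
qed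

lemma I1_GL2: "g \<in> I1 \<Longrightarrow> g \<in> GL2"
  using cong_subset_GL2[of 1 0] by (auto simp: I1_def)

lemma subspace_I1: "vs.subspace (fixed I1)"
  using subspace_fixed I1_GL2 by blast

text \<open>Conjugation by \<open>dm (\<pi> powi j) 1\<close> multiplies the upper right entry by
  that power and divides the lower left one by it. With \<open>j = n - 1\<close> the congruence
  group of level \<open>n\<close> becomes a group whose lower left entries fill the maximal ideal,
  as in \<open>I1\<close>; the price is depth \<open>2 * n - 1\<close> in the upper right
  corner.\<close>

lemma exists_cong_fixed:
  assumes W: "Pstable W" "W \<noteq> {0}"
  shows "\<exists>n>0. \<exists>x\<in>W. x \<noteq> 0 \<and> x \<in> fixed (cong (int n) (2 * int n - 1))"
proof -
  obtain w where w: "w \<in> W" "w \<noteq> 0"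
    using W vs.subspace_0[OF Pstable_subspace] by blast
  then have wV: "w \<in> V" using W Pstable_V_D by blast
  then obtain n where n: "n > 0" "\<And>g. g \<in> Kcong v n \<Longrightarrow> act g w = w" using smooth by blast
  define j where "j = int n - 1"
  define t where "t = dm (\<pi> powi j) 1"
  have t: "t \<in> Bor" "t \<in> GL2" by (simp_all add: t_def)
  have "act g (act t w) = act t w" if g: "g \<in> cong (int n) (2 * int n - 1)" for g
  proof -
    obtain a b c d where abcd: "g = (a,b,c,d)" by (cases g)
    define g' where "g' = (a, b / \<pi> powi j, \<pi> powi j * c, d)"
    have gG: "g \<in> GL2" using g cong_subset_GL2[of "int n" "2 * int n - 1"] n(1) by auto
    have "mmul g t = mmul t g'" by (simp add: t_def g'_def abcd)
    moreover have "g' \<in> Kcong v n"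
      using g by (auto simp: abcd g'_def Kcong_def j_def)
    moreover have "g' \<in> GL2" using gG by (simp add: g'_def abcd)
    ultimately show ?thesis using act_eqI[of g t t g' w] gG t wV n(2) by metis
  qed
  then have "act t w \<in> fixed (cong (int n) (2 * int n - 1))"
    using t wV by (auto simp: fixed_def)
  moreover have "act t w \<in> W" "act t w \<noteq> 0" using t w W wV by (auto intro: Pstable_act simp: act_eq_0)
  ultimately show ?thesis using n(1) by blast
qed

lemma funpow_act: "g \<in> GL2 \<Longrightarrow> x \<in> V \<Longrightarrow> (act g ^^ n) x = act ((mmul g ^^ n) mone) x \<and> (mmul g ^^ n) mone \<in> GL2"
  by (induction n) (auto simp: act_act)

text \<open>\<open>cong i m\<close> is generated by \<open>cong (i + 1) m\<close> and the finitely
  many diagonal matrices in \<open>D\<close>. These commute, normalize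
  \<open>cong (i + 1) m\<close>, and have \<open>p\<close>-th powers inside it, so they act on its
  fixed vectors as commuting operators of order dividing \<open>p\<close>.\<close>

lemma cong_shrink_torus:
  assumes W: "Pstable W" and i: "1 \<le> i" and m: "0 \<le> m"
    and x: "x \<in> W" "x \<noteq> 0" "x \<in> fixed (cong (i + 1) m)"
  shows "\<exists>x\<in>W. x \<noteq> 0 \<and> x \<in> fixed (cong i m)"
proof -
  define S where "S = W \<inter> fixed (cong (i + 1) m)"
  define D where "D = (\<lambda>(r, r'). dm (1 + \<pi> powi i * r) (1 + \<pi> powi i * r')) ` (Rep \<times> Rep)"
  have un: "unt (1 + \<pi> powi i * r)" if "r \<in> Rep" for r
    by (rule unt_one_plus_ge[of i]) (use that Rep(3) i in auto)
  have D: "\<exists>a d. g = dm a d \<and> ip i (a - 1) \<and> ip i (d - 1) \<and> unt a \<and> unt d" if "g \<in> D" for g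
    using that un Rep(3) by (force simp: D_def)
  have cG: "cong (i + 1) m \<subseteq> GL2" using i m by (intro cong_subset_GL2) auto
  have SV: "S \<subseteq> V" using W by (auto simp: S_def Pstable_def)
  have DG: "g \<in> Bor \<and> g \<in> GL2" if "g \<in> D" for g using D[OF that] by (auto dest: unt_nonzero)
  have "\<exists>x\<in>S. x \<noteq> 0 \<and> (\<forall>g\<in>D. act g x = x)"
  proof (rule vs.common_fixed_vector[OF alg_closure])
    show "finite D" unfolding D_def using Rep(1) by blast
    show "vs.subspace S" unfolding S_def using W cG by (intro vs.subspace_inter subspace_fixed) (auto simp: Pstable_def)
    show "S \<noteq> {0}" using x by (auto simp: S_def)
    show "lin_on sc S (act g)" if "g \<in> D" for g using DG[OF that] SV by (intro lin_on_act) auto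
    show "act g x \<in> S" if "g \<in> D" "x \<in> S" for g x
    proof -
      obtain a d where g: "g = dm a d" "unt a" "unt d" using D[OF \<open>g \<in> D\<close>] by blast
      then have nz: "a \<noteq> 0" "d \<noteq> 0" by (auto dest: unt_nonzero)
      have "act h (act g x) = act g x" if h: "h \<in> cong (i + 1) m" for h
      proof -
        obtain a' b' c' d' where h': "h = (a',b',c',d')" by (cases h)
        define h2 where "h2 = (a', b' * d / a, c' * a / d, d')"
        have "h2 \<in> cong (i + 1) m" using h g by (simp add: h' h2_def)
        moreover have "mmul h g = mmul g h2" using nz by (simp add: h' g h2_def)
        ultimately show ?thesis
          using act_eqI[of h g g h2 x] h DG[OF \<open>g \<in> D\<close>] cG SV \<open>x \<in> S\<close> by (auto simp: S_def fixed_def)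
      qed
      then show ?thesis using that DG W SV by (auto simp: S_def fixed_def Pstable_def)
    qed
    show "act g (act h x) = act h (act g x)" if "g \<in> D" "h \<in> D" "x \<in> S" for g h x
      by (rule act_eqI) (use that DG SV D[OF that(1)] D[OF that(2)] in auto)
    show "\<exists>m. \<forall>x\<in>S. (act g ^^ (p ^ m)) x = x" if "g \<in> D" for g
    proof (intro exI[of _ 1] ballI)
      fix x assume "x \<in> S"
      obtain a d where g: "g = dm a d" "ip i (a - 1)" "ip i (d - 1)" using D[OF \<open>g \<in> D\<close>] by blast
      have "(mmul g ^^ n) mone = dm (a ^ n) (d ^ n)" for n
        by (induction n) (auto simp: g mone_def)
      then have "(act g ^^ (p ^ 1)) x = act (dm (a ^ p) (d ^ p)) x"
        using funpow_act[of g x p] DG that SV \<open>x \<in> S\<close> by auto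
      moreover have "dm (a ^ p) (d ^ p) \<in> cong (i + 1) m"
        using g i ip_one_power_p by simp
      ultimately show "(act g ^^ (p ^ 1)) x = x" using \<open>x \<in> S\<close> by (auto simp: S_def fixed_def)
    qed
  qed
  then obtain x where x: "x \<in> S" "x \<noteq> 0" "\<And>g. g \<in> D \<Longrightarrow> act g x = x" by blast
  have "act g x = x" if g: "g \<in> cong i m" for g
  proof -
    obtain a b c d where abcd: "g = (a,b,c,d)" by (cases g)
    have *: "ip i (a - 1)" "ip i (d - 1)" "ip m b" "ip 1 c" using g by (auto simp: abcd)
    \<comment> \<open>One digit of \<open>a\<close> at depth \<open>i\<close> is split off; the
      quotient is congruent to 1 one step further.\<close>
    have dec: "\<exists>e. e \<in> (\<lambda>r. 1 + \<pi> powi i * r) ` Rep \<and> ip (i + 1) (a / e - 1)" if "ip i (a - 1)" for a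
    proof -
      define r where "r = rd ((a - 1) / \<pi> powi i)"
      have r: "r \<in> Rep" "ip 1 ((a - 1) / \<pi> powi i - r)" using rd[of "(a - 1) / \<pi> powi i"] that by (auto simp: r_def)
      have u: "unt (1 + \<pi> powi i * r)" by (rule un[OF r(1)])
      have "ip (i + 1) (\<pi> powi i * ((a - 1) / \<pi> powi i - r))" using r by simp
      moreover have "\<pi> powi i * ((a - 1) / \<pi> powi i - r) = a - (1 + \<pi> powi i * r)"
        using uniformizer_nonzero by (simp add: field_simps power_int_eq_0_iff)
      ultimately have "ip (i + 1) ((a - (1 + \<pi> powi i * r)) / (1 + \<pi> powi i * r))"
        using u by (simp only: ip_divide_unt)
      then have "ip (i + 1) (a / (1 + \<pi> powi i * r) - 1)"
        using unt_nonzero[OF u] by (simp add: diff_divide_distrib)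
      then show ?thesis using r by blast
    qed
    obtain e e' where e: "e \<in> (\<lambda>r. 1 + \<pi> powi i * r) ` Rep" "ip (i + 1) (a / e - 1)"
      "e' \<in> (\<lambda>r. 1 + \<pi> powi i * r) ` Rep" "ip (i + 1) (d / e' - 1)" using dec *(1,2) by meson
    then have u: "unt e" "unt e'" using un by auto
    define h where "h = (a / e, b / e, c / e', d / e')"
    have h: "h \<in> cong (i + 1) m" using e u * by (simp add: h_def)
    have k: "(dm e e') \<in> D" using e by (auto simp: D_def)
    have "h \<in> GL2" "x \<in> V" using h cG x SV by blast+
    moreover have "g = mmul (dm e e') h" using u[THEN unt_nonzero] by (simp add: h_def abcd)
    ultimately have "act g x = act (dm e e') (act h x)"
      using act_mmul DG[OF k] by metis
    also have "\<dots> = x" using h k x by (auto simp: S_def fixed_def)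
    finally show ?thesis .
  qed
  then show ?thesis using x SV by (auto simp: S_def fixed_def)
qed

text \<open>Same scheme with upper unipotent matrices in \<open>D\<close>. They normalize
  \<open>cong 1 (m + 1)\<close> because conjugation changes the upper right entry by
  \<open>b * (a' - d')\<close> and \<open>b * b * c'\<close>, both of depth \<open>m + 1\<close>:
  the diagonal entries agree modulo the maximal ideal.\<close>

lemma cong_shrink_unipotent:
  assumes W: "Pstable W" and m: "0 \<le> m"
    and x: "x \<in> W" "x \<noteq> 0" "x \<in> fixed (cong 1 (m + 1))"
  shows "\<exists>x\<in>W. x \<noteq> 0 \<and> x \<in> fixed (cong 1 m)"
proof -
  define S where "S = W \<inter> fixed (cong 1 (m + 1))"
  define D where "D = (\<lambda>r. um (\<pi> powi m * r)) ` Rep"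
  have D: "\<exists>b. g = um b \<and> ip m b" if "g \<in> D" for g
    using that Rep(3) by (auto simp: D_def)
  have cG: "cong 1 (m + 1) \<subseteq> GL2" using m by (intro cong_subset_GL2) auto
  have SV: "S \<subseteq> V" using W by (auto simp: S_def Pstable_def)
  have DG: "g \<in> Bor \<and> g \<in> GL2" if "g \<in> D" for g using D[OF that] by auto
  have "\<exists>x\<in>S. x \<noteq> 0 \<and> (\<forall>g\<in>D. act g x = x)"
  proof (rule vs.common_fixed_vector[OF alg_closure])
    show "finite D" unfolding D_def using Rep(1) by blast
    show "vs.subspace S" unfolding S_def using W cG by (intro vs.subspace_inter subspace_fixed) (auto simp: Pstable_def)
    show "S \<noteq> {0}" using x by (auto simp: S_def)
    show "lin_on sc S (act g)" if "g \<in> D" for g using DG[OF that] SV by (intro lin_on_act) auto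
    show "act g x \<in> S" if "g \<in> D" "x \<in> S" for g x
    proof -
      obtain b where g: "g = um b" "ip m b" using D[OF \<open>g \<in> D\<close>] by blast
      have "act h (act g x) = act g x" if h: "h \<in> cong 1 (m + 1)" for h
      proof -
        obtain a' b' c' d' where h': "h = (a',b',c',d')" by (cases h)
        have *: "ip 1 (a' - 1)" "ip (m + 1) b'" "ip 1 c'" "ip 1 (d' - 1)" using h by (auto simp: h')
        define h2 where "h2 = (a' - b * c', b' + b * ((a' - 1) - (d' - 1)) - b * b * c', c', d' + b * c')"
        have bc: "ip 1 (b * c')" using ip_mult_ge[OF g(2) *(3)] m by simp
        have "ip (m + 1) (b * ((a' - 1) - (d' - 1)))" using ip_mult[OF g(2) ip_diff[OF *(1,4)]] .
        moreover have "ip (m + 1) (b * b * c')" using ip_mult[OF g(2) bc] by (simp add: mult.assoc)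
        ultimately have "ip (m + 1) (b' + b * ((a' - 1) - (d' - 1)) - b * b * c')"
          using *(2) by (intro ip_diff[OF ip_add])
        moreover have "ip 1 (a' - b * c' - 1)" "ip 1 (d' + b * c' - 1)"
          using ip_diff[OF *(1) bc] ip_add[OF *(4) bc] by (simp_all add: algebra_simps)
        ultimately have "h2 \<in> cong 1 (m + 1)" using *(3) by (simp add: h2_def)
        moreover have "mmul h g = mmul g h2" by (simp add: h' g h2_def algebra_simps)
        ultimately show ?thesis
          using act_eqI[of h g g h2 x] h DG[OF \<open>g \<in> D\<close>] cG SV \<open>x \<in> S\<close> by (auto simp: S_def fixed_def)
      qed
      then show ?thesis using that DG W SV by (auto simp: S_def fixed_def Pstable_def)
    qed
    show "act g (act h x) = act h (act g x)" if "g \<in> D" "h \<in> D" "x \<in> S" for g h x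
      by (rule act_eqI) (use that DG SV D[OF that(1)] D[OF that(2)] in auto)
    show "\<exists>m. \<forall>x\<in>S. (act g ^^ (p ^ m)) x = x" if "g \<in> D" for g
    proof (intro exI[of _ 1] ballI)
      fix x assume "x \<in> S"
      obtain b where g: "g = um b" "ip m b" using D[OF \<open>g \<in> D\<close>] by blast
      have "(mmul g ^^ n) mone = um (of_nat n * b)" for n
        by (induction n) (auto simp: g mone_def algebra_simps)
      then have "(act g ^^ (p ^ 1)) x = act (um (of_nat p * b)) x"
        using funpow_act[of g x p] DG that SV \<open>x \<in> S\<close> by auto
      moreover have "(um (of_nat p * b)) \<in> cong 1 (m + 1)"
        using ip_mult[OF ip_p g(2)] by (simp add: add.commute)
      ultimately show "(act g ^^ (p ^ 1)) x = x" using \<open>x \<in> S\<close> by (auto simp: S_def fixed_def)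
    qed
  qed
  then obtain x where x: "x \<in> S" "x \<noteq> 0" "\<And>g. g \<in> D \<Longrightarrow> act g x = x" by blast
  have "act g x = x" if g: "g \<in> cong 1 m" for g
  proof -
    obtain a b c d where abcd: "g = (a,b,c,d)" by (cases g)
    have *: "ip 1 (a - 1)" "ip 1 (d - 1)" "ip m b" "ip 1 c" using g by (auto simp: abcd)
    define r where "r = rd (b / \<pi> powi m)"
    have r: "r \<in> Rep" "ip 1 (b / \<pi> powi m - r)" using rd[of "b / \<pi> powi m"] * by (auto simp: r_def)
    define e where "e = \<pi> powi m * r"
    have em: "ip m e" using Rep(3)[OF r(1)] by (simp add: e_def)
    have "ip (m + 1) (\<pi> powi m * (b / \<pi> powi m - r))" using r by simp
    then have be: "ip (m + 1) (b - e)" by (simp add: e_def algebra_simps)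
    define h where "h = (a - e * c, b - e * d, c, d)"
    have "ip 1 (e * c)" using ip_mult_ge[OF em *(4)] m by simp
    moreover have "b - e * d = (b - e) - e * (d - 1)" by (simp add: algebra_simps)
    moreover have "a - e * c - 1 = (a - 1) - e * c" by simp
    moreover have "ip (m + 1) (e * (d - 1))" using ip_mult[OF em *(2)] .
    ultimately have h: "h \<in> cong 1 (m + 1)"
      using * be unfolding h_def in_cong by (metis ip_diff)
    have k: "(um e) \<in> D" using r by (auto simp: D_def e_def)
    have "h \<in> GL2" "x \<in> V" using h cG x SV by blast+
    moreover have "g = mmul (um e) h" by (simp add: h_def abcd)
    ultimately have "act g x = act (um e) (act h x)"
      using act_mmul DG[OF k] by metis
    also have "\<dots> = x" using h k x by (auto simp: S_def fixed_def)
    finally show ?thesis .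
  qed
  then show ?thesis using x SV by (auto simp: S_def fixed_def)
qed

text \<open>The pro-\<open>p\<close> Iwahori group is exhausted by \<open>P \<inter> I1\<close> and a subgroup fixing a given vector
  after translation by the torus, so only elements of \<open>P\<close> are needed to reach an \<open>I1\<close>-fixed vector.\<close>

lemma exists_I1_fixed:
  assumes W: "Pstable W" "W \<noteq> {0}"
  shows "\<exists>x\<in>W. x \<noteq> 0 \<and> x \<in> fixed I1"
proof -
  obtain n x where n: "n > 0" "x \<in> W" "x \<noteq> 0" "x \<in> fixed (cong (int n) (2 * int n - 1))"
    using exists_cong_fixed[OF W] by blast
  define m where "m = nat (2 * int n - 1)"
  have m: "2 * int n - 1 = int m" using n(1) by (simp add: m_def)
  have 1: "\<exists>x\<in>W. x \<noteq> 0 \<and> x \<in> fixed (cong 1 (int m))"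
  proof -
    have "x \<in> W \<Longrightarrow> x \<noteq> 0 \<Longrightarrow> x \<in> fixed (cong (int k + 1) (int m)) \<Longrightarrow> ?thesis" for k x
    proof (induction k arbitrary: x)
      case (Suc k)
      then show ?case
        using cong_shrink_torus[OF W(1), of "int k + 1" "int m" x] by (auto simp: add_ac)
    qed auto
    from this[of x "n - 1"] show ?thesis using n m by (simp add: of_nat_diff)
  qed
  then obtain x where "x \<in> W" "x \<noteq> 0" "x \<in> fixed (cong 1 (int m))" by blast
  then show ?thesis
  proof (induction m arbitrary: x)
    case (Suc m)
    then show ?case
      using cong_shrink_unipotent[OF W(1), of "int m" x] by (auto simp: add_ac)
  qed (auto simp: I1_def)
qed

end

subsection \<open>The operator \<open>U\<close> on vectors fixed by the pro-p Iwahori subgroup\<close>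

context local_field
begin

text \<open>Two powers of \<open>r\<close> share a residue class by finiteness of
  \<open>Rep\<close>; dividing them gives the claim. It lets the units of the torus act with finite
  order on \<open>I1\<close>-fixed vectors.\<close>

lemma unt_root_of_unity: "unt r \<Longrightarrow> \<exists>n>0. ip 1 (r ^ n - 1)"
proof -
  assume r: "unt r"
  have ran: "rd (r ^ n) \<in> Rep" for n using rd(1) unt_ip unt_power r by blast
  have "\<not> inj (\<lambda>n. rd (r ^ n))"
    using ran Rep(1) finite_subset[of "range (\<lambda>n. rd (r ^ n))" Rep] range_inj_infinite by blast
  then obtain i j where "i \<noteq> j" "rd (r ^ i) = rd (r ^ j)" by (auto simp: inj_def)
  then obtain i j where ij: "i < j" "rd (r ^ i) = rd (r ^ j)" by (metis linorder_neqE_nat)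
  then have "ip 1 (r ^ j - r ^ i)"
    using rd(2)[of "r ^ i"] rd(2)[of "r ^ j"] unt_ip[OF unt_power[OF r]] ip_diff_trans ip_diff_commute by metis
  then have "ip 1 ((r ^ j - r ^ i) / r ^ i)" using unt_power[OF r] by simp
  moreover have "(r ^ j - r ^ i) / r ^ i = r ^ (j - i) - 1"
    using ij unt_nonzero[OF r] by (simp add: diff_divide_distrib power_diff)
  ultimately show ?thesis using ij by (intro exI[of _ "j - i"]) simp
qed

end

context gl2_rep
begin

text \<open>The Hecke operator of the double coset of \<open>dm \<pi> 1\<close>: the matrices
  \<open>(\<pi>, r, 0, 1)\<close> represent the left cosets of \<open>I1\<close> in it. They are
  upper triangular, so \<open>U\<close> maps \<open>P\<close>-stable subspaces to
  themselves.\<close>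

definition U :: "'v \<Rightarrow> 'v" where "U x = (\<Sum>r\<in>Rep. act (\<pi>, r, 0, 1) x)"

definition Pspan :: "'v \<Rightarrow> 'v set" where "Pspan z = vs.span ((\<lambda>g. act g z) ` Bor)"

definition Gspan :: "'v \<Rightarrow> 'v set" where "Gspan z = vs.span ((\<lambda>g. act g z) ` GL2)"

lemma span_stable:
  assumes "A \<subseteq> V" "g \<in> GL2" "\<And>x. x \<in> A \<Longrightarrow> act g x \<in> vs.span A" "x \<in> vs.span A"
  shows "act g x \<in> vs.span A \<and> x \<in> V"
proof -
  have "vs.subspace {x\<in>V. act g x \<in> vs.span A}"
    by (rule vs.subspaceI) (use assms in \<open>auto simp: act_add act_sc vs.span_zero vs.span_add vs.span_scale\<close>)
  moreover have "A \<subseteq> {x\<in>V. act g x \<in> vs.span A}" using assms by blast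
  ultimately show ?thesis using assms(4) vs.span_minimal by blast
qed

lemma Pspan_Pstable: assumes "z \<in> V" shows "Pstable (Pspan z)"
proof -
  have *: "act g (act h z) \<in> vs.span ((\<lambda>g. act g z) ` Bor)" if "g \<in> Bor" "h \<in> Bor" for g h
    using that assms by (simp add: act_act Bor_GL2 vs.span_base)
  have sub: "(\<lambda>g. act g z) ` Bor \<subseteq> V" using assms Bor_GL2 by auto
  show ?thesis
    unfolding Pstable_def Pspan_def using span_stable[OF sub] * sub Bor_GL2 vs.subspace_span
      vs.span_minimal[OF sub subspace_V] by blast
qed

lemma Gspan_Gstable: assumes "z \<in> V" shows "Gstable (Gspan z)"
proof -
  have *: "act g (act h z) \<in> vs.span ((\<lambda>g. act g z) ` GL2)" if "g \<in> GL2" "h \<in> GL2" for g h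
    using that assms by (simp add: act_act vs.span_base)
  have sub: "(\<lambda>g. act g z) ` GL2 \<subseteq> V" using assms by auto
  show ?thesis
    unfolding Gstable_def Gspan_def using span_stable[OF sub] * sub vs.subspace_span
      vs.span_minimal[OF sub subspace_V] by blast
qed

lemma Pspan_base: "z \<in> V \<Longrightarrow> g \<in> Bor \<Longrightarrow> act g z \<in> Pspan z"
  unfolding Pspan_def by (rule vs.span_base) blast

lemma Pspan_self: "z \<in> V \<Longrightarrow> z \<in> Pspan z"
  using Pspan_base[of z mone] by simp

lemma Pspan_minimal: "Pstable W \<Longrightarrow> z \<in> W \<Longrightarrow> Pspan z \<subseteq> W"
  unfolding Pspan_def by (rule vs.span_minimal) (auto simp: Pstable_def)

lemma Gspan_base: "z \<in> V \<Longrightarrow> g \<in> GL2 \<Longrightarrow> act g z \<in> Gspan z"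
  unfolding Gspan_def by (rule vs.span_base) blast

lemma Gspan_self: "z \<in> V \<Longrightarrow> z \<in> Gspan z"
  using Gspan_base[of z mone] by simp

lemma Gspan_minimal: "vs.subspace W \<Longrightarrow> (\<And>g. g \<in> GL2 \<Longrightarrow> act g z \<in> W) \<Longrightarrow> Gspan z \<subseteq> W"
  unfolding Gspan_def by (rule vs.span_minimal) auto

lemma U_in: "Pstable W \<Longrightarrow> z \<in> W \<Longrightarrow> U z \<in> W"
  unfolding U_def by (rule vs.subspace_sum) (auto simp: Pstable_def)

lemma U_V [simp]: "z \<in> V \<Longrightarrow> U z \<in> V"
  using U_in Pstable_V by blast

lemma lin_on_U: "S \<subseteq> V \<Longrightarrow> lin_on sc S U"
  unfolding lin_on_def U_def
  by (auto simp: act_add act_sc sum.distrib vs.scale_sum_right subset_iff)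

lemma U_cong:
  assumes "z \<in> fixed I1" "ip 1 y"
  shows "act (\<pi>, x + y, 0, 1) z = act (\<pi>, x, 0, 1) z"
proof -
  have "mmul (\<pi>, x, 0, 1) (um (y / \<pi>)) = (\<pi>, x + y, 0, 1)" by simp
  moreover have "act (um (y / \<pi>)) z = z" using assms by (intro fixedD(2)) auto
  moreover have "act (mmul (\<pi>, x, 0, 1) (um (y / \<pi>))) z = act (\<pi>, x, 0, 1) (act (um (y / \<pi>)) z)"
    by (rule act_mmul) (use fixedD(1)[OF assms(1)] in auto)
  ultimately show ?thesis by metis
qed

text \<open>Multiplying \<open>(\<pi>, r, 0, 1)\<close> on the left by an element of
  \<open>I1\<close> with upper right entry \<open>b\<close> shifts \<open>r\<close> to
  \<open>r + b\<close>, up to a factor from \<open>I1\<close> on the right; the shift permutes the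
  residue classes.\<close>

lemma U_fixed: assumes z: "z \<in> fixed I1" shows "U z \<in> fixed I1"
proof -
  have zV: "z \<in> V" using z by (rule fixedD)
  have "act g (U z) = U z" if g: "g \<in> I1" for g
  proof -
    obtain a b c d where abcd: "g = (a,b,c,d)" by (cases g)
    have *: "ip 1 (a - 1)" "ip 0 b" "ip 1 c" "ip 1 (d - 1)" using g by (auto simp: abcd)
    have "act g (act (\<pi>, r, 0, 1) z) = act (\<pi>, r + b, 0, 1) z" if r: "r \<in> Rep" for r
    proof -
      \<comment> \<open>\<open>\<beta>\<close> equals
        \<open>a * r + b - (r + b) * (c * r + d)\<close>, rewritten as a sum of terms that visibly
        lie in the maximal ideal; \<open>h\<close> is the factor left on the right.\<close>
      define \<beta> where "\<beta> = r * (a - 1) - r * (d - 1) - r * (r * c) - b * (d - 1) - b * (r * c)"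
      define h where "h = (a - (r + b) * c, \<beta> / \<pi>, \<pi> * c, c * r + d)"
      have r0: "ip 0 r" using Rep(3) r by simp
      have rc: "ip 1 (r * c)" "ip 1 (b * c)" using ip_mult[OF r0 *(3)] ip_mult[OF *(2,3)] by simp_all
      have "ip 1 \<beta>" unfolding \<beta>_def
        using ip_mult[OF r0 *(1)] ip_mult[OF r0 *(4)] ip_mult[OF r0 rc(1)] ip_mult[OF *(2,4)] ip_mult[OF *(2) rc(1)]
        by (intro ip_diff) simp_all
      moreover have "ip 1 ((a - 1) - (r * c + b * c))" "ip 1 ((r * c) + (d - 1))"
        using ip_diff[OF *(1) ip_add[OF rc]] ip_add[OF rc(1) *(4)] by blast+
      then have "ip 1 (a - (r + b) * c - 1)" "ip 1 (c * r + d - 1)" by (simp_all add: algebra_simps)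
      ultimately have hI: "h \<in> I1" using *(3) ip_mono[OF *(3), of 0] by (simp add: h_def)
      have "mmul g (\<pi>, r, 0, 1) = mmul (\<pi>, r + b, 0, 1) h"
        by (simp add: h_def abcd) (simp add: \<beta>_def algebra_simps)
      then have "act g (act (\<pi>, r, 0, 1) z) = act (\<pi>, r + b, 0, 1) (act h z)"
        by (rule act_eqI) (use I1_GL2[OF g] I1_GL2[OF hI] zV in auto)
      then show ?thesis using fixedD(2)[OF z hI] by simp
    qed
    then have "act g (U z) = (\<Sum>r\<in>Rep. act (\<pi>, r + b, 0, 1) z)"
      unfolding U_def using I1_GL2[OF g] zV by (subst act_sum) auto
    also have "\<dots> = U z"
      unfolding U_def by (rule sum_Rep_shift) (use U_cong[OF z] * in auto)
    finally show ?thesis .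
  qed
  then show ?thesis using zV by (simp add: fixed_def)
qed

text \<open>For a unit \<open>r\<close>, the matrix \<open>mmul sm (\<pi>, r, 0, 1)\<close> is upper
  triangular times the lower unipotent \<open>(1, 0, \<pi> / r, 1)\<close> from \<open>I1\<close>.
  Only the term \<open>r = 0\<close> may leave the \<open>P\<close>-span of \<open>z\<close>, and it
  contributes \<open>dm 1 \<pi>\<close> applied to \<open>act sm z\<close>.\<close>

lemma sm_U:
  assumes z: "z \<in> fixed I1"
  shows "act sm (U z) = act (0, 1, \<pi>, 0) z + (\<Sum>r\<in>Rep - {0}. act (- \<pi> / r, 1, 0, r) z)"
proof -
  have zV: "z \<in> V" using z by (rule fixedD)
  have "act sm (act (\<pi>, r, 0, 1) z) = act (- \<pi> / r, 1, 0, r) z" if r: "r \<in> Rep - {0}" for r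
  proof -
    have u: "unt r" using r Rep_unt by blast
    have h: "(1, 0, \<pi> / r, 1) \<in> I1" using u by simp
    have "mmul sm (\<pi>, r, 0, 1) = mmul (- \<pi> / r, 1, 0, r) (1, 0, \<pi> / r, 1)" using r by simp
    then show ?thesis
      using act_eqI[of sm "(\<pi>, r, 0, 1)" "(- \<pi> / r, 1, 0, r)" "(1, 0, \<pi> / r, 1)" z] r
        I1_GL2[OF h] zV fixedD(2)[OF z h] by simp
  qed
  moreover have "act sm (act (\<pi>, 0, 0, 1) z) = act (0, 1, \<pi>, 0) z"
    using zV by (simp add: act_act)
  moreover have "act sm (U z) = (\<Sum>r\<in>Rep. act sm (act (\<pi>, r, 0, 1) z))"
    unfolding U_def using zV by (subst act_sum) auto
  ultimately show ?thesis
    by (simp add: sum.remove[OF Rep(1,2)])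
qed

lemma Pi_eq: "z \<in> V \<Longrightarrow> act (0, 1, \<pi>, 0) z = act (dm 1 \<pi>) (act sm z)"
  by (simp add: act_act)

text \<open>The coset is read off from the bottom row, a point of the projective line: if
  \<open>c / d\<close> lies in the maximal ideal, a lower unipotent element of \<open>I1\<close>
  makes \<open>g\<close> upper triangular, and otherwise \<open>d / c\<close> is integral and an
  upper unipotent one is split off after \<open>sm\<close>.\<close>

lemma GL2_act_decomp:
  assumes z: "z \<in> fixed I1" and g: "g \<in> GL2"
  shows "\<exists>b\<in>Bor. act g z = act b z \<or> act g z = act b (act sm z)"
proof -
  have zV: "z \<in> V" using z by (rule fixedD)
  obtain a b c d where abcd: "g = (a,b,c,d)" by (cases g)
  have det: "a * d - b * c \<noteq> 0" using g by (simp add: abcd)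
  show ?thesis
  proof (cases "d \<noteq> 0 \<and> ip 1 (c / d)")
    case True
    define k :: "'f mat2" where "k = (1, 0, c / d, 1)"
    have k: "k \<in> I1" using True by (simp add: k_def)
    have "mmul ((a * d - b * c) / d, b, 0, d) k = g" using True by (simp add: k_def abcd field_simps)
    moreover have B: "((a * d - b * c) / d, b, 0, d) \<in> Bor" using True det by simp
    ultimately have "act g z = act ((a * d - b * c) / d, b, 0, d) (act k z)"
      using act_mmul Bor_GL2[OF B] I1_GL2[OF k] zV by metis
    then show ?thesis using B fixedD(2)[OF z k] by auto
  next
    case False
    have c: "c \<noteq> 0" using False det by (cases "c = 0") auto
    have dc: "ip 0 (d / c)"
      using False c by (cases "d = 0") (auto simp: in_pow_def v_divide)
    define k where "k = um (d / c)"
    have k: "k \<in> I1" using dc by (simp add: k_def)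
    define B :: "'f mat2" where "B = ((b * c - a * d) / c, a, 0, c)"
    have B: "B \<in> Bor" using c det by (simp add: B_def)
    have "mmul (mmul B sm) k = g" using c by (simp add: B_def k_def abcd field_simps)
    then have "act g z = act B (act sm (act k z))"
      using act_mmul[of "mmul B sm" k z] act_mmul[of B sm "act k z"] Bor_GL2[OF B] I1_GL2[OF k] zV by simp
    then show ?thesis using B fixedD(2)[OF z k] by auto
  qed
qed

lemma GL2_act_in:
  assumes "Pstable W" "z \<in> fixed I1" "z \<in> W" "act sm z \<in> W" "g \<in> GL2"
  shows "act g z \<in> W"
  using GL2_act_decomp[OF assms(2,5)] assms Pstable_act by metis

lemma Gspan_subset: "Pstable W \<Longrightarrow> z \<in> fixed I1 \<Longrightarrow> z \<in> W \<Longrightarrow> act sm z \<in> W \<Longrightarrow> Gspan z \<subseteq> W"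
  using Gspan_minimal GL2_act_in Pstable_subspace by blast

lemma Pspan_subset_Gspan: "z \<in> V \<Longrightarrow> Pspan z \<subseteq> Gspan z"
  using Pspan_minimal Gspan_Gstable Gstable_Pstable Gspan_self by blast

lemma Pspan_Gstable:
  assumes "z \<in> fixed I1" "act sm z \<in> Pspan z"
  shows "Gstable (Pspan z)"
proof -
  have zV: "z \<in> V" using assms by (auto dest: fixedD)
  have "Gspan z = Pspan z"
    using Gspan_subset[OF Pspan_Pstable assms(1) Pspan_self assms(2)] Pspan_subset_Gspan zV by blast
  then show ?thesis using Gspan_Gstable zV by metis
qed

lemma sm_Pi_in:
  assumes "Pstable W" "z \<in> V"
  shows "act sm z \<in> W \<longleftrightarrow> act (0, 1, \<pi>, 0) z \<in> W"
proof -
  have "act sm z = act (dm 1 (1 / \<pi>)) (act (0, 1, \<pi>, 0) z)" using assms(2) by (simp add: act_act)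
  moreover have "dm 1 (1 / \<pi>) \<in> Bor" "dm 1 \<pi> \<in> Bor" by simp_all
  ultimately show ?thesis using Pi_eq[OF assms(2)] Pstable_act[OF assms(1)] by metis
qed

lemma sm_U_cong:
  assumes "z \<in> fixed I1"
  shows "act sm (U z) - act (dm 1 \<pi>) (act sm z) \<in> Pspan z"
proof -
  have zV: "z \<in> V" using assms by (auto dest: fixedD)
  have "(\<Sum>r\<in>Rep - {0}. act (- \<pi> / r, 1, 0, r) z) \<in> Pspan z"
    using zV by (intro vs.subspace_sum[OF Pstable_subspace[OF Pspan_Pstable]] Pspan_base) auto
  then show ?thesis using sm_U[OF assms] Pi_eq[OF zV] by simp
qed

lemma U_zero_Gstable:
  assumes z: "z \<in> fixed I1" and U: "U z = 0"
  shows "Gstable (Pspan z)"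
proof -
  have zV: "z \<in> V" using z by (auto dest: fixedD)
  have "- act (0, 1, \<pi>, 0) z \<in> Pspan z" using sm_U_cong[OF z] U Pi_eq[OF zV] by simp
  then have "act (0, 1, \<pi>, 0) z \<in> Pspan z"
    using vs.subspace_neg[OF Pstable_subspace[OF Pspan_Pstable[OF zV]]] by force
  then show ?thesis
    using Pspan_Gstable[OF z] sm_Pi_in[OF Pspan_Pstable[OF zV] zV] by simp
qed

text \<open>Only the first diagonal entry is prescribed; the second is handled by the central
  character in \<open>act_dm_teig\<close>. \<open>\<theta>\<close> is a plain function, whose
  multiplicativity on units follows from the existence of a nonzero vector.\<close>

definition teig :: "('f \<Rightarrow> 'k) \<Rightarrow> 'v set" where
  "teig \<theta> = {x \<in> fixed I1. \<forall>a. unt a \<longrightarrow> act (dm a 1) x = sc (\<theta> a) x}"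

lemma teigD: "x \<in> teig \<theta> \<Longrightarrow> x \<in> fixed I1" "x \<in> teig \<theta> \<Longrightarrow> x \<in> V"
  "x \<in> teig \<theta> \<Longrightarrow> unt a \<Longrightarrow> act (dm a 1) x = sc (\<theta> a) x"
  by (auto simp: teig_def fixed_def)

lemma subspace_teig: "vs.subspace (teig \<theta>)"
proof (rule vs.subspaceI)
  show "0 \<in> teig \<theta>" using vs.subspace_0[OF subspace_I1] by (auto simp: teig_def dest: unt_nonzero)
  show "x + y \<in> teig \<theta>" if "x \<in> teig \<theta>" "y \<in> teig \<theta>" for x y
    using vs.subspace_add[OF subspace_I1] teigD[OF that(1)] teigD[OF that(2)] unt_nonzero
    by (simp add: teig_def act_add vs.scale_right_distrib)
  show "sc c x \<in> teig \<theta>" if "x \<in> teig \<theta>" for x c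
    using vs.subspace_scale[OF subspace_I1] teigD[OF that] unt_nonzero
    by (simp add: teig_def act_sc mult.commute)
qed

lemma act_dm_fixed:
  assumes "x \<in> fixed I1" "unt a" "unt d"
  shows "act (dm a d) x \<in> fixed I1"
proof -
  have nz: "a \<noteq> 0" "d \<noteq> 0" using assms by (auto dest: unt_nonzero)
  have xV: "x \<in> V" using assms by (auto dest: fixedD)
  have "act h (act (dm a d) x) = act (dm a d) x" if h: "h \<in> I1" for h
  proof -
    obtain a' b' c' d' where h': "h = (a',b',c',d')" by (cases h)
    define h2 where "h2 = (a', b' * d / a, c' * a / d, d')"
    have h2: "h2 \<in> I1" using h assms by (simp add: h' h2_def)
    have "mmul h (dm a d) = mmul (dm a d) h2" using nz by (simp add: h' h2_def)
    then show ?thesis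
      using act_eqI[of h "dm a d" "dm a d" h2 x] I1_GL2[OF h] I1_GL2[OF h2] xV nz fixedD(2)[OF assms(1) h2] by simp
  qed
  then show ?thesis using xV nz by (simp add: fixed_def)
qed

text \<open>The units act on \<open>I1\<close>-fixed vectors through the finite residue group, by
  commuting operators of finite order, so \<open>common_eigenvector\<close> applies. Representatives
  suffice, since a unit differs from its representative by an element of \<open>I1\<close>.\<close>

lemma exists_teig:
  assumes W: "Pstable W" "W \<noteq> {0}"
  shows "\<exists>\<theta>. \<exists>x\<in>W. x \<noteq> 0 \<and> x \<in> teig \<theta>"
proof -
  define S where "S = W \<inter> fixed I1"
  have SV: "S \<subseteq> V" by (auto simp: S_def dest: fixedD)
  have un: "unt r" if "r \<in> Rep - {0}" for r using that Rep_unt by blast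
  have "\<exists>x\<in>S. x \<noteq> 0 \<and> (\<forall>r\<in>Rep - {0}. \<exists>a. True \<and> act (dm r 1) x = sc a x)"
  proof (rule vs.common_eigenvector)
    show "0 < degree q \<Longrightarrow> \<exists>x. poly q x = 0" for q :: "'k poly" by (rule alg_closed)
    show "finite (Rep - {0})" using Rep(1) by simp
    show "vs.subspace S" unfolding S_def using W subspace_I1 by (intro vs.subspace_inter) (auto simp: Pstable_def)
    show "S \<noteq> {0}" using exists_I1_fixed[OF W] by (auto simp: S_def)
    show "lin_on sc S (act (dm r 1))" if "r \<in> Rep - {0}" for r using that SV by (intro lin_on_act) auto
    show "act (dm r 1) x \<in> S" if "r \<in> Rep - {0}" "x \<in> S" for r x
      using that W un act_dm_fixed Pstable_act by (auto simp: S_def)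
    show "act (dm r 1) (act (dm r' 1) x) = act (dm r' 1) (act (dm r 1) x)"
      if "r \<in> Rep - {0}" "r' \<in> Rep - {0}" "x \<in> S" for r r' x
      by (rule act_eqI) (use that SV in auto)
    show "\<exists>n>0. (\<forall>x\<in>S. (act (dm r 1) ^^ n) x = x) \<and> (\<forall>a::'k. a ^ n = 1 \<longrightarrow> True)" if r: "r \<in> Rep - {0}" for r
    proof -
      obtain n where n: "n > 0" "ip 1 (r ^ n - 1)" using unt_root_of_unity[OF un[OF r]] by blast
      have "(mmul (dm r 1) ^^ n) mone = dm (r ^ n) 1" for n
        by (induction n) (auto simp: mone_def)
      then have "(act (dm r 1) ^^ n) x = x" if "x \<in> S" for x
        using funpow_act[of "dm r 1" x n] r that n(2) by (auto simp: S_def fixed_def)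
      then show ?thesis using n(1) by blast
    qed
  qed
  then obtain x where x: "x \<in> S" "x \<noteq> 0" "\<And>r. r \<in> Rep - {0} \<Longrightarrow> \<exists>a. act (dm r 1) x = sc a x" by blast
  have "\<exists>c. act (dm a 1) x = sc c x" if a: "unt a" for a
  proof -
    have r: "rd a \<in> Rep" "ip 1 (a - rd a)" using rd unt_ip[OF a] by blast+
    have ur: "unt (rd a)" using unt_cong[of "rd a" a] a r ip_diff_commute by blast
    then have nz: "rd a \<noteq> 0" by (rule unt_nonzero)
    have "ip 1 ((a - rd a) / rd a)" using r ur by simp
    then have I: "dm (a / rd a) 1 \<in> I1" using nz by (simp add: diff_divide_distrib)
    have "dm a 1 = mmul (dm (rd a) 1) (dm (a / rd a) 1)" using nz by simp
    then have "act (dm a 1) x = act (dm (rd a) 1) (act (dm (a / rd a) 1) x)"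
      using act_mmul[of "dm (rd a) 1" "dm (a / rd a) 1" x] I1_GL2[OF I] nz x(1) SV by auto
    also have "act (dm (a / rd a) 1) x = x" using I x(1) by (auto simp: S_def fixed_def)
    finally show ?thesis using x(3)[of "rd a"] r nz by auto
  qed
  then obtain \<theta> where "\<And>a. unt a \<Longrightarrow> act (dm a 1) x = sc (\<theta> a) x" by metis
  then show ?thesis using x by (auto simp: teig_def S_def)
qed

lemma U_teig: assumes x: "x \<in> teig \<theta>" shows "U x \<in> teig \<theta>"
proof -
  have xV: "x \<in> V" using x by (rule teigD)
  have "act (dm a 1) (U x) = sc (\<theta> a) (U x)" if a: "unt a" for a
  proof -
    have "act (dm a 1) (act (\<pi>, r, 0, 1) x) = sc (\<theta> a) (act (\<pi>, a * r, 0, 1) x)" for r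
    proof -
      have "act (dm a 1) (act (\<pi>, r, 0, 1) x) = act (\<pi>, a * r, 0, 1) (act (dm a 1) x)"
        by (rule act_eqI) (use a xV unt_nonzero in auto)
      then show ?thesis using teigD(3)[OF x a] act_sc xV by simp
    qed
    then have "act (dm a 1) (U x) = sc (\<theta> a) (\<Sum>r\<in>Rep. act (\<pi>, a * r, 0, 1) x)"
      unfolding U_def using unt_nonzero[OF a] xV by (subst act_sum) (auto simp: vs.scale_sum_right)
    also have "(\<Sum>r\<in>Rep. act (\<pi>, a * r, 0, 1) x) = U x"
      unfolding U_def using a by (rule sum_Rep_mult[rotated]) (use U_cong[OF teigD(1)[OF x]] in auto)
    finally show ?thesis .
  qed
  then show ?thesis using U_fixed x by (auto simp: teig_def)
qed

end

locale gl2_central = gl2_rep v p \<pi> sc V act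
  for v :: "'f::field \<Rightarrow> int" and p :: nat and \<pi> :: 'f
    and sc :: "'k::field \<Rightarrow> 'v::ab_group_add \<Rightarrow> 'v" and V and act +
  fixes \<omega> :: "'f \<Rightarrow> 'k"
  assumes central: "z \<noteq> 0 \<Longrightarrow> x \<in> V \<Longrightarrow> act (dm z z) x = sc (\<omega> z) x"
begin

lemma central_nonzero: "z \<noteq> 0 \<Longrightarrow> x \<in> V \<Longrightarrow> x \<noteq> 0 \<Longrightarrow> \<omega> z \<noteq> 0"
  using central[of z x] act_eq_0[of "dm z z" x] by auto

lemma act_dm_teig:
  assumes "x \<in> teig \<theta>" "unt a" "unt d"
  shows "act (dm a d) x = sc (\<omega> d * \<theta> (a / d)) x"
proof -
  have "dm a d = mmul (dm d d) (dm (a / d) 1)" using unt_nonzero[OF assms(3)] by simp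
  then show ?thesis
    using act_mmul[of "dm d d" "dm (a / d) 1" x] teigD[OF assms(1)] unt_nonzero assms(2,3) unt_divide
    by (simp add: act_sc central)
qed

text \<open>Modulo \<open>Pspan z\<close>, the vector \<open>act sm z\<close> is an eigenvector of the torus; as it is fixed by
  \<open>um b\<close> for small \<open>b\<close>, conjugation by the torus shows that it is fixed by all \<open>um b\<close>.\<close>

lemma sm_eigen_mod:
  assumes z: "z \<in> teig \<theta>" "z \<noteq> 0" "U z = sc \<alpha> z" "\<alpha> \<noteq> 0" and g: "g \<in> Bor"
  shows "\<exists>c. act g (act sm z) - sc c (act sm z) \<in> Pspan z"
proof -
  have zV: "z \<in> V" using z teigD by blast
  define y where "y = act sm z"
  define Z where "Z = Pspan z"
  have yV: "y \<in> V" using zV by (simp add: y_def)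
  have Z: "Pstable Z" unfolding Z_def by (rule Pspan_Pstable[OF zV])
  note sub = Pstable_subspace[OF Z]
  define eig where "eig g c \<longleftrightarrow> act g y - sc c y \<in> Z" for g c
  have mult: "eig (mmul g h) (c * d)" if "eig g c" "eig h d" "g \<in> Bor" "h \<in> Bor" for g h c d
  proof -
    have "act g (act h y - sc d y) \<in> Z" using that Z Pstable_act by (auto simp: eig_def)
    then have "act (mmul g h) y - sc d (act g y) \<in> Z"
      using that yV by (simp add: act_diff act_sc act_mmul Bor_GL2)
    moreover have "sc d (act g y - sc c y) \<in> Z" using that sub vs.subspace_scale by (auto simp: eig_def)
    ultimately have "(act (mmul g h) y - sc d (act g y)) + sc d (act g y - sc c y) \<in> Z"
      using vs.subspace_add[OF sub] by blast
    then show ?thesis by (simp add: eig_def vs.scale_right_diff_distrib mult.commute)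
  qed
  have inv: "eig (minv g) (inverse c)" if "eig g c" "c \<noteq> 0" "g \<in> Bor" for g c
  proof -
    have "act (minv g) (act g y - sc c y) \<in> Z" using that Z Pstable_act by (auto simp: eig_def)
    then have "y - sc c (act (minv g) y) \<in> Z"
      using that yV by (simp add: act_diff act_sc act_minv Bor_GL2)
    then have "sc (- inverse c) (y - sc c (act (minv g) y)) \<in> Z" using vs.subspace_scale[OF sub] by blast
    then show ?thesis using that by (simp add: eig_def vs.scale_right_diff_distrib)
  qed
  have one: "eig mone 1" using yV vs.subspace_0[OF sub] by (simp add: eig_def)
  have unit: "\<exists>c. eig (dm a 1) c" if a: "unt a" for a
  proof -
    have "act (dm a 1) y = act sm (act (dm 1 a) z)"
      unfolding y_def by (rule act_eqI) (use unt_nonzero[OF a] zV in auto)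
    then have "act (dm a 1) y = sc (\<omega> a * \<theta> (1 / a)) y"
      using act_dm_teig[OF z(1) _ a, of 1] zV by (simp add: y_def act_sc)
    then have "eig (dm a 1) (\<omega> a * \<theta> (1 / a))" using vs.subspace_0[OF sub] by (simp add: eig_def)
    then show ?thesis by blast
  qed
  have scal: "eig (dm a a) (\<omega> a)" if "a \<noteq> 0" for a
    using central[OF that yV] vs.subspace_0[OF sub] by (simp add: eig_def)
  \<comment> \<open>Since \<open>U z = sc \<alpha> z\<close>, this congruence makes
    \<open>dm 1 \<pi>\<close> act on \<open>y\<close> by \<alpha> modulo \<open>Z\<close>; the
    centre then gives the eigenvalue of \<open>dm \<pi> 1\<close>.\<close>
  have "act sm (U z) - act (dm 1 \<pi>) (act sm z) \<in> Z"
    using sm_U_cong[OF teigD(1)[OF z(1)]] by (simp add: Z_def)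
  then have "sc \<alpha> y - act (dm 1 \<pi>) y \<in> Z" using z(3) zV by (simp add: y_def act_sc)
  then have "- (sc \<alpha> y - act (dm 1 \<pi>) y) \<in> Z" by (rule vs.subspace_neg[OF sub])
  then have d\<pi>: "eig (dm 1 \<pi>) \<alpha>" by (simp add: eig_def)
  have \<omega>0: "\<omega> \<pi> \<noteq> 0" using central_nonzero[OF _ zV z(2)] by simp
  have "eig (mmul (dm \<pi> \<pi>) (minv (dm 1 \<pi>))) (\<omega> \<pi> * inverse \<alpha>)"
    by (intro mult scal inv d\<pi> z(4)) auto
  then have t: "eig (dm \<pi> 1) (\<omega> \<pi> / \<alpha>)" by (simp add: minv_def divide_inverse)
  define \<kappa> where "\<kappa> = \<omega> \<pi> / \<alpha>"
  have \<kappa>0: "\<kappa> \<noteq> 0" using \<omega>0 z(4) by (simp add: \<kappa>_def)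
  have tn: "eig (dm (\<pi> ^ n) 1) (\<kappa> ^ n)" for n
  proof (induction n)
    case (Suc n)
    then show ?case using mult[OF t Suc] by (simp add: \<kappa>_def)
  qed (use one in \<open>simp add: mone_def\<close>)
  then have tninv: "eig (minv (dm (\<pi> ^ n) 1)) (inverse (\<kappa> ^ n))" for n
    by (intro inv) (use \<kappa>0 in auto)
  have ti: "\<exists>c. eig (dm (\<pi> powi n) 1) c" for n
    using tn[of "nat n"] tninv[of "nat (- n)"]
    by (cases "n \<ge> 0") (auto simp: power_int_def minv_def field_simps)
  have ub: "eig (um b) 1" for b
  proof -
    \<comment> \<open>Large enough for the lower unipotent matrix obtained by conjugating
      \<open>um (\<pi> ^ n * b)\<close> with \<open>sm\<close> to lie in \<open>I1\<close>.\<close>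
    define n where "n = nat (1 - v b)"
    have n: "ip 1 (\<pi> ^ n * b)"
      by (cases "b = 0") (auto simp: in_pow_def v_mult v_power n_def)
    have "act (um (\<pi> ^ n * b)) y = act sm (act (1, 0, \<pi> ^ n * b, 1) z)"
      unfolding y_def by (rule act_eqI) (use zV in auto)
    also have "act (1, 0, \<pi> ^ n * b, 1) z = z" by (rule fixedD(2)[OF teigD(1)[OF z(1)]]) (use n in simp)
    finally have "eig (um (\<pi> ^ n * b)) 1" using vs.subspace_0[OF sub] by (simp add: eig_def y_def)
    then have "eig (mmul (minv (dm (\<pi> ^ n) 1)) (mmul (um (\<pi> ^ n * b)) (dm (\<pi> ^ n) 1))) (inverse (\<kappa> ^ n) * (1 * \<kappa> ^ n))"
      by (intro mult tninv tn) auto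
    then show ?thesis using \<kappa>0 by (simp add: minv_def)
  qed
  obtain a b d where abd: "g = (a,b,0,d)" "a \<noteq> 0" "d \<noteq> 0" using g by (rule BorE)
  define e where "e = a / d"
  obtain c1 where c1: "eig (dm (\<pi> powi (v e)) 1) c1" using ti by blast
  have "unt (e / \<pi> powi (v e))" using abd by (intro unt_decomp) (simp add: e_def)
  then obtain c2 where c2: "eig (dm (e / \<pi> powi (v e)) 1) c2" using unit by blast
  have e0: "e \<noteq> 0" using abd by (simp add: e_def)
  have "eig (mmul (dm d d) (mmul (um (b / d)) (mmul (dm (\<pi> powi (v e)) 1) (dm (e / \<pi> powi (v e)) 1)))) (\<omega> d * (1 * (c1 * c2)))"
    by (intro mult scal ub c1 c2) (use abd e0 in auto)
  moreover have "mmul (dm d d) (mmul (um (b / d)) (mmul (dm (\<pi> powi (v e)) 1) (dm (e / \<pi> powi (v e)) 1))) = g"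
    using abd by (simp add: e_def)
  ultimately show ?thesis by (auto simp: eig_def y_def Z_def)
qed

definition Pspan_sm :: "'v \<Rightarrow> 'v set" where
  "Pspan_sm z = {w + sc c (act sm z) | w c. w \<in> Pspan z}"

lemma Pspan_sm_Pstable:
  assumes z: "z \<in> teig \<theta>" "z \<noteq> 0" "U z = sc \<alpha> z" "\<alpha> \<noteq> 0"
  shows "Pstable (Pspan_sm z)"
proof -
  have zV: "z \<in> V" using z teigD by blast
  have Z: "Pstable (Pspan z)" by (rule Pspan_Pstable[OF zV])
  note sub = Pstable_subspace[OF Z]
  have PV: "w \<in> V" if "w \<in> Pspan z" for w using that Z Pstable_V_D by blast
  have subs: "vs.subspace (Pspan_sm z)"
  proof (rule vs.subspaceI)
    show "0 \<in> Pspan_sm z"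
      unfolding Pspan_sm_def using vs.subspace_0[OF sub] by (auto intro!: exI[of _ 0])
    fix x y assume "x \<in> Pspan_sm z" "y \<in> Pspan_sm z"
    then obtain w c w' c' where "w \<in> Pspan z" "w' \<in> Pspan z" "x = w + sc c (act sm z)" "y = w' + sc c' (act sm z)"
      by (auto simp: Pspan_sm_def)
    then have "x + y = (w + w') + sc (c + c') (act sm z)" "w + w' \<in> Pspan z"
      using vs.subspace_add[OF sub] by (auto simp: vs.scale_left_distrib)
    then show "x + y \<in> Pspan_sm z" by (auto simp: Pspan_sm_def)
  next
    fix a x assume "x \<in> Pspan_sm z"
    then obtain w c where "w \<in> Pspan z" "x = w + sc c (act sm z)" by (auto simp: Pspan_sm_def)
    then have "sc a x = sc a w + sc (a * c) (act sm z)" "sc a w \<in> Pspan z"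
      using vs.subspace_scale[OF sub] by (auto simp: vs.scale_right_distrib)
    then show "sc a x \<in> Pspan_sm z" by (auto simp: Pspan_sm_def)
  qed
  have "act g x \<in> Pspan_sm z" if g: "g \<in> Bor" and x: "x \<in> Pspan_sm z" for g x
  proof -
    obtain w c where w: "w \<in> Pspan z" "x = w + sc c (act sm z)" using x by (auto simp: Pspan_sm_def)
    obtain d where d: "act g (act sm z) - sc d (act sm z) \<in> Pspan z"
      using sm_eigen_mod[OF z g] by blast
    have "act g x = (act g w + sc c (act g (act sm z) - sc d (act sm z))) + sc (c * d) (act sm z)"
      using w g PV zV by (simp add: act_add act_sc Bor_GL2 vs.scale_right_diff_distrib)
    moreover have "act g w + sc c (act g (act sm z) - sc d (act sm z)) \<in> Pspan z"
      using w d g Z by (intro vs.subspace_add[OF sub] vs.subspace_scale[OF sub] Pstable_act)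
    ultimately show ?thesis unfolding Pspan_sm_def by blast
  qed
  then show ?thesis using subs PV zV by (auto simp: Pstable_def Pspan_sm_def)
qed

text \<open>\<open>Pspan_sm z\<close> contains both \<open>z\<close> and \<open>act sm z\<close>,
  and \<open>P\<close> applied to these two vectors accounts for all translates by \<open>G\<close>.
  Hence the \<open>G\<close>-span exceeds the \<open>P\<close>-span by at most one
  dimension.\<close>

lemma Gspan_eigen:
  assumes z: "z \<in> teig \<theta>" "z \<noteq> 0" "U z = sc \<alpha> z" "\<alpha> \<noteq> 0"
  shows "Gspan z = Pspan_sm z"
proof
  have zV: "z \<in> V" using z teigD by blast
  have sub: "vs.subspace (Pspan z)" by (rule Pstable_subspace[OF Pspan_Pstable[OF zV]])
  have "z + sc 0 (act sm z) \<in> Pspan_sm z" unfolding Pspan_sm_def using Pspan_self[OF zV] by blast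
  moreover have "0 + sc 1 (act sm z) \<in> Pspan_sm z"
    unfolding Pspan_sm_def using vs.subspace_0[OF sub] by blast
  ultimately show "Gspan z \<subseteq> Pspan_sm z"
    using Gspan_subset[OF Pspan_sm_Pstable[OF z] teigD(1)[OF z(1)]] by simp
  show "Pspan_sm z \<subseteq> Gspan z"
    using Pspan_subset_Gspan[OF zV] Gspan_base[OF zV, of sm] Gspan_Gstable[OF zV]
    unfolding Pspan_sm_def Gstable_def by (auto intro!: vs.subspace_add vs.subspace_scale)
qed

end

subsection \<open>Principal series\<close>

context local_field
begin

lemma in_Kcong [simp]: "(a,b,c,d) \<in> Kcong v n \<longleftrightarrow> ip (int n) (a - 1) \<and> ip (int n) b \<and> ip (int n) c \<and> ip (int n) (d - 1)"
  by (simp add: Kcong_def)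

lemma Kcong_GL2: "0 < n \<Longrightarrow> k \<in> Kcong v n \<Longrightarrow> k \<in> GL2"
proof -
  assume n: "0 < n" "k \<in> Kcong v n"
  obtain a b c d where k: "k = (a,b,c,d)" by (cases k)
  have "unt a" "unt d" using n unt_one_plus_ge[of "int n"] by (auto simp: k)
  moreover have "ip 1 (- (b * c))" using n unfolding ip_minus by (intro ip_mult_ge[of "int n" b "int n" c]) (auto simp: k)
  then have "ip 1 ((a * d - b * c) - a * d)" by simp
  ultimately have "unt (a * d - b * c)" using unt_cong unt_mult by blast
  then have "a * d - b * c \<noteq> 0" by (rule unt_nonzero)
  then show ?thesis by (simp add: k)
qed

lemma Kcong_mono: "n \<le> m \<Longrightarrow> Kcong v m \<subseteq> Kcong v n"
  using ip_mono[of "int m" _ "int n"] by auto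

lemma exists_ip_bound: "\<exists>N::nat. \<forall>n\<ge>N. ip (- int n) x"
  by (rule exI[of _ "nat (- v x)"]) (auto simp: in_pow_def)

text \<open>If the entries of \<open>g\<close> and of its inverse lie in the ideal of exponent
  \<open>- N\<close>, conjugation costs at most \<open>2 * N\<close> in depth. This is how open
  stabilizers are transported, since smoothness is phrased through \<open>Kcong\<close>
  alone.\<close>

lemma Kcong_conj:
  assumes g: "g \<in> GL2" and n: "0 < n"
  shows "\<exists>n'>0. \<forall>k\<in>Kcong v n'. mmul (minv g) (mmul k g) \<in> Kcong v n"
proof -
  obtain a b c d where abcd: "g = (a,b,c,d)" by (cases g)
  obtain a' b' c' d' where m: "minv g = (a',b',c',d')" by (cases "minv g")
  have mg: "a'*a + b'*c = 1" "a'*b + b'*d = 0" "c'*a + d'*c = 0" "c'*b + d'*d = 1"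
    using minv(2)[OF g] unfolding m unfolding abcd by (simp_all add: mone_def)
  have "\<exists>N::nat. \<forall>x\<in>{a,b,c,d,a',b',c',d'}. ip (- int N) x"
  proof -
    have "\<forall>x. \<exists>N::nat. \<forall>n\<ge>N. ip (- int n) x" using exists_ip_bound by blast
    then obtain N where N: "\<And>x n. N x \<le> n \<Longrightarrow> ip (- int n) x" by metis
    define M where "M = Max (N ` {a,b,c,d,a',b',c',d'})"
    have "N x \<le> M" if "x \<in> {a,b,c,d,a',b',c',d'}" for x unfolding M_def using that by (intro Max_ge) blast+
    then show ?thesis using N by blast
  qed
  then obtain N where N: "\<And>x. x \<in> {a,b,c,d,a',b',c',d'} \<Longrightarrow> ip (- int N) x" by blast
  have "mmul (minv g) (mmul k g) \<in> Kcong v n" if k: "k \<in> Kcong v (n + 2 * N)" for k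
  proof -
    obtain e1 e2 e3 e4 where e: "k = (e1,e2,e3,e4)" by (cases k)
    have three: "ip (int n) (x * (y * z))" if "x \<in> {a',b',c',d'}" "z \<in> {a,b,c,d}" "ip (int n + 2 * int N) y" for x y z
      using ip_mult_ge[OF N[of x] ip_mult[OF that(3) N[of z]], of "int n"] that by auto
    have k': "ip (int n + 2 * int N) (e1 - 1)" "ip (int n + 2 * int N) e2" "ip (int n + 2 * int N) e3" "ip (int n + 2 * int N) (e4 - 1)"
      using k by (simp_all add: e)
    have four: "ip (int n) (x * ((e1 - 1) * y) + x * (e2 * z) + x' * (e3 * y) + x' * ((e4 - 1) * z))"
      if "x \<in> {a',b',c',d'}" "x' \<in> {a',b',c',d'}" "y \<in> {a,b,c,d}" "z \<in> {a,b,c,d}" for x x' y z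
      using that k' by (intro ip_add three)
    have "a' * (e1 * a + e2 * c) + b' * (e3 * a + e4 * c) - 1 = a' * ((e1 - 1) * a) + a' * (e2 * c) + b' * (e3 * a) + b' * ((e4 - 1) * c) + ((a'*a + b'*c) - 1)"
      "a' * (e1 * b + e2 * d) + b' * (e3 * b + e4 * d) = a' * ((e1 - 1) * b) + a' * (e2 * d) + b' * (e3 * b) + b' * ((e4 - 1) * d) + (a'*b + b'*d)"
      "c' * (e1 * a + e2 * c) + d' * (e3 * a + e4 * c) = c' * ((e1 - 1) * a) + c' * (e2 * c) + d' * (e3 * a) + d' * ((e4 - 1) * c) + (c'*a + d'*c)"
      "c' * (e1 * b + e2 * d) + d' * (e3 * b + e4 * d) - 1 = c' * ((e1 - 1) * b) + c' * (e2 * d) + d' * (e3 * b) + d' * ((e4 - 1) * d) + ((c'*b + d'*d) - 1)"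
      by (simp_all add: algebra_simps)
    then show ?thesis
      unfolding m unfolding abcd e mmul_simp in_Kcong using four mg by simp
  qed
  moreover have "n + 2 * N > 0" using n by simp
  ultimately show ?thesis by blast
qed

text \<open>Compactness of the disc with centre \<open>b\<close> and exponent \<open>n\<close>: if
  \<open>Q\<close> fails there, it fails on one of its finitely many subdiscs, and so on; the
  centres of the nested discs converge by completeness, and near the limit \<open>Q\<close> holds by
  \<open>small\<close>.\<close>

lemma disc_induct:
  assumes small: "\<And>y. \<exists>n. \<forall>m\<ge>n. Q y m"
    and split: "\<And>b n. (\<And>r. r \<in> Rep \<Longrightarrow> Q (b + \<pi> powi n * r) (n + 1)) \<Longrightarrow> Q b n"
    and cong: "\<And>b b' n. ip n (b - b') \<Longrightarrow> Q b n \<Longrightarrow> Q b' n"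
  shows "Q b n"
proof (rule ccontr)
  assume b: "\<not> Q b n"
  have "\<exists>s. s 0 = b \<and> (\<forall>i. \<not> Q (s i) (n + int i) \<and> ip (n + int i) (s (Suc i) - s i))"
  proof -
    have "\<exists>s. \<forall>i. (\<not> Q (s i) (n + int i) \<and> (i = 0 \<longrightarrow> s i = b)) \<and> ip (n + int i) (s (Suc i) - s i)"
    proof (rule dependent_nat_choice)
      fix x i assume "\<not> Q x (n + int i) \<and> (i = 0 \<longrightarrow> x = b)"
      then obtain r where "r \<in> Rep" "\<not> Q (x + \<pi> powi (n + int i) * r) (n + int i + 1)" using split by blast
      then show "\<exists>y. (\<not> Q y (n + int (Suc i)) \<and> (Suc i = 0 \<longrightarrow> y = b)) \<and> ip (n + int i) (y - x)"
        using Rep(3) by (intro exI[of _ "x + \<pi> powi (n + int i) * r"]) (auto simp: add_ac)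
    qed (use b in auto)
    then show ?thesis by blast
  qed
  then obtain s where s: "\<And>i. \<not> Q (s i) (n + int i)" "\<And>i. ip (n + int i) (s (Suc i) - s i)" by blast
  have cau: "ip (n + int i) (s j - s i)" if "i \<le> j" for i j
    using that
  proof (induction j rule: dec_induct)
    case (step k)
    have "ip (n + int i) (s (Suc k) - s k)" using step(1) by (intro ip_mono[OF s(2)[of k]]) auto
    then show ?case using step(3) ip_diff_trans by blast
  qed simp
  have "\<exists>N. \<forall>i\<ge>N. \<forall>j\<ge>N. ip m (s i - s j)" for m
  proof (intro exI allI impI)
    fix i j assume ij: "i \<ge> nat (m - n)" "j \<ge> nat (m - n)"
    have "ip m (s (max i j) - s i)" "ip m (s (max i j) - s j)"
      using ij by (intro ip_mono[OF cau]; simp)+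
    then show "ip m (s i - s j)" using ip_diff_trans ip_diff_commute by blast
  qed
  then obtain l where l: "\<And>m. \<exists>N. \<forall>i\<ge>N. ip m (s i - l)" using complete by blast
  have sl: "ip (n + int i) (l - s i)" for i
  proof -
    obtain N where "\<forall>j\<ge>N. ip (n + int i) (s j - l)" using l by blast
    then have "ip (n + int i) (s (max i N) - l)" by simp
    moreover have "ip (n + int i) (s (max i N) - s i)" by (rule cau) simp
    ultimately show ?thesis using ip_diff_trans ip_diff_commute by blast
  qed
  obtain m where m: "\<And>k. k \<ge> m \<Longrightarrow> Q l k" using small by blast
  have "Q l (n + int (nat (m - n)))" by (rule m) simp
  then have "Q (s (nat (m - n))) (n + int (nat (m - n)))" using cong sl by blast
  then show False using s(1) by blast
qed

end

section \<open>The induced representation and its smoothness\<close>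

locale ind_char = local_field v p \<pi>
  for v :: "'f::field \<Rightarrow> int" and p :: nat and \<pi> :: 'f +
  fixes \<chi> :: "'f \<Rightarrow> 'f \<Rightarrow> 'k::field"
  assumes alg_closure: "alg_closure_Fp p TYPE('k)" and smooth_char: "smooth_charT v \<chi>"
begin

lemma \<chi>_mult: "a \<noteq> 0 \<Longrightarrow> d \<noteq> 0 \<Longrightarrow> a' \<noteq> 0 \<Longrightarrow> d' \<noteq> 0 \<Longrightarrow> \<chi> (a*a') (d*d') = \<chi> a d * \<chi> a' d'"
  using smooth_char unfolding smooth_charT_def by blast

lemma \<chi>_nonzero: "a \<noteq> 0 \<Longrightarrow> d \<noteq> 0 \<Longrightarrow> \<chi> a d \<noteq> 0"
  using smooth_char unfolding smooth_charT_def by blast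

lemma \<chi>_1 [simp]: "\<chi> 1 1 = 1"
  using \<chi>_mult[of 1 1 1 1] \<chi>_nonzero[of 1 1] by simp

text \<open>Raising to the power \<open>p ^ n\<close> pushes \<open>a\<close> and \<open>d\<close>
  into the subgroup where \<chi> is trivial, so the value is a \<open>p\<close>-power root of unity
  and equals 1.\<close>

lemma \<chi>_one_units:
  assumes "ip 1 (a - 1)" "ip 1 (d - 1)"
  shows "\<chi> a d = 1"
proof -
  have nz: "a \<noteq> 0" "d \<noteq> 0" using assms unt_one_plus unt_nonzero by blast+
  obtain n where n: "n > 0" "\<And>a d. a \<noteq> 0 \<Longrightarrow> d \<noteq> 0 \<Longrightarrow> ip (int n) (a - 1) \<Longrightarrow> ip (int n) (d - 1) \<Longrightarrow> \<chi> a d = 1"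
    using smooth_char unfolding smooth_charT_def by blast
  have "\<chi> (a ^ m) (d ^ m) = \<chi> a d ^ m" for m
    by (induction m) (use nz in \<open>auto simp: \<chi>_mult\<close>)
  moreover have "\<chi> (a ^ p ^ n) (d ^ p ^ n) = 1"
    using nz ip_one_power_p_power[OF assms(1), of n] ip_one_power_p_power[OF assms(2), of n]
    by (intro n(2)) (auto intro: ip_mono)
  ultimately have "\<chi> a d ^ p ^ n = 1" by metis
  then show ?thesis by (rule p_power_root_unique[OF alg_closure])
qed

lemma Ind_outside: "f \<in> Ind v \<chi> \<Longrightarrow> g \<notin> GL2 \<Longrightarrow> f g = 0"
  and Ind_loc_const: "f \<in> Ind v \<chi> \<Longrightarrow> g \<in> GL2 \<Longrightarrow> \<exists>n>0. \<forall>k\<in>Kcong v n. f (mmul g k) = f g"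
  and Ind_equiv: "f \<in> Ind v \<chi> \<Longrightarrow> g \<in> GL2 \<Longrightarrow> a \<noteq> 0 \<Longrightarrow> d \<noteq> 0 \<Longrightarrow> f (mmul (a,b,0,d) g) = \<chi> a d * f g"
  unfolding Ind_def loc_const_G_def by blast+

lemma Ind_I:
  assumes "\<And>g. g \<notin> GL2 \<Longrightarrow> f g = 0" "\<And>g. g \<in> GL2 \<Longrightarrow> \<exists>n>0. \<forall>k\<in>Kcong v n. f (mmul g k) = f g"
    and "\<And>g a b d. g \<in> GL2 \<Longrightarrow> a \<noteq> 0 \<Longrightarrow> d \<noteq> 0 \<Longrightarrow> f (mmul (a,b,0,d) g) = \<chi> a d * f g"
  shows "f \<in> Ind v \<chi>"
  unfolding Ind_def loc_const_G_def using assms by blast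

text \<open>Bruhat decomposition, read off from the bottom row. Functions in \<open>Ind\<close> thus
  live on the projective line: \<open>mone\<close> is one point, and \<open>mmul sm (um x)\<close>
  runs through the affine line of the others.\<close>

lemma Ind_decomp:
  assumes "(a,b,c,d) \<in> GL2"
  shows "c = 0 \<Longrightarrow> (a,b,c,d) = mmul (a,b,0,d) mone \<and> a \<noteq> 0 \<and> d \<noteq> 0"
    and "c \<noteq> 0 \<Longrightarrow> (a,b,c,d) = mmul ((b*c - a*d) / c, a, 0, c) (mmul sm (um (d / c))) \<and> (b*c - a*d) / c \<noteq> 0"
  using assms by (auto simp: mone_def field_simps)

lemma Ind_eqI:
  assumes "\<And>g. g \<notin> GL2 \<Longrightarrow> f g = 0" "\<And>g. g \<notin> GL2 \<Longrightarrow> f' g = 0"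
    and "\<And>a b d g. g \<in> GL2 \<Longrightarrow> a \<noteq> 0 \<Longrightarrow> d \<noteq> 0 \<Longrightarrow> f (mmul (a,b,0,d) g) = \<chi> a d * f g"
    and "\<And>a b d g. g \<in> GL2 \<Longrightarrow> a \<noteq> 0 \<Longrightarrow> d \<noteq> 0 \<Longrightarrow> f' (mmul (a,b,0,d) g) = \<chi> a d * f' g"
    and "f mone = f' mone" "\<And>x. f (mmul sm (um x)) = f' (mmul sm (um x))"
  shows "f = f'"
proof
  fix g :: "'f mat2"
  obtain a b c d where g: "g = (a,b,c,d)" by (cases g)
  show "f g = f' g"
  proof (cases "g \<in> GL2")
    case True
    show ?thesis
    proof (cases "c = 0")
      case c: True
      then show ?thesis using Ind_decomp(1)[of a b c d] True assms(3,4)[of mone a d b] assms(5) by (metis g mone_in(1))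
    next
      case c: False
      have "mmul sm (um (d / c)) \<in> GL2" by simp
      then show ?thesis
        using Ind_decomp(2)[of a b c d] True assms(3,4)[of "mmul sm (um (d / c))" "(b*c - a*d) / c" c a] assms(6) c
        by (metis g)
    qed
  qed (use assms(1,2) in simp)
qed

lemma Ind_add: "f \<in> Ind v \<chi> \<Longrightarrow> f' \<in> Ind v \<chi> \<Longrightarrow> f + f' \<in> Ind v \<chi>"
proof -
  assume f: "f \<in> Ind v \<chi>" "f' \<in> Ind v \<chi>"
  have "\<exists>n>0. \<forall>k\<in>Kcong v n. (f + f') (mmul g k) = (f + f') g" if g: "g \<in> GL2" for g
  proof -
    obtain n m where "n > 0" "\<forall>k\<in>Kcong v n. f (mmul g k) = f g" "m > 0" "\<forall>k\<in>Kcong v m. f' (mmul g k) = f' g"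
      using Ind_loc_const f g by meson
    moreover have "Kcong v (max n m) \<subseteq> Kcong v n" "Kcong v (max n m) \<subseteq> Kcong v m" by (intro Kcong_mono; simp)+
    ultimately have "\<forall>k\<in>Kcong v (max n m). f (mmul g k) = f g \<and> f' (mmul g k) = f' g" "max n m > 0" by (blast, simp)
    then show ?thesis unfolding plus_fun_def by metis
  qed
  then show "f + f' \<in> Ind v \<chi>"
    using f by (intro Ind_I) (auto simp: Ind_outside Ind_equiv algebra_simps)
qed

lemma Ind_fscale: assumes f: "f \<in> Ind v \<chi>" shows "fscale c f \<in> Ind v \<chi>"
proof (rule Ind_I)
  show "\<exists>n>0. \<forall>k\<in>Kcong v n. fscale c f (mmul g k) = fscale c f g" if "g \<in> GL2" for g
    using Ind_loc_const[OF f that] unfolding fscale_def by metis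
qed (use f in \<open>auto simp: Ind_outside Ind_equiv fscale_def\<close>)

lemma vector_space_fscale: "vector_space (fscale :: 'k \<Rightarrow> ('a \<Rightarrow> 'k) \<Rightarrow> 'a \<Rightarrow> 'k)"
  by unfold_locales (auto simp: fscale_def algebra_simps)

lemma Ind_act: assumes f: "f \<in> Ind v \<chi>" and g: "g \<in> GL2" shows "ind_act g f \<in> Ind v \<chi>"
proof -
  have "\<exists>n>0. \<forall>k\<in>Kcong v n. ind_act g f (mmul x k) = ind_act g f x" if x: "x \<in> GL2" for x
  proof -
    obtain n where n: "n > 0" "\<forall>k\<in>Kcong v n. f (mmul (mmul x g) k) = f (mmul x g)"
      using Ind_loc_const[OF f, of "mmul x g"] x g by auto
    obtain n' where n': "n' > 0" "\<forall>k\<in>Kcong v n'. mmul (minv g) (mmul k g) \<in> Kcong v n"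
      using Kcong_conj[OF g n(1)] by blast
    have "ind_act g f (mmul x k) = ind_act g f x" if k: "k \<in> Kcong v n'" for k
    proof -
      have kk: "mmul (minv g) (mmul k g) \<in> Kcong v n" using n'(2) k by blast
      have "mmul (mmul x g) (mmul (minv g) (mmul k g)) = mmul x (mmul (mmul g (minv g)) (mmul k g))"
        by (simp only: mmul_assoc)
      then have "mmul (mmul x g) (mmul (minv g) (mmul k g)) = mmul (mmul x k) g"
        by (simp add: minv[OF g] mmul_assoc)
      then have "f (mmul (mmul x k) g) = f (mmul x g)" using n(2) kk by metis
      then show ?thesis
        using Kcong_GL2[OF n'(1) k] x by (simp add: ind_act_def)
    qed
    then show ?thesis using n'(1) by blast
  qed
  moreover have "ind_act g f (mmul (a,b,0,d) x) = \<chi> a d * ind_act g f x" if "x \<in> GL2" "a \<noteq> 0" "d \<noteq> 0" for a b d x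
    using that g Ind_equiv[OF f, of "mmul x g" a d b] by (simp add: ind_act_def mmul_assoc del: mmul_simp)
  ultimately show ?thesis by (intro Ind_I) (auto simp: ind_act_def[of _ _ ])
qed

text \<open>Local constancy at each point does not visibly give one stabilizer for the whole
  function. The functions with an open stabilizer form a smooth representation at once, and the
  machinery of \<open>P\<close>-spans is applied to it to prove that they exhaust
  \<open>Ind\<close>.\<close>

definition Ind_sm :: "('f mat2 \<Rightarrow> 'k) set" where
  "Ind_sm = {f \<in> Ind v \<chi>. \<exists>n>0. \<forall>g\<in>Kcong v n. ind_act g f = f}"

lemma is_rep_Ind: "is_rep fscale GL2 (Ind v \<chi>) ind_act"
proof -
  have "0 \<in> Ind v \<chi>" by (auto simp: Ind_def loc_const_G_def)
  moreover have "lin_on fscale (Ind v \<chi>) (ind_act g)" for g :: "'f mat2"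
    by (auto simp: lin_on_def ind_act_def fscale_def plus_fun_def)
  moreover have "ind_act mone f = f" if "f \<in> Ind v \<chi>" for f
    using Ind_outside[OF that] by (auto simp: ind_act_def)
  moreover have "ind_act (mmul g h) f = ind_act g (ind_act h f)" if "g \<in> GL2" "h \<in> GL2" for g h :: "'f mat2" and f :: "'f mat2 \<Rightarrow> 'k"
    using that by (auto simp: ind_act_def mmul_assoc simp del: mmul_simp)
  ultimately show ?thesis
    using vector_space_fscale Ind_add Ind_fscale Ind_act by (auto simp: is_rep_def lin_subspace_def)
qed

lemma smooth_rep_Ind_sm: "smooth_rep v fscale Ind_sm ind_act"
proof -
  have sub: "Ind_sm \<subseteq> Ind v \<chi>" by (auto simp: Ind_sm_def)
  have r: "is_rep fscale GL2 (Ind v \<chi>) ind_act" by (rule is_rep_Ind)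
  have 0: "0 \<in> Ind_sm" using r by (auto simp: Ind_sm_def is_rep_def lin_subspace_def ind_act_def intro!: exI[of _ 1])
  have 1: "f + f' \<in> Ind_sm" if f: "f \<in> Ind_sm" "f' \<in> Ind_sm" for f f'
  proof -
    obtain n m where "n > 0" "\<forall>k\<in>Kcong v n. ind_act k f = f" "m > 0" "\<forall>k\<in>Kcong v m. ind_act k f' = f'"
      using f by (auto simp: Ind_sm_def)
    moreover have "Kcong v (max n m) \<subseteq> Kcong v n" "Kcong v (max n m) \<subseteq> Kcong v m" by (intro Kcong_mono; simp)+
    moreover have "ind_act k (f + f') = ind_act k f + ind_act k f'" for k :: "'f mat2" by (auto simp: ind_act_def)
    ultimately have "\<forall>k\<in>Kcong v (max n m). ind_act k (f + f') = f + f'" "max n m > 0"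
      by (metis subsetD, simp)
    then show ?thesis using Ind_add f sub unfolding Ind_sm_def by blast
  qed
  have 2: "fscale c f \<in> Ind_sm" if f: "f \<in> Ind_sm" for f c
  proof -
    have "ind_act k (fscale c f) = fscale c (ind_act k f)" for k :: "'f mat2" by (auto simp: ind_act_def fscale_def)
    then show ?thesis using f Ind_fscale by (auto simp: Ind_sm_def)
  qed
  have 3: "ind_act g f \<in> Ind_sm" if g: "g \<in> GL2" and f: "f \<in> Ind_sm" for g f
  proof -
    obtain n where n: "n > 0" "\<forall>k\<in>Kcong v n. ind_act k f = f" using f by (auto simp: Ind_sm_def)
    obtain n' where n': "n' > 0" "\<forall>k\<in>Kcong v n'. mmul (minv g) (mmul k g) \<in> Kcong v n"
      using Kcong_conj[OF g n(1)] by blast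
    have mm: "ind_act (mmul g h) f = ind_act g (ind_act h f)" if "g \<in> GL2" "h \<in> GL2" for g h
      using r that f sub by (auto simp: is_rep_def)
    have "ind_act k (ind_act g f) = ind_act g f" if k: "k \<in> Kcong v n'" for k
    proof -
      define h where "h = mmul (minv g) (mmul k g)"
      have kG: "k \<in> GL2" using Kcong_GL2[OF n'(1) k] .
      have "mmul g h = mmul (mmul g (minv g)) (mmul k g)" unfolding h_def by (simp only: mmul_assoc)
      then have gh: "mmul g h = mmul k g" by (simp add: minv[OF g])
      have hK: "h \<in> Kcong v n" unfolding h_def using n' k by blast
      have hG: "h \<in> GL2" by (rule Kcong_GL2[OF n(1) hK])
      have "ind_act k (ind_act g f) = ind_act g (ind_act h f)"
        using mm[OF g hG] mm[OF kG g] gh by simp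
      then show ?thesis using n(2) hK by simp
    qed
    then show ?thesis using Ind_act g f n'(1) by (auto simp: Ind_sm_def)
  qed
  show ?thesis
    using r 0 1 2 3 sub unfolding smooth_rep_def is_rep_def lin_subspace_def lin_on_def
    by (auto simp: subset_iff Ind_sm_def)
qed

text \<open>The function supported on the cell \<open>P sm I1\<close>, fixed by \<open>I1\<close>
  and equal to 1 at \<open>sm\<close>. The value is \<chi> of the upper triangular factor in
  \<open>Ind_decomp\<close>, and the condition on \<open>d / c\<close> says that the affine
  coordinate is integral.\<close>

definition \<phi>0 :: "'f mat2 \<Rightarrow> 'k" where
  "\<phi>0 g = (case g of (a,b,c,d) \<Rightarrow> if g \<in> GL2 \<and> c \<noteq> 0 \<and> ip 0 (d / c) then \<chi> ((b*c - a*d) / c) c else 0)"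

lemma \<phi>0_simp: "\<phi>0 (a,b,c,d) = (if (a,b,c,d) \<in> GL2 \<and> c \<noteq> 0 \<and> ip 0 (d / c) then \<chi> ((b*c - a*d) / c) c else 0)"
  by (simp add: \<phi>0_def)

lemma \<phi>0_sm: "\<phi>0 (0,1,1,x) = (if ip 0 x then 1 else 0)"
  by (simp add: \<phi>0_simp)

lemma \<phi>0_mone [simp]: "\<phi>0 mone = 0"
  by (simp add: \<phi>0_simp mone_def)

lemma \<phi>0_outside: "g \<notin> GL2 \<Longrightarrow> \<phi>0 g = 0"
  by (cases g) (simp add: \<phi>0_simp)

lemma \<phi>0_equiv:
  assumes "g \<in> GL2" "a \<noteq> 0" "d \<noteq> 0"
  shows "\<phi>0 (mmul (a,b,0,d) g) = \<chi> a d * \<phi>0 g"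
proof -
  obtain a' b' c' d' where g: "g = (a',b',c',d')" by (cases g)
  have m: "mmul (a,b,0,d) g = (a*a' + b*c', a*b' + b*d', d*c', d*d')" by (simp add: g)
  have G: "mmul (a,b,0,d) g \<in> GL2" using assms by (intro mmul_GL2) auto
  have q: "d * d' / (d * c') = d' / c'" using assms by simp
  show ?thesis
  proof (cases "c' \<noteq> 0 \<and> ip 0 (d' / c')")
    case True
    have "((a*b' + b*d') * (d*c') - (a*a' + b*c') * (d*d')) / (d*c') = a * ((b'*c' - a'*d') / c')"
      using True assms by (simp add: field_simps)
    moreover have "(b'*c' - a'*d') / c' \<noteq> 0" using assms True by (auto simp: g)
    ultimately show ?thesis
      unfolding m \<phi>0_simp using G True assms \<chi>_mult[of a d "(b'*c' - a'*d') / c'" c'] by (simp add: m g \<phi>0_simp del: in_GL2)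
  next
    case False
    then show ?thesis unfolding m using q by (auto simp: \<phi>0_simp g)
  qed
qed

text \<open>\<open>u\<close> is the factor by which the lower left entry is multiplied and
  \<open>D\<close> the determinant of the element of \<open>I1\<close>. Both are congruent to 1, so
  \<open>\<chi> (D / u) u\<close> is 1 and the affine coordinate stays integral.\<close>

lemma \<phi>0_I1_le:
  assumes "x \<in> GL2" "ip 1 (\<alpha> - 1)" "ip 0 \<beta>" "ip 1 \<gamma>" "ip 1 (\<delta> - 1)" "\<phi>0 x \<noteq> 0"
  shows "\<phi>0 (mmul x (\<alpha>,\<beta>,\<gamma>,\<delta>)) = \<phi>0 x"
proof -
  obtain a b c d where x: "x = (a,b,c,d)" by (cases x)
  have c: "c \<noteq> 0" "ip 0 (d / c)" using assms(6) by (auto simp: x \<phi>0_simp split: if_splits)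
  define D where "D = \<alpha> * \<delta> - \<beta> * \<gamma>"
  define u where "u = \<alpha> + (d / c) * \<gamma>"
  have "u - 1 = (\<alpha> - 1) + (d / c) * \<gamma>" by (simp add: u_def)
  moreover have "ip 1 ((d / c) * \<gamma>)" using ip_mult[OF c(2) assms(4)] by simp
  ultimately have u: "ip 1 (u - 1)" using assms(2) ip_add by metis
  have "D - 1 = (\<alpha> * \<delta> - 1) - \<beta> * \<gamma>" by (simp add: D_def)
  moreover have "ip 1 (\<beta> * \<gamma>)" using ip_mult[OF assms(3,4)] by simp
  moreover have "ip 1 (\<alpha> * \<delta> - 1)" using ip_one_mult[OF assms(2,5)] by simp
  ultimately have D: "ip 1 (D - 1)" using ip_diff by metis
  have uu: "unt u" "u \<noteq> 0" "D \<noteq> 0" using u D unt_one_plus unt_nonzero by blast+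
  have m: "mmul x (\<alpha>,\<beta>,\<gamma>,\<delta>) = (a*\<alpha> + b*\<gamma>, a*\<beta> + b*\<delta>, c*u, c*\<beta> + d*\<delta>)"
    using c by (simp add: x u_def algebra_simps)
  have G: "mmul x (\<alpha>,\<beta>,\<gamma>,\<delta>) \<in> GL2" using assms(1) uu by (intro mmul_GL2) (auto simp: D_def)
  have "(c*\<beta> + d*\<delta>) / (c*u) = (\<beta> + (d/c) * \<delta>) / u" using c by (simp add: field_simps)
  moreover have "ip 0 (\<beta> + (d/c) * \<delta>)"
    using assms(3) c(2) ip_mult_unt[OF unt_one_plus[OF assms(5)]] by (intro ip_add) blast+
  ultimately have i: "ip 0 ((c*\<beta> + d*\<delta>) / (c*u))" using uu by simp
  have "((a*\<beta> + b*\<delta>) * (c*u) - (a*\<alpha> + b*\<gamma>) * (c*\<beta> + d*\<delta>)) = (b*c - a*d) * D"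
    using c by (simp add: u_def D_def field_simps)
  then have "((a*\<beta> + b*\<delta>) * (c*u) - (a*\<alpha> + b*\<gamma>) * (c*\<beta> + d*\<delta>)) / (c*u) = ((b*c - a*d) / c) * (D / u)"
    by simp
  moreover have "(b*c - a*d) / c \<noteq> 0" using assms(1) c by (auto simp: x)
  moreover have "\<chi> (D / u) u = 1" using u D by (intro \<chi>_one_units ip_one_divide) auto
  ultimately show ?thesis
    unfolding m using i G[unfolded m] c uu \<chi>_mult[of "(b*c - a*d) / c" c "D / u" u] assms(1)
    by (simp add: \<phi>0_simp x del: in_GL2)
qed

text \<open>Off the support the previous lemma is applied backwards: a nonzero value at the
  translate would be carried back to \<open>x\<close> by the inverse matrix, which has the same
  shape.\<close>

lemma \<phi>0_I1:
  assumes "x \<in> GL2" "ip 1 (\<alpha> - 1)" "ip 0 \<beta>" "ip 1 \<gamma>" "ip 1 (\<delta> - 1)"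
  shows "\<phi>0 (mmul x (\<alpha>,\<beta>,\<gamma>,\<delta>)) = \<phi>0 x"
proof (cases "\<phi>0 x = 0")
  case True
  define k where "k = (\<alpha>,\<beta>,\<gamma>,\<delta>)"
  define D where "D = \<alpha> * \<delta> - \<beta> * \<gamma>"
  have "D - 1 = (\<alpha> * \<delta> - 1) - \<beta> * \<gamma>" by (simp add: D_def)
  moreover have "ip 1 (\<beta> * \<gamma>)" using ip_mult[OF assms(3,4)] by simp
  moreover have "ip 1 (\<alpha> * \<delta> - 1)" using ip_one_mult[OF assms(2,5)] by simp
  ultimately have D: "ip 1 (D - 1)" using ip_diff by metis
  then have uD: "unt D" "D \<noteq> 0" using unt_one_plus unt_nonzero by blast+
  have kG: "k \<in> GL2" using uD by (simp add: k_def D_def)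
  have mk: "minv k = (\<delta> / D, - \<beta> / D, - \<gamma> / D, \<alpha> / D)" by (simp add: k_def minv_def D_def)
  have "\<phi>0 (mmul x k) = 0"
  proof (rule ccontr)
    assume "\<phi>0 (mmul x k) \<noteq> 0"
    then have "\<phi>0 (mmul (mmul x k) (minv k)) = \<phi>0 (mmul x k)"
      unfolding mk using assms D uD kG by (intro \<phi>0_I1_le ip_one_divide) auto
    then show False using True \<open>\<phi>0 (mmul x k) \<noteq> 0\<close> by (simp add: mmul_assoc minv[OF kG])
  qed
  then show ?thesis using True by (simp add: k_def)
qed (use assms \<phi>0_I1_le in blast)

lemma \<phi>0_Ind_sm: "\<phi>0 \<in> Ind_sm"
proof -
  have K: "\<phi>0 (mmul g k) = \<phi>0 g" if "g \<in> GL2" "k \<in> Kcong v 1" for g k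
    using that \<phi>0_I1[OF that(1)] ip_mono[of 1 _ 0] by (cases k) auto
  have "\<phi>0 \<in> Ind v \<chi>"
    using K \<phi>0_equiv \<phi>0_outside zero_less_one unfolding Ind_def loc_const_G_def by blast
  moreover have "ind_act k \<phi>0 = \<phi>0" if "k \<in> Kcong v 1" for k
    using K[OF _ that] \<phi>0_outside by (auto simp: ind_act_def)
  ultimately show ?thesis using zero_less_one unfolding Ind_sm_def by blast
qed

end

sublocale ind_char \<subseteq> sm: gl2_rep v p \<pi> fscale Ind_sm ind_act
  by unfold_locales (use alg_closure smooth_rep_Ind_sm in auto)

context ind_char
begin

lemma Ind_V: "f \<in> Ind_sm \<Longrightarrow> f \<in> Ind v \<chi>"
  by (simp add: Ind_sm_def)

lemma Ind_sm_eqI: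
  assumes "f \<in> Ind v \<chi>" "f' \<in> Ind v \<chi>" "f mone = f' mone" "\<And>x. f (0,1,1,x) = f' (0,1,1,x)"
  shows "f = f'"
  by (rule Ind_eqI) (use assms Ind_outside Ind_equiv in auto)

lemma ind_act_apply: "x \<in> GL2 \<Longrightarrow> ind_act g f x = f (mmul x g)"
  by (simp add: ind_act_def)

lemma Ind_Bor_mone: "f \<in> Ind v \<chi> \<Longrightarrow> a \<noteq> 0 \<Longrightarrow> d \<noteq> 0 \<Longrightarrow> f (a,b,0,d) = \<chi> a d * f mone"
  using Ind_equiv[of f mone a d b] by simp

text \<open>\<open>dsc b n\<close> is, as a function of \<open>x\<close> on the big cell \<open>P sm (um x)\<close>, supported on \<open>b + p\<^sup>n\<close>.\<close>

definition dsc :: "'f \<Rightarrow> int \<Rightarrow> 'f mat2 \<Rightarrow> 'k" where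
  "dsc b n = fscale (inverse (\<chi> 1 (\<pi> powi n))) (ind_act (mmul (um (- b)) (dm (\<pi> powi n) 1)) \<phi>0)"

lemma dsc_Pspan: "dsc b n \<in> sm.Pspan \<phi>0"
  unfolding dsc_def
  by (intro sm.vs.subspace_scale[OF sm.Pstable_subspace[OF sm.Pspan_Pstable]] sm.Pspan_base \<phi>0_Ind_sm) auto

lemma Pspan_Ind: "f \<in> sm.Pspan \<phi>0 \<Longrightarrow> f \<in> Ind_sm"
  using sm.Pspan_Pstable[OF \<phi>0_Ind_sm] sm.Pstable_V_D by blast

lemma \<phi>0_Ind: "\<phi>0 \<in> Ind v \<chi>"
  using \<phi>0_Ind_sm Ind_V by blast

lemma ind_act_\<phi>0_upper:
  assumes "a \<noteq> 0" "d \<noteq> 0"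
  shows "ind_act (a,b,0,d) \<phi>0 (0,1,1,x) = (if ip 0 ((b + x * d) / a) then \<chi> d a else 0)"
proof -
  have "mmul (0,1,1,x) (a,b,0,d) = mmul (d, 0, 0, a) (0, 1, 1, (b + x * d) / a)"
    using assms by (simp add: field_simps)
  then have "ind_act (a,b,0,d) \<phi>0 (0,1,1,x) = \<phi>0 (mmul (d, 0, 0, a) (0, 1, 1, (b + x * d) / a))"
    by (simp add: ind_act_apply)
  also have "\<dots> = \<chi> d a * \<phi>0 (0, 1, 1, (b + x * d) / a)"
    using assms by (intro \<phi>0_equiv) auto
  finally show ?thesis by (simp add: \<phi>0_sm)
qed

lemma dsc_sm: "dsc b n (0,1,1,x) = (if ip n (x - b) then 1 else 0)"
  using \<chi>_nonzero[of 1 "\<pi> powi n"]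
  by (simp add: dsc_def fscale_def ind_act_\<phi>0_upper)

lemma ind_act_Bor_mone: "a \<noteq> 0 \<Longrightarrow> d \<noteq> 0 \<Longrightarrow> f \<in> Ind v \<chi> \<Longrightarrow> ind_act (a,b,0,d) f mone = \<chi> a d * f mone"
  using Ind_Bor_mone by (simp add: ind_act_apply)

lemma Ind_small:
  assumes f: "f \<in> Ind v \<chi>"
  shows "\<exists>n. \<forall>m\<ge>n. \<forall>x. ip m (x - y) \<longrightarrow> f (0,1,1,x) = f (0,1,1,y)"
proof -
  obtain n where n: "n > 0" "\<forall>k\<in>Kcong v n. f (mmul (0,1,1,y) k) = f (0,1,1,y)"
    using Ind_loc_const[OF f, of "(0,1,1,y)"] by auto
  show ?thesis
  proof (intro exI[of _ "int n"] allI impI)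
    fix m x assume "int n \<le> m" "ip m (x - y)"
    then have "um (x - y) \<in> Kcong v n" using ip_mono by simp
    then have "f (mmul (0,1,1,y) (um (x - y))) = f (0,1,1,y)" using n by blast
    then show "f (0,1,1,x) = f (0,1,1,y)" by simp
  qed
qed

text \<open>On small discs around each point \<open>f\<close> is constant, hence a multiple of a
  \<open>dsc\<close>; \<open>disc_induct\<close> glues these over the subdiscs of a given disc,
  where the pieces for distinct representatives have disjoint supports.\<close>

lemma Ind_cut:
  assumes f: "f \<in> Ind v \<chi>"
  shows "\<exists>h\<in>sm.Pspan \<phi>0. \<forall>x. h (0,1,1,x) = (if ip n (x - b) then f (0,1,1,x) else 0)"
proof (rule disc_induct[where Q = "\<lambda>b n. \<exists>h\<in>sm.Pspan \<phi>0. \<forall>x. h (0,1,1,x) = (if ip n (x - b) then f (0,1,1,x) else 0)"])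
  fix y
  obtain n where n: "\<forall>m\<ge>n. \<forall>x. ip m (x - y) \<longrightarrow> f (0,1,1,x) = f (0,1,1,y)" using Ind_small[OF f] by blast
  show "\<exists>n. \<forall>m\<ge>n. \<exists>h\<in>sm.Pspan \<phi>0. \<forall>x. h (0,1,1,x) = (if ip m (x - y) then f (0,1,1,x) else 0)"
  proof (rule exI[of _ n], intro allI impI)
    fix m assume "n \<le> m"
    have "fscale (f (0,1,1,y)) (dsc y m) (0,1,1,x) = (if ip m (x - y) then f (0,1,1,x) else 0)" for x
    proof (cases "ip m (x - y)")
      case True
      then have "f (0,1,1,x) = f (0,1,1,y)" using n \<open>n \<le> m\<close> by blast
      then show ?thesis using True by (simp add: fscale_def dsc_sm)
    qed (simp add: fscale_def dsc_sm)
    moreover have "fscale (f (0,1,1,y)) (dsc y m) \<in> sm.Pspan \<phi>0"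
      by (intro sm.vs.subspace_scale[OF sm.Pstable_subspace[OF sm.Pspan_Pstable]] \<phi>0_Ind_sm dsc_Pspan)
    ultimately show "\<exists>h\<in>sm.Pspan \<phi>0. \<forall>x. h (0,1,1,x) = (if ip m (x - y) then f (0,1,1,x) else 0)" by blast
  qed
next
  fix b n
  assume *: "\<And>r. r \<in> Rep \<Longrightarrow> \<exists>h\<in>sm.Pspan \<phi>0. \<forall>x. h (0,1,1,x) =
    (if ip (n + 1) (x - (b + \<pi> powi n * r)) then f (0,1,1,x) else 0)"
  then have "\<exists>h. \<forall>r\<in>Rep. h r \<in> sm.Pspan \<phi>0 \<and> (\<forall>x. h r (0,1,1,x) =
    (if ip (n + 1) (x - (b + \<pi> powi n * r)) then f (0,1,1,x) else 0))"
    by (intro bchoice) blast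
  then obtain h where h: "\<And>r. r \<in> Rep \<Longrightarrow> h r \<in> sm.Pspan \<phi>0" "\<And>r x. r \<in> Rep \<Longrightarrow> h r (0,1,1,x) =
    (if ip (n + 1) (x - (b + \<pi> powi n * r)) then f (0,1,1,x) else 0)" by blast
  have app: "(\<Sum>r\<in>A. h r) g = (\<Sum>r\<in>A. h r g)" for A g
    by (induction A rule: infinite_finite_induct) auto
  have "(\<Sum>r\<in>Rep. h r) (0,1,1,x) = (if ip n (x - b) then f (0,1,1,x) else 0)" for x
  proof (cases "ip n (x - b)")
    case True
    define r where "r = rd ((x - b) / \<pi> powi n)"
    have r: "r \<in> Rep" "ip 1 ((x - b) / \<pi> powi n - r)" using rd[of "(x - b) / \<pi> powi n"] True by (auto simp: r_def)
    have iff: "ip (n + 1) (x - (b + \<pi> powi n * r')) \<longleftrightarrow> r' = r" if "r' \<in> Rep" for r'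
    proof -
      have "\<pi> powi n \<noteq> 0" by simp
      then have "x - (b + \<pi> powi n * r') = \<pi> powi n * ((x - b) / \<pi> powi n - r')"
        by (simp add: field_simps del: power_int_eq_0_iff)
      then have "ip (n + 1) (x - (b + \<pi> powi n * r')) \<longleftrightarrow> ip 1 ((x - b) / \<pi> powi n - r')"
        by (simp only: ip_powi_mult) simp
      then show ?thesis using r that rd_eqI[of r' "(x - b) / \<pi> powi n"] by (auto simp: r_def)
    qed
    have "(\<Sum>r'\<in>Rep. h r' (0,1,1,x)) = (\<Sum>r'\<in>Rep. if r' = r then f (0,1,1,x) else 0)"
      by (rule sum.cong) (use h(2) iff in auto)
    then show ?thesis using True r Rep(1) by (simp add: app)
  next
    case False
    have "h r (0,1,1,x) = 0" if r: "r \<in> Rep" for r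
    proof -
      have "\<not> ip (n + 1) (x - (b + \<pi> powi n * r))"
      proof
        assume "ip (n + 1) (x - (b + \<pi> powi n * r))"
        then have "ip n (x - (b + \<pi> powi n * r) + \<pi> powi n * r)"
          using Rep(3)[OF r] by (intro ip_add) (auto intro: ip_mono)
        then show False using False by (simp add: algebra_simps)
      qed
      then show ?thesis using h(2)[OF r] by simp
    qed
    then show ?thesis using False by (simp add: app)
  qed
  moreover have "(\<Sum>r\<in>Rep. h r) \<in> sm.Pspan \<phi>0"
    using h(1) by (intro sm.vs.subspace_sum[OF sm.Pstable_subspace[OF sm.Pspan_Pstable]] \<phi>0_Ind_sm)
  ultimately show "\<exists>h\<in>sm.Pspan \<phi>0. \<forall>x. h (0,1,1,x) = (if ip n (x - b) then f (0,1,1,x) else 0)" by blast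
next
  fix b b' n
  assume "ip n (b - b')" and *: "\<exists>h\<in>sm.Pspan \<phi>0. \<forall>x. h (0,1,1,x) = (if ip n (x - b) then f (0,1,1,x) else 0)"
  then have "ip n (x - b) \<longleftrightarrow> ip n (x - b')" for x using ip_diff_trans ip_diff_commute by blast
  then show "\<exists>h\<in>sm.Pspan \<phi>0. \<forall>x. h (0,1,1,x) = (if ip n (x - b') then f (0,1,1,x) else 0)" using * by auto
qed

text \<open>Coordinates around the point \<open>mone\<close> of the projective line: for
  \<open>x\<close> of very negative valuation the second factor is close to the identity, so the
  value there is governed by \<open>f mone\<close>.\<close>

lemma lower_decomp: "(x::'f) \<noteq> 0 \<Longrightarrow> (0,1,1,x) = mmul (- (1 / x), 1, 0, x) (1, 0, 1 / x, 1)"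
  by simp

lemma Pspan_\<phi>0_subset: "sm.Pspan \<phi>0 \<subseteq> {f \<in> Ind v \<chi>. f mone = 0}"
proof -
  have "sm.Pstable {f \<in> Ind_sm. f mone = 0}"
  proof -
    have "ind_act g f mone = 0" if "g \<in> Bor" "f \<in> Ind_sm" "f mone = 0" for g f
      using that ind_act_Bor_mone Ind_V by (auto elim!: BorE)
    moreover have "sm.vs.subspace {f \<in> Ind_sm. f mone = 0}"
    proof (rule sm.vs.subspaceI)
      show "fscale c f \<in> {f \<in> Ind_sm. f mone = 0}" if "f \<in> {f \<in> Ind_sm. f mone = 0}" for c f
        using that sm.V_closed(3)[of f c] by (simp add: fscale_def)
    qed auto
    ultimately show ?thesis using Bor_GL2 by (auto simp: sm.Pstable_def)
  qed
  then have "sm.Pspan \<phi>0 \<subseteq> {f \<in> Ind_sm. f mone = 0}"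
    using sm.Pspan_minimal \<phi>0_Ind_sm by simp
  then show ?thesis using Ind_V by blast
qed

text \<open>Vanishing at \<open>mone\<close> forces vanishing for all large \<open>x\<close>, so
  such a function has compact support in the affine line and is reached by \<open>Ind_cut\<close> on
  one large disc.\<close>

lemma Ind0_eq_Pspan: "{f \<in> Ind v \<chi>. f mone = 0} = sm.Pspan \<phi>0"
proof
  show "sm.Pspan \<phi>0 \<subseteq> {f \<in> Ind v \<chi>. f mone = 0}" by (rule Pspan_\<phi>0_subset)
next
  show "{f \<in> Ind v \<chi>. f mone = 0} \<subseteq> sm.Pspan \<phi>0"
  proof
    fix f assume "f \<in> {f \<in> Ind v \<chi>. f mone = 0}"
    then have f: "f \<in> Ind v \<chi>" "f mone = 0" by auto
    obtain n where n: "n > 0" "\<forall>k\<in>Kcong v n. f (mmul mone k) = f mone"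
      using Ind_loc_const[OF f(1) mone_in(1)] by blast
    have out: "f (0,1,1,x) = 0" if x: "\<not> ip (- int n) x" for x
    proof -
      have x0: "x \<noteq> 0" "ip (int n) (1 / x)" using x by (auto simp: in_pow_def v_divide)
      then have "f (1, 0, 1 / x, 1) = 0" using n(2)[rule_format, of "(1, 0, 1 / x, 1)"] f(2) by simp
      moreover have "f (0,1,1,x) = \<chi> (- (1 / x)) x * f (1, 0, 1 / x, 1)"
        unfolding lower_decomp[OF x0(1)] using x0 by (intro Ind_equiv[OF f(1)]) auto
      ultimately show ?thesis by simp
    qed
    obtain h where h: "h \<in> sm.Pspan \<phi>0" "\<And>x. h (0,1,1,x) = (if ip (- int n) (x - 0) then f (0,1,1,x) else 0)"
      using Ind_cut[OF f(1)] by blast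
    have "h = f"
    proof (rule Ind_sm_eqI[OF Ind_V[OF Pspan_Ind[OF h(1)]] f(1)])
      have "h \<in> {f \<in> Ind v \<chi>. f mone = 0}" using h Pspan_\<phi>0_subset by blast
      then show "h mone = f mone" using f by simp
      show "h (0,1,1,x) = f (0,1,1,x)" for x using h(2) out by simp
    qed
    then show "f \<in> sm.Pspan \<phi>0" using h by simp
  qed
qed

text \<open>Subtracting the multiple of \<open>ind_act sm \<phi>0\<close> that has the same value at
  \<open>mone\<close> moves \<open>f\<close> into the \<open>P\<close>-span of
  \<open>\<phi>0\<close>, whose members have open stabilizers.\<close>

lemma Ind_sm_eq: "Ind_sm = Ind v \<chi>"
proof
  show "Ind_sm \<subseteq> Ind v \<chi>" using Ind_V by blast
  show "Ind v \<chi> \<subseteq> Ind_sm"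
  proof
    fix f assume f: "f \<in> Ind v \<chi>"
    define h where "h = fscale (f mone) (ind_act sm \<phi>0)"
    have hs: "h \<in> Ind_sm" unfolding h_def using \<phi>0_Ind_sm by simp
    have "f + fscale (- 1) h \<in> Ind v \<chi>" using f hs Ind_V Ind_add Ind_fscale by blast
    moreover have "(f + fscale (- 1) h) mone = 0"
      by (simp add: h_def fscale_def ind_act_apply mone_def \<phi>0_sm)
    ultimately have "f + fscale (- 1) h \<in> Ind_sm" using Ind0_eq_Pspan Pspan_Ind by blast
    then have "(f + fscale (- 1) h) + h \<in> Ind_sm" by (rule sm.V_closed(2)[OF _ hs])
    moreover have "(f + fscale (- 1) h) + h = f" by (auto simp: fscale_def)
    ultimately show "f \<in> Ind_sm" by (simp only:)
  qed
qed

lemma smooth_rep_Ind: "smooth_rep v fscale (Ind v \<chi>) ind_act"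
  using smooth_rep_Ind_sm Ind_sm_eq by simp

lemma ind_act_scalar:
  assumes z: "z \<noteq> 0" and f: "f \<in> Ind v \<chi>"
  shows "ind_act (dm z z) f = fscale (\<chi> z z) f"
proof
  fix x :: "'f mat2"
  have "mmul x (dm z z) = mmul (dm z z) x" by (cases x) (simp add: mult.commute)
  then show "ind_act (dm z z) f x = fscale (\<chi> z z) f x"
    using z Ind_equiv[OF f, of x z z 0] Ind_outside[OF f] by (auto simp: ind_act_def fscale_def)
qed

end

sublocale ind_char \<subseteq> ind: gl2_central v p \<pi> fscale "Ind v \<chi>" ind_act "\<lambda>z. \<chi> z z"
  by unfold_locales (use alg_closure smooth_rep_Ind ind_act_scalar in auto)

section \<open>Submodule structure of the induced representation\<close>

context ind_char
begin

abbreviation Ind0 :: "('f mat2 \<Rightarrow> 'k) set" where "Ind0 \<equiv> {f \<in> Ind v \<chi>. f mone = 0}"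

lemma Ind0_eq: "Ind0 = ind.Pspan \<phi>0"
  using Ind0_eq_Pspan unfolding ind.Pspan_def sm.Pspan_def by simp

lemma Ind0_Pstable: "ind.Pstable Ind0"
  unfolding Ind0_eq by (rule ind.Pspan_Pstable[OF \<phi>0_Ind])

lemma \<phi>0_fixed: "\<phi>0 \<in> ind.fixed ind.I1"
proof -
  have "ind_act g \<phi>0 = \<phi>0" if g: "g \<in> ind.I1" for g
  proof
    fix x
    show "ind_act g \<phi>0 x = \<phi>0 x"
      using g \<phi>0_I1[of x] \<phi>0_outside by (cases g) (auto simp: ind_act_def)
  qed
  then show ?thesis using \<phi>0_Ind by (simp add: ind.fixed_def)
qed

text \<open>The integral coordinates form one orbit of the translations in \<open>I1\<close>, which
  gives the constant \<open>f sm\<close>; the remaining points are reached from \<open>mone\<close>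
  by lower unipotent elements of \<open>I1\<close>, and there \<open>f\<close> vanishes.\<close>

lemma Ind0_fixed:
  assumes f: "f \<in> Ind0" "f \<in> ind.fixed ind.I1"
  shows "f = fscale (f sm) \<phi>0"
proof (rule Ind_sm_eqI)
  show "f \<in> Ind v \<chi>" using f by simp
  show "fscale (f sm) \<phi>0 \<in> Ind v \<chi>" using Ind_fscale \<phi>0_Ind by blast
  show "f mone = fscale (f sm) \<phi>0 mone" using f by (simp add: fscale_def)
  have I: "f (mmul x g) = f x" if "g \<in> ind.I1" "x \<in> GL2" for g x
    using ind.fixedD(2)[OF f(2) that(1)] that(2) ind_act_apply by metis
  show "f (0,1,1,x) = fscale (f sm) \<phi>0 (0,1,1,x)" for x
  proof (cases "ip 0 x")
    case True
    then show ?thesis using I[of "um x" sm] by (simp add: fscale_def \<phi>0_sm)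
  next
    case False
    then have x: "x \<noteq> 0" "ip 1 (1 / x)" by (auto simp: in_pow_def v_divide)
    have "f (1, 0, 1 / x, 1) = 0" using I[of "(1, 0, 1 / x, 1)" mone] x f(1) by simp
    moreover have "f (0,1,1,x) = \<chi> (- (1 / x)) x * f (1, 0, 1 / x, 1)"
      unfolding lower_decomp[OF x(1)] using x f(1) by (intro Ind_equiv) auto
    ultimately show ?thesis using False by (simp add: fscale_def \<phi>0_sm)
  qed
qed

lemma Ind0_irreducible:
  assumes W: "ind.Pstable W" "W \<subseteq> Ind0" "W \<noteq> {0}"
  shows "W = Ind0"
proof -
  obtain f where f: "f \<in> W" "f \<noteq> 0" "f \<in> ind.fixed ind.I1" using ind.exists_I1_fixed[OF W(1,3)] by blast
  have eq: "f = fscale (f sm) \<phi>0" using Ind0_fixed f W(2) by blast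
  then have "f sm \<noteq> 0" using f(2) by (metis sm.vs.scale_zero_left)
  have "fscale (inverse (f sm)) f \<in> W"
    using W(1) f(1) sm.vs.subspace_scale by (auto simp: ind.Pstable_def)
  moreover have "fscale (inverse (f sm)) (fscale (f sm) \<phi>0) = \<phi>0"
    using \<open>f sm \<noteq> 0\<close> by (auto simp: fscale_def)
  then have "fscale (inverse (f sm)) f = \<phi>0" using eq by metis
  ultimately show ?thesis using ind.Pspan_minimal[OF W(1)] Ind0_eq W(2) by auto
qed

lemma sm_\<phi>0_mone: "ind_act sm \<phi>0 mone = 1"
  by (simp add: ind_act_apply mone_def \<phi>0_sm)

lemma Ind_eq_Ind0_plus:
  assumes "f \<in> Ind v \<chi>"
  shows "f - fscale (f mone) (ind_act sm \<phi>0) \<in> Ind0"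
proof -
  have "f - fscale (f mone) (ind_act sm \<phi>0) \<in> Ind v \<chi>" using assms \<phi>0_Ind by simp
  then show ?thesis using sm_\<phi>0_mone by (simp add: fscale_def)
qed

text \<open>By irreducibility of \<open>Ind0\<close> over \<open>P\<close> the subspace contains
  \<open>\<phi>0\<close>, and being \<open>G\<close>-stable also \<open>ind_act sm \<phi>0\<close>,
  which is nonzero at \<open>mone\<close> and spans a complement of \<open>Ind0\<close>.\<close>

lemma Gstable_Ind:
  assumes X: "ind.Gstable X" "X \<inter> Ind0 \<noteq> {0}"
  shows "X = Ind v \<chi>"
proof -
  have XI: "X \<subseteq> Ind v \<chi>" using X by (simp add: ind.Gstable_def)
  have "ind.Pstable (X \<inter> Ind0)"
    using ind.Gstable_Pstable[OF X(1)] Ind0_Pstable sm.vs.subspace_inter unfolding ind.Pstable_def by blast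
  then have "X \<inter> Ind0 = Ind0" using Ind0_irreducible X(2) by blast
  then have sub: "Ind0 \<subseteq> X" by blast
  have \<phi>: "\<phi>0 \<in> X" using sub \<phi>0_Ind by auto
  have "f \<in> X" if "f \<in> Ind v \<chi>" for f
  proof -
    have "f - fscale (f mone) (ind_act sm \<phi>0) \<in> X" using Ind_eq_Ind0_plus[OF that] sub by blast
    moreover have "fscale (f mone) (ind_act sm \<phi>0) \<in> X"
      using \<phi> X(1) by (auto simp: ind.Gstable_def intro!: sm.vs.subspace_scale)
    ultimately have "(f - fscale (f mone) (ind_act sm \<phi>0)) + fscale (f mone) (ind_act sm \<phi>0) \<in> X"
      using X(1) sm.vs.subspace_add unfolding ind.Gstable_def by blast
    then show ?thesis by (simp only: diff_add_cancel)
  qed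
  then show ?thesis using XI by blast
qed

text \<open>The matrices \<open>(\<pi>, r, 0, 1)\<close> turn \<open>\<phi>0\<close> into multiples
  of indicator functions of the residue classes, which partition the ring of integers. What matters
  later is that the eigenvalue is nonzero.\<close>

lemma U_\<phi>0: "ind.U \<phi>0 = fscale (\<chi> 1 \<pi>) \<phi>0"
proof (rule Ind_sm_eqI)
  show "ind.U \<phi>0 \<in> Ind v \<chi>" using \<phi>0_Ind by simp
  show "fscale (\<chi> 1 \<pi>) \<phi>0 \<in> Ind v \<chi>" using Ind_fscale \<phi>0_Ind by blast
  have app: "(\<Sum>r\<in>A. h r) g = (\<Sum>r\<in>A. h r g)" for A g and h :: "'f \<Rightarrow> 'f mat2 \<Rightarrow> 'k"
    by (induction A rule: infinite_finite_induct) auto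
  have "\<phi>0 \<in> ind.Pspan \<phi>0" using ind.Pspan_self \<phi>0_Ind by blast
  then have "ind.U \<phi>0 \<in> Ind0" using ind.U_in[OF Ind0_Pstable] Ind0_eq by blast
  then show "ind.U \<phi>0 mone = fscale (\<chi> 1 \<pi>) \<phi>0 mone" by (simp add: fscale_def)
  show "ind.U \<phi>0 (0,1,1,x) = fscale (\<chi> 1 \<pi>) \<phi>0 (0,1,1,x)" for x
  proof -
    have eq: "ind.U \<phi>0 (0,1,1,x) = (\<Sum>r\<in>Rep. if ip 1 (r + x) then \<chi> 1 \<pi> else 0)"
      by (simp add: ind.U_def app ind_act_\<phi>0_upper)
    show ?thesis
    proof (cases "ip 0 x")
      case True
      have "ip 1 (r + x) \<longleftrightarrow> r = rd (- x)" if r: "r \<in> Rep" for r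
      proof -
        have "r + x = - (- x - r)" by simp
        then have "ip 1 (r + x) \<longleftrightarrow> ip 1 (- x - r)" by (metis ip_minus)
        then show ?thesis using rd(2)[of "- x"] rd_eqI[OF r, of "- x"] True by auto
      qed
      then have "ind.U \<phi>0 (0,1,1,x) = (\<Sum>r\<in>Rep. if r = rd (- x) then \<chi> 1 \<pi> else 0)"
        unfolding eq by (intro sum.cong) auto
      then show ?thesis using rd(1)[of "- x"] True Rep(1) by (simp add: fscale_def \<phi>0_sm)
    next
      case False
      have "\<not> ip 1 (r + x)" if r: "r \<in> Rep" for r
      proof
        assume "ip 1 (r + x)"
        then have "ip 0 (r + x - r)" using Rep(3)[OF r] ip_mono[of 1 _ 0] by (intro ip_diff) auto
        then show False using False by simp
      qed
      then show ?thesis unfolding eq using False by (simp add: fscale_def \<phi>0_sm)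
    qed
  qed
qed

lemma \<phi>0_teig: "\<phi>0 \<in> ind.teig (\<lambda>a. \<chi> 1 a)"
proof -
  have "ind_act (dm a 1) \<phi>0 = fscale (\<chi> 1 a) \<phi>0" if a: "unt a" for a
  proof (rule Ind_sm_eqI)
    have a0: "a \<noteq> 0" using a unt_nonzero by blast
    show "ind_act (dm a 1) \<phi>0 \<in> Ind v \<chi>" "fscale (\<chi> 1 a) \<phi>0 \<in> Ind v \<chi>" using \<phi>0_Ind a0 by auto
    show "ind_act (dm a 1) \<phi>0 mone = fscale (\<chi> 1 a) \<phi>0 mone"
      using a0 \<phi>0_Ind by (simp add: ind_act_Bor_mone fscale_def)
    show "ind_act (dm a 1) \<phi>0 (0,1,1,x) = fscale (\<chi> 1 a) \<phi>0 (0,1,1,x)" for x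
      using a0 a by (simp add: ind_act_\<phi>0_upper fscale_def \<phi>0_sm)
  qed
  then show ?thesis using \<phi>0_fixed by (simp add: ind.teig_def)
qed

lemma \<phi>0_nonzero: "\<phi>0 \<noteq> 0"
  using \<phi>0_sm[of 0] by auto

end

subsection \<open>Embedding into a principal series\<close>

context gl2_rep
begin

text \<open>Frobenius reciprocity: a \<open>P\<close>-stable hyperplane is the kernel of a \<open>P\<close>-equivariant functional.
  The unipotent radical acts trivially on the quotient, since every \<open>um b\<close> has a \<open>p\<close>-power
  in a small subgroup and the coefficient field has no nontrivial \<open>p\<close>-power roots of unity.\<close>

lemma hyperplane_embedding:
  assumes V1: "Gstable V1" and Z: "Pstable Z" "Z \<subseteq> V1" and y: "y \<in> V1" "y \<notin> Z"
    and span: "\<And>x. x \<in> V1 \<Longrightarrow> \<exists>c. x - sc c y \<in> Z"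
  shows "\<exists>\<chi> E. smooth_charT v \<chi> \<and> E \<in> hom sc GL2 V1 act fscale (Ind v \<chi>) ind_act
     \<and> (\<forall>x\<in>V1. E x mone = 0 \<longleftrightarrow> x \<in> Z)"
proof -
  note sub = Pstable_subspace[OF Z(1)]
  have V1V: "x \<in> V" if "x \<in> V1" for x using that V1 by (auto simp: Gstable_def)
  have V1a: "act g x \<in> V1" if "x \<in> V1" "g \<in> GL2" for g x using that V1 by (auto simp: Gstable_def)
  have V1s: "vs.subspace V1" using V1 by (auto simp: Gstable_def)
  have uniq: "c = d" if "x - sc c y \<in> Z" "x - sc d y \<in> Z" for x c d
  proof (rule ccontr)
    assume "c \<noteq> d"
    have "(x - sc c y) - (x - sc d y) \<in> Z" using that vs.subspace_diff[OF sub] by blast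
    then have "sc (d - c) y \<in> Z" by (simp add: vs.scale_left_diff_distrib)
    then have "sc (inverse (d - c)) (sc (d - c) y) \<in> Z" using vs.subspace_scale[OF sub] by blast
    then show False using y(2) \<open>c \<noteq> d\<close> by simp
  qed
  \<comment> \<open>The coordinate of \<open>x\<close> along \<open>y\<close> modulo
    \<open>Z\<close>: a linear form with kernel \<open>Z\<close>.\<close>
  define L where "L x = (THE c. x - sc c y \<in> Z)" for x
  have L: "x - sc (L x) y \<in> Z" if "x \<in> V1" for x
    unfolding L_def by (rule theI') (use span[OF that] uniq in blast)
  have LI: "L x = c" if "x - sc c y \<in> Z" for x c
    unfolding L_def by (rule the_equality) (use that uniq in blast)+
  have Ladd: "L (x + x') = L x + L x'" if "x \<in> V1" "x' \<in> V1" for x x'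
  proof (rule LI)
    have "(x - sc (L x) y) + (x' - sc (L x') y) \<in> Z" using L that vs.subspace_add[OF sub] by blast
    then show "x + x' - sc (L x + L x') y \<in> Z" by (simp add: vs.scale_left_distrib algebra_simps)
  qed
  have Lsc: "L (sc a x) = a * L x" if "x \<in> V1" for x a
  proof (rule LI)
    have "sc a (x - sc (L x) y) \<in> Z" using L that vs.subspace_scale[OF sub] by blast
    then show "sc a x - sc (a * L x) y \<in> Z" by (simp add: vs.scale_right_diff_distrib)
  qed
  have Ly: "L y = 1" by (rule LI) (use vs.subspace_0[OF sub] in simp)
  have L0: "L x = 0 \<longleftrightarrow> x \<in> Z" if "x \<in> V1" for x
    using L[OF that] LI[of x 0] by auto
  have Lact: "L (act g x) = L (act g y) * L x" if x: "x \<in> V1" and g: "g \<in> Bor" for x g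
  proof -
    have "act g (x - sc (L x) y) \<in> Z" using L[OF x] Z(1) g Pstable_act by blast
    then have 1: "act g x - sc (L x) (act g y) \<in> Z"
      using x y g V1V by (simp add: act_diff act_sc Bor_GL2)
    have "sc (L x) (act g y - sc (L (act g y)) y) \<in> Z"
      using L[of "act g y"] V1a y g Bor_GL2 vs.subspace_scale[OF sub] by blast
    then have "(act g x - sc (L x) (act g y)) + sc (L x) (act g y - sc (L (act g y)) y) \<in> Z"
      using 1 vs.subspace_add[OF sub] by blast
    then have "act g x - sc (L (act g y) * L x) y \<in> Z" by (simp add: vs.scale_right_diff_distrib mult.commute)
    then show ?thesis by (rule LI)
  qed
  define c where "c g = L (act g y)" for g
  have cm: "c (mmul g h) = c g * c h" if "g \<in> Bor" "h \<in> Bor" for g h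
    using that Lact[of "act h y" g] V1a y V1V by (simp add: c_def act_mmul Bor_GL2)
  have c1: "c mone = 1" using Ly V1V y by (simp add: c_def)
  have c0: "c g \<noteq> 0" if "g \<in> Bor" for g
    using cm[OF that minv_Bor[OF that]] minv(1)[OF Bor_GL2[OF that]] c1 by auto
  obtain n where n: "n > 0" "\<And>g. g \<in> Kcong v n \<Longrightarrow> act g y = y" using smooth[OF V1V[OF y(1)]] by blast
  have cK: "c g = 1" if "g \<in> Kcong v n" for g using n(2)[OF that] Ly by (simp add: c_def)
  have cu: "c (um b) = 1" for b
  proof -
    obtain m where m: "ip (int n) (of_nat (p ^ m) * b)" using exists_ip_power_p by blast
    have "c (um (of_nat k * b)) = c (um b) ^ k" for k
    proof (induction k)
      case (Suc k)
      have "um (of_nat (Suc k) * b) = mmul (um b) (um (of_nat k * b))" by (simp add: algebra_simps)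
      then show ?case using Suc cm[of "um b" "um (of_nat k * b)"] by simp
    qed (use c1 in \<open>simp add: mone_def\<close>)
    from this[of "p ^ m"] have "c (um b) ^ (p ^ m) = 1" using cK[of "um (of_nat (p ^ m) * b)"] m by simp
    then show ?thesis by (rule p_power_root_unique[OF alg_closure])
  qed
  define \<chi> where "\<chi> a d = c (dm a d)" for a d
  have c\<chi>: "c (a,b,0,d) = \<chi> a d" if "a \<noteq> 0" "d \<noteq> 0" for a b d
  proof -
    have "(a,b,0,d) = mmul (um (b / d)) (dm a d)" using that by simp
    then show ?thesis using cm[of "um (b / d)" "dm a d"] cu that by (simp add: \<chi>_def)
  qed
  have sm\<chi>: "smooth_charT v \<chi>"
    unfolding smooth_charT_def
  proof (intro conjI allI impI)
    fix a d a' d' :: 'f assume "a \<noteq> 0" "d \<noteq> 0" "a' \<noteq> 0" "d' \<noteq> 0"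
    then show "\<chi> (a * a') (d * d') = \<chi> a d * \<chi> a' d'"
      using cm[of "dm a d" "dm a' d'"] by (simp add: \<chi>_def)
  next
    show "\<chi> a d \<noteq> 0" if "a \<noteq> 0" "d \<noteq> 0" for a d using c0[of "dm a d"] that by (simp add: \<chi>_def)
  next
    show "\<exists>n>0. \<forall>a d. a \<noteq> 0 \<longrightarrow> d \<noteq> 0 \<longrightarrow> ip (int n) (a - 1) \<longrightarrow> ip (int n) (d - 1) \<longrightarrow> \<chi> a d = 1"
      using n(1) cK by (intro exI[of _ n]) (auto simp: \<chi>_def)
  qed
  \<comment> \<open>The \<open>G\<close>-map attached to \<open>L\<close> by Frobenius reciprocity;
    its value at \<open>mone\<close> is \<open>L\<close> again, which gives the stated kernel
    condition.\<close>
  define E where "E x = (\<lambda>g. if x \<in> V1 \<and> g \<in> GL2 then L (act g x) else 0)" for x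
  have EInd: "E x \<in> Ind v \<chi>" if x: "x \<in> V1" for x
  proof -
    obtain m where m: "m > 0" "\<And>g. g \<in> Kcong v m \<Longrightarrow> act g x = x" using smooth[OF V1V[OF x]] by blast
    have "E x (mmul g k) = E x g" if "g \<in> GL2" "k \<in> Kcong v m" for g k
      using that m x V1V Kcong_GL2[OF m(1)] by (simp add: E_def act_mmul)
    then have "loc_const_G v (E x)" unfolding loc_const_G_def using m(1) by blast
    moreover have "E x (mmul (a,b,0,d) g) = \<chi> a d * E x g" if "a \<noteq> 0" "d \<noteq> 0" "g \<in> GL2" for a b d g
    proof -
      have "(a,b,0,d) \<in> Bor" using that by simp
      then have "L (act (mmul (a,b,0,d) g) x) = c (a,b,0,d) * L (act g x)"
        using Lact[of "act g x" "(a,b,0,d)"] that x V1a V1V act_mmul[OF Bor_GL2, of "(a,b,0,d)" g x]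
        unfolding c_def by metis
      moreover have "mmul (a,b,0,d) g \<in> GL2" using that by (intro mmul_GL2) auto
      ultimately show ?thesis using that x c\<chi> by (simp add: E_def del: mmul_simp)
    qed
    ultimately show ?thesis by (simp add: Ind_def E_def del: mmul_simp)
  qed
  have "E \<in> hom sc GL2 V1 act fscale (Ind v \<chi>) ind_act"
  proof -
    have "E (x + x') = E x + E x'" if "x \<in> V1" "x' \<in> V1" for x x'
      using that vs.subspace_add[OF V1s] Ladd V1a V1V by (auto simp: E_def act_add)
    moreover have "E (sc a x) = fscale a (E x)" if "x \<in> V1" for x a
      using that vs.subspace_scale[OF V1s] Lsc V1a V1V by (auto simp: E_def act_sc fscale_def)
    moreover have "E (act g x) = ind_act g (E x)" if "x \<in> V1" "g \<in> GL2" for x g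
      using that V1a V1V by (auto simp: E_def ind_act_def act_mmul)
    moreover have "E x = 0" if "x \<notin> V1" for x using that by (auto simp: E_def)
    ultimately show ?thesis using EInd by (simp add: hom_def)
  qed
  moreover have "\<forall>x\<in>V1. E x mone = 0 \<longleftrightarrow> x \<in> Z" using L0 V1V by (simp add: E_def)
  ultimately show ?thesis using sm\<chi> by blast
qed

end

subsection \<open>Sums of translates indexed by discs\<close>

text \<open>The action of upper triangular matrices on the affine line. The entry \<open>c\<close>
  is ignored, so composition is asserted for elements of \<open>Bor\<close>.\<close>

definition affine :: "'f::field mat2 \<Rightarrow> 'f \<Rightarrow> 'f" where
  "affine g x = (case g of (a,b,c,d) \<Rightarrow> (a * x + b) / d)"

lemma affine_simp: "affine (a,b,c,d) x = (a * x + b) / d"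
  by (simp add: affine_def)

lemma affine_mmul: "g \<in> Bor \<Longrightarrow> h \<in> Bor \<Longrightarrow> affine (mmul g h) x = affine g (affine h x)"
  by (auto elim!: BorE simp: affine_simp field_simps)

lemma affine_mone [simp]: "affine mone x = x"
  by (simp add: mone_def affine_simp)

lemma affine_image_mmul: "g \<in> Bor \<Longrightarrow> h \<in> Bor \<Longrightarrow> affine (mmul g h) ` D = affine g ` affine h ` D"
  by (simp add: affine_mmul image_image)

lemma affine_image_mone [simp]: "affine mone ` D = D"
  by simp

lemma affine_image_minv [simp]:
  assumes "g \<in> Bor"
  shows "affine (minv g) ` affine g ` D = D" "affine g ` affine (minv g) ` D = D"
  using affine_image_mmul[OF assms minv_Bor[OF assms]] affine_image_mmul[OF minv_Bor[OF assms] assms]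
    minv[OF Bor_GL2[OF assms]] by (metis affine_image_mone)+

section \<open>Discs, their stabilizers and their digit expansions\<close>

context local_field
begin

definition disc :: "'f \<Rightarrow> int \<Rightarrow> 'f set" where "disc b n = {x. ip n (x - b)}"

abbreviation oo :: "'f set" where "oo \<equiv> disc 0 0"

lemma affine_disc:
  assumes "a \<noteq> 0" "d \<noteq> 0"
  shows "affine (a,b,0,d) ` disc x n = disc ((a * x + b) / d) (n + v (a / d))"
proof -
  have 1: "(a * y + b) / d - (a * x + b) / d = (a / d) * (y - x)" for y
    using assms by (simp add: field_simps)
  have 2: "ip (n + v (a / d)) ((a / d) * z) \<longleftrightarrow> ip n z" for z
    using assms by (cases "z = 0") (auto simp: in_pow_def v_mult[of "a / d" z] simp del: times_divide_eq_left)
  show ?thesis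
  proof (intro equalityI subsetI)
    fix z assume "z \<in> affine (a,b,0,d) ` disc x n"
    then show "z \<in> disc ((a * x + b) / d) (n + v (a / d))"
      using 1 2 by (auto simp: disc_def affine_simp)
  next
    fix z assume z: "z \<in> disc ((a * x + b) / d) (n + v (a / d))"
    define y where "y = (d * z - b) / a"
    have zy: "z = (a * y + b) / d" using assms by (simp add: y_def)
    then have "y \<in> disc x n" using z 1[of y] 2 by (simp add: disc_def)
    then show "z \<in> affine (a,b,0,d) ` disc x n" using zy by (auto simp: affine_simp)
  qed
qed

lemma disc_eq_iff: "disc b n = disc b' n' \<longleftrightarrow> n = n' \<and> ip n (b - b')"
proof
  assume eq: "disc b n = disc b' n'"
  have "b \<in> disc b' n'" unfolding eq[symmetric] by (simp add: disc_def)
  moreover have "b + \<pi> powi n \<in> disc b' n'" unfolding eq[symmetric] by (simp add: disc_def)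
  moreover have "b' \<in> disc b n" "b' + \<pi> powi n' \<in> disc b n" unfolding eq by (simp_all add: disc_def)
  ultimately have *: "ip n' (b - b')" "ip n' (b + \<pi> powi n - b')" "ip n (b' - b)" "ip n (b' + \<pi> powi n' - b)"
    by (auto simp: disc_def)
  have "ip n' ((b + \<pi> powi n - b') - (b - b'))" "ip n ((b' + \<pi> powi n' - b) - (b' - b))"
    using * ip_diff by blast+
  then have "n' \<le> n" "n \<le> n'" by simp_all
  then show "n = n' \<and> ip n (b - b')" using * by simp
next
  assume "n = n' \<and> ip n (b - b')"
  then show "disc b n = disc b' n'" unfolding disc_def using ip_diff_trans ip_diff_commute by blast
qed

text \<open>The stabilizer of \<open>oo\<close> in \<open>P\<close>, i.e. the intersection of \<open>P\<close> with the product of \<open>GL\<^sub>2(o)\<close> and the centre.\<close>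

definition P0 :: "'f mat2 set" where
  "P0 = {(a,b,c,d). c = 0 \<and> a \<noteq> 0 \<and> d \<noteq> 0 \<and> unt (a / d) \<and> ip 0 (b / d)}"

lemma in_P0 [simp]: "(a,b,c,d) \<in> P0 \<longleftrightarrow> c = 0 \<and> a \<noteq> 0 \<and> d \<noteq> 0 \<and> unt (a / d) \<and> ip 0 (b / d)"
  by (simp add: P0_def)

lemma P0_Bor: "g \<in> P0 \<Longrightarrow> g \<in> Bor"
  by (cases g) simp

lemma P0_iff: "g \<in> Bor \<Longrightarrow> affine g ` oo = oo \<longleftrightarrow> g \<in> P0"
  by (elim BorE) (auto simp: affine_disc disc_eq_iff unt_def)

lemma P0_of_eq:
  assumes "g \<in> Bor" "h \<in> Bor" "affine g ` oo = affine h ` oo"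
  shows "mmul (minv g) h \<in> P0"
proof -
  have "affine (mmul (minv g) h) ` oo = affine (minv g) ` affine g ` oo"
    using assms by (simp add: affine_image_mmul)
  also have "\<dots> = oo" using assms(1) by simp
  finally show ?thesis using assms P0_iff[of "mmul (minv g) h"] by simp
qed

text \<open>Truncated digit expansions of length \<open>n\<close> with digits in \<open>Rep\<close>:
  representatives of the integers modulo the \<open>n\<close>-th power of the maximal ideal.\<close>

primrec reps :: "nat \<Rightarrow> 'f set" where
  "reps 0 = {0}"
| "reps (Suc n) = (\<lambda>(r, s). r + \<pi> * s) ` (Rep \<times> reps n)"

lemma finite_reps: "finite (reps n)"
  by (induction n) (auto simp: Rep(1))

lemma reps_ip: "s \<in> reps n \<Longrightarrow> ip 0 s"
  by (induction n arbitrary: s) (use Rep(3) ip_mono[of 0 _ "-1"] in \<open>auto intro!: ip_add\<close>)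

lemma reps_cover: "ip 0 x \<Longrightarrow> \<exists>s\<in>reps n. ip (int n) (x - s)"
proof (induction n arbitrary: x)
  case (Suc n)
  have "ip 0 ((x - rd x) / \<pi>)" using rd(2)[OF Suc(2)] by simp
  then obtain s where s: "s \<in> reps n" "ip (int n) ((x - rd x) / \<pi> - s)" using Suc(1) by blast
  have "x - (rd x + \<pi> * s) = \<pi> * ((x - rd x) / \<pi> - s)" by (simp add: field_simps)
  then have "ip (int (Suc n)) (x - (rd x + \<pi> * s))" using s(2) by (simp only: ip_pi_mult) simp
  moreover have "rd x + \<pi> * s \<in> reps (Suc n)" using s(1) rd(1)[OF Suc(2)] by auto
  ultimately show ?case by blast
qed auto

lemma reps_decomp_inj:
  assumes "r \<in> Rep" "r' \<in> Rep" "ip 0 s" "ip 0 s'" "ip 1 ((r + \<pi> * s) - (r' + \<pi> * s'))"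
  shows "r = r'"
proof -
  have "ip 1 (((r + \<pi> * s) - (r' + \<pi> * s')) - \<pi> * (s - s'))"
    using assms(5) ip_diff[OF assms(3,4)] by (intro ip_diff[OF assms(5)]) simp
  then show ?thesis using Rep_eqI[OF assms(1,2)] by (simp add: algebra_simps)
qed

lemma reps_inj: "s \<in> reps n \<Longrightarrow> s' \<in> reps n \<Longrightarrow> ip (int n) (s - s') \<Longrightarrow> s = s'"
proof (induction n arbitrary: s s')
  case (Suc n)
  obtain r u r' u' where *: "s = r + \<pi> * u" "s' = r' + \<pi> * u'" "r \<in> Rep" "r' \<in> Rep" "u \<in> reps n" "u' \<in> reps n"
    using Suc(2,3) by auto
  have "ip 1 (s - s')" using Suc(4) by (rule ip_mono) simp
  then have "r = r'" using reps_decomp_inj[of r r' u u'] * reps_ip by blast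
  then have "s - s' = \<pi> * (u - u')" using * by (simp add: algebra_simps)
  then have "ip (int n) (u - u')" using Suc(4) by simp
  then show ?case using Suc(1) * \<open>r = r'\<close> by blast
qed simp

end

context gl2_rep
begin

text \<open>Composition of the matrices in \<open>U\<close> prepends a digit, so the
  \<open>n\<close>-th iterate sums over all discs of depth \<open>n\<close> in \<open>oo\<close>. A
  sum with equal coefficients over such discs is thereby a multiple of an iterate of
  \<open>U\<close>.\<close>

lemma U_funpow:
  assumes "f \<in> V"
  shows "(U ^^ n) f = (\<Sum>s\<in>reps n. act (\<pi> ^ n, s, 0, 1) f)"
proof (induction n)
  case 0
  show ?case using assms act_mone[of f] by (simp add: mone_def)
next
  case (Suc n)
  have inj: "inj_on (\<lambda>(r, s). r + \<pi> * s) (Rep \<times> reps n)"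
  proof (rule inj_onI)
    fix x y assume *: "x \<in> Rep \<times> reps n" "y \<in> Rep \<times> reps n" "(\<lambda>(r, s). r + \<pi> * s) x = (\<lambda>(r, s). r + \<pi> * s) y"
    obtain r s r' s' where xy: "x = (r, s)" "y = (r', s')" by (cases x; cases y)
    then have "r = r'" using reps_decomp_inj[of r r' s s'] * reps_ip by auto
    then show "x = y" using * xy by simp
  qed
  have "(U ^^ Suc n) f = (\<Sum>r\<in>Rep. act (\<pi>, r, 0, 1) (\<Sum>s\<in>reps n. act (\<pi> ^ n, s, 0, 1) f))"
    by (simp add: Suc) (simp add: U_def)
  also have "\<dots> = (\<Sum>r\<in>Rep. \<Sum>s\<in>reps n. act (\<pi> ^ Suc n, r + \<pi> * s, 0, 1) f)"
  proof (rule sum.cong[OF refl])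
    fix r
    have "act (\<pi>, r, 0, 1) (\<Sum>s\<in>reps n. act (\<pi> ^ n, s, 0, 1) f) = (\<Sum>s\<in>reps n. act (\<pi>, r, 0, 1) (act (\<pi> ^ n, s, 0, 1) f))"
      using assms by (intro act_sum) auto
    also have "\<dots> = (\<Sum>s\<in>reps n. act (\<pi> ^ Suc n, r + \<pi> * s, 0, 1) f)"
      using assms by (intro sum.cong refl) (simp add: act_act add.commute)
    finally show "act (\<pi>, r, 0, 1) (\<Sum>s\<in>reps n. act (\<pi> ^ n, s, 0, 1) f) = (\<Sum>s\<in>reps n. act (\<pi> ^ Suc n, r + \<pi> * s, 0, 1) f)" .
  qed
  also have "\<dots> = (\<Sum>s\<in>reps (Suc n). act (\<pi> ^ Suc n, s, 0, 1) f)"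
    unfolding reps.simps(2) by (subst sum.reindex[OF inj]) (simp add: sum.cartesian_product case_prod_beta)
  finally show ?case .
qed

end

text \<open>\<open>\<sigma>\<close> is stable under the stabilizer \<open>P0\<close> of
  \<open>oo\<close>, so each disc carries exactly one \<open>P\<close>-translate of it. Invariance
  under integral translations leaves only multiples of \<open>f\<close> in \<open>\<sigma>\<close>,
  and by \<open>U_free\<close> the iterates of \<open>U\<close> at \<open>f\<close> are linearly
  independent; together these exclude relations between the translates.\<close>

locale disc_family = gl2_rep v p \<pi> sc V act
  for v :: "'f::field \<Rightarrow> int" and p :: nat and \<pi> :: 'f
    and sc :: "'k::field \<Rightarrow> 'v::ab_group_add \<Rightarrow> 'v" and V and act +
  fixes \<sigma> :: "'v set" and f :: 'v
  assumes \<sigma>_subspace: "vs.subspace \<sigma>" and \<sigma>_V: "\<sigma> \<subseteq> V"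
    and \<sigma>_P0: "g \<in> P0 \<Longrightarrow> x \<in> \<sigma> \<Longrightarrow> act g x \<in> \<sigma>"
    and \<sigma>_fixed: "ip 1 b \<Longrightarrow> x \<in> \<sigma> \<Longrightarrow> act (um b) x = x"
    and \<sigma>_invariants: "x \<in> \<sigma> \<Longrightarrow> (\<And>b. ip 0 b \<Longrightarrow> act (um b) x = x) \<Longrightarrow> \<exists>c. x = sc c f"
    and f_V: "f \<in> V" and f_fixed: "ip 0 b \<Longrightarrow> act (um b) f = f"
    and U_free: "q \<noteq> 0 \<Longrightarrow> polyop sc q U f \<noteq> 0"
begin

lemma \<sigma>_in [simp]: "x \<in> \<sigma> \<Longrightarrow> x \<in> V"
  using \<sigma>_V by blast

text \<open>The translate of \<open>\<sigma>\<close> sitting at the disc \<open>D\<close>. Inserting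
  0 makes this a subspace for every set \<open>D\<close>, also when no element of \<open>Bor\<close>
  carries \<open>oo\<close> to it.\<close>

definition SD :: "'f set \<Rightarrow> 'v set" where
  "SD D = insert 0 {y. \<exists>g\<in>Bor. affine g ` oo = D \<and> y \<in> act g ` \<sigma>}"

lemma SD_eq: assumes g: "g \<in> Bor" shows "SD (affine g ` oo) = act g ` \<sigma>"
proof
  show "act g ` \<sigma> \<subseteq> SD (affine g ` oo)" using g by (auto simp: SD_def)
  have "act h y \<in> act g ` \<sigma>" if h: "h \<in> Bor" "affine h ` oo = affine g ` oo" "y \<in> \<sigma>" for h y
  proof -
    define k where "k = mmul (minv g) h"
    have k: "k \<in> P0" unfolding k_def by (rule P0_of_eq) (use g h in auto)
    have "mmul g k = h" unfolding k_def using minv(1)[OF Bor_GL2[OF g]] by (metis mmul_assoc mone_mmul(1))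
    then have "act h y = act g (act k y)"
      using act_mmul[of g k y] g P0_Bor[OF k] h(3) by simp
    then show ?thesis using \<sigma>_P0[OF k h(3)] by blast
  qed
  moreover have "0 \<in> act g ` \<sigma>"
    using vs.subspace_0[OF \<sigma>_subspace] act_0[OF Bor_GL2[OF g]] by (metis image_eqI)
  ultimately show "SD (affine g ` oo) \<subseteq> act g ` \<sigma>" by (auto simp: SD_def)
qed

lemma SD_cases:
  assumes "y \<in> SD D" "y \<noteq> 0"
  obtains g z where "g \<in> Bor" "D = affine g ` oo" "z \<in> \<sigma>" "y = act g z"
  using assms by (auto simp: SD_def)

lemma SD_V: "y \<in> SD D \<Longrightarrow> y \<in> V"
  using \<sigma>_V Bor_GL2 by (auto simp: SD_def)

lemma SD_subspace: "vs.subspace (SD D)"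
proof (cases "\<exists>g\<in>Bor. affine g ` oo = D")
  case True
  then obtain g where g: "g \<in> Bor" "D = affine g ` oo" by blast
  have gG: "g \<in> GL2" using g Bor_GL2 by blast
  show ?thesis
    unfolding g(2) SD_eq[OF g(1)]
  proof (rule vs.subspaceI)
    show "0 \<in> act g ` \<sigma>" using vs.subspace_0[OF \<sigma>_subspace] act_0[OF gG] by (metis image_eqI)
    show "x + y \<in> act g ` \<sigma>" if "x \<in> act g ` \<sigma>" "y \<in> act g ` \<sigma>" for x y
    proof -
      obtain x' y' where *: "x = act g x'" "y = act g y'" "x' \<in> \<sigma>" "y' \<in> \<sigma>" using \<open>x \<in> act g ` \<sigma>\<close> \<open>y \<in> act g ` \<sigma>\<close> by blast
      then have "x + y = act g (x' + y')" using gG by (simp add: act_add)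
      then show ?thesis using * vs.subspace_add[OF \<sigma>_subspace] by blast
    qed
    show "sc c x \<in> act g ` \<sigma>" if "x \<in> act g ` \<sigma>" for c x
    proof -
      obtain x' where *: "x = act g x'" "x' \<in> \<sigma>" using \<open>x \<in> act g ` \<sigma>\<close> by blast
      then have "sc c x = act g (sc c x')" using gG by (simp add: act_sc)
      then show ?thesis using * vs.subspace_scale[OF \<sigma>_subspace] by blast
    qed
  qed
next
  case False
  then have "SD D = {0}" by (auto simp: SD_def)
  then show ?thesis by simp
qed

lemma SD_act: assumes g: "g \<in> Bor" and y: "y \<in> SD D" shows "act g y \<in> SD (affine g ` D)"
proof (cases "y = 0")
  case False
  then obtain h z where h: "h \<in> Bor" "D = affine h ` oo" "z \<in> \<sigma>" "y = act h z" using y SD_cases by blast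
  have "act g y = act (mmul g h) z" using g h by (simp add: act_mmul)
  moreover have "affine g ` D = affine (mmul g h) ` oo" using g h by (simp add: affine_image_mmul)
  ultimately show ?thesis using SD_eq[of "mmul g h"] g h by auto
qed (use g in \<open>simp add: SD_def\<close>)

text \<open>The external direct sum of the spaces \<open>SD D\<close>. The map \<open>tot\<close>
  sends it to \<open>V\<close>, and its injectivity is the independence of the translates;
  \<open>tr\<close> is the action of \<open>Bor\<close> for which \<open>tot\<close> is
  equivariant.\<close>

definition X :: "('f set \<Rightarrow> 'v) set" where
  "X = {x. finite {D. x D \<noteq> 0} \<and> (\<forall>D. x D \<in> SD D)}"

definition tot :: "('f set \<Rightarrow> 'v) \<Rightarrow> 'v" where "tot x = (\<Sum>D | x D \<noteq> 0. x D)"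

definition scF :: "'k \<Rightarrow> ('f set \<Rightarrow> 'v) \<Rightarrow> 'f set \<Rightarrow> 'v" where "scF c x = (\<lambda>D. sc c (x D))"

definition tr :: "'f mat2 \<Rightarrow> ('f set \<Rightarrow> 'v) \<Rightarrow> 'f set \<Rightarrow> 'v" where
  "tr g x = (\<lambda>D. act g (x (affine (minv g) ` D)))"

lemma scF_vector_space: "vector_space scF"
  by unfold_locales (auto simp: scF_def vs.scale_right_distrib vs.scale_left_distrib)

interpretation F: vector_space scF by (rule scF_vector_space)

lemma X_D: "x \<in> X \<Longrightarrow> x D \<in> SD D" "x \<in> X \<Longrightarrow> x D \<in> V" "x \<in> X \<Longrightarrow> finite {D. x D \<noteq> 0}"
  using SD_V by (auto simp: X_def)

lemma tot_eq: "finite A \<Longrightarrow> {D. x D \<noteq> 0} \<subseteq> A \<Longrightarrow> tot x = sum x A"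
  unfolding tot_def by (rule sum.mono_neutral_left) auto

lemma X_subspace: "F.subspace X"
proof (rule F.subspaceI)
  show "0 \<in> X" by (auto simp: X_def SD_def)
  fix x y assume xy: "x \<in> X" "y \<in> X"
  have "{D. (x + y) D \<noteq> 0} \<subseteq> {D. x D \<noteq> 0} \<union> {D. y D \<noteq> 0}" by auto
  then have "finite {D. (x + y) D \<noteq> 0}" using X_D(3)[OF xy(1)] X_D(3)[OF xy(2)] by (meson finite_UnI finite_subset)
  moreover have "(x + y) D \<in> SD D" for D
    using vs.subspace_add[OF SD_subspace X_D(1)[OF xy(1)] X_D(1)[OF xy(2)]] by simp
  ultimately show "x + y \<in> X" unfolding X_def by blast
next
  fix c x assume x: "x \<in> X"
  have "{D. scF c x D \<noteq> 0} \<subseteq> {D. x D \<noteq> 0}" by (auto simp: scF_def)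
  then have "finite {D. scF c x D \<noteq> 0}" using X_D(3)[OF x] by (rule finite_subset)
  moreover have "scF c x D \<in> SD D" for D
    using vs.subspace_scale[OF SD_subspace X_D(1)[OF x]] by (simp add: scF_def)
  ultimately show "scF c x \<in> X" unfolding X_def by blast
qed

lemma tot_add: "x \<in> X \<Longrightarrow> y \<in> X \<Longrightarrow> tot (x + y) = tot x + tot y"
proof -
  assume xy: "x \<in> X" "y \<in> X"
  define A where "A = {D. x D \<noteq> 0} \<union> {D. y D \<noteq> 0}"
  have "finite A" using xy X_D by (auto simp: A_def)
  moreover have "{D. (x + y) D \<noteq> 0} \<subseteq> A" "{D. x D \<noteq> 0} \<subseteq> A" "{D. y D \<noteq> 0} \<subseteq> A" by (auto simp: A_def)
  ultimately show ?thesis using tot_eq[of A] by (simp add: sum.distrib)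
qed

lemma tot_scF: "x \<in> X \<Longrightarrow> tot (scF c x) = sc c (tot x)"
proof -
  assume x: "x \<in> X"
  have "{D. scF c x D \<noteq> 0} \<subseteq> {D. x D \<noteq> 0}" by (auto simp: scF_def)
  then have "tot (scF c x) = sum (scF c x) {D. x D \<noteq> 0}" using tot_eq X_D(3)[OF x] by blast
  then show ?thesis by (simp add: scF_def vs.scale_sum_right tot_def)
qed

lemma tr_supp: assumes "g \<in> Bor" "x \<in> X" shows "{D. tr g x D \<noteq> 0} = (`) (affine g) ` {D. x D \<noteq> 0}"
proof (intro equalityI subsetI)
  fix D assume "D \<in> {D. tr g x D \<noteq> 0}"
  then have "x (affine (minv g) ` D) \<noteq> 0" using assms by (auto simp: tr_def)
  moreover have "D = affine g ` (affine (minv g) ` D)" using assms by simp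
  ultimately show "D \<in> (`) (affine g) ` {D. x D \<noteq> 0}" by blast
next
  fix D assume "D \<in> (`) (affine g) ` {D. x D \<noteq> 0}"
  then obtain D' where "D = affine g ` D'" "x D' \<noteq> 0" by blast
  then show "D \<in> {D. tr g x D \<noteq> 0}"
    using assms X_D(2) by (simp add: tr_def act_eq_0 Bor_GL2)
qed

lemma tr_X: assumes g: "g \<in> Bor" and x: "x \<in> X" shows "tr g x \<in> X"
proof -
  have "tr g x D \<in> SD D" for D
    using SD_act[OF g X_D(1)[OF x], of "affine (minv g) ` D"] g by (simp add: tr_def)
  then show ?thesis using tr_supp[OF g x] X_D(3)[OF x] by (simp add: X_def)
qed

lemma affine_image_inj: "g \<in> Bor \<Longrightarrow> inj ((`) (affine g))"
  by (rule inj_on_inverseI[of _ "(`) (affine (minv g))"]) simp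

lemma sum_tr:
  assumes g: "g \<in> Bor" and x: "x \<in> X"
  shows "(\<Sum>D | tr g x D \<noteq> 0. h D (tr g x D)) = (\<Sum>D | x D \<noteq> 0. h (affine g ` D) (act g (x D)))"
proof -
  have "(\<Sum>D | tr g x D \<noteq> 0. h D (tr g x D)) = (\<Sum>D | x D \<noteq> 0. h (affine g ` D) (tr g x (affine g ` D)))"
    unfolding tr_supp[OF g x]
    by (subst sum.reindex[OF inj_on_subset[OF affine_image_inj[OF g]]]) (auto simp: comp_def)
  then show ?thesis using g by (simp add: tr_def)
qed

lemma tot_tr: "g \<in> Bor \<Longrightarrow> x \<in> X \<Longrightarrow> tot (tr g x) = act g (tot x)"
  unfolding tot_def using sum_tr[of g x "\<lambda>D y. y"] X_D(2) by (simp add: act_sum)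

lemma minv_mmul: "g \<in> GL2 \<Longrightarrow> h \<in> GL2 \<Longrightarrow> minv (mmul g h) = mmul (minv h) (minv g)"
proof -
  assume gh: "g \<in> GL2" "h \<in> GL2"
  have "mmul (mmul (minv h) (minv g)) (mmul g h) = mmul (minv h) (mmul (mmul (minv g) g) h)" by (simp only: mmul_assoc)
  then have 1: "mmul (mmul (minv h) (minv g)) (mmul g h) = mone" using gh by (simp add: minv)
  have "mmul (minv h) (minv g) = mmul (mmul (minv h) (minv g)) (mmul (mmul g h) (minv (mmul g h)))"
    using gh minv(1)[of "mmul g h"] by simp
  then show ?thesis using 1 by (metis mmul_assoc mone_mmul(1))
qed

lemma tr_tr: "g \<in> Bor \<Longrightarrow> h \<in> Bor \<Longrightarrow> x \<in> X \<Longrightarrow> tr g (tr h x) = tr (mmul g h) x"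
  using X_D(2) by (auto simp: tr_def act_act minv_mmul affine_image_mmul)

lemma tr_linear: "g \<in> Bor \<Longrightarrow> S \<subseteq> X \<Longrightarrow> lin_on scF S (tr g)"
  unfolding lin_on_def
proof (intro conjI ballI allI ext)
  assume g: "g \<in> Bor" and S: "S \<subseteq> X"
  show "tr g (x + y) D = (tr g x + tr g y) D" if "x \<in> S" "y \<in> S" for x y D
  proof -
    have "x \<in> X" "y \<in> X" using that S by blast+
    then show ?thesis using g X_D(2) by (simp add: tr_def act_add)
  qed
  show "tr g (scF c x) D = scF c (tr g x) D" if "x \<in> S" for c x D
  proof -
    have "x \<in> X" using that S by blast
    then show ?thesis using g X_D(2) by (simp add: tr_def scF_def act_sc)
  qed
qed

definition good :: "nat \<Rightarrow> 'f set set" where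
  "good M = {disc b n | b n. ip 0 b \<and> 0 \<le> n \<and> n \<le> int M}"

lemma good_mono: "M \<le> M' \<Longrightarrow> good M \<subseteq> good M'"
  by (force simp: good_def)

text \<open>Multiplication by a high power of \<pi> moves any given disc into \<open>oo\<close>; one
  power works for the whole finite support of \<open>x\<close>.\<close>

lemma shrink_into_good:
  assumes x: "x \<in> X"
  shows "\<exists>m M. {D. tr (dm (\<pi> ^ m) 1) x D \<noteq> 0} \<subseteq> good M"
proof -
  have "\<exists>N. \<forall>m\<ge>N. \<exists>M. affine (dm (\<pi> ^ m) 1) ` D \<in> good M" if D: "x D \<noteq> 0" for D
  proof -
    obtain g where g: "g \<in> Bor" "D = affine g ` oo" using SD_cases[OF X_D(1)[OF x] D] by blast
    obtain a b d where abd: "g = (a,b,0,d)" "a \<noteq> 0" "d \<noteq> 0" using g(1) by (rule BorE)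
    obtain N where N: "\<And>n. n \<ge> N \<Longrightarrow> ip (- int n) (b / d)" using exists_ip_bound by blast
    show ?thesis
    proof (rule exI[of _ "max N (nat (- v (a / d)))"], intro allI impI)
      fix m assume m: "max N (nat (- v (a / d))) \<le> m"
      have "affine (dm (\<pi> ^ m) 1) ` D = disc (\<pi> ^ m * (b / d)) (v (a / d) + int m)"
        using abd by (simp add: g affine_disc[of "\<pi> ^ m" 1 0] affine_disc[of a d b] v_power)
      moreover have "ip 0 (\<pi> powi (int m) * (b / d))" using N[of m] m by (simp only: ip_powi_mult) simp
      moreover have "0 \<le> v (a / d) + int m"
      proof -
        have "- v (a / d) \<le> int (nat (- v (a / d)))" "nat (- v (a / d)) \<le> m" using m by auto
        then show ?thesis by linarith
      qed
      ultimately show "\<exists>M. affine (dm (\<pi> ^ m) 1) ` D \<in> good M"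
        unfolding good_def by (intro exI[of _ "nat (v (a / d) + int m)"]) (auto simp: power_int_def)
    qed
  qed
  then obtain N where N: "\<And>D m. x D \<noteq> 0 \<Longrightarrow> m \<ge> N D \<Longrightarrow> \<exists>M. affine (dm (\<pi> ^ m) 1) ` D \<in> good M" by metis
  have fin: "finite {D. x D \<noteq> 0}" by (rule X_D[OF x])
  define m where "m = Max (insert 0 (N ` {D. x D \<noteq> 0}))"
  have "m \<ge> N D" if "x D \<noteq> 0" for D unfolding m_def using that fin by (intro Max_ge) auto
  then have "\<exists>M. affine (dm (\<pi> ^ m) 1) ` D \<in> good M" if "x D \<noteq> 0" for D using N that by blast
  then obtain M where M: "\<And>D. x D \<noteq> 0 \<Longrightarrow> affine (dm (\<pi> ^ m) 1) ` D \<in> good (M D)" by metis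
  define M' where "M' = Max (insert 0 (M ` {D. x D \<noteq> 0}))"
  have "M D \<le> M'" if "x D \<noteq> 0" for D unfolding M'_def using that fin by (intro Max_ge) auto
  then have "affine (dm (\<pi> ^ m) 1) ` D \<in> good M'" if "x D \<noteq> 0" for D using M good_mono that by blast
  moreover have "{D. tr (dm (\<pi> ^ m) 1) x D \<noteq> 0} = (`) (affine (dm (\<pi> ^ m) 1)) ` {D. x D \<noteq> 0}"
    by (rule tr_supp) (use x in auto)
  ultimately have "{D. tr (dm (\<pi> ^ m) 1) x D \<noteq> 0} \<subseteq> good M'"
    by (simp only: image_subset_iff mem_Collect_eq) simp
  then show ?thesis by (intro exI)
qed

lemma um_image_disc: "affine (um c) ` disc b n = disc (b + c) n"
  using affine_disc[of 1 1 c b n] by simp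

lemma minv_um: "minv (um b) = um (- b)" for b :: 'f
  by (simp add: minv_def)

text \<open>Depth \<open>M\<close> would suffice to fix the discs. The extra 1 is for the vectors:
  conjugated into \<open>oo\<close>, the translation by \<open>c\<close> at a disc of depth
  \<open>n\<close> becomes \<open>um (c / \<pi> powi n)\<close>, which acts trivially on
  \<open>\<sigma>\<close> because \<open>c / \<pi> powi n\<close> lies in the maximal ideal.\<close>

lemma tr_um_trivial:
  assumes x: "x \<in> X" "{D. x D \<noteq> 0} \<subseteq> good M" and c: "ip (int M + 1) c"
  shows "tr (um c) x = x"
proof
  fix D
  show "tr (um c) x D = x D"
  proof (cases "D \<in> good M")
    case True
    then obtain b n where D: "D = disc b n" "0 \<le> n" "n \<le> int M" by (auto simp: good_def)
    have "affine (minv (um c)) ` D = D"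
      unfolding D minv_um um_image_disc disc_eq_iff using ip_mono[OF c, of n] D by simp
    then have eq: "tr (um c) x D = act (um c) (x D)" by (simp add: tr_def)
    define g :: "'f mat2" where "g = (\<pi> powi n, b, 0, 1)"
    have g: "g \<in> Bor" by (simp add: g_def)
    have "affine g ` oo = D" using affine_disc[of "\<pi> powi n" 1 b 0 0] by (simp add: g_def D)
    then obtain z where z: "z \<in> \<sigma>" "x D = act g z" using X_D(1)[OF x(1), of D] SD_eq[OF g] by auto
    have zV: "z \<in> V" using z \<sigma>_V by blast
    have "act (um c) (act g z) = act g (act (um (c / \<pi> powi n)) z)"
      by (rule act_eqI) (use g Bor_GL2 zV in \<open>auto simp: g_def\<close>)
    also have "act (um (c / \<pi> powi n)) z = z"
      by (rule \<sigma>_fixed) (use c D z in \<open>auto intro: ip_mono\<close>)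
    finally show ?thesis using eq z by simp
  next
    case False
    have "affine (minv (um c)) ` D \<notin> good M"
    proof
      assume "affine (minv (um c)) ` D \<in> good M"
      then obtain b n where D: "affine (minv (um c)) ` D = disc b n" "ip 0 b" "0 \<le> n" "n \<le> int M" by (auto simp: good_def)
      then have "D = affine (um c) ` disc b n" using affine_image_minv(2)[of "um c" D] by simp
      then have "D = disc (b + c) n" by (simp only: um_image_disc)
      moreover have "ip 0 (b + c)" using D(2) ip_mono[OF c, of 0] by (intro ip_add) auto
      ultimately show False using False D by (auto simp: good_def)
    qed
    then have "x (affine (minv (um c)) ` D) = 0" "x D = 0" using x(2) False by blast+
    then show ?thesis by (simp add: tr_def)
  qed
qed

lemma good_um: "ip 0 c \<Longrightarrow> D \<in> good M \<Longrightarrow> affine (um c) ` D \<in> good M"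
  unfolding good_def using ip_add um_image_disc by blast

lemma good_bij: "bij_betw (\<lambda>(n, s). disc s (int n)) (SIGMA n:{..M}. reps n) (good M)"
proof (rule bij_betw_imageI)
  show "inj_on (\<lambda>(n, s). disc s (int n)) (SIGMA n:{..M}. reps n)"
    by (rule inj_onI) (auto simp: disc_eq_iff dest: reps_inj)
  show "(\<lambda>(n, s). disc s (int n)) ` (SIGMA n:{..M}. reps n) = good M"
  proof (intro equalityI subsetI)
    fix D assume "D \<in> (\<lambda>(n, s). disc s (int n)) ` (SIGMA n:{..M}. reps n)"
    then show "D \<in> good M" using reps_ip by (fastforce simp: good_def)
  next
    fix D assume "D \<in> good M"
    then obtain b n where D: "D = disc b n" "ip 0 b" "0 \<le> n" "n \<le> int M" by (auto simp: good_def)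
    then obtain s where s: "s \<in> reps (nat n)" "ip n (b - s)" using reps_cover[of b "nat n"] by auto
    then have "D = disc s (int (nat n))" using D by (simp add: disc_eq_iff)
    then show "D \<in> (\<lambda>(n, s). disc s (int n)) ` (SIGMA n:{..M}. reps n)" using s D
      by (intro image_eqI[of _ _ "(nat n, s)"]) auto
  qed
qed

text \<open>A relation between the subspaces \<open>SD D\<close> can be moved into \<open>oo\<close> and made invariant under the
  pro-\<open>p\<close> group of all \<open>um b\<close> with \<open>b\<close> integral; an invariant relation is a polynomial in \<open>U\<close>
  annihilating \<open>f\<close>.\<close>

lemma tot_injective:
  assumes x: "x \<in> X" "tot x = 0"
  shows "x = 0"
proof (rule ccontr)
  assume x0: "x \<noteq> 0"
  obtain m M where mM: "{D. tr (dm (\<pi> ^ m) 1) x D \<noteq> 0} \<subseteq> good M" using shrink_into_good[OF x(1)] by blast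
  \<comment> \<open>All relations supported in \<open>good M\<close>, not only the given one: a
    translation-invariant one is to be found among them.\<close>
  define S where "S = {x \<in> X. tot x = 0 \<and> {D. x D \<noteq> 0} \<subseteq> good M}"
  have tB: "dm (\<pi> ^ m) 1 \<in> Bor" by simp
  have "tr (dm (\<pi> ^ m) 1) x \<in> S"
    using mM tr_X[OF tB x(1)] tot_tr[OF tB x(1)] x(2) Bor_GL2[OF tB] by (simp add: S_def)
  moreover have "tr (dm (\<pi> ^ m) 1) x \<noteq> 0"
  proof -
    obtain D where "x D \<noteq> 0" using x0 by (auto simp: fun_eq_iff)
    then have "tr (dm (\<pi> ^ m) 1) x (affine (dm (\<pi> ^ m) 1) ` D) \<noteq> 0" using tr_supp[OF tB x(1)] by blast
    then show ?thesis by auto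
  qed
  ultimately have Snz: "S \<noteq> {0}" by blast
  have SX: "S \<subseteq> X" by (auto simp: S_def)
  have "F.subspace S"
  proof (rule F.subspaceI)
    have "tot 0 = 0" by (simp add: tot_def)
    then show "0 \<in> S" using F.subspace_0[OF X_subspace] by (simp add: S_def)
    show "x + y \<in> S" if "x \<in> S" "y \<in> S" for x y
    proof -
      have X: "x \<in> X" "y \<in> X" and t: "tot x = 0" "tot y = 0"
        and s: "{D. x D \<noteq> 0} \<subseteq> good M" "{D. y D \<noteq> 0} \<subseteq> good M" using that by (auto simp: S_def)
      have "{D. (x + y) D \<noteq> 0} \<subseteq> {D. x D \<noteq> 0} \<union> {D. y D \<noteq> 0}" by auto
      then have "{D. (x + y) D \<noteq> 0} \<subseteq> good M" using s by (meson Un_least order_trans)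
      then show ?thesis
        using tot_add[OF X] t F.subspace_add[OF X_subspace X] unfolding S_def mem_Collect_eq by simp
    qed
    show "scF c x \<in> S" if "x \<in> S" for c x
    proof -
      have X: "x \<in> X" and t: "tot x = 0" and s: "{D. x D \<noteq> 0} \<subseteq> good M" using that by (auto simp: S_def)
      have "{D. scF c x D \<noteq> 0} \<subseteq> {D. x D \<noteq> 0}" by (auto simp: scF_def)
      then have "{D. scF c x D \<noteq> 0} \<subseteq> good M" using s by (rule order_trans)
      then show ?thesis
        using tot_scF[OF X] t F.subspace_scale[OF X_subspace X] unfolding S_def mem_Collect_eq by simp
    qed
  qed
  have trS: "tr (um b) x \<in> S" if b: "ip 0 b" and x: "x \<in> S" for b x
  proof -
    have B: "um b \<in> Bor" by simp
    have "{D. tr (um b) x D \<noteq> 0} \<subseteq> good M"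
      using tr_supp[OF B, of x] x good_um[OF b] by (auto simp: S_def)
    then show ?thesis using tr_X[OF B] tot_tr[OF B] x Bor_GL2[OF B] by (simp add: S_def)
  qed
  \<comment> \<open>Integral translations act on \<open>S\<close> through the integers modulo the
    ideal of exponent \<open>M + 1\<close>, a finite p-group with representatives
    \<open>reps (Suc M)\<close>.\<close>
  have "\<exists>x\<in>S. x \<noteq> 0 \<and> (\<forall>b\<in>reps (Suc M). tr (um b) x = x)"
  proof (rule F.common_fixed_vector[OF alg_closure finite_reps \<open>F.subspace S\<close> Snz])
    show "lin_on scF S (tr (um b))" for b :: 'f using SX by (intro tr_linear) auto
    show "tr (um b) x \<in> S" if "b \<in> reps (Suc M)" "x \<in> S" for b x using that trS reps_ip by blast
    show "tr (um b) (tr (um b') x) = tr (um b') (tr (um b) x)" if "x \<in> S" for b b' x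
      using that SX by (auto simp: tr_tr add.commute subset_iff)
    show "\<exists>m. \<forall>x\<in>S. (tr (um b) ^^ (p ^ m)) x = x" if "b \<in> reps (Suc M)" for b
    proof -
      obtain m where m: "ip (int M + 1) (of_nat (p ^ m) * b)" using exists_ip_power_p by blast
      have "(tr (um b) ^^ k) x = tr (um (of_nat k * b)) x" if x: "x \<in> S" for k x
      proof (induction k)
        case 0
        have "tr (um 0) x = x" using tr_um_trivial[of x M 0] x by (simp add: S_def)
        then show ?case by simp
      next
        case (Suc k)
        then show ?case using x SX by (auto simp: tr_tr subset_iff algebra_simps)
      qed
      moreover have "tr (um (of_nat (p ^ m) * b)) x = x" if "x \<in> S" for x
        using tr_um_trivial[OF _ _ m] that by (simp add: S_def)
      ultimately show ?thesis by (intro exI[of _ m]) simp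
    qed
  qed
  then obtain x where x: "x \<in> S" "x \<noteq> 0" "\<And>b. b \<in> reps (Suc M) \<Longrightarrow> tr (um b) x = x" by blast
  have xX: "x \<in> X" "tot x = 0" "{D. x D \<noteq> 0} \<subseteq> good M" using x by (auto simp: S_def)
  have inv: "tr (um b) x = x" if b: "ip 0 b" for b
  proof -
    obtain s where s: "s \<in> reps (Suc M)" "ip (int (Suc M)) (b - s)" using reps_cover[OF b] by blast
    have "um b = mmul (um s) (um (b - s))" by simp
    then have "tr (um b) x = tr (um s) (tr (um (b - s)) x)" using tr_tr[of "um s" "um (b - s)" x] xX by simp
    also have "tr (um (b - s)) x = x" using tr_um_trivial[OF xX(1,3)] s(2) by (simp add: add.commute)
    finally show ?thesis using x(3) s by simp
  qed
  have xa: "act (um b) (x (disc c n)) = x (disc (c + b) n)" if "ip 0 b" for b c n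
  proof -
    have "x (disc (c + b) n) = tr (um b) x (disc (c + b) n)" using inv[OF that] by simp
    also have "\<dots> = act (um b) (x (disc c n))" by (simp only: tr_def minv_um um_image_disc) simp
    finally show ?thesis by simp
  qed
  \<comment> \<open>Translations of depth \<open>n\<close> preserve the disc at 0, so the vector
    there is invariant under them; pulled back to \<open>oo\<close> it is invariant under all
    integral translations and thus a multiple of \<open>f\<close>.\<close>
  have "\<exists>c. x (disc 0 (int n)) = sc c (act (dm (\<pi> ^ n) 1) f)" for n
  proof -
    define t where "t = dm (\<pi> ^ n) 1"
    have tB: "t \<in> Bor" by (simp add: t_def)
    have "affine t ` oo = disc 0 (int n)" using affine_disc[of "\<pi> ^ n" 1 0 0 0] by (simp add: t_def v_power)
    then obtain z where z: "z \<in> \<sigma>" "x (disc 0 (int n)) = act t z"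
      using X_D(1)[OF xX(1), of "disc 0 (int n)"] SD_eq[OF tB] by auto
    have zV: "z \<in> V" using z \<sigma>_V by blast
    have "act (um b) z = z" if b: "ip 0 b" for b
    proof -
      have b': "ip (int n) (\<pi> ^ n * b)" using ip_powi_mult[of "int n" "int n" b] b by simp
      have "act t (act (um b) z) = act (um (\<pi> ^ n * b)) (act t z)"
        by (rule act_eqI) (use zV in \<open>auto simp: t_def\<close>)
      also have "\<dots> = x (disc (0 + \<pi> ^ n * b) (int n))"
        using xa[of "\<pi> ^ n * b" 0 "int n"] z(2) ip_mono[OF b', of 0] by simp
      also have "disc (0 + \<pi> ^ n * b) (int n) = disc 0 (int n)" using b' by (simp add: disc_eq_iff)
      finally have "act (minv t) (act t (act (um b) z)) = act (minv t) (act t z)" using z by simp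
      then show ?thesis using act_minv(2)[OF Bor_GL2[OF tB]] zV by simp
    qed
    then obtain c where "z = sc c f" using \<sigma>_invariants[OF z(1)] by blast
    then show ?thesis using z f_V tB by (simp add: act_sc Bor_GL2 t_def)
  qed
  then obtain a where a: "\<And>n. x (disc 0 (int n)) = sc (a n) (act (dm (\<pi> ^ n) 1) f)" by metis
  have xD: "x (disc s (int n)) = sc (a n) (act (\<pi> ^ n, s, 0, 1) f)" if "s \<in> reps n" for s n
  proof -
    have "x (disc s (int n)) = act (um s) (x (disc 0 (int n)))" using xa[of s 0 "int n"] reps_ip[OF that] by simp
    then show ?thesis using a f_V by (simp add: act_sc act_act)
  qed
  have fing: "finite (good M)"
    using good_bij bij_betw_finite finite_reps by (metis finite_SigmaI finite_atMost)
  \<comment> \<open>Invariance gives equal coefficients \<open>a n\<close> on all discs of depth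
    \<open>n\<close>, and by \<open>U_funpow\<close> these add up to \<open>a n\<close> times the
    \<open>n\<close>-th iterate of \<open>U\<close> at \<open>f\<close>.\<close>
  have "tot x = (\<Sum>D\<in>good M. x D)" by (rule tot_eq[OF fing xX(3)])
  also have "\<dots> = (\<Sum>(n, s)\<in>(SIGMA n:{..M}. reps n). x (disc s (int n)))"
    by (subst sum.reindex_bij_betw[OF good_bij, symmetric]) (simp add: case_prod_beta)
  also have "\<dots> = (\<Sum>n\<le>M. \<Sum>s\<in>reps n. x (disc s (int n)))"
    by (rule sum.Sigma[symmetric]) (auto simp: finite_reps)
  also have "\<dots> = (\<Sum>n\<le>M. sc (a n) ((U ^^ n) f))"
    by (intro sum.cong refl) (simp add: xD U_funpow f_V vs.scale_sum_right)
  finally have rel: "(\<Sum>n\<le>M. sc (a n) ((U ^^ n) f)) = 0" using xX by simp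
  define q where "q = (\<Sum>n\<le>M. monom (a n) n)"
  have cq: "coeff q n = (if n \<le> M then a n else 0)" for n
    by (simp add: q_def coeff_sum)
  have "degree q \<le> M" by (rule degree_le) (auto simp: cq)
  then have "polyop sc q U f = (\<Sum>n\<le>M. sc (coeff q n) ((U ^^ n) f))" by (rule vs.polyop_altdef)
  then have "polyop sc q U f = 0" using rel by (simp add: cq)
  then have "q = 0" using U_free by blast
  then have a0: "a n = 0" if "n \<le> M" for n using cq[of n] that by simp
  have "x D = 0" for D
  proof (cases "D \<in> good M")
    case True
    then have "D \<in> (\<lambda>(n, s). disc s (int n)) ` (SIGMA n:{..M}. reps n)"
      using good_bij by (simp add: bij_betw_def)
    then obtain n s where "D = disc s (int n)" "s \<in> reps n" "n \<le> M" by auto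
    then show ?thesis using xD a0 by simp
  qed (use xX(3) in blast)
  then show False using x(2) by auto
qed

lemma tot_image_span: "tot ` X = vs.span (\<Union>g\<in>Bor. act g ` \<sigma>)"
proof
  show "tot ` X \<subseteq> vs.span (\<Union>g\<in>Bor. act g ` \<sigma>)"
  proof
    fix y assume "y \<in> tot ` X"
    then obtain x where x: "x \<in> X" "y = tot x" by blast
    have "x D \<in> vs.span (\<Union>g\<in>Bor. act g ` \<sigma>)" for D
    proof (cases "x D = 0")
      case False
      then obtain g z where "g \<in> Bor" "z \<in> \<sigma>" "x D = act g z" using SD_cases[OF X_D(1)[OF x(1)]] by metis
      then show ?thesis by (intro vs.span_base) blast
    qed (simp add: vs.span_zero)
    then show "y \<in> vs.span (\<Union>g\<in>Bor. act g ` \<sigma>)" unfolding x(2) tot_def by (intro vs.span_sum) blast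
  qed
  have "vs.subspace (tot ` X)"
  proof (rule vs.subspaceI)
    have "tot 0 = 0" by (simp add: tot_def)
    then show "0 \<in> tot ` X" using F.subspace_0[OF X_subspace] by (metis image_eqI)
    show "x + y \<in> tot ` X" if "x \<in> tot ` X" "y \<in> tot ` X" for x y
    proof -
      obtain x' y' where X: "x' \<in> X" "y' \<in> X" "x = tot x'" "y = tot y'"
        using \<open>x \<in> tot ` X\<close> \<open>y \<in> tot ` X\<close> by blast
      show ?thesis unfolding X(3,4) tot_add[OF X(1,2), symmetric] by (intro imageI F.subspace_add[OF X_subspace] X)
    qed
    show "sc c x \<in> tot ` X" if "x \<in> tot ` X" for c x
    proof -
      obtain x' where X: "x' \<in> X" "x = tot x'" using \<open>x \<in> tot ` X\<close> by blast
      show ?thesis unfolding X(2) tot_scF[OF X(1), symmetric] by (intro imageI F.subspace_scale[OF X_subspace] X)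
    qed
  qed
  moreover have "act g y \<in> tot ` X" if "g \<in> Bor" "y \<in> \<sigma>" for g y
  proof -
    define x where "x = (\<lambda>D. if D = affine g ` oo then act g y else 0)"
    have supp: "{D. x D \<noteq> 0} \<subseteq> {affine g ` oo}" by (auto simp: x_def)
    moreover have "x D \<in> SD D" for D using SD_eq[OF that(1)] that(2) by (auto simp: x_def SD_def)
    ultimately have "x \<in> X" unfolding X_def using finite_subset by blast
    moreover have "tot x = act g y" using tot_eq[OF _ supp] by (simp add: x_def)
    ultimately show ?thesis by (metis image_eqI)
  qed
  ultimately show "vs.span (\<Union>g\<in>Bor. act g ` \<sigma>) \<subseteq> tot ` X" by (intro vs.span_minimal) auto
qed

text \<open>As the translates are independent, a functional can be prescribed on each
  \<open>SD D\<close> separately, by transporting \<open>lf\<close> with the factor \<chi>. The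
  transport does not depend on the matrix chosen for the disc because \<open>lf\<close> transforms
  by \<chi> under \<open>P0\<close>.\<close>

lemma exists_functional:
  fixes lf :: "'v \<Rightarrow> 'k" and \<chi> :: "'f mat2 \<Rightarrow> 'k"
  assumes lf: "\<And>x y. x \<in> \<sigma> \<Longrightarrow> y \<in> \<sigma> \<Longrightarrow> lf (x + y) = lf x + lf y" "\<And>c x. x \<in> \<sigma> \<Longrightarrow> lf (sc c x) = c * lf x"
    and \<chi>: "\<And>g h. g \<in> Bor \<Longrightarrow> h \<in> Bor \<Longrightarrow> \<chi> (mmul g h) = \<chi> g * \<chi> h" "\<chi> mone = 1"
    and lf_P0: "\<And>g x. g \<in> P0 \<Longrightarrow> x \<in> \<sigma> \<Longrightarrow> lf (act g x) = \<chi> g * lf x"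
  defines "W \<equiv> vs.span (\<Union>g\<in>Bor. act g ` \<sigma>)"
  shows "\<exists>L. (\<forall>x\<in>W. \<forall>y\<in>W. L (x + y) = L x + L y) \<and> (\<forall>c. \<forall>x\<in>W. L (sc c x) = c * L x)
    \<and> (\<forall>g\<in>Bor. \<forall>x\<in>W. L (act g x) = \<chi> g * L x) \<and> (\<forall>x\<in>\<sigma>. L x = lf x)"
proof -
  define gD where "gD D = (SOME g. g \<in> Bor \<and> affine g ` oo = D)" for D
  define lam where "lam D y = \<chi> (gD D) * lf (act (minv (gD D)) y)" for D y
  have lam: "lam (affine g ` oo) (act g z) = \<chi> g * lf z" if g: "g \<in> Bor" and z: "z \<in> \<sigma>" for g z
  proof -
    define h where "h = gD (affine g ` oo)"
    have h: "h \<in> Bor" "affine h ` oo = affine g ` oo"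
      using someI[of "\<lambda>h. h \<in> Bor \<and> affine h ` oo = affine g ` oo" g] g by (auto simp: h_def gD_def)
    define k where "k = mmul (minv h) g"
    have k: "k \<in> P0" unfolding k_def by (rule P0_of_eq) (use g h in auto)
    have "mmul h k = g" unfolding k_def using minv(1)[OF Bor_GL2[OF h(1)]] by (metis mmul_assoc mone_mmul(1))
    then have "\<chi> g = \<chi> h * \<chi> k" using \<chi>(1)[OF h(1) P0_Bor[OF k]] by simp
    moreover have "act (minv h) (act g z) = act k z"
      using g h z \<sigma>_V by (auto simp: act_act Bor_GL2 k_def subset_iff)
    ultimately show ?thesis using lf_P0[OF k z] by (simp add: lam_def h_def)
  qed
  have lam0: "lam D 0 = 0" if "D = affine g ` oo" "g \<in> Bor" for D g
    using lam[OF that(2) vs.subspace_0[OF \<sigma>_subspace]] that lf(2)[of 0 0] vs.subspace_0[OF \<sigma>_subspace] Bor_GL2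
    by simp
  have lam_add: "lam D (y + y') = lam D y + lam D y'" if y: "y \<in> SD D" "y' \<in> SD D" "D = affine g ` oo" "g \<in> Bor" for D y y' g
  proof -
    obtain z z' where z: "z \<in> \<sigma>" "z' \<in> \<sigma>" "y = act g z" "y' = act g z'" using y SD_eq[of g] by auto
    then have "y + y' = act g (z + z')" using y(4) by (simp add: act_add)
    then show ?thesis
      using lam[OF y(4)] z y(3) lf(1) vs.subspace_add[OF \<sigma>_subspace] by (simp add: algebra_simps)
  qed
  have lam_sc: "lam D (sc c y) = c * lam D y" if y: "y \<in> SD D" "D = affine g ` oo" "g \<in> Bor" for D y c g
  proof -
    obtain z where z: "z \<in> \<sigma>" "y = act g z" using y SD_eq[of g] by auto
    then have "sc c y = act g (sc c z)" using y(3) by (simp add: act_sc)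
    then show ?thesis
      using lam[OF y(3)] z y(2) lf(2) vs.subspace_scale[OF \<sigma>_subspace] by simp
  qed
  define Lam where "Lam x = (\<Sum>D | x D \<noteq> 0. lam D (x D))" for x
  have Lam_eq: "Lam x = (\<Sum>D\<in>A. lam D (x D))" if A: "finite A" "{D. x D \<noteq> 0} \<subseteq> A" "\<And>D. D \<in> A \<Longrightarrow> \<exists>g\<in>Bor. D = affine g ` oo" for x A
    unfolding Lam_def
  proof (rule sum.mono_neutral_left[OF A(1,2)], rule ballI)
    fix D assume D: "D \<in> A - {D. x D \<noteq> 0}"
    then obtain g where "g \<in> Bor" "D = affine g ` oo" using A(3) by blast
    then show "lam D (x D) = 0" using lam0 D by simp
  qed
  have disc: "\<exists>g\<in>Bor. D = affine g ` oo" if "x \<in> X" "x D \<noteq> 0" for x D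
    using SD_cases[OF X_D(1)[OF that(1)] that(2)] by metis
  have Lam_add: "Lam (x + y) = Lam x + Lam y" if xy: "x \<in> X" "y \<in> X" for x y
  proof -
    define A where "A = {D. x D \<noteq> 0} \<union> {D. y D \<noteq> 0}"
    have A: "finite A" "\<And>D. D \<in> A \<Longrightarrow> \<exists>g\<in>Bor. D = affine g ` oo" using xy X_D disc by (auto simp: A_def)
    have "Lam (x + y) = (\<Sum>D\<in>A. lam D ((x + y) D))" by (rule Lam_eq) (use A in \<open>auto simp: A_def\<close>)
    also have "\<dots> = (\<Sum>D\<in>A. lam D (x D) + lam D (y D))"
      unfolding plus_fun_def
      by (rule sum.cong[OF refl]) (use A(2) lam_add X_D(1)[OF xy(1)] X_D(1)[OF xy(2)] in blast)
    also have "\<dots> = Lam x + Lam y"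
      unfolding sum.distrib using Lam_eq[of A x] Lam_eq[of A y] A by (auto simp: A_def)
    finally show ?thesis .
  qed
  have Lam_sc: "Lam (scF c x) = c * Lam x" if x: "x \<in> X" for c x
  proof -
    have "Lam (scF c x) = (\<Sum>D | x D \<noteq> 0. lam D (scF c x D))"
      by (rule Lam_eq) (use x X_D disc in \<open>auto simp: scF_def\<close>)
    also have "\<dots> = (\<Sum>D | x D \<noteq> 0. c * lam D (x D))"
      unfolding scF_def by (rule sum.cong[OF refl]) (use disc[OF x] lam_sc X_D(1)[OF x] in blast)
    finally show ?thesis by (simp add: Lam_def sum_distrib_left)
  qed
  have Lam_tr: "Lam (tr g x) = \<chi> g * Lam x" if g: "g \<in> Bor" and x: "x \<in> X" for g x
  proof -
    have "Lam (tr g x) = (\<Sum>D | x D \<noteq> 0. lam (affine g ` D) (act g (x D)))"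
      unfolding Lam_def by (rule sum_tr[OF g x])
    also have "\<dots> = (\<Sum>D | x D \<noteq> 0. \<chi> g * lam D (x D))"
    proof (rule sum.cong[OF refl])
      fix D assume "D \<in> {D. x D \<noteq> 0}"
      then obtain h z where h: "h \<in> Bor" "D = affine h ` oo" "z \<in> \<sigma>" "x D = act h z"
        using SD_cases[OF X_D(1)[OF x]] by blast
      have "lam (affine g ` D) (act g (x D)) = lam (affine (mmul g h) ` oo) (act (mmul g h) z)"
        using g h by (simp add: affine_image_mmul act_mmul)
      also have "\<dots> = \<chi> g * lam D (x D)" using lam[of "mmul g h" z] lam[of h z] g h \<chi>(1) by simp
      finally show "lam (affine g ` D) (act g (x D)) = \<chi> g * lam D (x D)" .
    qed
    finally show ?thesis by (simp add: Lam_def sum_distrib_left)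
  qed
  \<comment> \<open>Any preimage may be taken, as \<open>tot\<close> is injective on
    \<open>X\<close>.\<close>
  define L where "L y = Lam (SOME x. x \<in> X \<and> tot x = y)" for y
  have L: "L (tot x) = Lam x" if x: "x \<in> X" for x
  proof -
    define x' where "x' = (SOME x'. x' \<in> X \<and> tot x' = tot x)"
    have x': "x' \<in> X" "tot x' = tot x"
      using someI[of "\<lambda>x'. x' \<in> X \<and> tot x' = tot x" x] x by (auto simp: x'_def)
    have "x' + scF (- 1) x \<in> X" using x x' X_subspace F.subspace_add F.subspace_scale by blast
    moreover have "tot (x' + scF (- 1) x) = tot x' + sc (- 1) (tot x)"
      unfolding tot_add[OF x'(1) F.subspace_scale[OF X_subspace x]] tot_scF[OF x] ..
    then have "tot (x' + scF (- 1) x) = 0" using x' by (simp del: F.scale_minus_left)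
    ultimately have "x' + scF (- 1) x = 0" by (rule tot_injective)
    then have "x' D = x D" for D by (simp add: fun_eq_iff scF_def)
    then have "x' = x" by blast
    then show ?thesis by (simp add: L_def x'_def)
  qed
  have W: "W = tot ` X" unfolding W_def by (rule tot_image_span[symmetric])
  have "L (x + y) = L x + L y" if xW: "x \<in> W" "y \<in> W" for x y
  proof -
    obtain x' y' where *: "x' \<in> X" "y' \<in> X" "x = tot x'" "y = tot y'" using xW W by blast
    then have "L (x + y) = Lam (x' + y')" using L[OF F.subspace_add[OF X_subspace]] tot_add by simp
    then show ?thesis using * L Lam_add by simp
  qed
  moreover have "L (sc c x) = c * L x" if xW: "x \<in> W" for c x
  proof -
    obtain x' where *: "x' \<in> X" "x = tot x'" using xW W by blast
    then have "L (sc c x) = Lam (scF c x')" using L[OF F.subspace_scale[OF X_subspace]] tot_scF by simp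
    then show ?thesis using * L Lam_sc by simp
  qed
  moreover have "L (act g x) = \<chi> g * L x" if gB: "g \<in> Bor" and xW: "x \<in> W" for g x
  proof -
    obtain x' where *: "x' \<in> X" "x = tot x'" using xW W by blast
    then have "L (act g x) = Lam (tr g x')" using L[OF tr_X[OF gB]] tot_tr[OF gB] by simp
    then show ?thesis using * L Lam_tr gB by simp
  qed
  moreover have "L z = lf z" if z: "z \<in> \<sigma>" for z
  proof -
    define x where "x = (\<lambda>D. if D = oo then z else 0)"
    have oo: "affine mone ` oo = oo" by simp
    have m: "act mone z = z" using z \<sigma>_V by auto
    have supp: "{D. x D \<noteq> 0} \<subseteq> {oo}" by (auto simp: x_def)
    moreover have "SD oo = act mone ` \<sigma>" using SD_eq[of mone] by simp
    then have "z \<in> SD oo" using z m by (metis image_eqI)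
    then have "x D \<in> SD D" for D by (auto simp: x_def SD_def)
    ultimately have "x \<in> X" unfolding X_def using finite_subset by blast
    moreover have "tot x = z" using tot_eq[OF _ supp] by (simp add: x_def)
    moreover have "Lam x = (\<Sum>D\<in>{oo}. lam D (x D))"
      by (rule Lam_eq[OF _ supp]) (auto intro!: bexI[of _ mone])
    moreover have "lam oo z = lf z" using lam[of mone z] z m \<chi>(2) by simp
    ultimately show ?thesis using L[of x] by (simp add: x_def)
  qed
  ultimately show ?thesis by blast
qed

end

subsection \<open>A dichotomy for vectors fixed by the pro-p Iwahori subgroup\<close>

context vector_space
begin

lemma exists_functional_nonzero:
  assumes "x \<noteq> 0"
  shows "\<exists>l. (\<forall>x y. l (x + y) = l x + l y) \<and> (\<forall>c x. l (scale c x) = c * l x) \<and> l x \<noteq> 0"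
proof -
  have ind: "independent {x}" using assms by simp
  define B where "B = extend_basis {x}"
  have B: "independent B" "x \<in> B" "span B = UNIV"
    using independent_extend_basis[OF ind] extend_basis_superset[OF ind] span_extend_basis[OF ind]
    by (auto simp: B_def)
  define l where "l y = representation B y x" for y
  have "l (y + z) = l y + l z" for y z using B by (simp add: l_def representation_add)
  moreover have "l (scale c y) = c * l y" for c y using B by (simp add: l_def representation_scale)
  moreover have "l x = 1" using B by (simp add: l_def representation_basis)
  ultimately show ?thesis by (metis zero_neq_one)
qed

end

context gl2_central
begin

lemma U_t_cong: "z \<in> fixed I1 \<Longrightarrow> ip 1 b \<Longrightarrow> act (um b) (act (dm \<pi> 1) z) = act (dm \<pi> 1) z"
  using U_cong[of z b 0] by (simp add: act_act fixedD)

lemma \<omega>_mult: "x \<in> V \<Longrightarrow> x \<noteq> 0 \<Longrightarrow> a \<noteq> 0 \<Longrightarrow> b \<noteq> 0 \<Longrightarrow> \<omega> (a * b) = \<omega> a * \<omega> b"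
  using act_mmul[of "dm a a" "dm b b" x] central[of "a * b" x] central[of b x] central[of a x]
  by (simp add: act_sc mult.commute)

text \<open>The character of the units on \<open>x\<close> is extended to \<open>P\<close> by the
  value 1 at \<open>dm \<pi> 1\<close>, that is, by replacing \<open>a / d\<close> with its unit
  part. The value 1 on all \<open>(\<pi>, r, 0, 1)\<close> makes an equivariant functional agree on
  the terms of \<open>U\<close>, whose number is divisible by \<open>p\<close>.\<close>

lemma exists_Bor_character:
  assumes x: "x \<in> V" "x \<noteq> 0" and \<tau>: "\<And>u. unt u \<Longrightarrow> act (dm u 1) x = sc (\<tau> u) x"
  shows "\<exists>\<chi>. (\<forall>g\<in>Bor. \<forall>h\<in>Bor. \<chi> (mmul g h) = \<chi> g * \<chi> h) \<and> \<chi> mone = 1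
     \<and> (\<forall>a b d. (a,b,0,d) \<in> P0 \<longrightarrow> \<chi> (a,b,0,d) = \<omega> d * \<tau> (a / d)) \<and> (\<forall>r. \<chi> (\<pi>, r, 0, 1) = 1)"
proof -
  have \<tau>m: "\<tau> (u * w) = \<tau> u * \<tau> w" if "unt u" "unt w" for u w
    using act_mmul[of "dm u 1" "dm w 1" x] \<tau>[OF unt_mult[OF that]] \<tau>[OF that(1)] \<tau>[OF that(2)] that[THEN unt_nonzero] x
    by (simp add: act_sc mult.commute)
  have \<tau>1: "\<tau> 1 = 1" using \<tau>[of 1] x act_mone[of x] vs.scale_right_imp_eq[OF x(2), of "\<tau> 1" 1] by (simp add: mone_def)
  have \<omega>1: "\<omega> 1 = 1" using central[of 1 x] x act_mone[of x] vs.scale_right_imp_eq[OF x(2), of "\<omega> 1" 1] by (simp add: mone_def)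
  define unit_part where "unit_part a = a / \<pi> powi (v a)" for a :: 'f
  have up_mult: "unit_part (a * b) = unit_part a * unit_part b" if "a \<noteq> 0" "b \<noteq> 0" for a b
    using that by (simp add: unit_part_def v_mult power_int_add)
  have up_unt: "unt (unit_part a)" if "a \<noteq> 0" for a unfolding unit_part_def by (rule unt_decomp[OF that])
  define \<chi> where "\<chi> g = (case g of (a,b,c,d) \<Rightarrow> \<omega> d * \<tau> (unit_part (a / d)))" for g :: "'f mat2"
  have "\<chi> (mmul g h) = \<chi> g * \<chi> h" if g: "g \<in> Bor" and h: "h \<in> Bor" for g h
  proof -
    obtain a b d where g': "g = (a,b,0,d)" "a \<noteq> 0" "d \<noteq> 0" using g by (rule BorE)
    obtain a' b' d' where h': "h = (a',b',0,d')" "a' \<noteq> 0" "d' \<noteq> 0" using h by (rule BorE)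
    have "a * a' / (d * d') = (a / d) * (a' / d')" by simp
    then have "\<tau> (unit_part (a * a' / (d * d'))) = \<tau> (unit_part (a / d)) * \<tau> (unit_part (a' / d'))"
      using up_mult[of "a / d" "a' / d'"] \<tau>m[OF up_unt up_unt, of "a / d" "a' / d'"] g' h' by simp
    then show ?thesis using \<omega>_mult[OF x] g' h' by (simp add: \<chi>_def)
  qed
  moreover have "\<chi> mone = 1" by (simp add: \<chi>_def mone_def unit_part_def \<omega>1 \<tau>1)
  moreover have "\<chi> (a,b,0,d) = \<omega> d * \<tau> (a / d)" if "(a,b,0,d) \<in> P0" for a b d
    using that by (simp add: \<chi>_def unit_part_def unt_def)
  moreover have "\<chi> (\<pi>, r, 0, 1) = 1" for r by (simp add: \<chi>_def unit_part_def \<omega>1 \<tau>1)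
  ultimately show ?thesis by blast
qed

lemma disc_dichotomy:
  assumes "vs.subspace \<sigma>" "\<sigma> \<subseteq> V" "\<And>g x. g \<in> P0 \<Longrightarrow> x \<in> \<sigma> \<Longrightarrow> act g x \<in> \<sigma>"
    and "\<And>b x. ip 1 b \<Longrightarrow> x \<in> \<sigma> \<Longrightarrow> act (um b) x = x"
    and "\<And>x. x \<in> \<sigma> \<Longrightarrow> (\<And>b. ip 0 b \<Longrightarrow> act (um b) x = x) \<Longrightarrow> \<exists>c. x = sc c f"
    and "f \<in> V" "\<And>b. ip 0 b \<Longrightarrow> act (um b) f = f"
    and lf: "\<And>x y. x \<in> \<sigma> \<Longrightarrow> y \<in> \<sigma> \<Longrightarrow> lf (x + y) = lf x + lf y" "\<And>c x. x \<in> \<sigma> \<Longrightarrow> lf (sc c x) = c * lf x"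
    and \<chi>: "\<forall>g\<in>Bor. \<forall>h\<in>Bor. \<chi> (mmul g h) = \<chi> g * \<chi> h" "\<chi> mone = 1"
    and lf_P0: "\<And>g x. g \<in> P0 \<Longrightarrow> x \<in> \<sigma> \<Longrightarrow> lf (act g x) = \<chi> g * lf x"
  defines "W \<equiv> vs.span (\<Union>g\<in>Bor. act g ` \<sigma>)"
  shows "(\<exists>q. q \<noteq> 0 \<and> polyop sc q U f = 0) \<or>
    (\<exists>L. (\<forall>x\<in>W. \<forall>y\<in>W. L (x + y) = L x + L y) \<and> (\<forall>c. \<forall>x\<in>W. L (sc c x) = c * L x)
      \<and> (\<forall>g\<in>Bor. \<forall>x\<in>W. L (act g x) = \<chi> g * L x) \<and> (\<forall>x\<in>\<sigma>. L x = lf x))"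
proof (cases "\<exists>q. q \<noteq> 0 \<and> polyop sc q U f = 0")
  case False
  interpret D: disc_family v p \<pi> sc V act \<sigma> f
    by unfold_locales (use assms(1-7) False in auto)
  show ?thesis unfolding W_def using D.exists_functional[of lf \<chi>] lf \<chi> lf_P0 by blast
qed blast

text \<open>The vectors of \<open>W\<close> in \<open>teig \<theta>\<close> killed by
  \<open>q\<close> evaluated at \<open>U\<close> form a nonzero \<open>U\<close>-stable subspace,
  since \<open>U\<close> commutes with polynomials in itself and preserves
  \<open>teig \<theta>\<close>.\<close>

lemma eigenvector_of_relation:
  assumes W: "Pstable W" and f: "f \<in> W" "f \<noteq> 0" "f \<in> teig \<theta>" and q: "q \<noteq> 0" "polyop sc q U f = 0"
  shows "\<exists>\<alpha> z. z \<in> W \<and> z \<noteq> 0 \<and> z \<in> teig \<theta> \<and> U z = sc \<alpha> z"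
proof -
  define S0 where "S0 = W \<inter> teig \<theta>"
  have S0: "vs.subspace S0" unfolding S0_def using W subspace_teig by (intro vs.subspace_inter) (auto simp: Pstable_def)
  have S0V: "S0 \<subseteq> V" by (auto simp: S0_def dest: teigD)
  have U0: "U x \<in> S0" if "x \<in> S0" for x using that U_in[OF W] U_teig by (auto simp: S0_def)
  have lin: "lin_on sc S0 U" using lin_on_U S0V by blast
  have lin': "U (x + y) = U x + U y" "U (sc c x) = sc c (U x)" if "x \<in> V" "y \<in> V" for x y c
    using lin_on_U[of V] that by (auto simp: lin_on_def)
  define S where "S = {x \<in> S0. polyop sc q U x = 0}"
  have pl: "polyop sc q U (x - sc a y) = polyop sc q U x - sc a (polyop sc q U y)" if "x \<in> S0" "y \<in> S0" for x y a
    by (rule vs.polyop_linear[OF lin U0 that S0])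
  have p0: "polyop sc q U 0 = 0" using pl[of 0 0 1] vs.subspace_0[OF S0] by simp
  have "vs.subspace S"
  proof (rule vs.subspaceI)
    show "0 \<in> S" using vs.subspace_0[OF S0] p0 by (simp add: S_def)
    show "x + y \<in> S" if "x \<in> S" "y \<in> S" for x y
      using that pl[of x y "- 1"] vs.subspace_add[OF S0] by (simp add: S_def)
    show "sc c x \<in> S" if "x \<in> S" for c x
      using that pl[of 0 x "- c"] vs.subspace_scale[OF S0] vs.subspace_0[OF S0] p0 by (simp add: S_def)
  qed
  moreover have "S \<noteq> {0}" using f q by (auto simp: S_def S0_def)
  moreover have "lin_on sc S U" using lin by (auto simp: lin_on_def S_def)
  moreover have "U x \<in> S" if x: "x \<in> S" for x
  proof -
    have "polyop sc q U (U x) = U (polyop sc q U x)"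
    proof -
      have xi: "(U ^^ i) x \<in> V" for i
        using x S0V by (induction i) (auto simp: S_def)
      have "U (\<Sum>i\<in>I. sc (coeff q i) ((U ^^ i) x)) = (\<Sum>i\<in>I. sc (coeff q i) (U ((U ^^ i) x)))" if "finite I" for I
        using that
      proof (induction I rule: finite_induct)
        case empty then show ?case using lin'(2)[of 0 0 0] by simp
      next
        case (insert i I)
        have "(\<Sum>i\<in>I. sc (coeff q i) ((U ^^ i) x)) \<in> V" using xi by (intro sum_in_V) simp
        then show ?case using insert xi lin' by simp
      qed
      then show ?thesis by (simp add: polyop_def funpow_swap1)
    qed
    then show ?thesis using x U0 lin'(2)[of 0 0 0] by (simp add: S_def)
  qed
  ultimately obtain a x where "poly q a = 0" "x \<in> S" "x \<noteq> 0" "U x = sc a x"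
    using vs.eigenvector_exists[OF alg_closed q(1), of S U] unfolding S_def by blast
  then show ?thesis by (auto simp: S_def S0_def)
qed

section \<open>Cyclic modules over the group algebra of the residue field\<close>

definition Nspan :: "'v \<Rightarrow> 'v set" where
  "Nspan m = {(\<Sum>r\<in>Rep. sc (c r) (act (um r) m)) | c. True}"

text \<open>The norm element of the group algebra of o/p applied to \<open>m\<close>; for
  \<open>m = act (dm \<pi> 1) z\<close> it is \<open>U z\<close>.\<close>

definition Nsum :: "'v \<Rightarrow> 'v" where "Nsum m = (\<Sum>r\<in>Rep. act (um r) m)"

lemma Nspan_I: "x = (\<Sum>r\<in>Rep. sc (c r) (act (um r) m)) \<Longrightarrow> x \<in> Nspan m"
  by (auto simp: Nspan_def)

lemma Nspan_V: "m \<in> V \<Longrightarrow> Nspan m \<subseteq> V"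
  by (auto simp: Nspan_def intro!: sum_in_V)

lemma Nspan_subspace: "vs.subspace (Nspan m)"
proof (rule vs.subspaceI)
  show "0 \<in> Nspan m" unfolding Nspan_def by (auto intro!: exI[of _ "\<lambda>_. 0"])
  fix x y assume "x \<in> Nspan m" "y \<in> Nspan m"
  then obtain c d where "x = (\<Sum>r\<in>Rep. sc (c r) (act (um r) m))" "y = (\<Sum>r\<in>Rep. sc (d r) (act (um r) m))"
    unfolding Nspan_def by blast
  then have "x + y = (\<Sum>r\<in>Rep. sc (c r + d r) (act (um r) m))" by (simp add: sum.distrib vs.scale_left_distrib)
  then show "x + y \<in> Nspan m" by (rule Nspan_I)
next
  fix a x assume "x \<in> Nspan m"
  then obtain c where "x = (\<Sum>r\<in>Rep. sc (c r) (act (um r) m))" unfolding Nspan_def by blast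
  then have "sc a x = (\<Sum>r\<in>Rep. sc (a * c r) (act (um r) m))" by (simp add: vs.scale_sum_right)
  then show "sc a x \<in> Nspan m" by (rule Nspan_I)
qed

context
  fixes m :: 'v
  assumes m: "m \<in> V" and m_fixed: "\<And>b. ip 1 b \<Longrightarrow> act (um b) m = m"
begin

lemma um_periodic: "ip 1 y \<Longrightarrow> act (um (x + y)) m = act (um x) m"
  using act_mmul[of "um x" "um y" m] m m_fixed[of y] by (simp add: add.commute)

lemma um_rd: "ip 0 x \<Longrightarrow> act (um x) m = act (um (rd x)) m"
  using um_periodic[of "x - rd x" "rd x"] rd(2)[of x] by simp

lemma Nspan_um: "ip 0 x \<Longrightarrow> act (um x) m \<in> Nspan m"
proof -
  assume x: "ip 0 x"
  have "act (um x) m = (\<Sum>r\<in>Rep. sc (if r = rd x then 1 else 0) (act (um r) m))"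
    using rd(1)[OF x] Rep(1) by (simp add: if_distrib[of "\<lambda>c. sc c _"] um_rd[OF x] cong: if_cong)
  then show ?thesis by (rule Nspan_I)
qed

lemma Nspan_self: "m \<in> Nspan m"
  using Nspan_um[of 0] act_mone[OF m] by (simp add: mone_def)

lemma Nspan_induct:
  assumes x: "x \<in> Nspan m" and W: "vs.subspace W" and g: "g \<in> GL2"
    and "\<And>r. r \<in> Rep \<Longrightarrow> act g (act (um r) m) \<in> W"
  shows "act g x \<in> W"
proof -
  obtain c where c: "x = (\<Sum>r\<in>Rep. sc (c r) (act (um r) m))" using x unfolding Nspan_def by blast
  have "act g x = (\<Sum>r\<in>Rep. sc (c r) (act g (act (um r) m)))"
    unfolding c using g m by (subst act_sum) (auto simp: act_sc)
  then show ?thesis using assms(4) W by (auto intro!: vs.subspace_sum vs.subspace_scale)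
qed

lemma Nspan_um_fixed: "x \<in> Nspan m \<Longrightarrow> ip 1 b \<Longrightarrow> act (um b) x = x"
proof -
  assume x: "x \<in> Nspan m" and b: "ip 1 b"
  obtain c where c: "x = (\<Sum>r\<in>Rep. sc (c r) (act (um r) m))" using x unfolding Nspan_def by blast
  have "act (um b) (act (um r) m) = act (um r) m" for r
    using um_periodic[OF b, of r] m by (simp add: act_act)
  then show ?thesis unfolding c using m by (subst act_sum) (auto simp: act_sc)
qed

lemma Nspan_um_stable: "x \<in> Nspan m \<Longrightarrow> ip 0 b \<Longrightarrow> act (um b) x \<in> Nspan m"
  by (rule Nspan_induct) (use m Nspan_subspace Nspan_um Rep(3) in \<open>auto simp: act_act intro: ip_add\<close>)

text \<open>A nonzero ideal of the group algebra of \<open>o/p\<close> contains the norm element, so \<open>m\<close> generates a free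
  module as soon as the norm does not kill it.\<close>

lemma Nspan_invariants:
  assumes N: "Nsum m \<noteq> 0" and x: "x \<in> Nspan m" "\<And>b. ip 0 b \<Longrightarrow> act (um b) x = x"
  shows "\<exists>e. x = sc e (Nsum m)"
proof -
  \<comment> \<open>\<open>C\<close> is the group algebra of o/p, as functions that vanish off the
    integers and are periodic modulo the maximal ideal; \<open>ev\<close> maps it onto
    \<open>Nspan m\<close>, with kernel \<open>J\<close>.\<close>
  define C where "C = {c :: 'f \<Rightarrow> 'k. (\<forall>x. \<not> ip 0 x \<longrightarrow> c x = 0) \<and> (\<forall>x y. ip 0 x \<longrightarrow> ip 1 y \<longrightarrow> c (x + y) = c x)}"
  define ev where "ev c = (\<Sum>r\<in>Rep. sc (c r) (act (um r) m))" for c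
  define T where "T b c = (\<lambda>x. c (x - b))" for b :: 'f and c :: "'f \<Rightarrow> 'k"
  interpret fs: vector_space "fscale :: 'k \<Rightarrow> ('f \<Rightarrow> 'k) \<Rightarrow> 'f \<Rightarrow> 'k"
    by unfold_locales (auto simp: fscale_def algebra_simps)
  have ev_T: "ev (T b c) = act (um b) (ev c)" if b: "ip 0 b" and c: "c \<in> C" for b c
  proof -
    have "act (um b) (ev c) = (\<Sum>r\<in>Rep. sc (c r) (act (um (r + b)) m))"
      unfolding ev_def using m by (subst act_sum) (auto simp: act_sc act_act)
    also have "\<dots> = (\<Sum>r\<in>Rep. (\<lambda>x. sc (c (x - b)) (act (um x) m)) (r + b))" by simp
    also have "\<dots> = (\<Sum>r\<in>Rep. sc (c (r - b)) (act (um r) m))"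
    proof (rule sum_Rep_shift[OF _ b])
      fix x y assume xy: "ip 0 x" "ip 1 y"
      have "c ((x - b) + y) = c (x - b)" using c xy b ip_diff unfolding C_def by blast
      then show "sc (c (x + y - b)) (act (um (x + y)) m) = sc (c (x - b)) (act (um x) m)"
        using um_periodic[OF xy(2)] by (simp add: algebra_simps)
    qed
    finally show ?thesis by (simp add: ev_def T_def)
  qed
  have TC: "T b c \<in> C" if b: "ip 0 b" and c: "c \<in> C" for b c
  proof -
    have "\<not> ip 0 (x - b)" if "\<not> ip 0 x" for x using that ip_add[of 0 "x - b" b] b by auto
    moreover have "c (x + y - b) = c (x - b)" if "ip 0 x" "ip 1 y" for x y
    proof -
      have "c ((x - b) + y) = c (x - b)" using c that b ip_diff unfolding C_def by blast
      then show ?thesis by (simp add: algebra_simps)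
    qed
    ultimately show ?thesis using c by (auto simp: C_def T_def)
  qed
  have Csub: "fs.subspace C" by (rule fs.subspaceI) (auto simp: C_def fscale_def)
  have const: "c x = c 0" if c: "c \<in> C" "\<And>b. b \<in> Rep \<Longrightarrow> T b c = c" and x: "ip 0 x" for c x
  proof -
    have "c (rd x + (x - rd x)) = c (rd x)" using c(1) x rd[OF x] Rep(3) unfolding C_def by blast
    moreover have "c (rd x) = T (rd x) c (rd x)" using c(2)[OF rd(1)[OF x]] by simp
    ultimately show ?thesis by (simp add: T_def)
  qed
  have ev_const: "ev c = sc (c 0) (Nsum m)" if "c \<in> C" "\<And>b. b \<in> Rep \<Longrightarrow> T b c = c" for c
  proof -
    have "ev c = (\<Sum>r\<in>Rep. sc (c 0) (act (um r) m))"
      unfolding ev_def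
    proof (rule sum.cong[OF refl])
      fix r assume "r \<in> Rep"
      then have "c r = c 0" using const[OF that] Rep(3) by blast
      then show "sc (c r) (act (um r) m) = sc (c 0) (act (um r) m)" by (simp only:)
    qed
    then show ?thesis by (simp add: Nsum_def vs.scale_sum_right)
  qed
  have ev_lin: "ev (c + d) = ev c + ev d" "ev (fscale a c) = sc a (ev c)" for a c d
    by (simp_all add: ev_def fscale_def vs.scale_left_distrib sum.distrib vs.scale_sum_right)
  define J where "J = {c \<in> C. ev c = 0}"
  have J: "J = {0}"
  proof (rule ccontr)
    assume J0: "J \<noteq> {0}"
    have "ev 0 = 0" by (simp add: ev_def)
    then have Jsub: "fs.subspace J"
      using ev_lin Csub fs.subspace_0 fs.subspace_add fs.subspace_scale
      by (intro fs.subspaceI) (auto simp: J_def)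
    \<comment> \<open>A nonzero \<open>J\<close> would contain a nonzero translation-invariant
      function, that is, a constant on the integers; then the norm would kill
      \<open>m\<close>.\<close>
    have "\<exists>c\<in>J. c \<noteq> 0 \<and> (\<forall>b\<in>Rep. T b c = c)"
    proof (rule fs.common_fixed_vector[OF alg_closure Rep(1) Jsub J0])
      show "lin_on fscale J (T b)" for b by (auto simp: lin_on_def T_def fscale_def)
      show "T b c \<in> J" if "b \<in> Rep" "c \<in> J" for b c
        using that TC Rep(3) ev_T by (simp add: J_def)
      show "T b (T b' c) = T b' (T b c)" for b b' c by (simp add: T_def algebra_simps)
      show "\<exists>m. \<forall>c\<in>J. (T b ^^ p ^ m) c = c" if b: "b \<in> Rep" for b
      proof (intro exI[of _ 1] ballI ext)
        fix c x assume c: "c \<in> J"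
        have "(T b ^^ n) c = T (of_nat n * b) c" for n by (induction n) (auto simp: T_def algebra_simps)
        then have 1: "(T b ^^ p ^ 1) c x = c (x - of_nat p * b)" by (simp add: T_def)
        have pb: "ip 1 (of_nat p * b)" using ip_mult[OF ip_p Rep(3)[OF b]] by simp
        show "(T b ^^ p ^ 1) c x = c x"
        proof (cases "ip 0 x")
          case True
          have "c (x + - (of_nat p * b)) = c x" using c True pb ip_minus unfolding J_def C_def by blast
          then show ?thesis using 1 by simp
        next
          case False
          then have "\<not> ip 0 (x - of_nat p * b)" using ip_add[of 0 "x - of_nat p * b" "of_nat p * b"] ip_mono[OF pb, of 0] by auto
          then show ?thesis using 1 c False by (simp add: J_def C_def)
        qed
      qed
    qed
    then obtain c where c: "c \<in> J" "c \<noteq> 0" "\<And>b. b \<in> Rep \<Longrightarrow> T b c = c" by blast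
    have cC: "c \<in> C" using c by (simp add: J_def)
    obtain x where cx: "c x \<noteq> 0" using c(2) by (auto simp: fun_eq_iff)
    then have "ip 0 x" using cC unfolding C_def by blast
    then have "c x = c 0" using const[OF cC c(3)] by blast
    then have "sc (c 0) (Nsum m) \<noteq> 0" using cx N by simp
    then show False using ev_const[OF cC c(3)] c(1) by (simp add: J_def)
  qed
  obtain c0 where c0: "x = (\<Sum>r\<in>Rep. sc (c0 r) (act (um r) m))" using x unfolding Nspan_def by blast
  define c where "c = (\<lambda>x. if ip 0 x then c0 (rd x) else 0)"
  have rdper: "rd (x + y) = rd x" if "ip 0 x" "ip 1 y" for x y
    using rd[OF that(1)] ip_add[OF rd(2)[OF that(1)] that(2)] by (intro rd_eqI) (auto simp: algebra_simps)
  have cC: "c \<in> C"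
  proof -
    have "c (x + y) = c x" if "ip 0 x" "ip 1 y" for x y
      using that rdper ip_add[of 0 x y] ip_mono[of 1 y 0] by (simp add: c_def)
    then show ?thesis by (auto simp: C_def c_def)
  qed
  have xe: "ev c = x"
    unfolding ev_def c0 by (rule sum.cong[OF refl]) (use Rep(3) rd_eqI in \<open>auto simp: c_def\<close>)
  \<comment> \<open>Injectivity of \<open>ev\<close> lifts the invariance of \<open>x\<close> to its
    coefficient function.\<close>
  have "T b c = c" if b: "b \<in> Rep" for b
  proof -
    have "T b c + fscale (- 1) c \<in> C"
      using TC[OF Rep(3)[OF b] cC] cC Csub fs.subspace_add fs.subspace_scale by blast
    moreover have "ev (T b c + fscale (- 1) c) = 0"
      unfolding ev_lin using ev_T[OF Rep(3)[OF b] cC] x(2)[OF Rep(3)[OF b]] xe by simp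
    ultimately have "T b c + fscale (- 1) c \<in> J" unfolding J_def by blast
    then have "T b c + fscale (- 1) c = 0" using J by blast
    then show ?thesis by (simp add: fun_eq_iff fscale_def)
  qed
  then show ?thesis using ev_const[OF cC] xe by metis
qed

text \<open>Fixed vectors are sought in the dual of \<open>Nspan m\<close>, on which translations
  again act with order dividing \<open>p\<close>. An invariant form that vanishes at the generator
  \<open>m\<close> vanishes on all its translates, hence everywhere.\<close>

lemma exists_invariant_functional:
  assumes m0: "m \<noteq> 0"
  shows "\<exists>l. (\<forall>x\<in>Nspan m. \<forall>y\<in>Nspan m. l (x + y) = l x + l y) \<and> (\<forall>c. \<forall>x\<in>Nspan m. l (sc c x) = c * l x)
    \<and> (\<forall>b. ip 0 b \<longrightarrow> (\<forall>x\<in>Nspan m. l (act (um b) x) = l x)) \<and> l m \<noteq> 0"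
proof -
  define S where "S = Nspan m"
  have Ssub: "vs.subspace S" unfolding S_def by (rule Nspan_subspace)
  have SV: "x \<in> V" if "x \<in> S" for x using that Nspan_V[OF m] by (auto simp: S_def)
  have Sst: "act (um b) x \<in> S" if "ip 0 b" "x \<in> S" for b x using that Nspan_um_stable by (simp add: S_def)
  define D where "D = {l :: 'v \<Rightarrow> 'k. (\<forall>x\<in>S. \<forall>y\<in>S. l (x + y) = l x + l y) \<and> (\<forall>c. \<forall>x\<in>S. l (sc c x) = c * l x)
     \<and> (\<forall>x. x \<notin> S \<longrightarrow> l x = 0)}"
  define T where "T b l = (\<lambda>x. if x \<in> S then l (act (um b) x) else 0)" for b :: 'f and l :: "'v \<Rightarrow> 'k"
  interpret fs: vector_space "fscale :: 'k \<Rightarrow> ('v \<Rightarrow> 'k) \<Rightarrow> 'v \<Rightarrow> 'k"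
    by unfold_locales (auto simp: fscale_def algebra_simps)
  have Dsub: "fs.subspace D" by (rule fs.subspaceI) (auto simp: D_def fscale_def algebra_simps)
  have mS: "m \<in> S" using Nspan_self by (simp add: S_def)
  have D0: "D \<noteq> {0}"
  proof -
    obtain l where l: "\<And>x y. l (x + y) = l x + l y" "\<And>c x. l (sc c x) = c * l x" "l m \<noteq> 0"
      using vs.exists_functional_nonzero[OF m0] by blast
    define l' where "l' = (\<lambda>x. if x \<in> S then l x else 0)"
    have "l' \<in> D" using l Ssub by (auto simp: D_def l'_def vs.subspace_add vs.subspace_scale)
    moreover have "l' m \<noteq> 0" using l(3) mS by (simp add: l'_def)
    ultimately show ?thesis by auto
  qed
  have "\<exists>l\<in>D. l \<noteq> 0 \<and> (\<forall>b\<in>Rep. T b l = l)"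
  proof (rule fs.common_fixed_vector[OF alg_closure Rep(1) Dsub D0])
    show "lin_on fscale D (T b)" for b by (auto simp: lin_on_def T_def fscale_def)
    show "T b l \<in> D" if "b \<in> Rep" "l \<in> D" for b l
      using that Rep(3) Sst SV Ssub
      by (auto simp: D_def T_def act_add act_sc vs.subspace_add vs.subspace_scale)
    show "T b (T b' l) = T b' (T b l)" if "b \<in> Rep" "b' \<in> Rep" for b b' l
    proof
      fix x
      have "act (um b') (act (um b) x) = act (um b) (act (um b') x)" if "x \<in> S"
        by (rule act_eqI) (use SV that in auto)
      then show "T b (T b' l) x = T b' (T b l) x" using that Rep(3) Sst by (simp add: T_def)
    qed
    show "\<exists>m. \<forall>l\<in>D. (T b ^^ p ^ m) l = l" if b: "b \<in> Rep" for b
    proof (intro exI[of _ 1] ballI)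
      fix l assume l: "l \<in> D"
      have iter: "(T b ^^ n) l x = l (act (um (of_nat n * b)) x)" if x: "x \<in> S" for n x
        using x
      proof (induction n arbitrary: x)
        case 0
        then show ?case using act_mone[OF SV[OF 0]] by (simp add: mone_def)
      next
        case (Suc n)
        have "act (um (of_nat n * b)) (act (um b) x) = act (um (of_nat (Suc n) * b)) x"
          using SV[OF Suc(2)] by (simp add: act_act algebra_simps)
        then show ?case using Suc(1)[OF Sst[OF Rep(3)[OF b] Suc(2)]] Suc(2) by (simp add: T_def)
      qed
      have "(T b ^^ p ^ 1) l x = l x" for x
      proof (cases "x \<in> S")
        case True
        have "ip 1 (of_nat p * b)" using ip_mult[OF ip_p Rep(3)[OF b]] by simp
        then show ?thesis using iter[OF True, of p] Nspan_um_fixed True by (simp add: S_def)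
      next
        case False
        then have "(T b ^^ n) l x = 0" for n using l by (cases n) (auto simp: T_def D_def)
        then show ?thesis using False l by (simp add: D_def)
      qed
      then show "(T b ^^ p ^ 1) l = l" by blast
    qed
  qed
  then obtain l where l: "l \<in> D" "l \<noteq> 0" "\<And>b. b \<in> Rep \<Longrightarrow> T b l = l" by blast
  have linv: "l (act (um b) x) = l x" if b: "ip 0 b" and x: "x \<in> S" for b x
  proof -
    have "act (um b) x = act (um (rd b)) (act (um (b - rd b)) x)" using SV[OF x] by (simp add: act_act)
    also have "act (um (b - rd b)) x = x" using Nspan_um_fixed[of x "b - rd b"] rd(2)[OF b] x by (simp add: S_def)
    also have "l (act (um (rd b)) x) = T (rd b) l x" using x by (simp add: T_def)
    finally show ?thesis using l(3)[OF rd(1)[OF b]] by simp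
  qed
  have lD: "l (x + y) = l x + l y" "l (sc c x) = c * l x" if "x \<in> S" "y \<in> S" for x y c
    using l(1) that by (auto simp: D_def)
  have "l m \<noteq> 0"
  proof
    assume lm: "l m = 0"
    have "l x = 0" if x: "x \<in> S" for x
    proof -
      obtain c where c: "x = (\<Sum>r\<in>Rep. sc (c r) (act (um r) m))" using x unfolding S_def Nspan_def by blast
      have "l (\<Sum>r\<in>I. sc (c r) (act (um r) m)) = 0 \<and> (\<Sum>r\<in>I. sc (c r) (act (um r) m)) \<in> S" if "I \<subseteq> Rep" for I
        using finite_subset[OF that Rep(1)] that
      proof (induction I rule: finite_induct)
        case empty
        show ?case using lD(2)[of m m 0] mS vs.subspace_0[OF Ssub] by simp
      next
        case (insert r I)
        have "act (um r) m \<in> S" "l (act (um r) m) = 0" using Sst[of r m] linv[of r m] mS lm Rep(3) insert by auto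
        then show ?case
          using insert lD vs.subspace_add[OF Ssub] vs.subspace_scale[OF Ssub] by simp
      qed
      then show ?thesis using c by blast
    qed
    then have "l x = 0" for x using l(1) by (cases "x \<in> S") (auto simp: D_def)
    then show False using l(2) by auto
  qed
  then show ?thesis using lD linv S_def by (intro exI[of _ l]) blast
qed

end

lemma Nsum_um:
  assumes "m \<in> V" "\<And>b. ip 1 b \<Longrightarrow> act (um b) m = m" "ip 0 b"
  shows "(\<Sum>r\<in>Rep. act (um r) (act (um b) m)) = Nsum m"
proof -
  have "(\<Sum>r\<in>Rep. act (um r) (act (um b) m)) = (\<Sum>r\<in>Rep. (\<lambda>x. act (um x) m) (r + b))"
    using assms(1) by (simp add: act_act add.commute)
  also have "\<dots> = Nsum m"
    unfolding Nsum_def by (rule sum_Rep_shift[OF _ assms(3)]) (use um_periodic[OF assms(1,2)] in auto)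
  finally show ?thesis .
qed

text \<open>The space \<open>\<sigma>\<close> in the proof is the representation of \<open>GL\<^sub>2(o)\<close> generated by \<open>U z\<close>; the point is
  that its vectors fixed by all integral \<open>um b\<close> form a line, as for the weights of Barthel and Livne.\<close>

lemma U_dichotomy:
  assumes z: "z \<in> teig \<theta>" and Uz: "U z \<noteq> 0"
  shows "(\<exists>q. q \<noteq> 0 \<and> polyop sc q U (U z) = 0) \<or>
    (\<exists>L \<chi>. (\<forall>x\<in>Gspan (U z). \<forall>y\<in>Gspan (U z). L (x + y) = L x + L y)
      \<and> (\<forall>c. \<forall>x\<in>Gspan (U z). L (sc c x) = c * L x)
      \<and> (\<forall>g\<in>Bor. \<forall>x\<in>Gspan (U z). L (act g x) = \<chi> g * L x) \<and> (\<exists>x\<in>Gspan (U z). L x \<noteq> 0))"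
proof -
  have zI: "z \<in> fixed I1" and zV: "z \<in> V" using z by (auto dest: teigD)
  define f where "f = U z"
  have fte: "f \<in> teig \<theta>" unfolding f_def by (rule U_teig[OF z])
  have fI: "f \<in> fixed I1" and fV: "f \<in> V" using fte by (auto dest: teigD)
  have f0: "f \<noteq> 0" using Uz by (simp add: f_def)
  have ffix: "act (um b) f = f" if "ip 0 b" for b by (rule fixedD(2)[OF fI]) (use that in simp)
  \<comment> \<open>The matrix \<open>(0,1,\<pi>,0)\<close> normalizes \<open>I1\<close>, so
    \<open>y\<close> is again fixed by integral translations.\<close>
  define y where "y = act (0,1,\<pi>,0) z"
  have yV: "y \<in> V" using zV by (simp add: y_def)
  have yfix: "act (um b) y = y" if b: "ip 0 b" for b
  proof -
    have "act (um b) y = act (0,1,\<pi>,0) (act (1, 0, \<pi> * b, 1) z)"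
      unfolding y_def by (rule act_eqI) (use zV in auto)
    also have "act (1, 0, \<pi> * b, 1) z = z" by (rule fixedD(2)[OF zI]) (use b in simp)
    finally show ?thesis by (simp add: y_def)
  qed
  define m where "m = act (dm \<pi> 1) z"
  have mV: "m \<in> V" using zV by (simp add: m_def)
  have mfix: "act (um b) m = m" if "ip 1 b" for b unfolding m_def by (rule U_t_cong[OF zI that])
  have Nm: "Nsum m = f" using zV by (simp add: Nsum_def f_def U_def m_def act_act)
  have smy: "act sm y = m" using zV by (simp add: y_def m_def act_act)
  \<comment> \<open>The vectors are linked by \<open>sm\<close>, which exchanges \<open>y\<close>
    with \<open>m\<close> and \<open>n\<close> with \<open>f\<close>, while \<open>f\<close> is the
    norm of \<open>m\<close>.\<close>
  define n where "n = act sm f"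
  have nV: "n \<in> V" using fV by (simp add: n_def)
  have n0: "n \<noteq> 0" using f0 fV by (simp add: n_def act_eq_0)
  have nfix: "act (um b) n = n" if b: "ip 1 b" for b
  proof -
    have "act (um b) n = act sm (act (1, 0, b, 1) f)" unfolding n_def by (rule act_eqI) (use fV in auto)
    also have "act (1, 0, b, 1) f = f" by (rule fixedD(2)[OF fI]) (use b in simp)
    finally show ?thesis by (simp add: n_def)
  qed
  have smn: "act sm n = f" using fV act_mone[OF fV] by (simp add: n_def act_act mone_def)
  have ntor: "act (dm a d) n = sc (\<omega> a * \<theta> (d / a)) n" if "unt a" "unt d" for a d
  proof -
    have "act (dm a d) n = act sm (act (dm d a) f)" unfolding n_def by (rule act_eqI) (use fV that unt_nonzero in auto)
    then show ?thesis using act_dm_teig[OF fte that(2,1)] fV by (simp add: n_def act_sc)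
  qed
  have mtor: "act (dm a d) m = sc (\<omega> d * \<theta> (a / d)) m" if "unt a" "unt d" for a d
  proof -
    have "act (dm a d) m = act (dm \<pi> 1) (act (dm a d) z)" unfolding m_def by (rule act_eqI) (use zV that unt_nonzero in auto)
    then show ?thesis using act_dm_teig[OF z that] zV by (simp add: m_def act_sc)
  qed
  \<comment> \<open>Torus eigenvalues: \<open>k\<close> arises from factoring
    \<open>(- \<pi> / r, 1, 0, r)\<close> as \<open>um (1 / r)\<close> times
    \<open>dm (- (1 / r)) r\<close> times \<open>dm \<pi> 1\<close>, and \<open>k'\<close> from the
    analogous factorization of \<open>mmul (mmul sm (um r)) sm\<close>.\<close>
  define k where "k r = \<omega> r * \<theta> ((- (1 / r)) / r)" for r
  define k' where "k' r = \<omega> (- (1 / r)) * \<theta> (r / (- (1 / r)))" for r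
  have un: "unt r" "unt (1 / r)" "unt (- (1 / r))" "r \<noteq> 0" if "r \<in> Rep - {0}" for r
    using that Rep_unt[of r] unt_divide[OF unt_1, of r] by auto
  have n_eq: "n = y + (\<Sum>r\<in>Rep - {0}. sc (k r) (act (um (1 / r)) m))"
  proof -
    have "act (- \<pi> / r, 1, 0, r) z = sc (k r) (act (um (1 / r)) m)" if r: "r \<in> Rep - {0}" for r
    proof -
      have "sc (k r) (act (um (1 / r)) m) = act (um (1 / r)) (act (dm (- (1 / r)) r) m)"
        using mtor[of "- (1 / r)" r] un[OF r] mV by (simp add: act_sc k_def)
      also have "\<dots> = act (mmul (mmul (um (1 / r)) (dm (- (1 / r)) r)) (dm \<pi> 1)) z"
        unfolding m_def using un[OF r] zV by (subst act_mmul; simp add: act_mmul del: mmul_simp)+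
      also have "mmul (mmul (um (1 / r)) (dm (- (1 / r)) r)) (dm \<pi> 1) = (- \<pi> / r, 1, 0, r)" using un[OF r] by simp
      finally show ?thesis by simp
    qed
    then show ?thesis using sm_U[OF zI] by (simp add: n_def f_def y_def)
  qed
  \<comment> \<open>The norm of \<open>n\<close> is \<open>C\<close> times \<open>f\<close>: the
    contribution of \<open>y\<close> is repeated once per residue class and vanishes, and all
    translates of \<open>m\<close> have the same norm \<open>f\<close>. Whether \<open>C\<close> is
    zero decides a case distinction below.\<close>
  define C where "C = (\<Sum>r\<in>Rep - {0}. k r)"
  have Nn: "Nsum n = sc C f"
  proof -
    have "Nsum n = (\<Sum>s\<in>Rep. act (um s) y + (\<Sum>r\<in>Rep - {0}. sc (k r) (act (um s) (act (um (1 / r)) m))))"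
      unfolding Nsum_def
    proof (rule sum.cong[OF refl])
      fix s
      have "act (um s) n = act (um s) y + act (um s) (\<Sum>r\<in>Rep - {0}. sc (k r) (act (um (1 / r)) m))"
        unfolding n_eq using yV mV by (intro act_add sum_in_V) auto
      also have "act (um s) (\<Sum>r\<in>Rep - {0}. sc (k r) (act (um (1 / r)) m)) = (\<Sum>r\<in>Rep - {0}. sc (k r) (act (um s) (act (um (1 / r)) m)))"
        using mV by (subst act_sum) (auto simp: act_sc)
      finally show "act (um s) n = act (um s) y + (\<Sum>r\<in>Rep - {0}. sc (k r) (act (um s) (act (um (1 / r)) m)))" .
    qed
    also have "\<dots> = (\<Sum>s\<in>Rep. act (um s) y) + (\<Sum>r\<in>Rep - {0}. sc (k r) (\<Sum>s\<in>Rep. act (um s) (act (um (1 / r)) m)))"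
      unfolding sum.distrib by (subst sum.swap) (simp add: vs.scale_sum_right)
    also have "(\<Sum>s\<in>Rep. act (um s) y) = sc (of_nat (card Rep)) y"
      using yfix Rep(3) by (simp add: vs.sum_constant_scale)
    also have "\<dots> = 0" by (simp add: of_nat_card_Rep)
    also have "(\<Sum>r\<in>Rep - {0}. sc (k r) (\<Sum>s\<in>Rep. act (um s) (act (um (1 / r)) m))) = (\<Sum>r\<in>Rep - {0}. sc (k r) f)"
      using Nsum_um[OF mV mfix] un Nm by (intro sum.cong refl) (simp add: unt_ip)
    also have "\<dots> = sc C f" by (simp add: C_def vs.scale_sum_left)
    finally show ?thesis by simp
  qed
  define \<sigma> where "\<sigma> = Nspan n"
  have \<sigma>sub: "vs.subspace \<sigma>" unfolding \<sigma>_def by (rule Nspan_subspace)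
  have \<sigma>V: "\<sigma> \<subseteq> V" unfolding \<sigma>_def by (rule Nspan_V[OF nV])
  have n\<sigma>: "n \<in> \<sigma>" unfolding \<sigma>_def by (rule Nspan_self[OF nV nfix])
  have um\<sigma>: "act (um b) n \<in> \<sigma>" if "ip 0 b" for b unfolding \<sigma>_def by (rule Nspan_um[OF nV nfix that])
  have sm_um_n: "act sm (act (um r) n) = sc (k' r) (act (um (1 / r)) n)" if r: "r \<in> Rep - {0}" for r
  proof -
    have "act sm (act (um r) n) = act (mmul (mmul sm (um r)) sm) f"
      unfolding n_def using fV by (simp add: act_act)
    also have "mmul (mmul sm (um r)) sm = mmul (mmul (mmul (um (1 / r)) (dm (- (1 / r)) r)) sm) (um (1 / r))"
      using un[OF r] by simp
    also have "act \<dots> f = act (um (1 / r)) (act (dm (- (1 / r)) r) (act sm (act (um (1 / r)) f)))"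
      using un[OF r] fV by (subst act_mmul; simp add: act_mmul del: mmul_simp)+
    also have "act (um (1 / r)) f = f" using ffix un[OF r] by (simp add: unt_ip)
    finally show ?thesis using ntor[of "- (1 / r)" r] un[OF r] nV by (simp add: act_sc k'_def flip: n_def)
  qed
  \<comment> \<open>Applying \<open>sm\<close> to the norm of \<open>n\<close> yields
    \<open>sc C n\<close>, and the term at \<open>r = 0\<close> is \<open>f\<close>; all other terms
    are multiples of translates of \<open>n\<close>.\<close>
  have f\<sigma>: "f \<in> \<sigma>"
  proof -
    have "act sm (Nsum n) = (\<Sum>r\<in>Rep. act sm (act (um r) n))"
      unfolding Nsum_def using nV by (subst act_sum) auto
    also have "\<dots> = act sm (act (um 0) n) + (\<Sum>r\<in>Rep - {0}. act sm (act (um r) n))"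
      by (rule sum.remove[OF Rep(1,2)])
    also have "act (um 0) n = n" using act_mone[OF nV] by (simp add: mone_def)
    also have "(\<Sum>r\<in>Rep - {0}. act sm (act (um r) n)) = (\<Sum>r\<in>Rep - {0}. sc (k' r) (act (um (1 / r)) n))"
      using sm_um_n by (intro sum.cong) auto
    finally have "sc C n = f + (\<Sum>r\<in>Rep - {0}. sc (k' r) (act (um (1 / r)) n))"
      using Nn smn fV by (simp add: act_sc n_def)
    then have "f = sc C n - (\<Sum>r\<in>Rep - {0}. sc (k' r) (act (um (1 / r)) n))" by simp
    moreover have "sc C n - (\<Sum>r\<in>Rep - {0}. sc (k' r) (act (um (1 / r)) n)) \<in> \<sigma>"
      using un um\<sigma> n\<sigma> \<sigma>sub by (intro vs.subspace_diff vs.subspace_sum vs.subspace_scale) (auto simp: unt_ip)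
    ultimately show ?thesis by simp
  qed
  have smG: "(sm :: 'f mat2) \<in> GL2" by simp
  have sm\<sigma>: "act sm x \<in> \<sigma>" if x: "x \<in> \<sigma>" for x
  proof (rule Nspan_induct[OF nV nfix x[unfolded \<sigma>_def] \<sigma>sub smG])
    fix r assume r: "r \<in> Rep"
    show "act sm (act (um r) n) \<in> \<sigma>"
    proof (cases "r = 0")
      case True
      then show ?thesis using f\<sigma> smn act_mone[OF nV] by (simp add: mone_def)
    next
      case False
      then show ?thesis using sm_um_n[of r] r un[of r] um\<sigma> vs.subspace_scale[OF \<sigma>sub] by (simp add: unt_ip)
    qed
  qed
  have P0n: "act (a,b,0,d) (act (um r) n) = sc (\<omega> d * \<omega> (a / d) * \<theta> (d / a)) (act (um (b / d + (a / d) * r)) n)"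
    if g: "(a,b,0,d) \<in> P0" for a b d r
  proof -
    have nz: "a \<noteq> 0" "d \<noteq> 0" and u: "unt (a / d)" using g by auto
    have "act (a,b,0,d) (act (um r) n) = act (mmul (mmul (dm d d) (um (b / d + (a / d) * r))) (dm (a / d) 1)) n"
      using nz nV by (simp add: act_act algebra_simps)
    also have "\<dots> = act (dm d d) (act (um (b / d + (a / d) * r)) (act (dm (a / d) 1) n))"
      using nz nV by (subst act_mmul; simp add: act_mmul del: mmul_simp)+
    also have "act (dm (a / d) 1) n = sc (\<omega> (a / d) * \<theta> (d / a)) n" using ntor[OF u unt_1] by simp
    finally show ?thesis using nz nV by (simp add: act_sc central mult_ac)
  qed
  have P0r: "ip 0 (b / d + (a / d) * r)" if "(a,b,0,d) \<in> P0" "r \<in> Rep" for a b d r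
    using that Rep(3) by (intro ip_add) (auto simp del: times_divide_eq_left)
  have \<sigma>P0: "act g x \<in> \<sigma>" if g: "g \<in> P0" and x: "x \<in> \<sigma>" for g x
  proof -
    obtain a b d where abd: "g = (a,b,0,d)" using BorE[OF P0_Bor[OF g]] by metis
    show ?thesis
      using P0n P0r um\<sigma> g vs.subspace_scale[OF \<sigma>sub] unfolding abd
      by (intro Nspan_induct[OF nV nfix x[unfolded \<sigma>_def] \<sigma>sub]) auto
  qed
  \<comment> \<open>If \<open>C\<close> is nonzero, the norm does not kill \<open>n\<close>, and the
    invariants in its cyclic module are the multiples of that norm. If \<open>C\<close> is zero,
    invariants are compared with the cyclic module of \<open>m\<close> instead, whose norm
    \<open>f\<close> is nonzero.\<close>
  have inv: "\<exists>c. x = sc c f" if x: "x \<in> \<sigma>" "\<And>b. ip 0 b \<Longrightarrow> act (um b) x = x" for x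
  proof (cases "C = 0")
    case False
    then have "Nsum n \<noteq> 0" using Nn f0 by simp
    then obtain e where "x = sc e (Nsum n)" using Nspan_invariants[OF nV nfix] x unfolding \<sigma>_def by blast
    then show ?thesis using Nn by auto
  next
    case True
    then have Nn0: "Nsum n = 0" using Nn by simp
    define M where "M = Nspan m"
    have Msub: "vs.subspace M" unfolding M_def by (rule Nspan_subspace)
    define z0 where "z0 = (\<Sum>r\<in>Rep - {0}. sc (k r) (act (um (1 / r)) m))"
    have z0M: "z0 \<in> M"
      unfolding z0_def M_def using un Nspan_um[OF mV mfix] Msub
      by (intro vs.subspace_sum vs.subspace_scale) (auto simp: M_def unt_ip)
    have z0V: "z0 \<in> V" using z0M Nspan_V[OF mV] by (auto simp: M_def)
    obtain c where c: "x = (\<Sum>r\<in>Rep. sc (c r) (act (um r) n))" using x(1) unfolding \<sigma>_def Nspan_def by blast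
    define s where "s = (\<Sum>r\<in>Rep. c r)"
    have "x = (\<Sum>r\<in>Rep. sc (c r) y + sc (c r) (act (um r) z0))"
      unfolding c
    proof (rule sum.cong[OF refl])
      fix r assume "r \<in> Rep"
      then show "sc (c r) (act (um r) n) = sc (c r) y + sc (c r) (act (um r) z0)"
        using n_eq yfix[OF Rep(3)] yV z0V by (simp add: act_add vs.scale_right_distrib flip: z0_def)
    qed
    then have xs: "x - sc s y = (\<Sum>r\<in>Rep. sc (c r) (act (um r) z0))"
      by (simp add: sum.distrib s_def vs.scale_sum_left)
    have "(\<Sum>r\<in>Rep. sc (c r) (act (um r) z0)) \<in> M"
      using Nspan_um_stable[OF mV mfix z0M[unfolded M_def]] Rep(3) Msub
      by (intro vs.subspace_sum vs.subspace_scale) (auto simp: M_def)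
    then have xM: "x - sc s y \<in> Nspan m" using xs by (simp add: M_def)
    have xV: "x \<in> V" using x \<sigma>V by blast
    have "act (um b) (x - sc s y) = x - sc s y" if "ip 0 b" for b
      using x(2)[OF that] yfix[OF that] xV yV by (simp add: act_diff act_sc)
    then obtain e where e: "x - sc s y = sc e f"
      using Nspan_invariants[OF mV mfix _ xM] Nm f0 by metis
    \<comment> \<open>Otherwise \<open>y\<close>, hence \<open>m = act sm y\<close>, would lie in
      \<open>\<sigma>\<close>, on which the norm vanishes when \<open>C = 0\<close>; but the norm of
      \<open>m\<close> is \<open>f\<close>.\<close>
    have "s = 0"
    proof (rule ccontr)
      assume s: "s \<noteq> 0"
      have "sc (inverse s) (x - sc e f) \<in> \<sigma>" using x(1) f\<sigma> \<sigma>sub by (intro vs.subspace_scale vs.subspace_diff)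
      moreover have "x - sc e f = sc s y" using e by (simp add: algebra_simps)
      ultimately have "y \<in> \<sigma>" using s by simp
      then have "m \<in> \<sigma>" using sm\<sigma> smy by blast
      then obtain d where d: "m = (\<Sum>r\<in>Rep. sc (d r) (act (um r) n))" unfolding \<sigma>_def Nspan_def by blast
      have "Nsum m = (\<Sum>s\<in>Rep. \<Sum>r\<in>Rep. sc (d r) (act (um s) (act (um r) n)))"
        unfolding Nsum_def
      proof (rule sum.cong[OF refl])
        fix s :: 'f
        show "act (um s) m = (\<Sum>r\<in>Rep. sc (d r) (act (um s) (act (um r) n)))"
          by (subst d) (use nV in \<open>subst act_sum; simp add: act_sc\<close>)
      qed
      also have "\<dots> = (\<Sum>r\<in>Rep. sc (d r) (\<Sum>s\<in>Rep. act (um s) (act (um r) n)))"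
        by (subst sum.swap) (simp add: vs.scale_sum_right)
      also have "\<dots> = 0" using Nsum_um[OF nV nfix] Rep(3) Nn0 by simp
      finally show False using Nm f0 by simp
    qed
    then show ?thesis using e by auto
  qed
  obtain l where l: "\<And>x y. x \<in> \<sigma> \<Longrightarrow> y \<in> \<sigma> \<Longrightarrow> l (x + y) = l x + l y" "\<And>c x. x \<in> \<sigma> \<Longrightarrow> l (sc c x) = c * l x"
    "\<And>b x. ip 0 b \<Longrightarrow> x \<in> \<sigma> \<Longrightarrow> l (act (um b) x) = l x" "l n \<noteq> 0"
    using exists_invariant_functional[OF nV nfix n0] unfolding \<sigma>_def by blast
  have "\<exists>\<chi>. (\<forall>g\<in>Bor. \<forall>h\<in>Bor. \<chi> (mmul g h) = \<chi> g * \<chi> h) \<and> \<chi> mone = 1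
     \<and> (\<forall>a b d. (a,b,0,d) \<in> P0 \<longrightarrow> \<chi> (a,b,0,d) = \<omega> d * (\<omega> (a / d) * \<theta> (1 / (a / d)))) \<and> (\<forall>r. \<chi> (\<pi>, r, 0, 1) = 1)"
    by (rule exists_Bor_character[OF nV n0]) (use ntor[OF _ unt_1] in simp)
  then obtain \<chi> where \<chi>: "\<forall>g\<in>Bor. \<forall>h\<in>Bor. \<chi> (mmul g h) = \<chi> g * \<chi> h" "\<chi> mone = 1"
    "\<And>a b d. (a,b,0,d) \<in> P0 \<Longrightarrow> \<chi> (a,b,0,d) = \<omega> d * \<omega> (a / d) * \<theta> (d / a)" by (auto simp: mult.assoc)
  have lsum: "l (\<Sum>r\<in>I. h r) = (\<Sum>r\<in>I. l (h r))" if "finite I" "\<And>r. r \<in> I \<Longrightarrow> h r \<in> \<sigma>" for I :: "'f set" and h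
    using that
  proof (induction I rule: finite_induct)
    case empty
    show ?case using l(2)[OF n\<sigma>, of 0] by simp
  next
    case (insert i I)
    then have "sum h I \<in> \<sigma>" "h i \<in> \<sigma>" using vs.subspace_sum[OF \<sigma>sub] by blast+
    then show ?case using insert l(1) by simp
  qed
  have lP0: "l (act g x) = \<chi> g * l x" if g: "g \<in> P0" and x: "x \<in> \<sigma>" for g x
  proof -
    obtain a b d where abd: "g = (a,b,0,d)" using BorE[OF P0_Bor[OF g]] by metis
    have gB: "g \<in> GL2" using P0_Bor[OF g] by simp
    obtain c where c: "x = (\<Sum>r\<in>Rep. sc (c r) (act (um r) n))" using x unfolding \<sigma>_def Nspan_def by blast
    have "act g x = (\<Sum>r\<in>Rep. sc (c r) (act g (act (um r) n)))"
      unfolding c using gB nV by (subst act_sum) (auto simp: act_sc)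
    also have "\<dots> = (\<Sum>r\<in>Rep. sc (c r) (sc (\<chi> g) (act (um (b / d + (a / d) * r)) n)))"
      using P0n[of a b d] g \<chi>(3)[of a b d] by (simp add: abd)
    finally have "l (act g x) = (\<Sum>r\<in>Rep. l (sc (c r) (sc (\<chi> g) (act (um (b / d + (a / d) * r)) n))))"
      using um\<sigma> P0r[of a b d] g vs.subspace_scale[OF \<sigma>sub] lsum[OF Rep(1)] by (simp add: abd)
    also have "\<dots> = (\<Sum>r\<in>Rep. c r * (\<chi> g * l n))"
    proof (rule sum.cong[OF refl])
      fix r assume r: "r \<in> Rep"
      have *: "ip 0 (b / d + (a / d) * r)" using P0r g r unfolding abd by blast
      show "l (sc (c r) (sc (\<chi> g) (act (um (b / d + (a / d) * r)) n))) = c r * (\<chi> g * l n)"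
        using l(2)[OF vs.subspace_scale[OF \<sigma>sub um\<sigma>[OF *]]] l(2)[OF um\<sigma>[OF *]] l(3)[OF * n\<sigma>] by simp
    qed
    also have "\<dots> = \<chi> g * (\<Sum>r\<in>Rep. l (sc (c r) (act (um r) n)))"
      using l(2)[OF um\<sigma>] l(3)[OF _ n\<sigma>] Rep(3) by (simp add: sum_distrib_left mult_ac)
    also have "(\<Sum>r\<in>Rep. l (sc (c r) (act (um r) n))) = l x"
      unfolding c using um\<sigma> Rep(3) vs.subspace_scale[OF \<sigma>sub] lsum[OF Rep(1)] by simp
    finally show ?thesis .
  qed
  define W where "W = vs.span (\<Union>g\<in>Bor. act g ` \<sigma>)"
  \<comment> \<open>Both \<open>f\<close> and \<open>act sm f\<close> lie in
    \<open>\<sigma>\<close>, so the \<open>P\<close>-translates of \<open>\<sigma>\<close> already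
    span the whole \<open>G\<close>-span of \<open>f\<close>.\<close>
  have WG: "W = Gspan f"
  proof
    have "act g x \<in> Gspan f" if g: "g \<in> Bor" and x: "x \<in> \<sigma>" for g x
    proof -
      have "act g (act (um r) n) \<in> Gspan f" for r
      proof -
        have "act g (act (um r) n) = act (mmul g (mmul (um r) sm)) f"
          using g fV by (simp add: n_def act_mmul del: mmul_simp)
        then show ?thesis using Gspan_base[OF fV, of "mmul g (mmul (um r) sm)"] g by (simp del: mmul_simp)
      qed
      then show ?thesis
        using Nspan_induct[OF nV nfix x[unfolded \<sigma>_def], of "Gspan f" g] Gspan_Gstable[OF fV] g
        by (simp add: Gstable_def)
    qed
    then show "W \<subseteq> Gspan f" unfolding W_def
      using Gspan_Gstable[OF fV] by (intro vs.span_minimal) (auto simp: Gstable_def)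
    have gB: "act g f \<in> W" "act g n \<in> W" if "g \<in> Bor" for g
      unfolding W_def using that f\<sigma> n\<sigma> by (auto intro!: vs.span_base)
    have "act g f \<in> W" if "g \<in> GL2" for g
      using GL2_act_decomp[OF fI that] gB unfolding n_def by metis
    then show "Gspan f \<subseteq> W" by (intro Gspan_minimal) (auto simp: W_def)
  qed
  have "(\<exists>q. q \<noteq> 0 \<and> polyop sc q U f = 0) \<or>
    (\<exists>L. (\<forall>x\<in>W. \<forall>y\<in>W. L (x + y) = L x + L y) \<and> (\<forall>c. \<forall>x\<in>W. L (sc c x) = c * L x)
      \<and> (\<forall>g\<in>Bor. \<forall>x\<in>W. L (act g x) = \<chi> g * L x) \<and> (\<forall>x\<in>\<sigma>. L x = l x))"
    unfolding W_def
    by (rule disc_dichotomy[OF \<sigma>sub \<sigma>V \<sigma>P0 _ inv fV ffix l(1,2) \<chi>(1,2) lP0])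
      (use Nspan_um_fixed[OF nV nfix] in \<open>auto simp: \<sigma>_def\<close>)
  then show ?thesis
  proof
    assume "\<exists>L. (\<forall>x\<in>W. \<forall>y\<in>W. L (x + y) = L x + L y) \<and> (\<forall>c. \<forall>x\<in>W. L (sc c x) = c * L x)
      \<and> (\<forall>g\<in>Bor. \<forall>x\<in>W. L (act g x) = \<chi> g * L x) \<and> (\<forall>x\<in>\<sigma>. L x = l x)"
    then obtain L where L: "\<forall>x\<in>W. \<forall>y\<in>W. L (x + y) = L x + L y" "\<forall>c. \<forall>x\<in>W. L (sc c x) = c * L x"
      "\<forall>g\<in>Bor. \<forall>x\<in>W. L (act g x) = \<chi> g * L x" "\<forall>x\<in>\<sigma>. L x = l x" by blast
    have "n \<in> W" using WG Gspan_base[OF fV, of sm] by (simp add: n_def)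
    moreover have "L n \<noteq> 0" using L(4) n\<sigma> l(4) by simp
    ultimately show ?thesis using L WG unfolding f_def by blast
  qed (simp add: f_def)
qed

end

subsection \<open>Homomorphisms\<close>

lemma homD:
  assumes "\<phi> \<in> hom sc H V act sc' V' act'"
  shows "x \<in> V \<Longrightarrow> \<phi> x \<in> V'" "x \<in> V \<Longrightarrow> y \<in> V \<Longrightarrow> \<phi> (x + y) = \<phi> x + \<phi> y"
    "x \<in> V \<Longrightarrow> \<phi> (sc c x) = sc' c (\<phi> x)" "g \<in> H \<Longrightarrow> x \<in> V \<Longrightarrow> \<phi> (act g x) = act' g (\<phi> x)"
    "x \<notin> V \<Longrightarrow> \<phi> x = 0"
  using assms by (simp_all add: hom_def)

lemma homI:
  assumes "\<And>x. x \<in> V \<Longrightarrow> \<phi> x \<in> V'" "\<And>x y. x \<in> V \<Longrightarrow> y \<in> V \<Longrightarrow> \<phi> (x + y) = \<phi> x + \<phi> y"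
    "\<And>x c. x \<in> V \<Longrightarrow> \<phi> (sc c x) = sc' c (\<phi> x)" "\<And>g x. g \<in> H \<Longrightarrow> x \<in> V \<Longrightarrow> \<phi> (act g x) = act' g (\<phi> x)"
    "\<And>x. x \<notin> V \<Longrightarrow> \<phi> x = 0"
  shows "\<phi> \<in> hom sc H V act sc' V' act'"
  using assms by (simp add: hom_def)

lemma hom_mono: "H \<subseteq> H' \<Longrightarrow> \<phi> \<in> hom sc H' V act sc' V' act' \<Longrightarrow> \<phi> \<in> hom sc H V act sc' V' act'"
  unfolding hom_def by blast

lemma hom_preimage:
  assumes \<phi>: "\<phi> \<in> hom sc H V act sc' V' act'" and V: "stable_sub sc H act V" and U: "stable_sub sc' H act' U"
    and v: "vector_space sc" "vector_space sc'"
  shows "stable_sub sc H act {x \<in> V. \<phi> x \<in> U}"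
proof -
  interpret a: vector_space sc by fact
  interpret b: vector_space sc' by fact
  have "0 \<in> V" using V by (simp add: stable_sub_def lin_subspace_def)
  then have "\<phi> 0 = 0" using homD(3)[OF \<phi>, of 0 0] by simp
  then show ?thesis
    using V U homD[OF \<phi>] by (auto simp: stable_sub_def lin_subspace_def)
qed

lemma hom_image:
  assumes \<phi>: "\<phi> \<in> hom sc H V act sc' V' act'" and W: "stable_sub sc H act W" "W \<subseteq> V"
    and v: "vector_space sc" "vector_space sc'"
  shows "stable_sub sc' H act' (\<phi> ` W)"
proof -
  interpret a: vector_space sc by fact
  interpret b: vector_space sc' by fact
  have "0 \<in> W" using W by (simp add: stable_sub_def lin_subspace_def)
  then have "0 \<in> \<phi> ` W" using homD(3)[OF \<phi>, of 0 0] W(2) by (metis a.scale_zero_left b.scale_zero_left image_eqI subsetD)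
  moreover have "x + y \<in> \<phi> ` W" if xy: "x \<in> \<phi> ` W" "y \<in> \<phi> ` W" for x y
  proof -
    obtain x' y' where *: "x' \<in> W" "y' \<in> W" "x = \<phi> x'" "y = \<phi> y'" using xy by blast
    then have "x' \<in> V" "y' \<in> V" using W(2) by blast+
    then have "x + y = \<phi> (x' + y')" using homD(2)[OF \<phi>] * by simp
    then show ?thesis using * W by (auto simp: stable_sub_def lin_subspace_def)
  qed
  moreover have "sc' c x \<in> \<phi> ` W" if xy: "x \<in> \<phi> ` W" for x c
  proof -
    obtain x' where *: "x' \<in> W" "x = \<phi> x'" using xy by blast
    then have "x' \<in> V" using W(2) by blast
    then have "sc' c x = \<phi> (sc c x')" using homD(3)[OF \<phi>] * by simp
    then show ?thesis using * W by (auto simp: stable_sub_def lin_subspace_def)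
  qed
  moreover have "act' g x \<in> \<phi> ` W" if g: "g \<in> H" and xy: "x \<in> \<phi> ` W" for x g
  proof -
    obtain x' where *: "x' \<in> W" "x = \<phi> x'" using xy by blast
    then have "x' \<in> V" using W(2) by blast
    then have "act' g x = \<phi> (act g x')" using homD(4)[OF \<phi> g] * by simp
    then show ?thesis using * W g by (auto simp: stable_sub_def)
  qed
  ultimately show ?thesis by (simp add: stable_sub_def lin_subspace_def)
qed

lemma hom_inj:
  assumes \<phi>: "\<phi> \<in> hom sc H V act sc' V' act'" and V: "lin_subspace sc V" and v: "vector_space sc" "vector_space sc'"
    and ker: "\<And>x. x \<in> V \<Longrightarrow> \<phi> x = 0 \<Longrightarrow> x = 0"
  shows "inj_on \<phi> V"
proof (rule inj_onI)
  interpret a: vector_space sc by fact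
  interpret b: vector_space sc' by fact
  fix x y assume xy: "x \<in> V" "y \<in> V" "\<phi> x = \<phi> y"
  have my: "sc (- 1) y \<in> V" using V xy unfolding lin_subspace_def by blast
  then have "x + sc (- 1) y \<in> V" using V xy unfolding lin_subspace_def by blast
  moreover have "\<phi> (x + sc (- 1) y) = \<phi> x + sc' (- 1) (\<phi> y)"
    using homD(2)[OF \<phi> xy(1) my] homD(3)[OF \<phi> xy(2)] by (simp del: a.scale_minus_left b.scale_minus_left)
  then have "\<phi> (x + sc (- 1) y) = 0" using xy(3) by (simp del: a.scale_minus_left)
  ultimately have "x + sc (- 1) y = 0" using ker by blast
  then show "x = y" by simp
qed

lemma hom_inv_into:
  assumes \<phi>: "\<phi> \<in> hom sc H V act sc' V' act'" and V: "stable_sub sc H act V" and bij: "bij_betw \<phi> V V'"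
  shows "(\<lambda>y. if y \<in> V' then inv_into V \<phi> y else 0) \<in> hom sc' H V' act' sc V act"
proof (rule homI)
  define \<psi> where "\<psi> = (\<lambda>y. if y \<in> V' then inv_into V \<phi> y else 0)"
  have \<psi>V: "\<psi> y \<in> V" "\<phi> (\<psi> y) = y" if "y \<in> V'" for y
    using that bij by (auto simp: \<psi>_def bij_betw_def inv_into_into f_inv_into_f)
  have \<psi>I: "\<psi> y = x" if "x \<in> V" "\<phi> x = y" for x y
    using that bij homD(1)[OF \<phi> that(1)] inv_into_f_f[of \<phi> V x] by (simp add: \<psi>_def bij_betw_def)
  have Vc: "x + y \<in> V" "sc c x \<in> V" if "x \<in> V" "y \<in> V" for x y c
    using that V by (auto simp: stable_sub_def lin_subspace_def)
  show "(if y \<in> V' then inv_into V \<phi> y else 0) \<in> V" if "y \<in> V'" for y using \<psi>V(1)[OF that] by (simp add: \<psi>_def)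
  show "(if x + y \<in> V' then inv_into V \<phi> (x + y) else 0) = (if x \<in> V' then inv_into V \<phi> x else 0) + (if y \<in> V' then inv_into V \<phi> y else 0)"
    if "x \<in> V'" "y \<in> V'" for x y
    using \<psi>I[of "\<psi> x + \<psi> y" "x + y"] Vc(1)[OF \<psi>V(1)[OF that(1)] \<psi>V(1)[OF that(2)]] homD(2)[OF \<phi> \<psi>V(1)[OF that(1)] \<psi>V(1)[OF that(2)]] \<psi>V(2)[OF that(1)] \<psi>V(2)[OF that(2)]
    by (simp add: \<psi>_def)
  show "(if sc' c x \<in> V' then inv_into V \<phi> (sc' c x) else 0) = sc c (if x \<in> V' then inv_into V \<phi> x else 0)"
    if "x \<in> V'" for x c
    using \<psi>I[of "sc c (\<psi> x)" "sc' c x"] Vc(2)[OF \<psi>V(1)[OF that] \<psi>V(1)[OF that]] homD(3)[OF \<phi> \<psi>V(1)[OF that]] \<psi>V(2)[OF that]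
    by (simp add: \<psi>_def)
  show "(if act' g x \<in> V' then inv_into V \<phi> (act' g x) else 0) = act g (if x \<in> V' then inv_into V \<phi> x else 0)"
    if "g \<in> H" "x \<in> V'" for g x
  proof -
    have "act g (\<psi> x) \<in> V" using V \<psi>V(1)[OF that(2)] that(1) by (simp add: stable_sub_def)
    then show ?thesis
      using \<psi>I[of "act g (\<psi> x)" "act' g x"] homD(4)[OF \<phi> that(1) \<psi>V(1)[OF that(2)]] \<psi>V(2)[OF that(2)] that
      by (simp add: \<psi>_def)
  qed
qed simp

context gl2_rep
begin

lemma stable_V: "stable_sub sc GL2 act V" "stable_sub sc Bor act V"
  using stable_sub_iff[of V] Gstable_V Pstable_V by auto

lemma lin_subspace_V: "lin_subspace sc V"
  using subspace_V lin_subspace_iff[OF vs.vector_space_axioms] by blast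

lemma irred_GL2_iff: "irred sc GL2 V act \<longleftrightarrow> V \<noteq> {0} \<and> (\<forall>W. Gstable W \<longrightarrow> W = {0} \<or> W = V)"
  using stable_sub_iff(1) by (auto simp: irred_def Gstable_def)

lemma irred_Bor_iff: "irred sc Bor V act \<longleftrightarrow> V \<noteq> {0} \<and> (\<forall>W. Pstable W \<longrightarrow> W = {0} \<or> W = V)"
  using stable_sub_iff(2) by (auto simp: irred_def Pstable_def)

lemma Gspan_irred: "irred sc GL2 V act \<Longrightarrow> x \<in> V \<Longrightarrow> x \<noteq> 0 \<Longrightarrow> Gspan x = V"
  using Gspan_Gstable[of x] Gspan_self[of x] unfolding irred_GL2_iff by blast

end

section \<open>From a proper P-stable subspace to a map into a principal series\<close>

context gl2_central
begin

lemma eigen_hyperplane: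
  assumes z: "z \<in> teig \<theta>" "z \<noteq> 0" "U z = sc \<alpha> z" "\<alpha> \<noteq> 0" and x: "x \<in> Gspan z"
  shows "\<exists>c. x - sc c (act sm z) \<in> Pspan z"
proof -
  obtain w c where "w \<in> Pspan z" "x = w + sc c (act sm z)"
    using x Gspan_eigen[OF z] by (auto simp: Pspan_sm_def)
  then show ?thesis by (intro exI[of _ c]) simp
qed

lemma irred_embedding:
  assumes irr: "irred sc GL2 V act" and W: "Pstable W" "W \<noteq> {0}" "W \<noteq> V"
  shows "\<exists>\<chi> E Z. smooth_charT v \<chi> \<and> E \<in> hom sc GL2 V act fscale (Ind v \<chi>) ind_act
     \<and> (\<forall>x\<in>V. E x mone = 0 \<longleftrightarrow> x \<in> Z) \<and> Z \<subseteq> V \<and> Z \<noteq> V \<and> Z \<noteq> {0}"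
proof -
  have hyper: ?thesis
    if Z: "Pstable Z" and y: "y \<in> V" "y \<notin> Z" and span: "\<And>x. x \<in> V \<Longrightarrow> \<exists>c. x - sc c y \<in> Z" for Z y
  proof -
    have ZV: "Z \<subseteq> V" using Z by (auto simp: Pstable_def)
    \<comment> \<open>A zero \<open>Z\<close> would make \<open>V\<close> one-dimensional, leaving
      no room for the proper nonzero subspace \<open>W\<close>.\<close>
    have "Z \<noteq> {0}"
    proof
      assume Z0: "Z = {0}"
      obtain w where w: "w \<in> W" "w \<noteq> 0" using W vs.subspace_0[OF Pstable_subspace] by blast
      then obtain c where c: "w = sc c y" using span[of w] Z0 Pstable_V_D[OF W(1)] by auto
      then have "c \<noteq> 0" using w by auto
      then have "y = sc (inverse c) w" using c by simp
      then have yW: "y \<in> W" using w vs.subspace_scale[OF Pstable_subspace[OF W(1)]] by simp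
      have "x \<in> W" if "x \<in> V" for x
        using span[OF that] Z0 yW vs.subspace_scale[OF Pstable_subspace[OF W(1)]] by auto
      then show False using W by (auto simp: Pstable_def)
    qed
    then show ?thesis
      using hyperplane_embedding[OF Gstable_V Z ZV y span] ZV y by blast
  qed
  \<comment> \<open>No nonzero vector of \<open>W\<close> can have a \<open>G\<close>-stable
    \<open>P\<close>-span; with \<open>U_zero_Gstable\<close> this keeps \<open>U\<close> from
    killing nonzero \<open>I1\<close>-fixed vectors of \<open>W\<close>.\<close>
  have full: "x \<in> W \<Longrightarrow> x \<noteq> 0 \<Longrightarrow> \<not> Gstable (Pspan x)" for x
    using irr Pspan_minimal[OF W(1)] Pspan_self[of x] W Pstable_V_D[OF W(1)]
    unfolding irred_GL2_iff by (metis Pstable_def singletonD subset_antisym)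
  obtain \<theta> z where z: "z \<in> W" "z \<noteq> 0" "z \<in> teig \<theta>" using exists_teig[OF W(1,2)] by blast
  have U0: "U x \<noteq> 0" if "x \<in> W" "x \<noteq> 0" "x \<in> teig \<theta>" for x
    using U_zero_Gstable teigD(1) full that by blast
  have Uz: "U z \<noteq> 0" "U z \<in> W" "U z \<in> teig \<theta>" "U z \<in> V"
    using U0 U_in[OF W(1)] U_teig z teigD by blast+
  have GV: "Gspan (U z) = V" using Gspan_irred[OF irr Uz(4,1)] .
  show ?thesis
    using U_dichotomy[OF z(3) Uz(1)]
  proof
    assume "\<exists>q. q \<noteq> 0 \<and> polyop sc q U (U z) = 0"
    then obtain q where q: "q \<noteq> 0" "polyop sc q U (U z) = 0" by blast
    obtain \<alpha> x where x: "x \<in> W" "x \<noteq> 0" "x \<in> teig \<theta>" "U x = sc \<alpha> x"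
      using eigenvector_of_relation[OF W(1) Uz(2,1,3) q] by blast
    have \<alpha>: "\<alpha> \<noteq> 0" using U0[OF x(1-3)] x(4) by auto
    have xV: "x \<in> V" using x teigD by blast
    have "act sm x \<notin> Pspan x" using Pspan_Gstable[OF teigD(1)[OF x(3)]] full[OF x(1,2)] by blast
    moreover have "\<exists>c. y - sc c (act sm x) \<in> Pspan x" if "y \<in> V" for y
      using eigen_hyperplane[OF x(3,2,4) \<alpha>] Gspan_irred[OF irr xV x(2)] that by blast
    ultimately show ?thesis using hyper[OF Pspan_Pstable[OF xV], of "act sm x"] xV by simp
  next
    assume "\<exists>L \<chi>. (\<forall>x\<in>Gspan (U z). \<forall>y\<in>Gspan (U z). L (x + y) = L x + L y)
      \<and> (\<forall>c. \<forall>x\<in>Gspan (U z). L (sc c x) = c * L x)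
      \<and> (\<forall>g\<in>Bor. \<forall>x\<in>Gspan (U z). L (act g x) = \<chi> g * L x) \<and> (\<exists>x\<in>Gspan (U z). L x \<noteq> 0)"
    then obtain L \<chi> y where L: "\<And>x y. x \<in> V \<Longrightarrow> y \<in> V \<Longrightarrow> L (x + y) = L x + L y" "\<And>c x. x \<in> V \<Longrightarrow> L (sc c x) = c * L x"
      "\<And>g x. g \<in> Bor \<Longrightarrow> x \<in> V \<Longrightarrow> L (act g x) = \<chi> g * L x" "y \<in> V" "L y \<noteq> 0"
      unfolding GV by blast
    define Z where "Z = {x \<in> V. L x = 0}"
    have "L 0 = 0" using L(2)[of 0 0] by simp
    then have "Pstable Z"
      using L(1-3) by (auto simp: Pstable_def Z_def intro!: vs.subspaceI)
    moreover have "\<exists>c. x - sc c y \<in> Z" if x: "x \<in> V" for x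
    proof -
      have "L (x + sc (- (L x / L y)) y) = 0" using L x by (simp del: vs.scale_minus_left)
      then show ?thesis using x L(4) by (intro exI[of _ "L x / L y"]) (simp add: Z_def)
    qed
    ultimately show ?thesis using hyper[of Z y] L(4,5) by (simp add: Z_def)
  qed
qed

end

section \<open>Reducibility and length of induced representations\<close>

context ind_char
begin

lemma Ind_det_character:
  assumes \<eta>: "\<And>a b. a \<noteq> 0 \<Longrightarrow> b \<noteq> 0 \<Longrightarrow> \<eta> (a * b) = \<eta> a * \<eta> b" "\<And>a d. a \<noteq> 0 \<Longrightarrow> d \<noteq> 0 \<Longrightarrow> \<chi> a d = \<eta> (a * d)"
  defines "h \<equiv> (\<lambda>g. if g \<in> GL2 then \<eta> (mdet g) else 0)"
  shows "h \<in> Ind v \<chi>" "g \<in> GL2 \<Longrightarrow> ind_act g h = fscale (\<eta> (mdet g)) h" "h mone = 1"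
proof -
  have e1: "\<eta> 1 = 1" using \<eta>(2)[of 1 1] by simp
  show m: "h mone = 1" using e1 by (simp add: h_def) (simp add: mone_def)
  have nz: "mdet g \<noteq> 0" if "g \<in> GL2" for g :: "'f mat2" using that by (simp add: GL2_def)
  have mul: "h (mmul x g) = \<eta> (mdet x) * \<eta> (mdet g)" if "x \<in> GL2" "g \<in> GL2" for x g
    using that \<eta>(1) nz by (simp add: h_def mdet_mmul)
  show "h \<in> Ind v \<chi>"
  proof (rule Ind_I)
    show "h g = 0" if "g \<notin> GL2" for g using that by (simp add: h_def)
    show "\<exists>n>0. \<forall>k\<in>Kcong v n. h (mmul g k) = h g" if g: "g \<in> GL2" for g
    proof (intro exI[of _ 1] conjI ballI)
      fix k assume k: "k \<in> Kcong v 1"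
      obtain a b c d where abcd: "k = (a,b,c,d)" by (cases k)
      have *: "ip 1 (a - 1)" "ip 1 b" "ip 1 c" "ip 1 (d - 1)" using k by (auto simp: abcd)
      have "ip 1 (a * d - 1)" using ip_one_mult[OF *(1,4)] by simp
      moreover have "ip 1 (b * c)" using ip_mult_ge[OF *(2,3)] by simp
      ultimately have "ip 1 ((a * d - 1) - b * c)" by (rule ip_diff)
      then have "\<chi> (a * d - b * c) 1 = 1" "a * d - b * c \<noteq> 0"
        using \<chi>_one_units[of "a * d - b * c" 1] unt_nonzero[OF unt_one_plus, of "a * d - b * c"] by (simp_all add: algebra_simps)
      then have "\<eta> (mdet k) = 1" using \<eta>(2)[of "a * d - b * c" 1] by (simp add: abcd)
      then show "h (mmul g k) = h g" using mul[OF g Kcong_GL2[OF _ k]] g by (simp add: h_def)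
    qed simp
    show "h (mmul (a,b,0,d) g) = \<chi> a d * h g" if "g \<in> GL2" "a \<noteq> 0" "d \<noteq> 0" for g a b d
      using mul[of "(a,b,0,d)" g] that \<eta>(2) by (simp add: h_def del: mmul_simp)
  qed
  show "ind_act g h = fscale (\<eta> (mdet g)) h" if g: "g \<in> GL2"
  proof
    fix x
    show "ind_act g h x = fscale (\<eta> (mdet g)) h x"
    proof (cases "x \<in> GL2")
      case True
      then show ?thesis using mul[OF True g] by (simp add: ind_act_def fscale_def h_def mult.commute)
    qed (simp add: ind_act_def fscale_def h_def)
  qed
qed

text \<open>If \<open>\<chi>\<close> is invariant under the Weyl group, then it factors through the determinant and
  \<open>Ind\<close> contains a character, hence is reducible.\<close>

lemma Ind_reducible:
  assumes sym: "\<And>a d. a \<noteq> 0 \<Longrightarrow> d \<noteq> 0 \<Longrightarrow> \<chi> a d = \<chi> d a"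
  shows "\<exists>X. ind.Gstable X \<and> X \<noteq> {0} \<and> X \<noteq> Ind v \<chi>"
proof -
  define \<eta> where "\<eta> a = \<chi> a 1" for a
  have e1: "\<eta> (a * b) = \<eta> a * \<eta> b" if "a \<noteq> 0" "b \<noteq> 0" for a b
    using \<chi>_mult[of a 1 b 1] that by (simp add: \<eta>_def)
  have e2: "\<chi> a d = \<eta> (a * d)" if "a \<noteq> 0" "d \<noteq> 0" for a d
    using \<chi>_mult[of a 1 1 d] sym[of 1 d] e1[of a d] that by (simp add: \<eta>_def)
  define h where "h = (\<lambda>g. if g \<in> GL2 then \<eta> (mdet g) else 0)"
  have h: "h \<in> Ind v \<chi>" "\<And>g. g \<in> GL2 \<Longrightarrow> ind_act g h = fscale (\<eta> (mdet g)) h" "h mone = 1"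
    using Ind_det_character[of \<eta>] e1 e2 unfolding h_def by blast+
  define X where "X = range (\<lambda>c. fscale c h)"
  have "ind.Gstable X"
    unfolding ind.Gstable_def
  proof (intro conjI ballI)
    show "sm.vs.subspace X"
    proof (rule sm.vs.subspaceI)
      have "fscale 0 h = 0" by (auto simp: fscale_def)
      then show "0 \<in> X" unfolding X_def by (metis rangeI)
      show "x + y \<in> X" if "x \<in> X" "y \<in> X" for x y
        using that by (auto simp: X_def sm.vs.scale_left_distrib[symmetric])
      show "fscale c x \<in> X" if "x \<in> X" for c x using that by (auto simp: X_def)
    qed
    show "X \<subseteq> Ind v \<chi>" using h(1) Ind_fscale by (auto simp: X_def)
    show "ind_act g x \<in> X" if "g \<in> GL2" "x \<in> X" for g x
    proof -
      obtain c where "x = fscale c h" using \<open>x \<in> X\<close> by (auto simp: X_def)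
      then have "ind_act g x = fscale (c * \<eta> (mdet g)) h"
        using ind.act_sc[OF \<open>g \<in> GL2\<close> h(1), of c] h(2)[OF \<open>g \<in> GL2\<close>] by simp
      then show ?thesis unfolding X_def by (intro range_eqI)
    qed
  qed
  moreover have "X \<noteq> {0}"
  proof -
    have "fscale 1 h \<in> X" unfolding X_def by blast
    moreover have "fscale 1 h mone \<noteq> 0" using h(3) by (simp add: fscale_def)
    ultimately show ?thesis by force
  qed
  moreover have "\<phi>0 \<notin> X"
  proof
    assume "\<phi>0 \<in> X"
    then obtain c where c: "\<phi>0 = fscale c h" by (auto simp: X_def)
    then have "c = 0" using h(3) \<phi>0_mone by (metis fscale_def mult.right_neutral)
    then show False using c \<phi>0_nonzero by (auto simp: fscale_def)
  qed
  ultimately show ?thesis using \<phi>0_Ind by blast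
qed

text \<open>The chain is 0, \<open>Ind0\<close>, \<open>Ind\<close>: the first step is irreducible
  by \<open>Ind0_irreducible\<close>, and the second quotient is the line detected by evaluation at
  \<open>mone\<close>.\<close>

lemma rep_length_Ind: "rep_length fscale Bor (Ind v \<chi>) ind_act 2"
  unfolding rep_length_def
proof (intro exI[of _ "\<lambda>i::nat. if i = 0 then {0} else if i = 1 then Ind0 else Ind v \<chi>"] conjI)
  let ?W = "\<lambda>i::nat. if i = 0 then {0} else if i = 1 then Ind0 else Ind v \<chi>"
  have st0: "stable_sub fscale Bor ind_act {0 :: 'f mat2 \<Rightarrow> 'k}"
    using ind.stable_sub_iff(2)[of "{0}"] by (auto simp: ind.Pstable_def)
  have st1: "stable_sub fscale Bor ind_act Ind0"
    using ind.stable_sub_iff(2)[of Ind0] Ind0_Pstable by auto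
  show "\<forall>i\<le>2. stable_sub fscale Bor ind_act (?W i)"
    using st0 st1 ind.stable_V(2) by auto
  have "\<phi>0 \<in> Ind0" using \<phi>0_Ind by simp
  moreover have "0 \<in> Ind0" by (rule sm.vs.subspace_0[OF ind.Pstable_subspace[OF Ind0_Pstable]])
  ultimately have s0: "{0} \<subset> Ind0" using \<phi>0_nonzero by blast
  have smI: "ind_act sm \<phi>0 \<in> Ind v \<chi>" using \<phi>0_Ind by simp
  then have "ind_act sm \<phi>0 \<notin> Ind0" using sm_\<phi>0_mone by simp
  then have s1: "Ind0 \<subset> Ind v \<chi>" using smI by blast
  have m0: "U = {0} \<or> U = Ind0" if U: "stable_sub fscale Bor ind_act U" "{0} \<subseteq> U" "U \<subseteq> Ind0" for U
  proof -
    have "ind.Pstable U" using ind.stable_sub_iff(2)[of U] U by auto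
    then show ?thesis using Ind0_irreducible U by blast
  qed
  have m1: "U = Ind0 \<or> U = Ind v \<chi>" if U: "stable_sub fscale Bor ind_act U" "Ind0 \<subseteq> U" "U \<subseteq> Ind v \<chi>" for U
  proof (cases "U = Ind0")
    case False
    then obtain f where f: "f \<in> U" "f mone \<noteq> 0" using U by auto
    have Ps: "sm.vs.subspace U" using ind.stable_sub_iff(2)[of U] U by (auto simp: ind.Pstable_def)
    have "f - fscale (f mone) (ind_act sm \<phi>0) \<in> U" using Ind_eq_Ind0_plus f U by blast
    then have "f - (f - fscale (f mone) (ind_act sm \<phi>0)) \<in> U" using f sm.vs.subspace_diff[OF Ps] by blast
    then have "fscale (f mone) (ind_act sm \<phi>0) \<in> U" by simp
    then have "fscale (inverse (f mone)) (fscale (f mone) (ind_act sm \<phi>0)) \<in> U" using sm.vs.subspace_scale[OF Ps] by blast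
    then have sU: "ind_act sm \<phi>0 \<in> U" using f(2) by simp
    have "g \<in> U" if "g \<in> Ind v \<chi>" for g
    proof -
      have "(g - fscale (g mone) (ind_act sm \<phi>0)) + fscale (g mone) (ind_act sm \<phi>0) \<in> U"
        using Ind_eq_Ind0_plus[OF that] U sU by (intro sm.vs.subspace_add[OF Ps] sm.vs.subspace_scale[OF Ps]) auto
      then show ?thesis by (simp only: diff_add_cancel)
    qed
    then show ?thesis using U by blast
  qed simp
  show "\<forall>i<2. ?W i \<subset> ?W (Suc i) \<and>
        (\<forall>U. stable_sub fscale Bor ind_act U \<longrightarrow> ?W i \<subseteq> U \<longrightarrow> U \<subseteq> ?W (Suc i) \<longrightarrow> U = ?W i \<or> U = ?W (Suc i))"
  proof (intro allI impI)
    fix i :: nat assume "i < 2"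
    then consider "i = 0" | "i = 1" by linarith
    then show "?W i \<subset> ?W (Suc i) \<and>
        (\<forall>U. stable_sub fscale Bor ind_act U \<longrightarrow> ?W i \<subseteq> U \<longrightarrow> U \<subseteq> ?W (Suc i) \<longrightarrow> U = ?W i \<or> U = ?W (Suc i))"
    proof cases
      case 1
      then show ?thesis using s0 m0 by simp
    next
      case 2
      then show ?thesis using s1 m1 by simp
    qed
  qed
  show "?W 0 = {0}" by (simp only: if_True refl)
  show "?W 2 = Ind v \<chi>" by simp
qed

end

lemma rep_length_transport:
  assumes \<phi>: "\<phi> \<in> hom sc H V act sc' V' act'" "bij_betw \<phi> V V'" and V: "stable_sub sc H act V" "stable_sub sc' H act' V'"
    and v: "vector_space sc" "vector_space sc'" and n: "rep_length sc H V act n"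
  shows "rep_length sc' H V' act' n"
proof -
  obtain W where WW: "W 0 = {0} \<and> W n = V \<and> (\<forall>i\<le>n. stable_sub sc H act (W i)) \<and> (\<forall>i<n. W i \<subset> W (Suc i) \<and>
      (\<forall>U. stable_sub sc H act U \<longrightarrow> W i \<subseteq> U \<longrightarrow> U \<subseteq> W (Suc i) \<longrightarrow> U = W i \<or> U = W (Suc i)))"
    using n unfolding rep_length_def by (elim exE)
  then have W: "W 0 = {0}" "W n = V" "\<And>i. i \<le> n \<Longrightarrow> stable_sub sc H act (W i)"
    "\<And>i. i < n \<Longrightarrow> W i \<subset> W (Suc i)"
    "\<And>i U. i < n \<Longrightarrow> stable_sub sc H act U \<Longrightarrow> W i \<subseteq> U \<Longrightarrow> U \<subseteq> W (Suc i) \<Longrightarrow> U = W i \<or> U = W (Suc i)"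
    by metis+
  interpret a: vector_space sc by fact
  interpret b: vector_space sc' by fact
  have WV: "W i \<subseteq> V" if "i \<le> n" for i
    using that
  proof (induction rule: inc_induct)
    case (step i)
    then show ?case using W(4)[of i] by auto
  qed (simp add: W)
  have "0 \<in> V" using V by (simp add: stable_sub_def lin_subspace_def)
  then have "\<phi> 0 = 0" using homD(3)[OF \<phi>(1), of 0 0] by simp
  have inj: "inj_on \<phi> V" and im: "\<phi> ` V = V'" using \<phi>(2) by (auto simp: bij_betw_def)
  show ?thesis
    unfolding rep_length_def
  proof (intro exI[of _ "\<lambda>i. \<phi> ` W i"] conjI allI impI)
    show "\<phi> ` W 0 = {0}" using W \<open>\<phi> 0 = 0\<close> by simp
    show "\<phi> ` W n = V'" using W im by simp
    show "stable_sub sc' H act' (\<phi> ` W i)" if "i \<le> n" for i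
      using hom_image[OF \<phi>(1) W(3)[OF that] WV[OF that] v] .
  next
    fix i assume i: "i < n"
    then have V': "W (Suc i) \<subseteq> V" "W i \<subseteq> V" using WV[of "Suc i"] WV[of i] by simp_all
    show "\<phi> ` W i \<subset> \<phi> ` W (Suc i)"
      using W(4)[OF i] inj_on_image_eq_iff[OF inj V'(2,1)] by blast
    fix U assume U: "stable_sub sc' H act' U" "\<phi> ` W i \<subseteq> U" "U \<subseteq> \<phi> ` W (Suc i)"
    define Y where "Y = {x \<in> V. \<phi> x \<in> U}"
    have Y: "stable_sub sc H act Y" unfolding Y_def by (rule hom_preimage[OF \<phi>(1) V(1) U(1) v])
    have "W i \<subseteq> Y" using U V' by (auto simp: Y_def)
    moreover have "Y \<subseteq> W (Suc i)"
    proof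
      fix x assume x: "x \<in> Y"
      then obtain x' where "x' \<in> W (Suc i)" "\<phi> x = \<phi> x'" using U by (auto simp: Y_def)
      then show "x \<in> W (Suc i)" using x V' inj by (auto simp: Y_def dest: inj_onD)
    qed
    ultimately have "Y = W i \<or> Y = W (Suc i)" using W(5)[OF i Y] by blast
    moreover have "\<phi> ` Y = U" using U V' by (force simp: Y_def)
    ultimately show "U = \<phi> ` W i \<or> U = \<phi> ` W (Suc i)" by blast
  qed
qed

context gl2_rep
begin

lemma principal_series_rep_length:
  assumes "principal_series v sc V act"
  shows "rep_length sc Bor V act 2"
proof -
  obtain \<chi> \<phi> where \<chi>: "smooth_charT v \<chi>" and \<phi>: "\<phi> \<in> hom fscale GL2 (Ind v \<chi>) ind_act sc V act" "bij_betw \<phi> (Ind v \<chi>) V"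
    using assms by (auto simp: principal_series_def iso_rep_def)
  interpret I: ind_char v p \<pi> \<chi> by unfold_locales (use \<chi> alg_closure in auto)
  show ?thesis
    using rep_length_transport[OF hom_mono[OF Bor_subset_GL2 \<phi>(1)] \<phi>(2) I.ind.stable_V(2) stable_V(2) I.vector_space_fscale vs.vector_space_axioms I.rep_length_Ind] .
qed

text \<open>The kernel of \<open>E\<close> is \<open>G\<close>-stable and proper because
  \<open>Z\<close> is proper, hence zero. As \<open>Z\<close> is nonzero, the image meets
  \<open>Ind0\<close> nontrivially and is all of \<open>Ind\<close>. Irreducibility passes to
  \<open>Ind\<close> and excludes a symmetric \<chi> by \<open>Ind_reducible\<close>.\<close>

lemma principal_of_embedding:
  assumes irr: "irred sc GL2 V act" and \<chi>: "smooth_charT v \<chi>"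
    and E: "E \<in> hom sc GL2 V act fscale (Ind v \<chi>) ind_act" and Z: "\<And>x. x \<in> V \<Longrightarrow> E x mone = 0 \<longleftrightarrow> x \<in> Z"
      "Z \<subseteq> V" "Z \<noteq> V" "Z \<noteq> {0}"
  shows "principal_series v sc V act"
proof -
  interpret I: ind_char v p \<pi> \<chi> by unfold_locales (use \<chi> alg_closure in auto)
  have pre: "Gstable {x \<in> V. E x \<in> X}" if "I.ind.Gstable X" for X
  proof -
    have XI: "X \<subseteq> Ind v \<chi>" using that by (simp add: I.ind.Gstable_def)
    show ?thesis
      using hom_preimage[OF E stable_V(1) _ vs.vector_space_axioms I.vector_space_fscale, of X]
        I.ind.stable_sub_iff(1)[OF XI] that stable_sub_iff(1)[of "{x \<in> V. E x \<in> X}"] by auto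
  qed
  have E0: "E 0 = 0" using homD(3)[OF E, of 0 0] by (simp add: fscale_def fun_eq_iff)
  obtain x1 where x1: "x1 \<in> V" "x1 \<notin> Z" using Z by blast
  have "I.ind.Gstable {0}" by (auto simp: I.ind.Gstable_def)
  then have "Gstable {x \<in> V. E x \<in> {0}}" by (rule pre)
  moreover have "E x1 \<noteq> 0" using Z(1)[OF x1(1)] x1(2) by auto
  ultimately have ker: "{x \<in> V. E x \<in> {0}} = {0}" using irr x1(1) unfolding irred_GL2_iff by blast
  have inj: "inj_on E V"
    by (rule hom_inj[OF E lin_subspace_V vs.vector_space_axioms I.vector_space_fscale]) (use ker in blast)
  have EV: "I.ind.Gstable (E ` V)"
    using hom_image[OF E stable_V(1) order_refl vs.vector_space_axioms I.vector_space_fscale]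
      I.ind.stable_sub_iff(1)[of "E ` V"] homD(1)[OF E] by blast
  have "0 \<in> Z" using Z(1)[of 0] E0 by simp
  then obtain z where z: "z \<in> Z" "z \<noteq> 0" using Z(4) by blast
  have "E z \<in> E ` V \<inter> I.Ind0" using z Z homD(1)[OF E] by auto
  moreover have "E z \<noteq> 0" using z Z ker by blast
  ultimately have im: "E ` V = Ind v \<chi>" using I.Gstable_Ind[OF EV] by blast
  then have bij: "bij_betw E V (Ind v \<chi>)" using inj by (simp add: bij_betw_def)
  have "\<exists>a d. a \<noteq> 0 \<and> d \<noteq> 0 \<and> \<chi> a d \<noteq> \<chi> d a"
  proof (rule ccontr)
    assume "\<not> ?thesis"
    then obtain X where X: "I.ind.Gstable X" "X \<noteq> {0}" "X \<noteq> Ind v \<chi>" using I.Ind_reducible by blast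
    have "{x \<in> V. E x \<in> X} = {0} \<or> {x \<in> V. E x \<in> X} = V" using pre[OF X(1)] irr unfolding irred_GL2_iff by blast
    moreover have "E ` {x \<in> V. E x \<in> X} = X" using im X(1) by (force simp: I.ind.Gstable_def)
    ultimately show False using E0 im X by auto
  qed
  moreover have "iso_rep fscale GL2 (Ind v \<chi>) ind_act sc V act"
    unfolding iso_rep_def
  proof (rule bexI[OF _ hom_inv_into[OF E stable_V(1) bij]])
    have "bij_betw (inv_into V E) (Ind v \<chi>) V" using bij bij_betw_inv_into by blast
    then show "bij_betw (\<lambda>y. if y \<in> Ind v \<chi> then inv_into V E y else 0) (Ind v \<chi>) V"
      by (subst bij_betw_cong[of _ _ "inv_into V E"]) auto
  qed
  ultimately show ?thesis using \<chi> unfolding principal_series_def by blast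
qed

end

context gl2_central
begin

lemma irred_Bor_of_not_principal:
  assumes irr: "irred sc GL2 V act" and "\<not> principal_series v sc V act"
  shows "irred sc Bor V act"
  unfolding irred_Bor_iff
proof (intro conjI allI impI)
  show "V \<noteq> {0}" using irr by (simp add: irred_def)
  fix W assume W: "Pstable W"
  show "W = {0} \<or> W = V"
    using irred_embedding[OF irr W] principal_of_embedding[OF irr] assms(2) by metis
qed

end

subsection \<open>Graphs of \<open>P\<close>-equivariant maps\<close>

locale rep_pair = gl2_central v p \<pi> sc V act \<omega> + B: gl2_rep v p \<pi> sc' V' act'
  for v :: "'f::field \<Rightarrow> int" and p :: nat and \<pi> :: 'f
    and sc :: "'k::field \<Rightarrow> 'v::ab_group_add \<Rightarrow> 'v" and V and act and \<omega>
    and sc' :: "'k \<Rightarrow> 'w::ab_group_add \<Rightarrow> 'w" and V' and act'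
begin

definition scp :: "'k \<Rightarrow> 'v \<times> 'w \<Rightarrow> 'v \<times> 'w" where "scp c z = (sc c (fst z), sc' c (snd z))"

definition actp :: "'f mat2 \<Rightarrow> 'v \<times> 'w \<Rightarrow> 'v \<times> 'w" where "actp g z = (act g (fst z), act' g (snd z))"

text \<open>The part of the product where the centre acts by \<omega> in the second component as
  well. A \<open>P\<close>-map is equivariant for the centre, so its graph lies here, and
  \<open>R\<close> becomes an instance of \<open>gl2_central\<close>.\<close>

definition R :: "('v \<times> 'w) set" where
  "R = {z. fst z \<in> V \<and> snd z \<in> V' \<and> (\<forall>a. a \<noteq> 0 \<longrightarrow> act' (dm a a) (snd z) = sc' (\<omega> a) (snd z))}"

lemma scp_simp [simp]: "scp c (x, y) = (sc c x, sc' c y)" and actp_simp [simp]: "actp g (x, y) = (act g x, act' g y)"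
  by (simp_all add: scp_def actp_def)

lemma scp_proj [simp]: "fst (scp c z) = sc c (fst z)" "snd (scp c z) = sc' c (snd z)"
    "fst (actp g z) = act g (fst z)" "snd (actp g z) = act' g (snd z)"
  by (simp_all add: scp_def actp_def)

lemma vector_space_scp: "vector_space scp"
  by unfold_locales
    (auto simp: scp_def prod_eq_iff vs.scale_right_distrib vs.scale_left_distrib B.vs.scale_right_distrib B.vs.scale_left_distrib)

lemma in_R: "(x, y) \<in> R \<longleftrightarrow> x \<in> V \<and> y \<in> V' \<and> (\<forall>a. a \<noteq> 0 \<longrightarrow> act' (dm a a) y = sc' (\<omega> a) y)"
  by (simp add: R_def)

lemma R_act: assumes g: "g \<in> GL2" and z: "z \<in> R" shows "actp g z \<in> R"
proof -
  have "act' (dm a a) (act' g (snd z)) = sc' (\<omega> a) (act' g (snd z))" if a: "a \<noteq> 0" for a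
  proof -
    have "mmul (dm a a) g = mmul g (dm a a)" by (cases g) (simp add: mult.commute)
    then have "act' (dm a a) (act' g (snd z)) = act' g (act' (dm a a) (snd z))"
      by (rule B.act_eqI) (use g a z in \<open>auto simp: R_def\<close>)
    then show ?thesis using a g z by (simp add: R_def B.act_sc)
  qed
  then show ?thesis using g z by (simp add: R_def)
qed

lemma smooth_rep_R: "smooth_rep v scp R actp"
proof -
  have "lin_subspace scp R"
    by (auto simp: lin_subspace_def R_def B.act_add B.act_sc B.vs.scale_right_distrib mult.commute)
  moreover have "lin_on scp R (actp g)" if "g \<in> GL2" for g
    using that by (auto simp: lin_on_def R_def prod_eq_iff act_add act_sc B.act_add B.act_sc)
  moreover have "\<exists>n>0. \<forall>g\<in>Kcong v n. actp g z = z" if z: "z \<in> R" for z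
  proof -
    obtain n where n: "n > 0" "\<forall>g\<in>Kcong v n. act g (fst z) = fst z" using smooth[of "fst z"] z by (auto simp: R_def)
    obtain m where m: "m > 0" "\<forall>g\<in>Kcong v m. act' g (snd z) = snd z" using B.smooth[of "snd z"] z by (auto simp: R_def)
    have "Kcong v (max n m) \<subseteq> Kcong v n" "Kcong v (max n m) \<subseteq> Kcong v m" by (intro Kcong_mono; simp)+
    then have "\<forall>g\<in>Kcong v (max n m). actp g z = z" using n m by (metis actp_def subsetD surjective_pairing)
    then show ?thesis using n(1) by (intro exI[of _ "max n m"]) simp
  qed
  moreover have "actp mone z = z" if "z \<in> R" for z using that by (simp add: actp_def R_def)
  moreover have "actp (mmul g h) z = actp g (actp h z)" if "g \<in> GL2" "h \<in> GL2" "z \<in> R" for g h z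
    using that by (simp add: actp_def R_def act_mmul B.act_mmul)
  ultimately show ?thesis using vector_space_scp R_act by (simp add: smooth_rep_def is_rep_def)
qed

end

sublocale rep_pair \<subseteq> R: gl2_central v p \<pi> scp R actp \<omega>
  by unfold_locales (use alg_closure smooth_rep_R in \<open>auto simp: R_def central prod_eq_iff\<close>)

context rep_pair
begin

definition graph :: "'v set \<Rightarrow> ('v \<Rightarrow> 'w) \<Rightarrow> ('v \<times> 'w) set" where "graph W \<phi> = (\<lambda>x. (x, \<phi> x)) ` W"

lemma in_graph [simp]: "(x, y) \<in> graph W \<phi> \<longleftrightarrow> x \<in> W \<and> y = \<phi> x"
  by (auto simp: graph_def)

lemma graph_Pstable:
  assumes W: "Pstable W" and \<phi>: "\<phi> \<in> hom sc Bor W act sc' V' act'"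
  shows "R.Pstable (graph W \<phi>)"
proof -
  have WV: "x \<in> V" if "x \<in> W" for x using that W Pstable_V_D by blast
  note sub = Pstable_subspace[OF W]
  have "act' (dm a a) (\<phi> x) = sc' (\<omega> a) (\<phi> x)" if "x \<in> W" "a \<noteq> 0" for x a
    using homD(4)[OF \<phi>, of "dm a a" x] homD(3)[OF \<phi>, of x "\<omega> a"] central[OF that(2) WV[OF that(1)]] that by simp
  then have 1: "graph W \<phi> \<subseteq> R" using WV homD(1)[OF \<phi>] by (auto simp: graph_def in_R)
  have \<phi>0: "\<phi> 0 = 0" using homD(3)[OF \<phi> vs.subspace_0[OF sub], of 0] by simp
  have 2: "R.vs.subspace (graph W \<phi>)"
  proof (rule R.vs.subspaceI)
    show "0 \<in> graph W \<phi>" using \<phi>0 vs.subspace_0[OF sub] by (simp add: zero_prod_def)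
    show "x + y \<in> graph W \<phi>" if "x \<in> graph W \<phi>" "y \<in> graph W \<phi>" for x y
      using that homD(2)[OF \<phi>] vs.subspace_add[OF sub] by (cases x; cases y) simp
    show "scp c x \<in> graph W \<phi>" if "x \<in> graph W \<phi>" for c x
      using that homD(3)[OF \<phi>] vs.subspace_scale[OF sub] by (cases x) simp
  qed
  have 3: "actp g x \<in> graph W \<phi>" if "g \<in> Bor" "x \<in> graph W \<phi>" for g x
    using that homD(4)[OF \<phi>] Pstable_act[OF W] by (cases x) simp
  show ?thesis using 1 2 3 by (simp add: R.Pstable_def)
qed

lemma Gstable_graph_equivariant:
  assumes "R.Gstable (graph V \<phi>)" "\<phi> \<in> hom sc Bor V act sc' V' act'"
  shows "\<phi> \<in> hom sc GL2 V act sc' V' act'"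
proof (rule homI)
  show "\<phi> (act g x) = act' g (\<phi> x)" if "g \<in> GL2" "x \<in> V" for g x
  proof -
    have "(x, \<phi> x) \<in> graph V \<phi>" using that by simp
    then have "actp g (x, \<phi> x) \<in> graph V \<phi>" using assms(1) that unfolding R.Gstable_def by blast
    then show ?thesis by simp
  qed
qed (use homD[OF assms(2)] in auto)

lemma hom_of_Gstable:
  assumes \<Delta>: "R.Gstable \<Delta>" and ex: "\<And>x. x \<in> V \<Longrightarrow> \<exists>!y. (x, y) \<in> \<Delta>"
  shows "\<exists>\<psi>\<in>hom sc GL2 V act sc' V' act'. \<forall>x\<in>V. (x, \<psi> x) \<in> \<Delta>"
proof -
  define \<psi> where "\<psi> x = (if x \<in> V then THE y. (x, y) \<in> \<Delta> else 0)" for x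
  have \<psi>: "(x, \<psi> x) \<in> \<Delta>" if "x \<in> V" for x using theI'[OF ex[OF that]] that by (simp add: \<psi>_def)
  have \<psi>I: "\<psi> x = y" if "(x, y) \<in> \<Delta>" "x \<in> V" for x y using ex[OF that(2)] \<psi>[OF that(2)] that(1) by blast
  have sub: "R.vs.subspace \<Delta>" and \<Delta>R: "\<Delta> \<subseteq> R" using \<Delta> by (auto simp: R.Gstable_def)
  have "\<psi> \<in> hom sc GL2 V act sc' V' act'"
  proof (rule homI)
    show "\<psi> x \<in> V'" if "x \<in> V" for x using \<psi>[OF that] \<Delta>R by (auto simp: in_R)
    show "\<psi> (x + y) = \<psi> x + \<psi> y" if "x \<in> V" "y \<in> V" for x y
      using R.vs.subspace_add[OF sub \<psi>[OF that(1)] \<psi>[OF that(2)]] that by (intro \<psi>I) auto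
    show "\<psi> (sc c x) = sc' c (\<psi> x)" if "x \<in> V" for c x
      using R.vs.subspace_scale[OF sub \<psi>[OF that], of c] that by (intro \<psi>I) auto
    show "\<psi> (act g x) = act' g (\<psi> x)" if "g \<in> GL2" "x \<in> V" for g x
    proof (rule \<psi>I)
      have "actp g (x, \<psi> x) \<in> \<Delta>" using \<Delta> \<psi>[OF that(2)] that(1) unfolding R.Gstable_def by blast
      then show "(act g x, act' g (\<psi> x)) \<in> \<Delta>" by simp
    qed (use that in simp)
    show "\<psi> x = 0" if "x \<notin> V" for x using that by (simp add: \<psi>_def)
  qed
  then show ?thesis using \<psi> by blast
qed

lemma fst_Pstable: assumes "R.Pstable W" shows "Pstable (fst ` W)"
proof -
  have W: "R.vs.subspace W" "W \<subseteq> R" "\<And>g x. g \<in> Bor \<Longrightarrow> x \<in> W \<Longrightarrow> actp g x \<in> W"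
    using assms by (auto simp: R.Pstable_def)
  have "vs.subspace (fst ` W)"
  proof (rule vs.subspaceI)
    show "0 \<in> fst ` W" using R.vs.subspace_0[OF W(1)] by (metis fst_zero image_eqI)
    fix x y assume "x \<in> fst ` W" "y \<in> fst ` W"
    then obtain x' y' where "x' \<in> W" "y' \<in> W" "x = fst x'" "y = fst y'" by blast
    then show "x + y \<in> fst ` W" using R.vs.subspace_add[OF W(1)] by (metis fst_add image_eqI)
  next
    fix c x assume "x \<in> fst ` W"
    then obtain x' where "x' \<in> W" "x = fst x'" by blast
    then show "sc c x \<in> fst ` W" using R.vs.subspace_scale[OF W(1)] by (metis scp_proj(1) image_eqI)
  qed
  moreover have "act g x \<in> fst ` W" if g: "g \<in> Bor" and x: "x \<in> fst ` W" for g x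
  proof -
    obtain x' where "x' \<in> W" "x = fst x'" using x by blast
    then show ?thesis using W(3)[OF g] by (metis scp_proj(3) image_eqI)
  qed
  moreover have "fst ` W \<subseteq> V" using W(2) by (auto simp: R_def)
  ultimately show ?thesis by (simp add: Pstable_def)
qed

lemma fixed_fst: "z \<in> R.fixed S \<Longrightarrow> fst z \<in> fixed S"
proof -
  assume z: "z \<in> R.fixed S"
  have "fst z \<in> V" using R.fixedD(1)[OF z] by (simp add: R_def)
  moreover have "act g (fst z) = fst z" if "g \<in> S" for g
    using R.fixedD(2)[OF z that] by (metis scp_proj(3))
  ultimately show ?thesis by (simp add: fixed_def)
qed

end

section \<open>Homomorphisms out of an induced representation\<close>

locale ind_target = ind_char v p \<pi> \<chi> + B: gl2_rep v p \<pi> sc' V' act'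
  for v :: "'f::field \<Rightarrow> int" and p :: nat and \<pi> :: 'f and \<chi> :: "'f \<Rightarrow> 'f \<Rightarrow> 'k::field"
    and sc' :: "'k \<Rightarrow> 'w::ab_group_add \<Rightarrow> 'w" and V' and act'

sublocale ind_target \<subseteq> pr: rep_pair v p \<pi> fscale "Ind v \<chi>" ind_act "\<lambda>z. \<chi> z z" sc' V' act'
  by unfold_locales

context ind_target
begin

text \<open>The graph of \<open>\<phi>\<close> is generated over \<open>P\<close> by an eigenvector of \<open>U\<close>, hence is a hyperplane in the
  \<open>G\<close>-representation it generates; the latter is again a graph.\<close>

lemma extend_from_Ind0:
  assumes \<phi>: "\<phi> \<in> hom fscale Bor Ind0 ind_act sc' V' act'"
  shows "\<exists>\<psi>\<in>hom fscale GL2 (Ind v \<chi>) ind_act sc' V' act'. \<forall>f\<in>Ind0. \<psi> f = \<phi> f"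
proof -
  define \<Gamma> where "\<Gamma> = pr.graph Ind0 \<phi>"
  define z where "z = (\<phi>0, \<phi> \<phi>0)"
  have \<Gamma>: "pr.R.Pstable \<Gamma>" unfolding \<Gamma>_def by (rule pr.graph_Pstable[OF Ind0_Pstable \<phi>])
  note sub = pr.R.Pstable_subspace[OF \<Gamma>]
  have \<phi>0I: "\<phi>0 \<in> Ind0" using \<phi>0_Ind by simp
  have zero: "\<phi> 0 = 0" using homD(3)[OF \<phi> \<phi>0I, of 0] by simp
  have z\<Gamma>: "z \<in> \<Gamma>" using \<phi>0I by (simp add: z_def \<Gamma>_def)
  have z0: "z \<noteq> 0" using \<phi>0_nonzero by (simp add: z_def zero_prod_def)
  have zR: "z \<in> pr.R" using z\<Gamma> pr.R.Pstable_V_D[OF \<Gamma>] by blast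
  \<comment> \<open>The vector \<open>\<phi> \<phi>0\<close> is not visibly fixed by
    \<open>I1\<close>, as \<phi> respects only \<open>P\<close>. But the graph contains a nonzero
    \<open>I1\<close>-fixed vector, its first component is a multiple of \<open>\<phi>0\<close>, and
    so \<open>z\<close> itself is fixed.\<close>
  have "\<Gamma> \<noteq> {0}" using z\<Gamma> z0 by blast
  then obtain x where x: "x \<in> \<Gamma>" "x \<noteq> 0" "x \<in> pr.R.fixed pr.R.I1" using pr.R.exists_I1_fixed[OF \<Gamma>] by blast
  obtain f where f: "x = (f, \<phi> f)" "f \<in> Ind0" using x(1) by (auto simp: \<Gamma>_def pr.graph_def)
  have "f \<in> ind.fixed ind.I1" using pr.fixed_fst[OF x(3)] unfolding f(1) fst_conv .
  then have feq: "f = fscale (f sm) \<phi>0" using Ind0_fixed f(2) by blast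
  have fs: "f sm \<noteq> 0"
  proof
    assume "f sm = 0"
    then have "f = 0" using feq by simp
    then show False using x(2) f zero by (simp add: zero_prod_def)
  qed
  have "x = pr.scp (f sm) z"
    using feq homD(3)[OF \<phi> \<phi>0I, of "f sm"] by (simp add: z_def f(1))
  then have "pr.scp (inverse (f sm)) x = z" using fs by simp
  moreover have "pr.scp (inverse (f sm)) x \<in> pr.R.fixed pr.R.I1"
    by (rule pr.R.vs.subspace_scale[OF pr.R.subspace_I1 x(3)])
  ultimately have zfix: "z \<in> pr.R.fixed pr.R.I1" by (simp only:)
  have zte: "z \<in> pr.R.teig (\<lambda>a. \<chi> 1 a)"
  proof -
    have "pr.actp (dm a 1) z = pr.scp (\<chi> 1 a) z" if a: "unt a" for a
    proof -
      have "ind_act (dm a 1) \<phi>0 = fscale (\<chi> 1 a) \<phi>0" by (rule ind.teigD(3)[OF \<phi>0_teig a])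
      then show ?thesis
        using homD(4)[OF \<phi> _ \<phi>0I, of "dm a 1"] homD(3)[OF \<phi> \<phi>0I, of "\<chi> 1 a"] unt_nonzero[OF a] by (simp add: z_def)
    qed
    then show ?thesis using zfix by (simp add: pr.R.teig_def)
  qed
  have Uz: "pr.R.U z = pr.scp (\<chi> 1 \<pi>) z"
  proof -
    have "fst (pr.R.U z) = ind.U \<phi>0" by (simp add: pr.R.U_def ind.U_def fst_sum z_def)
    moreover have "pr.R.U z \<in> \<Gamma>" by (rule pr.R.U_in[OF \<Gamma> z\<Gamma>])
    ultimately have "pr.R.U z = (fscale (\<chi> 1 \<pi>) \<phi>0, \<phi> (fscale (\<chi> 1 \<pi>) \<phi>0))"
      using U_\<phi>0 by (cases "pr.R.U z") (simp add: \<Gamma>_def)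
    then show ?thesis using homD(3)[OF \<phi> \<phi>0I] by (simp add: z_def)
  qed
  have \<alpha>: "\<chi> 1 \<pi> \<noteq> 0" by (rule \<chi>_nonzero) auto
  note eig = zte z0 Uz \<alpha>
  define \<Delta> where "\<Delta> = pr.R.Gspan z"
  have \<Delta>eq: "\<Delta> = pr.R.Pspan_sm z" unfolding \<Delta>_def by (rule pr.R.Gspan_eigen[OF eig])
  have \<Delta>G: "pr.R.Gstable \<Delta>" unfolding \<Delta>_def by (rule pr.R.Gspan_Gstable[OF zR])
  have PG: "pr.R.Pspan z \<subseteq> \<Gamma>" by (rule pr.R.Pspan_minimal[OF \<Gamma> z\<Gamma>])
  have fP: "ind.Pstable (fst ` pr.R.Pspan z)" by (rule pr.fst_Pstable[OF pr.R.Pspan_Pstable[OF zR]])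
  have "\<phi>0 \<in> fst ` pr.R.Pspan z" using pr.R.Pspan_self[OF zR] by (force simp: z_def)
  then have "Ind0 \<subseteq> fst ` pr.R.Pspan z" using ind.Pspan_minimal[OF fP] Ind0_eq by simp
  then have \<Gamma>P: "(f, \<phi> f) \<in> pr.R.Pspan z" if f: "f \<in> Ind0" for f
  proof -
    obtain w where w: "w \<in> pr.R.Pspan z" "f = fst w" using f \<open>Ind0 \<subseteq> fst ` pr.R.Pspan z\<close> by blast
    then have "w = (f, \<phi> f)" using PG by (cases w) (auto simp: \<Gamma>_def)
    then show ?thesis using w by simp
  qed
  have \<Delta>sub: "pr.R.vs.subspace \<Delta>" using \<Delta>G by (simp add: pr.R.Gstable_def)
  have ex: "\<exists>!y. (f, y) \<in> \<Delta>" if f: "f \<in> Ind v \<chi>" for f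
  proof (rule ex_ex1I)
    define f0 where "f0 = f - fscale (f mone) (ind_act sm \<phi>0)"
    have "f0 \<in> Ind0" unfolding f0_def by (rule Ind_eq_Ind0_plus[OF f])
    then have "(f0, \<phi> f0) + pr.scp (f mone) (pr.actp sm z) \<in> \<Delta>"
      unfolding \<Delta>eq pr.R.Pspan_sm_def using \<Gamma>P by blast
    then show "\<exists>y. (f, y) \<in> \<Delta>" by (auto simp: z_def f0_def)
  next
    fix y y' assume y: "(f, y) \<in> \<Delta>" "(f, y') \<in> \<Delta>"
    have "(f, y) - (f, y') \<in> \<Delta>" by (rule pr.R.vs.subspace_diff[OF \<Delta>sub y])
    then obtain w c where w: "w \<in> pr.R.Pspan z" "(0, y - y') = w + pr.scp c (pr.actp sm z)"
      unfolding \<Delta>eq pr.R.Pspan_sm_def by auto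
    obtain g where g: "w = (g, \<phi> g)" "g \<in> Ind0" using w(1) PG by (cases w) (auto simp: \<Gamma>_def)
    have "0 = g + fscale c (ind_act sm \<phi>0)" using w(2) by (simp add: g z_def)
    \<comment> \<open>Evaluation of the first component at \<open>mone\<close> isolates
      \<open>c\<close>, since \<open>g\<close> vanishes there and \<open>ind_act sm \<phi>0\<close>
      takes the value 1.\<close>
    then have "(0 :: 'f mat2 \<Rightarrow> 'k) mone = (g + fscale c (ind_act sm \<phi>0)) mone" by (rule arg_cong)
    then have "c = 0" using g(2) sm_\<phi>0_mone by (simp add: fscale_def)
    then have "(0, y - y') = (g, \<phi> g)" using w(2) g by (simp add: zero_prod_def)
    then have "g = 0" "y - y' = \<phi> g" by auto
    then show "y = y'" using zero by simp
  qed
  obtain \<psi> where \<psi>: "\<psi> \<in> hom fscale GL2 (Ind v \<chi>) ind_act sc' V' act'" "\<forall>f\<in>Ind v \<chi>. (f, \<psi> f) \<in> \<Delta>"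
    using pr.hom_of_Gstable[OF \<Delta>G ex] by blast
  have "\<psi> f = \<phi> f" if f: "f \<in> Ind0" for f
  proof -
    have "(f, \<phi> f) \<in> \<Delta>" unfolding \<Delta>_def using pr.R.Pspan_subset_Gspan[OF zR] \<Gamma>P[OF f] by blast
    then show ?thesis using \<psi>(2) ex f by blast
  qed
  then show ?thesis using \<psi>(1) by blast
qed

text \<open>\<open>Ind\<close> is spanned by \<open>Ind0\<close> and the vector
  \<open>ind_act sm \<phi>0\<close>, whose image under a \<open>G\<close>-map is determined by that
  of \<open>\<phi>0\<close>.\<close>

lemma hom_eq_on_Ind0:
  assumes \<psi>: "\<psi> \<in> hom fscale GL2 (Ind v \<chi>) ind_act sc' V' act'" "\<psi>' \<in> hom fscale GL2 (Ind v \<chi>) ind_act sc' V' act'"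
    and eq: "\<And>f. f \<in> Ind0 \<Longrightarrow> \<psi> f = \<psi>' f"
  shows "\<psi> = \<psi>'"
proof
  fix f
  show "\<psi> f = \<psi>' f"
  proof (cases "f \<in> Ind v \<chi>")
    case True
    define f0 where "f0 = f - fscale (f mone) (ind_act sm \<phi>0)"
    have f0: "f0 \<in> Ind0" unfolding f0_def by (rule Ind_eq_Ind0_plus[OF True])
    have feq: "f = f0 + fscale (f mone) (ind_act sm \<phi>0)" by (simp add: f0_def)
    have smI: "ind_act sm \<phi>0 \<in> Ind v \<chi>" "fscale (f mone) (ind_act sm \<phi>0) \<in> Ind v \<chi>" using \<phi>0_Ind Ind_fscale by auto
    have "\<psi> \<phi>0 = \<psi>' \<phi>0" using eq \<phi>0_Ind by simp
    then have "\<psi> (ind_act sm \<phi>0) = \<psi>' (ind_act sm \<phi>0)"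
      using homD(4)[OF \<psi>(1) _ \<phi>0_Ind, of sm] homD(4)[OF \<psi>(2) _ \<phi>0_Ind, of sm] by simp
    then have "\<psi> (f0 + fscale (f mone) (ind_act sm \<phi>0)) = \<psi>' (f0 + fscale (f mone) (ind_act sm \<phi>0))"
      using homD(2)[OF \<psi>(1) _ smI(2), of f0] homD(2)[OF \<psi>(2) _ smI(2), of f0]
        homD(3)[OF \<psi>(1) smI(1)] homD(3)[OF \<psi>(2) smI(1)] eq[OF f0] f0 by simp
    then show ?thesis using feq by metis
  qed (use homD(5)[OF \<psi>(1)] homD(5)[OF \<psi>(2)] in simp)
qed

lemma restrict0_hom:
  assumes \<phi>: "\<phi> \<in> hom fscale Bor (Ind v \<chi>) ind_act sc' V' act'"
  shows "restrict0 Ind0 \<phi> \<in> hom fscale Bor Ind0 ind_act sc' V' act'"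
proof -
  have r: "restrict0 Ind0 \<phi> f = \<phi> f" if "f \<in> Ind0" for f using that by (simp add: restrict0_def)
  note sub = ind.Pstable_subspace[OF Ind0_Pstable]
  show ?thesis
  proof (rule homI)
    show "restrict0 Ind0 \<phi> x \<in> V'" if "x \<in> Ind0" for x using r[OF that] homD(1)[OF \<phi>] that by simp
    show "restrict0 Ind0 \<phi> (x + y) = restrict0 Ind0 \<phi> x + restrict0 Ind0 \<phi> y" if "x \<in> Ind0" "y \<in> Ind0" for x y
      using r[OF sm.vs.subspace_add[OF sub that]] r[OF that(1)] r[OF that(2)] homD(2)[OF \<phi>] that by simp
    show "restrict0 Ind0 \<phi> (fscale c x) = sc' c (restrict0 Ind0 \<phi> x)" if "x \<in> Ind0" for x c
      using r[OF sm.vs.subspace_scale[OF sub that]] r[OF that] homD(3)[OF \<phi>] that by simp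
    show "restrict0 Ind0 \<phi> (ind_act g x) = act' g (restrict0 Ind0 \<phi> x)" if "g \<in> Bor" "x \<in> Ind0" for g x
      using r[OF ind.Pstable_act[OF Ind0_Pstable that]] r[OF that(2)] homD(4)[OF \<phi>] that by simp
  qed (simp only: restrict0_def if_False)
qed

text \<open>For the trivial character the constants are a complement of \<open>Ind0\<close>, which
  is therefore a model of the restriction of \<open>Sp\<close> to \<open>P\<close>.\<close>

lemma restrict0_bij:
  "bij_betw (restrict0 Ind0) (hom fscale GL2 (Ind v \<chi>) ind_act sc' V' act') (hom fscale Bor Ind0 ind_act sc' V' act')"
proof (rule bij_betw_imageI)
  have r: "restrict0 Ind0 \<psi> f = \<psi> f" if "f \<in> Ind0" for \<psi> :: "('f mat2 \<Rightarrow> 'k) \<Rightarrow> 'w" and f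
    using that by (simp add: restrict0_def)
  show "inj_on (restrict0 Ind0) (hom fscale GL2 (Ind v \<chi>) ind_act sc' V' act')"
  proof (rule inj_onI)
    fix \<psi> \<psi>' assume h: "\<psi> \<in> hom fscale GL2 (Ind v \<chi>) ind_act sc' V' act'"
      "\<psi>' \<in> hom fscale GL2 (Ind v \<chi>) ind_act sc' V' act'" and eq: "restrict0 Ind0 \<psi> = restrict0 Ind0 \<psi>'"
    show "\<psi> = \<psi>'"
    proof (rule hom_eq_on_Ind0[OF h])
      fix f assume f: "f \<in> Ind0"
      show "\<psi> f = \<psi>' f" using r[OF f, of \<psi>] r[OF f, of \<psi>'] eq by (simp only:)
    qed
  qed
  have "restrict0 Ind0 \<psi> \<in> hom fscale Bor Ind0 ind_act sc' V' act'"
    if "\<psi> \<in> hom fscale GL2 (Ind v \<chi>) ind_act sc' V' act'" for \<psi>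
    by (rule restrict0_hom[OF hom_mono[OF Bor_subset_GL2 that]])
  moreover have "\<exists>\<psi>\<in>hom fscale GL2 (Ind v \<chi>) ind_act sc' V' act'. \<phi> = restrict0 Ind0 \<psi>"
    if \<phi>: "\<phi> \<in> hom fscale Bor Ind0 ind_act sc' V' act'" for \<phi>
  proof -
    obtain \<psi> where \<psi>: "\<psi> \<in> hom fscale GL2 (Ind v \<chi>) ind_act sc' V' act'" "\<forall>f\<in>Ind0. \<psi> f = \<phi> f"
      using extend_from_Ind0[OF \<phi>] by blast
    have "\<phi> f = restrict0 Ind0 \<psi> f" for f
    proof (cases "f \<in> Ind0")
      case True then show ?thesis using r[OF True] \<psi>(2) by simp
    next
      case False then show ?thesis using homD(5)[OF \<phi> False] by (simp only: restrict0_def if_False)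
    qed
    then show ?thesis using \<psi>(1) by blast
  qed
  ultimately show "restrict0 Ind0 ` hom fscale GL2 (Ind v \<chi>) ind_act sc' V' act' = hom fscale Bor Ind0 ind_act sc' V' act'"
    by blast
qed

text \<open>A \<open>P\<close>-eigenvector in a smooth representation is fixed by all unipotent matrices, hence by an element
  normalizing the torus and exchanging its two entries.\<close>

lemma eigenvector_symmetric:
  assumes y: "y \<in> V'" "y \<noteq> 0" and eig: "\<And>a b d. a \<noteq> 0 \<Longrightarrow> d \<noteq> 0 \<Longrightarrow> act' (a,b,0,d) y = sc' (\<chi> a d) y"
    and ad: "a \<noteq> 0" "d \<noteq> 0"
  shows "\<chi> a d = \<chi> d a"
proof -
  obtain n where n: "n > 0" "\<forall>g\<in>Kcong v n. act' g y = y" using B.smooth[OF y(1)] by blast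
  \<comment> \<open>Small enough for the lower unipotent matrix with entry \<open>c\<close> to fix
    \<open>y\<close>; two such factors around \<open>um (- (1 / c))\<close> produce the antidiagonal
    matrix \<open>w\<close>.\<close>
  define c where "c = \<pi> ^ n"
  have c0: "c \<noteq> 0" by (simp add: c_def)
  define l :: "'f mat2" where "l = (1, 0, c, 1)"
  have "l \<in> Kcong v n" using ip_powi[of "int n" "int n"] by (simp add: l_def c_def)
  then have l: "act' l y = y" "l \<in> GL2" using n by (auto simp: l_def)
  define w :: "'f mat2" where "w = (0, - (1 / c), c, 0)"
  have w: "w = mmul l (mmul (um (- (1 / c))) l)" using c0 by (simp add: w_def l_def)
  have wG: "w \<in> GL2" using c0 by (simp add: w_def)
  have "act' (um (- (1 / c))) y = y" using eig[of 1 1] by simp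
  then have wy: "act' w y = y" unfolding w using l y(1) by (simp add: B.act_mmul)
  have "act' (dm a d) (act' w y) = act' w (act' (dm d a) y)"
    by (rule B.act_eqI) (use ad wG y in \<open>auto simp: w_def\<close>)
  then have "sc' (\<chi> a d) y = sc' (\<chi> d a) y"
    using wy eig[of a d 0] eig[of d a 0] ad y wG by (simp add: B.act_sc)
  then show ?thesis using y(2) by simp
qed

text \<open>The restriction to \<open>Ind0\<close> extends to a \<open>G\<close>-map \<psi>, and
  \<phi> - \<psi> factors through evaluation at \<open>mone\<close>. It is thus given by a vector
  \<open>y\<close> on which \<open>P\<close> acts by \<chi>, and
  \<open>eigenvector_symmetric\<close> makes this vector zero.\<close>

lemma hom_Bor_Ind_equivariant:
  assumes \<phi>: "\<phi> \<in> hom fscale Bor (Ind v \<chi>) ind_act sc' V' act'" and ns: "a \<noteq> 0" "d \<noteq> 0" "\<chi> a d \<noteq> \<chi> d a"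
  shows "\<phi> \<in> hom fscale GL2 (Ind v \<chi>) ind_act sc' V' act'"
proof -
  have r: "restrict0 Ind0 \<phi> f = \<phi> f" if "f \<in> Ind0" for f using that by (simp add: restrict0_def)
  obtain \<psi> where \<psi>: "\<psi> \<in> hom fscale GL2 (Ind v \<chi>) ind_act sc' V' act'" "\<forall>f\<in>Ind0. \<psi> f = restrict0 Ind0 \<phi> f"
    using extend_from_Ind0[OF restrict0_hom[OF \<phi>]] by blast
  have eq0: "\<phi> f = \<psi> f" if "f \<in> Ind0" for f using \<psi>(2) r[OF that] that by simp
  define e where "e = ind_act sm \<phi>0"
  have eI: "e \<in> Ind v \<chi>" using \<phi>0_Ind by (simp add: e_def)
  define y where "y = \<phi> e - \<psi> e"
  have yV: "y \<in> V'" using homD(1)[OF \<phi> eI] homD(1)[OF \<psi>(1) eI] by (simp add: y_def)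
  have \<delta>: "\<phi> f - \<psi> f = sc' (f mone) y" if f: "f \<in> Ind v \<chi>" for f
  proof -
    define f0 where "f0 = f - fscale (f mone) e"
    have f0: "f0 \<in> Ind0" unfolding f0_def e_def by (rule Ind_eq_Ind0_plus[OF f])
    have f0I: "f0 \<in> Ind v \<chi>" "fscale (f mone) e \<in> Ind v \<chi>" using f0 eI Ind_fscale by auto
    have "\<phi> (f0 + fscale (f mone) e) - \<psi> (f0 + fscale (f mone) e) = sc' (f mone) y"
      using homD(2)[OF \<phi> f0I] homD(2)[OF \<psi>(1) f0I] homD(3)[OF \<phi> eI] homD(3)[OF \<psi>(1) eI] eq0[OF f0]
      by (simp add: y_def B.vs.scale_right_diff_distrib)
    moreover have "f0 + fscale (f mone) e = f" by (simp add: f0_def)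
    ultimately show ?thesis by metis
  qed
  have "act' (a,b,0,d) y = sc' (\<chi> a d) y" if ad: "a \<noteq> 0" "d \<noteq> 0" for a b d
  proof -
    have B: "(a,b,0,d) \<in> Bor" using ad by simp
    have "act' (a,b,0,d) y = \<phi> (ind_act (a,b,0,d) e) - \<psi> (ind_act (a,b,0,d) e)"
      using homD(4)[OF \<phi> B eI] homD(4)[OF \<psi>(1) Bor_GL2[OF B] eI] homD(1)[OF \<phi> eI] homD(1)[OF \<psi>(1) eI]
        Bor_GL2[OF B] by (simp add: y_def B.act_diff del: in_GL2)
    also have "\<dots> = sc' (ind_act (a,b,0,d) e mone) y" by (rule \<delta>) (use eI Bor_GL2[OF B] in \<open>simp del: in_GL2\<close>)
    also have "ind_act (a,b,0,d) e mone = \<chi> a d" using ind_act_Bor_mone[OF ad eI] sm_\<phi>0_mone by (simp add: e_def)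
    finally show ?thesis .
  qed
  then have "y = 0" using eigenvector_symmetric[OF yV] ns by blast
  then have "\<phi> f = \<psi> f" for f
    using \<delta>[of f] homD(5)[OF \<phi>, of f] homD(5)[OF \<psi>(1), of f] by (cases "f \<in> Ind v \<chi>") auto
  then have "\<phi> = \<psi>" by blast
  then show ?thesis using \<psi>(1) by simp
qed

end

subsection \<open>Representations irreducible over \<open>P\<close>\<close>

context gl2_rep
begin

text \<open>A multiplicative \<open>h\<close> is a character of \<open>G\<close>. Being trivial on
  upper and lower unipotent matrices it factors through the determinant, and multiplication by it
  identifies the twist of \<open>Ind v triv_char\<close> with \<open>Ind v \<chi>\<close>, constants
  corresponding to multiples of \<open>h\<close>.\<close>

lemma special_of_quotient:
  assumes \<chi>: "smooth_charT v \<chi>" and h: "h \<in> Ind v \<chi>" "h mone = 1"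
    and eig: "\<And>x g. x \<in> GL2 \<Longrightarrow> g \<in> GL2 \<Longrightarrow> h (mmul x g) = h x * h g"
    and \<Psi>: "\<Psi> \<in> hom fscale GL2 (Ind v \<chi>) ind_act sc V act" "\<Psi> ` Ind v \<chi> = V"
    and ker: "\<And>f. f \<in> Ind v \<chi> \<Longrightarrow> \<Psi> f = 0 \<longleftrightarrow> (\<exists>c. f = fscale c h)"
  shows "special_series v sc V act"
proof -
  interpret I: ind_char v p \<pi> \<chi> by unfold_locales (use \<chi> alg_closure in auto)
  have triv: "smooth_charT v (triv_char :: 'f \<Rightarrow> 'f \<Rightarrow> 'k)"
    unfolding smooth_charT_def triv_char_def using zero_less_one by auto
  interpret T: ind_char v p \<pi> "triv_char :: 'f \<Rightarrow> 'f \<Rightarrow> 'k" by unfold_locales (use triv alg_closure in auto)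
  define \<psi> where "\<psi> a = \<chi> a 1" for a
  have hB: "h (a,b,0,d) = \<chi> a d" if "a \<noteq> 0" "d \<noteq> 0" for a b d
    using I.Ind_Bor_mone[OF h(1) that, of b] h(2) by simp
  have h0: "h g \<noteq> 0" if "g \<in> GL2" for g
    using eig[OF that minv_GL2[OF that]] minv(1)[OF that] h(2) by auto
  have hsm: "h sm * h sm = 1" using eig[of sm sm] h(2) by (simp add: mone_def)
  have conj: "h (mmul sm (mmul g sm)) = h g" if "g \<in> GL2" for g
    using eig[of sm "mmul g sm"] eig[of g sm] hsm that by (simp add: mult_ac del: mmul_simp)
  have hu: "h (um b) = 1" for b using hB[of 1 1 b] by simp
  have hl: "h (1,0,c,1) = 1" for c using conj[of "um c"] hu[of c] by simp
  have \<psi>m: "\<psi> (a * b) = \<psi> a * \<psi> b" if "a \<noteq> 0" "b \<noteq> 0" for a b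
    using I.\<chi>_mult[of a 1 b 1] that by (simp add: \<psi>_def)
  have h\<chi>: "\<chi> a d = \<psi> (a * d)" if ad: "a \<noteq> 0" "d \<noteq> 0" for a d
  proof -
    have "\<chi> 1 d = \<psi> d" using conj[of "dm d 1"] hB[of d 1 0] hB[of 1 d 0] ad by (simp add: \<psi>_def)
    then show ?thesis using I.\<chi>_mult[of a 1 1 d] \<psi>m[OF ad] ad by (simp add: \<psi>_def)
  qed
  have hsm': "h sm = \<psi> (- 1)"
  proof -
    \<comment> \<open>\<open>sm\<close> as a diagonal matrix times unipotent ones, so that its value
      under \<open>h\<close> reduces to that of \<open>dm 1 (- 1)\<close>.\<close>
    define m where "m = mmul (dm 1 (- 1)) (mmul (um 1) (mmul (1,0,- 1,1) (um (1 :: 'f))))"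
    have "sm = m" by (simp add: m_def)
    moreover have "h m = h (dm 1 (- 1)) * (h (um 1) * (h (1,0,- 1,1) * h (um 1)))"
      unfolding m_def by (subst eig; simp add: eig del: mmul_simp)+
    ultimately have "h sm = h (dm 1 (- 1))" by (simp only: hu hl mult_1_right)
    moreover have "h (dm 1 (- 1)) = \<chi> 1 (- 1)" by (rule hB) auto
    moreover have "\<chi> 1 (- 1) = \<psi> (1 * (- 1))" by (rule h\<chi>) auto
    ultimately show ?thesis by (simp only: mult_1_left)
  qed
  have hdet: "h g = \<psi> (mdet g)" if g: "g \<in> GL2" for g
  proof -
    obtain a b c d where abcd: "g = (a,b,c,d)" by (cases g)
    show ?thesis
    proof (cases "c = 0")
      case True
      then have "a \<noteq> 0" "d \<noteq> 0" using g by (auto simp: abcd)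
      then show ?thesis using hB h\<chi> True by (simp add: abcd)
    next
      case False
      have dc: "g = mmul ((b*c - a*d) / c, a, 0, c) (mmul sm (um (d / c)))" "(b*c - a*d) / c \<noteq> 0"
        using I.Ind_decomp(2)[of a b c d] g False by (auto simp: abcd)
      have B: "((b*c - a*d) / c, a, 0, c) \<in> GL2" using dc False by simp
      have "h g = h ((b*c - a*d) / c, a, 0, c) * (h sm * h (um (d / c)))"
        unfolding dc(1) using B by (subst eig; simp add: eig del: mmul_simp)+
      also have "h ((b*c - a*d) / c, a, 0, c) = \<psi> (b*c - a*d)" using hB[of "(b*c - a*d) / c" c a] h\<chi>[OF dc(2) False] dc False by simp
      also have "h sm * h (um (d / c)) = \<psi> (- 1)" using hsm' hu by simp
      also have "\<psi> (b*c - a*d) * \<psi> (- 1) = \<psi> ((b*c - a*d) * (- 1))" using \<psi>m[of "b*c - a*d" "- 1"] dc(2) by simp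
      finally show ?thesis by (simp add: abcd)
    qed
  qed
  have sm\<psi>: "smooth_char1 v \<psi>"
    unfolding smooth_char1_def
  proof (intro conjI allI impI)
    show "\<psi> x \<noteq> 0" if "x \<noteq> 0" for x using I.\<chi>_nonzero[of x 1] that by (simp add: \<psi>_def)
    show "\<exists>n>0. \<forall>x. x \<noteq> 0 \<longrightarrow> ip (int n) (x - 1) \<longrightarrow> \<psi> x = 1"
      using I.\<chi>_one_units[of _ 1] by (intro exI[of _ 1]) (auto simp: \<psi>_def)
  qed (rule \<psi>m)
  define times where "times F = (\<lambda>g. F g * h g)" for F :: "'f mat2 \<Rightarrow> 'k"
  have times_Ind: "times F \<in> Ind v \<chi>" if F: "F \<in> Ind v triv_char" for F
  proof (rule I.Ind_I)
    show "times F g = 0" if "g \<notin> GL2" for g using T.Ind_outside[OF F that] by (simp add: times_def)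
    show "\<exists>n>0. \<forall>k\<in>Kcong v n. times F (mmul g k) = times F g" if g: "g \<in> GL2" for g
    proof -
      obtain n m where nm: "n > 0" "\<forall>k\<in>Kcong v n. F (mmul g k) = F g" "m > 0" "\<forall>k\<in>Kcong v m. h (mmul g k) = h g"
        using T.Ind_loc_const[OF F g] I.Ind_loc_const[OF h(1) g] by meson
      have "Kcong v (max n m) \<subseteq> Kcong v n" "Kcong v (max n m) \<subseteq> Kcong v m" by (intro Kcong_mono; simp)+
      then have "\<forall>k\<in>Kcong v (max n m). times F (mmul g k) = times F g" using nm unfolding times_def by (metis subsetD)
      then show ?thesis using nm(1) by (intro exI[of _ "max n m"]) simp
    qed
    show "times F (mmul (a,b,0,d) g) = \<chi> a d * times F g" if "g \<in> GL2" "a \<noteq> 0" "d \<noteq> 0" for g a b d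
      using T.Ind_equiv[OF F that, of b] I.Ind_equiv[OF h(1) that, of b] by (simp add: times_def triv_char_def del: mmul_simp)
  qed
  have times_surj: "\<exists>F\<in>Ind v triv_char. f = times F" if f: "f \<in> Ind v \<chi>" for f
  proof -
    define F where "F = (\<lambda>g. if g \<in> GL2 then f g / h g else 0)"
    have "F \<in> Ind v triv_char"
    proof (rule T.Ind_I)
      show "F g = 0" if "g \<notin> GL2" for g using that by (simp add: F_def)
      show "\<exists>n>0. \<forall>k\<in>Kcong v n. F (mmul g k) = F g" if g: "g \<in> GL2" for g
      proof -
        obtain n m where nm: "n > 0" "\<forall>k\<in>Kcong v n. f (mmul g k) = f g" "m > 0" "\<forall>k\<in>Kcong v m. h (mmul g k) = h g"
          using I.Ind_loc_const[OF f g] I.Ind_loc_const[OF h(1) g] by meson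
        have sub: "Kcong v (max n m) \<subseteq> Kcong v n" "Kcong v (max n m) \<subseteq> Kcong v m" by (intro Kcong_mono; simp)+
        have "F (mmul g k) = F g" if k: "k \<in> Kcong v (max n m)" for k
        proof -
          have "f (mmul g k) = f g" "h (mmul g k) = h g" "k \<in> GL2"
            using nm sub k Kcong_GL2[OF nm(1)] by blast+
          then show ?thesis using g by (simp add: F_def)
        qed
        then show ?thesis using nm(1) by (intro exI[of _ "max n m"]) simp
      qed
      show "F (mmul (a,b,0,d) g) = triv_char a d * F g" if "g \<in> GL2" "a \<noteq> 0" "d \<noteq> 0" for g a b d
      proof -
        have "mmul (a,b,0,d) g \<in> GL2" using that by (intro mmul_GL2) auto
        then show ?thesis
          using that I.Ind_equiv[OF f that, of b] I.Ind_equiv[OF h(1) that, of b] I.\<chi>_nonzero[OF that(2,3)]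
          by (simp add: F_def triv_char_def del: mmul_simp)
      qed
    qed
    moreover have "f = times F" using h0 I.Ind_outside[OF f] by (auto simp: times_def F_def)
    ultimately show ?thesis by blast
  qed
  define \<Phi> where "\<Phi> F = (if F \<in> Ind v triv_char then \<Psi> (times F) else 0)" for F
  have \<Phi>: "\<Phi> \<in> hom fscale GL2 (Ind v triv_char) (tw_act \<psi>) sc V act"
  proof (rule homI)
    show "\<Phi> F \<in> V" if "F \<in> Ind v triv_char" for F using homD(1)[OF \<Psi>(1) times_Ind[OF that]] that by (simp add: \<Phi>_def)
    show "\<Phi> (F + F') = \<Phi> F + \<Phi> F'" if "F \<in> Ind v triv_char" "F' \<in> Ind v triv_char" for F F'
    proof -
      have "times (F + F') = times F + times F'" by (auto simp: times_def algebra_simps)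
      then show ?thesis using that T.Ind_add homD(2)[OF \<Psi>(1) times_Ind times_Ind] by (simp add: \<Phi>_def)
    qed
    show "\<Phi> (fscale c F) = sc c (\<Phi> F)" if "F \<in> Ind v triv_char" for F c
    proof -
      have "times (fscale c F) = fscale c (times F)" by (auto simp: times_def fscale_def algebra_simps)
      then show ?thesis using that T.Ind_fscale homD(3)[OF \<Psi>(1) times_Ind] by (simp add: \<Phi>_def)
    qed
    show "\<Phi> (tw_act \<psi> g F) = act g (\<Phi> F)" if g: "g \<in> GL2" and F: "F \<in> Ind v triv_char" for g F
    proof -
      have "tw_act \<psi> g F = fscale (\<psi> (mdet g)) (ind_act g F)" by (auto simp: tw_act_def fscale_def ind_act_def)
      then have tI: "tw_act \<psi> g F \<in> Ind v triv_char" using T.Ind_fscale T.Ind_act[OF F g] by simp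
      have "times (tw_act \<psi> g F) x = ind_act g (times F) x" for x
      proof (cases "x \<in> GL2")
        case True
        then show ?thesis using eig[OF True g] hdet[OF g] by (simp add: times_def tw_act_def ind_act_def)
      qed (simp add: times_def tw_act_def ind_act_def)
      then have "times (tw_act \<psi> g F) = ind_act g (times F)" by blast
      then show ?thesis using tI F homD(4)[OF \<Psi>(1) g times_Ind[OF F]] by (simp add: \<Phi>_def)
    qed
  qed (simp add: \<Phi>_def)
  have "\<Phi> ` Ind v triv_char = V"
  proof
    show "\<Phi> ` Ind v triv_char \<subseteq> V" using homD(1)[OF \<Phi>] by blast
    show "V \<subseteq> \<Phi> ` Ind v triv_char"
    proof
      fix x assume "x \<in> V"
      then obtain f where f: "f \<in> Ind v \<chi>" "x = \<Psi> f" using \<Psi>(2) by blast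
      then obtain F where "F \<in> Ind v triv_char" "f = times F" using times_surj by blast
      then show "x \<in> \<Phi> ` Ind v triv_char" using f by (intro image_eqI[of _ _ F]) (auto simp: \<Phi>_def)
    qed
  qed
  moreover have "\<Phi> F = 0 \<longleftrightarrow> (\<exists>c. \<forall>g\<in>GL2. F g = c)" if F: "F \<in> Ind v triv_char" for F
  proof -
    have 1: "\<Phi> F = 0 \<longleftrightarrow> (\<exists>c. times F = fscale c h)" using F ker[OF times_Ind[OF F]] by (simp add: \<Phi>_def)
    have "times F = fscale c h \<longleftrightarrow> (\<forall>g\<in>GL2. F g = c)" for c
    proof
      assume *: "times F = fscale c h"
      show "\<forall>g\<in>GL2. F g = c"
      proof
        fix g :: "'f mat2" assume g: "g \<in> GL2"
        have "F g * h g = c * h g" using fun_cong[OF *, of g] by (simp add: times_def fscale_def)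
        then show "F g = c" using h0[OF g] by simp
      qed
    next
      assume *: "\<forall>g\<in>GL2. F g = c"
      show "times F = fscale c h"
      proof
        fix g
        show "times F g = fscale c h g"
          using * I.Ind_outside[OF h(1), of g] by (cases "g \<in> GL2") (auto simp: times_def fscale_def)
      qed
    qed
    then show ?thesis using 1 by simp
  qed
  ultimately show ?thesis
    unfolding special_series_def using sm\<psi> \<Phi> by (intro exI[of _ \<psi>] conjI bexI[of _ \<Phi>]) auto
qed

end

context gl2_central
begin

text \<open>If no polynomial in \<open>U\<close> annihilates \<open>z\<close>, the translates of \<open>z\<close> under \<open>P\<close> are as independent as
  possible, so the augmentation is a functional which vanishes on \<open>U z\<close> but not on \<open>z\<close>.\<close>

lemma exists_eigen_of_irred_Pspan:
  assumes \<Gamma>: "Pstable \<Gamma>" "\<And>W. Pstable W \<Longrightarrow> W \<subseteq> \<Gamma> \<Longrightarrow> W = {0} \<or> W = \<Gamma>" and z: "z \<in> \<Gamma>" "z \<noteq> 0" "z \<in> teig \<theta>"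
  shows "\<exists>\<alpha> x. x \<in> \<Gamma> \<and> x \<noteq> 0 \<and> x \<in> teig \<theta> \<and> U x = sc \<alpha> x"
proof -
  have zV: "z \<in> V" and zI: "z \<in> fixed I1" using z teigD by blast+
  have zu: "act (um b) z = z" if "ip 0 b" for b by (rule fixedD(2)[OF zI]) (use that in simp)
  define \<sigma> where "\<sigma> = range (\<lambda>c. sc c z)"
  define l where "l x = (THE c. x = sc c z)" for x
  have lz: "l (sc c z) = c" for c unfolding l_def by (rule the_equality) (use z(2) in auto)
  obtain \<chi> where \<chi>: "\<forall>g\<in>Bor. \<forall>h\<in>Bor. \<chi> (mmul g h) = \<chi> g * \<chi> h" "\<chi> mone = 1"
    "\<forall>a b d. (a,b,0,d) \<in> P0 \<longrightarrow> \<chi> (a,b,0,d) = \<omega> d * \<theta> (a / d)" "\<forall>r. \<chi> (\<pi>, r, 0, 1) = 1"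
    using exists_Bor_character[OF zV z(2) teigD(3)[OF z(3)]] by blast
  have P0z: "act g z = sc (\<chi> g) z" if g: "g \<in> P0" for g
  proof -
    obtain a b d where abd: "g = (a,b,0,d)" using BorE[OF P0_Bor[OF g]] by metis
    have nz: "a \<noteq> 0" "d \<noteq> 0" and u: "unt (a / d)" "ip 0 (b / d)" using g by (auto simp: abd)
    have "act g z = act (mmul (mmul (dm d d) (um (b / d))) (dm (a / d) 1)) z" using nz by (simp add: abd)
    also have "\<dots> = act (dm d d) (act (um (b / d)) (act (dm (a / d) 1) z))"
      using nz zV by (subst act_mmul; simp add: act_mmul del: mmul_simp)+
    also have "\<dots> = sc (\<omega> d * \<theta> (a / d)) z"
      using teigD(3)[OF z(3) u(1)] zu[OF u(2)] zV nz by (simp add: act_sc central mult.commute)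
    also have "\<omega> d * \<theta> (a / d) = \<chi> g" using \<chi>(3) g unfolding abd by metis
    finally show ?thesis .
  qed
  define W where "W = vs.span (\<Union>g\<in>Bor. act g ` \<sigma>)"
  have "(\<exists>q. q \<noteq> 0 \<and> polyop sc q U z = 0) \<or>
    (\<exists>L. (\<forall>x\<in>W. \<forall>y\<in>W. L (x + y) = L x + L y) \<and> (\<forall>c. \<forall>x\<in>W. L (sc c x) = c * L x)
      \<and> (\<forall>g\<in>Bor. \<forall>x\<in>W. L (act g x) = \<chi> g * L x) \<and> (\<forall>x\<in>\<sigma>. L x = l x))"
    unfolding W_def
  proof (rule disc_dichotomy)
    show "vs.subspace \<sigma>"
    proof (rule vs.subspaceI)
      have "sc 0 z \<in> \<sigma>" unfolding \<sigma>_def by blast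
      then show "0 \<in> \<sigma>" by simp
      show "x + y \<in> \<sigma>" if "x \<in> \<sigma>" "y \<in> \<sigma>" for x y
        using that by (auto simp: \<sigma>_def vs.scale_left_distrib[symmetric])
      show "sc c x \<in> \<sigma>" if "x \<in> \<sigma>" for c x using that by (auto simp: \<sigma>_def)
    qed
    show "\<sigma> \<subseteq> V" using zV by (auto simp: \<sigma>_def)
    show "act g x \<in> \<sigma>" if "g \<in> P0" "x \<in> \<sigma>" for g x
      using that P0z[OF that(1)] act_sc[OF Bor_GL2[OF P0_Bor[OF that(1)]] zV] by (auto simp: \<sigma>_def)
    show "act (um b) x = x" if "ip 1 b" "x \<in> \<sigma>" for b x
      using that zu[of b] ip_mono[of 1 b 0] zV by (auto simp: \<sigma>_def act_sc)
    show "\<exists>c. x = sc c z" if "x \<in> \<sigma>" for x using that by (auto simp: \<sigma>_def)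
    show "l (x + y) = l x + l y" if "x \<in> \<sigma>" "y \<in> \<sigma>" for x y
      using that lz by (auto simp: \<sigma>_def vs.scale_left_distrib[symmetric])
    show "l (sc c x) = c * l x" if "x \<in> \<sigma>" for c x using that lz by (auto simp: \<sigma>_def)
    show "l (act g x) = \<chi> g * l x" if "g \<in> P0" "x \<in> \<sigma>" for g x
      using that P0z[OF that(1)] act_sc[OF Bor_GL2[OF P0_Bor[OF that(1)]] zV] lz by (auto simp: \<sigma>_def mult.commute)
  qed (use zV zu \<chi> in auto)
  then show ?thesis
  proof
    assume "\<exists>q. q \<noteq> 0 \<and> polyop sc q U z = 0"
    then show ?thesis using eigenvector_of_relation[OF \<Gamma>(1) z] by blast
  next
    assume "\<exists>L. (\<forall>x\<in>W. \<forall>y\<in>W. L (x + y) = L x + L y) \<and> (\<forall>c. \<forall>x\<in>W. L (sc c x) = c * L x)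
      \<and> (\<forall>g\<in>Bor. \<forall>x\<in>W. L (act g x) = \<chi> g * L x) \<and> (\<forall>x\<in>\<sigma>. L x = l x)"
    then obtain L where L: "\<And>x y. x \<in> W \<Longrightarrow> y \<in> W \<Longrightarrow> L (x + y) = L x + L y" "\<And>c x. x \<in> W \<Longrightarrow> L (sc c x) = c * L x"
      "\<And>g x. g \<in> Bor \<Longrightarrow> x \<in> W \<Longrightarrow> L (act g x) = \<chi> g * L x" "\<And>x. x \<in> \<sigma> \<Longrightarrow> L x = l x" by blast
    have z\<sigma>: "z \<in> \<sigma>" unfolding \<sigma>_def by (rule range_eqI[of _ _ 1]) simp
    have gW: "act g z \<in> W" if "g \<in> Bor" for g unfolding W_def by (rule vs.span_base) (use that z\<sigma> in blast)
    have zW: "z \<in> W" using gW[of mone] zV by simp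
    have Wsub: "vs.subspace W" by (simp add: W_def)
    have W\<Gamma>: "W \<subseteq> \<Gamma>"
      unfolding W_def
    proof (rule vs.span_minimal[OF _ Pstable_subspace[OF \<Gamma>(1)]])
      show "(\<Union>g\<in>Bor. act g ` \<sigma>) \<subseteq> \<Gamma>"
        using z(1) \<Gamma>(1) vs.subspace_scale[OF Pstable_subspace[OF \<Gamma>(1)]] Pstable_act[OF \<Gamma>(1)] by (auto simp: \<sigma>_def)
    qed
    have WP: "Pspan z \<subseteq> W" unfolding Pspan_def using gW Wsub by (intro vs.span_minimal) auto
    have "Pspan z = \<Gamma>"
      using \<Gamma>(2)[OF Pspan_Pstable[OF zV]] Pspan_minimal[OF \<Gamma>(1) z(1)] Pspan_self[OF zV] z(2) by blast
    then have WG: "W = \<Gamma>" using WP W\<Gamma> by blast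
    \<comment> \<open>Irreducibility of \<Gamma> makes the kernel of \<open>L\<close> zero, because
      \<open>L z\<close> is 1.\<close>
    define K where "K = {x \<in> W. L x = 0}"
    have L0: "L 0 = 0" using L(2)[OF zW, of 0] by simp
    have "Pstable K"
      using \<Gamma>(1) L0 L(1-3) vs.subspace_0[OF Wsub] vs.subspace_add[OF Wsub] vs.subspace_scale[OF Wsub]
      unfolding WG by (auto simp: Pstable_def K_def WG intro!: vs.subspaceI)
    moreover have "K \<subseteq> \<Gamma>" using WG by (auto simp: K_def)
    moreover have "L z = 1" using L(4)[OF z\<sigma>] lz[of 1] by simp
    then have "z \<notin> K" by (simp add: K_def)
    then have "K \<noteq> \<Gamma>" using z(1) by blast
    ultimately have K0: "K = {0}" using \<Gamma>(2) by blast
    \<comment> \<open>Each term of \<open>U z\<close> has the value 1 under \<open>L\<close>, so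
      \<open>L (U z)\<close> is the number of residue classes, which is 0 in the coefficient field;
      hence \<open>U z\<close> is zero and \<open>z\<close> is an eigenvector for the eigenvalue
      0.\<close>
    have "L (\<Sum>r\<in>I. act (\<pi>, r, 0, 1) z) = of_nat (card I) \<and> (\<Sum>r\<in>I. act (\<pi>, r, 0, 1) z) \<in> W" if "finite I" for I
      using that
    proof (induction I rule: finite_induct)
      case empty
      show ?case using L0 vs.subspace_0[OF Wsub] by simp
    next
      case (insert r I)
      have B: "(\<pi>, r, 0, 1) \<in> Bor" by simp
      have "L (act (\<pi>, r, 0, 1) z) = 1" using L(3)[OF B zW] \<chi>(4) \<open>L z = 1\<close> by simp
      then show ?case using insert L(1)[OF gW[OF B]] vs.subspace_add[OF Wsub gW[OF B]] by simp
    qed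
    from this[OF Rep(1)] have "U z \<in> K" by (simp add: U_def K_def of_nat_card_Rep)
    then have "U z = sc 0 z" using K0 by simp
    then show ?thesis using z by blast
  qed
qed

end

section \<open>Equivariance for representations irreducible over P\<close>

context rep_pair
begin

text \<open>The first projection makes the graph \<Gamma> irreducible over \<open>P\<close>. If
  \<Gamma> is not \<open>G\<close>-stable, it is a hyperplane in the \<open>G\<close>-span
  \<open>V1\<close> of an eigenvector, and \<open>V1\<close> is isomorphic to some
  \<open>Ind v \<chi>\<close>. The vectors of \<open>V1\<close> with first component 0 form a
  \<open>G\<close>-stable line, and \<open>V\<close> is the quotient by it.\<close>

lemma hom_Bor_equivariant:
  assumes irr: "irred sc Bor V act" and ns: "\<not> special_series v sc V act"
    and \<phi>: "\<phi> \<in> hom sc Bor V act sc' V' act'"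
  shows "\<phi> \<in> hom sc GL2 V act sc' V' act'"
proof -
  define \<Gamma> where "\<Gamma> = graph V \<phi>"
  have \<Gamma>: "R.Pstable \<Gamma>" unfolding \<Gamma>_def by (rule graph_Pstable[OF Pstable_V \<phi>])
  have irrP: "W = {0} \<or> W = V" if "Pstable W" for W using irr that unfolding irred_Bor_iff by blast
  have \<phi>0: "\<phi> 0 = 0" using homD(3)[OF \<phi>, of 0 0] by simp
  have Girr: "W = {0} \<or> W = \<Gamma>" if W: "R.Pstable W" "W \<subseteq> \<Gamma>" for W
  proof -
    have mem: "w = (fst w, \<phi> (fst w))" if "w \<in> W" for w using W(2) that by (cases w) (auto simp: \<Gamma>_def)
    have "0 \<in> W" by (rule R.vs.subspace_0[OF R.Pstable_subspace[OF W(1)]])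
    have "fst ` W = {0} \<or> fst ` W = V" by (rule irrP[OF fst_Pstable[OF W(1)]])
    then show ?thesis
    proof
      assume "fst ` W = {0}"
      then have "w = 0" if "w \<in> W" for w using mem[OF that] that \<phi>0 by (metis image_eqI singletonD zero_prod_def)
      then show ?thesis using \<open>0 \<in> W\<close> by blast
    next
      assume im: "fst ` W = V"
      have "x \<in> W" if "x \<in> \<Gamma>" for x
      proof -
        obtain u where u: "x = (u, \<phi> u)" "u \<in> V" using \<open>x \<in> \<Gamma>\<close> by (auto simp: \<Gamma>_def graph_def)
        then obtain w where w: "w \<in> W" "u = fst w" using im by blast
        then show ?thesis using mem[OF w(1)] u by simp
      qed
      then show ?thesis using W(2) by blast
    qed
  qed
  have hom_if_Gstable: "?thesis" if "R.Gstable \<Gamma>"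
    using Gstable_graph_equivariant[OF that[unfolded \<Gamma>_def] \<phi>] .
  obtain u where u: "u \<in> V" "u \<noteq> 0" using irr vs.subspace_0[OF subspace_V] unfolding irred_Bor_iff by blast
  then have "(u, \<phi> u) \<in> \<Gamma>" "(u, \<phi> u) \<noteq> 0" by (simp_all add: \<Gamma>_def zero_prod_def)
  then have "\<Gamma> \<noteq> {0}" by blast
  then obtain \<theta> x where x: "x \<in> \<Gamma>" "x \<noteq> 0" "x \<in> R.teig \<theta>" using R.exists_teig[OF \<Gamma>] by blast
  obtain \<alpha> z where z: "z \<in> \<Gamma>" "z \<noteq> 0" "z \<in> R.teig \<theta>" "R.U z = scp \<alpha> z"
    using R.exists_eigen_of_irred_Pspan[OF \<Gamma> Girr x] by blast
  have zR: "z \<in> R" using z(3) by (rule R.teigD)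
  have zI: "z \<in> R.fixed R.I1" using z(3) by (rule R.teigD)
  have P\<Gamma>: "R.Pspan z = \<Gamma>"
    using Girr[OF R.Pspan_Pstable[OF zR] R.Pspan_minimal[OF \<Gamma> z(1)]] R.Pspan_self[OF zR] z(2) by blast
  show ?thesis
  proof (cases "R.Gstable \<Gamma>")
    case True then show ?thesis by (rule hom_if_Gstable)
  next
    case nG: False
    have \<alpha>: "\<alpha> \<noteq> 0"
    proof
      assume "\<alpha> = 0"
      then have "R.U z = 0" using z(4) by simp
      then show False using R.U_zero_Gstable[OF zI] P\<Gamma> nG by simp
    qed
    define y where "y = actp sm z"
    have yR: "y \<in> R" unfolding y_def using R_act[of sm z] zR by simp
    have y\<Gamma>: "y \<notin> \<Gamma>" using R.Pspan_Gstable[OF zI] P\<Gamma> nG by (auto simp: y_def)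
    define V1 where "V1 = R.Gspan z"
    have V1: "R.Gstable V1" unfolding V1_def by (rule R.Gspan_Gstable[OF zR])
    have V1s: "R.vs.subspace V1" and V1R: "V1 \<subseteq> R" using V1 by (auto simp: R.Gstable_def)
    have \<Gamma>V1: "\<Gamma> \<subseteq> V1" unfolding V1_def using R.Pspan_subset_Gspan[OF zR] P\<Gamma> by simp
    have yV1: "y \<in> V1" unfolding V1_def y_def using R.Gspan_base[OF zR, of sm] by simp
    have hyp: "\<exists>c. w - scp c y \<in> \<Gamma>" if "w \<in> V1" for w
      using R.eigen_hyperplane[OF z(3,2,4) \<alpha>, of w] that P\<Gamma> by (simp add: V1_def y_def)
    obtain \<chi> E where \<chi>: "smooth_charT v \<chi>" and E: "E \<in> hom scp GL2 V1 actp fscale (Ind v \<chi>) ind_act"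
      and E0: "\<And>w. w \<in> V1 \<Longrightarrow> E w mone = 0 \<longleftrightarrow> w \<in> \<Gamma>"
      using R.hyperplane_embedding[OF V1 \<Gamma> \<Gamma>V1 yV1 y\<Gamma> hyp] by blast
    interpret I: ind_char v p \<pi> \<chi> by unfold_locales (use \<chi> alg_closure in auto)
    have V1st: "stable_sub scp GL2 actp V1" using R.stable_sub_iff(1)[OF V1R] V1 by simp
    have V1lin: "lin_subspace scp V1" using V1st by (simp add: stable_sub_def)
    note vsp = R.vs.vector_space_axioms I.vector_space_fscale
    have EZ: "E 0 = 0" using homD(3)[OF E R.vs.subspace_0[OF V1s], of 0] by (simp add: fscale_def fun_eq_iff)
    \<comment> \<open>The kernel of \<open>E\<close> is \<open>G\<close>-stable and inside \<Gamma>,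
      which is irreducible over \<open>P\<close> and not \<open>G\<close>-stable itself.\<close>
    have ker: "w = 0" if w: "w \<in> V1" "E w = 0" for w
    proof -
      define K where "K = {w \<in> V1. E w \<in> {0}}"
      have "stable_sub fscale GL2 ind_act {0 :: 'f mat2 \<Rightarrow> 'k}"
        using I.ind.stable_sub_iff(1)[of "{0}"] by (auto simp: I.ind.Gstable_def)
      then have "stable_sub scp GL2 actp K" unfolding K_def by (rule hom_preimage[OF E V1st _ vsp])
      moreover have K\<Gamma>: "K \<subseteq> \<Gamma>"
      proof
        fix w assume "w \<in> K"
        then have "w \<in> V1" "E w mone = 0" by (simp_all add: K_def)
        then show "w \<in> \<Gamma>" using E0 by blast
      qed
      moreover have "K \<subseteq> R" using V1R by (auto simp: K_def)
      ultimately have KG: "R.Gstable K" using R.stable_sub_iff(1) by blast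
      then have "K = {0} \<or> K = \<Gamma>" using Girr[OF R.Gstable_Pstable K\<Gamma>] by blast
      then have "K = {0}" using KG nG by blast
      then show ?thesis using w by (auto simp: K_def)
    qed
    have inj: "inj_on E V1" by (rule hom_inj[OF E V1lin vsp ker])
    have EV: "I.ind.Gstable (E ` V1)"
      using hom_image[OF E V1st order_refl vsp] I.ind.stable_sub_iff(1)[of "E ` V1"] homD(1)[OF E] by blast
    have "z \<in> V1" using z(1) \<Gamma>V1 by blast
    then have "E z \<in> E ` V1 \<inter> I.Ind0" using z(1) E0[of z] homD(1)[OF E, of z] by simp
    moreover have "E z \<noteq> 0" using ker z \<Gamma>V1 by blast
    ultimately have im: "E ` V1 = Ind v \<chi>" using I.Gstable_Ind[OF EV] by blast
    have bij: "bij_betw E V1 (Ind v \<chi>)" using inj im by (simp add: bij_betw_def)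
    define Ei where "Ei = (\<lambda>f. if f \<in> Ind v \<chi> then inv_into V1 E f else 0)"
    have Ei: "Ei \<in> hom fscale GL2 (Ind v \<chi>) ind_act scp V1 actp"
      unfolding Ei_def by (rule hom_inv_into[OF E V1st bij])
    have EEi: "Ei f \<in> V1" "E (Ei f) = f" if "f \<in> Ind v \<chi>" for f
      using that bij by (auto simp: Ei_def bij_betw_def inv_into_into f_inv_into_f)
    have EiE: "Ei (E w) = w" if "w \<in> V1" for w
      using that inj homD(1)[OF E that] by (simp add: Ei_def)
    \<comment> \<open>Subtracting from \<open>y\<close> the point of \<Gamma> with the same first
      component leaves a vector with first component 0, which is outside \<Gamma> as
      \<open>y\<close> is.\<close>
    obtain c0 where c0: "c0 \<in> V1" "fst c0 = 0" "c0 \<notin> \<Gamma>"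
    proof -
      have fy: "fst y \<in> V" using yR by (simp add: R_def)
      then have "(fst y, \<phi> (fst y)) \<in> \<Gamma>" by (simp add: \<Gamma>_def)
      moreover from this have "y - (fst y, \<phi> (fst y)) \<in> V1" using yV1 \<Gamma>V1 R.vs.subspace_diff[OF V1s] by blast
      moreover have "y - (fst y, \<phi> (fst y)) \<notin> \<Gamma>"
      proof
        assume "y - (fst y, \<phi> (fst y)) \<in> \<Gamma>"
        then have "(y - (fst y, \<phi> (fst y))) + (fst y, \<phi> (fst y)) \<in> \<Gamma>"
          using calculation(1) R.vs.subspace_add[OF R.Pstable_subspace[OF \<Gamma>]] by blast
        then show False using y\<Gamma> by (simp only: diff_add_cancel)
      qed
      ultimately show thesis by (intro that[of "y - (fst y, \<phi> (fst y))"]) auto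
    qed
    have hm: "E c0 mone \<noteq> 0" using E0[OF c0(1)] c0(3) by blast
    define c1 where "c1 = scp (inverse (E c0 mone)) c0"
    have c1: "c1 \<in> V1" "fst c1 = 0" using c0 R.vs.subspace_scale[OF V1s] by (auto simp: c1_def)
    define h where "h = E c1"
    have hI: "h \<in> Ind v \<chi>" unfolding h_def by (rule homD(1)[OF E c1(1)])
    have h1: "h mone = 1" using homD(3)[OF E c0(1)] hm by (simp add: h_def c1_def fscale_def)
    \<comment> \<open>Modulo a multiple of \<open>c1\<close> such a vector falls into \<Gamma>, and
      the graph contains no nonzero vector with first component 0.\<close>
    have line: "w = scp (E w mone) c1" if w: "w \<in> V1" "fst w = 0" for w
    proof -
      define d where "d = w - scp (E w mone) c1"
      have sV: "scp (E w mone) c1 \<in> V1" using c1 R.vs.subspace_scale[OF V1s] by blast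
      have dV: "d \<in> V1" unfolding d_def using w sV R.vs.subspace_diff[OF V1s] by blast
      have "w = d + scp (E w mone) c1" by (simp add: d_def)
      then have "E w = E d + fscale (E w mone) h" using homD(2)[OF E dV sV] homD(3)[OF E c1(1)] by (simp add: h_def)
      then have "E w mone = (E d + fscale (E w mone) h) mone" by (rule fun_cong)
      then have "E d mone = 0" using h1 by (simp add: fscale_def)
      then have "d \<in> \<Gamma>" using E0[OF dV] by blast
      moreover have "fst d = 0" using w c1 by (simp add: d_def)
      ultimately have "d = 0" using \<phi>0 by (cases d) (simp add: \<Gamma>_def zero_prod_def)
      then show ?thesis by (simp add: d_def)
    qed
    \<comment> \<open>\<open>G\<close> acts on this line by a character, which evaluation at
      \<open>mone\<close> identifies with \<open>h\<close>.\<close>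
    have heig: "h (mmul a g) = h a * h g" if a: "a \<in> GL2" and g: "g \<in> GL2" for a g
    proof -
      have gc: "actp g c1 \<in> V1" using V1 g c1(1) by (simp add: R.Gstable_def)
      have "fst (actp g c1) = 0" using c1(2) g by simp
      then have "actp g c1 = scp (E (actp g c1) mone) c1" using line gc by blast
      then have "E (actp g c1) = E (scp (E (actp g c1) mone) c1)" by (rule arg_cong)
      then have eq: "ind_act g h = fscale (ind_act g h mone) h"
        using homD(4)[OF E g c1(1)] homD(3)[OF E c1(1)] by (simp add: h_def)
      have "ind_act g h mone = h g" by (simp add: I.ind_act_apply)
      then have "ind_act g h a = h g * h a" using eq by (metis fscale_def)
      then show ?thesis using a by (simp add: I.ind_act_apply mult.commute)
    qed
    define \<Psi> where "\<Psi> f = fst (Ei f)" for f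
    have \<Psi>hom: "\<Psi> \<in> hom fscale GL2 (Ind v \<chi>) ind_act sc V act"
    proof (rule homI)
      show "\<Psi> f \<in> V" if "f \<in> Ind v \<chi>" for f using EEi(1)[OF that] V1R by (auto simp: \<Psi>_def R_def)
      show "\<Psi> (f + f') = \<Psi> f + \<Psi> f'" if "f \<in> Ind v \<chi>" "f' \<in> Ind v \<chi>" for f f'
        using homD(2)[OF Ei that] by (simp add: \<Psi>_def)
      show "\<Psi> (fscale c f) = sc c (\<Psi> f)" if "f \<in> Ind v \<chi>" for f c using homD(3)[OF Ei that] by (simp add: \<Psi>_def)
      show "\<Psi> (ind_act g f) = act g (\<Psi> f)" if "g \<in> GL2" "f \<in> Ind v \<chi>" for g f using homD(4)[OF Ei that] by (simp add: \<Psi>_def)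
      show "\<Psi> f = 0" if "f \<notin> Ind v \<chi>" for f using that by (simp add: \<Psi>_def Ei_def)
    qed
    moreover have "\<Psi> ` Ind v \<chi> = V"
    proof
      show "\<Psi> ` Ind v \<chi> \<subseteq> V" using homD(1)[OF \<Psi>hom] by blast
      show "V \<subseteq> \<Psi> ` Ind v \<chi>"
      proof
        fix w assume "w \<in> V"
        then have w: "(w, \<phi> w) \<in> V1" using \<Gamma>V1 by (auto simp: \<Gamma>_def)
        then show "w \<in> \<Psi> ` Ind v \<chi>"
          using homD(1)[OF E w] EiE[OF w] by (intro image_eqI[of _ _ "E (w, \<phi> w)"]) (auto simp: \<Psi>_def)
      qed
    qed
    moreover have "\<Psi> f = 0 \<longleftrightarrow> (\<exists>c. f = fscale c h)" if f: "f \<in> Ind v \<chi>" for f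
    proof
      assume "\<Psi> f = 0"
      then have "Ei f = scp (E (Ei f) mone) c1" using line[OF EEi(1)[OF f]] by (simp add: \<Psi>_def)
      then have "E (Ei f) = E (scp (E (Ei f) mone) c1)" by (rule arg_cong)
      then have "f = fscale (f mone) h" using homD(3)[OF E c1(1)] EEi(2)[OF f] by (simp add: h_def)
      then show "\<exists>c. f = fscale c h" by blast
    next
      assume "\<exists>c. f = fscale c h"
      then obtain c where c: "f = fscale c h" by blast
      have "Ei h = c1" unfolding h_def by (rule EiE[OF c1(1)])
      then have "Ei f = scp c c1" using homD(3)[OF Ei hI, of c] c by simp
      then show "\<Psi> f = 0" using c1(2) by (simp add: \<Psi>_def)
    qed
    ultimately have "special_series v sc V act" using special_of_quotient[OF \<chi> hI h1 heig] by blast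
    then show ?thesis using ns by blast
  qed
qed

end

section \<open>The principal series case and the conclusion\<close>

lemma hom_Bor_principal_equivariant:
  assumes A: "gl2_rep v p \<pi> sc V act" and B: "gl2_rep v p \<pi> sc' V' act'"
    and ps: "principal_series v sc V act" and \<phi>: "\<phi> \<in> hom sc Bor V act sc' V' act'"
  shows "\<phi> \<in> hom sc GL2 V act sc' V' act'"
proof -
  interpret A: gl2_rep v p \<pi> sc V act by (rule A)
  interpret B: gl2_rep v p \<pi> sc' V' act' by (rule B)
  obtain \<chi> a d \<Phi> where \<chi>: "smooth_charT v \<chi>" "a \<noteq> 0" "d \<noteq> 0" "\<chi> a d \<noteq> \<chi> d a"
    and \<Phi>: "\<Phi> \<in> hom fscale GL2 (Ind v \<chi>) ind_act sc V act" "bij_betw \<Phi> (Ind v \<chi>) V"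
    using ps by (auto simp: principal_series_def iso_rep_def)
  interpret I: ind_target v p \<pi> \<chi> sc' V' act' by unfold_locales (use \<chi>(1) A.alg_closure in auto)
  define \<eta> where "\<eta> f = (if f \<in> Ind v \<chi> then \<phi> (\<Phi> f) else 0)" for f
  note \<Phi>B = hom_mono[OF Bor_subset_GL2 \<Phi>(1)]
  have "\<eta> \<in> hom fscale Bor (Ind v \<chi>) ind_act sc' V' act'"
  proof (rule homI)
    show "\<eta> f \<in> V'" if "f \<in> Ind v \<chi>" for f using that homD(1)[OF \<phi> homD(1)[OF \<Phi>(1) that]] by (simp add: \<eta>_def)
    show "\<eta> (f + f') = \<eta> f + \<eta> f'" if "f \<in> Ind v \<chi>" "f' \<in> Ind v \<chi>" for f f'
      using that I.Ind_add[OF that] homD(2)[OF \<Phi>(1) that] homD(2)[OF \<phi> homD(1)[OF \<Phi>(1) that(1)] homD(1)[OF \<Phi>(1) that(2)]]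
      by (simp add: \<eta>_def)
    show "\<eta> (fscale c f) = sc' c (\<eta> f)" if "f \<in> Ind v \<chi>" for f c
      using that I.Ind_fscale[OF that] homD(3)[OF \<Phi>(1) that] homD(3)[OF \<phi> homD(1)[OF \<Phi>(1) that]] by (simp add: \<eta>_def)
    show "\<eta> (ind_act g f) = act' g (\<eta> f)" if "g \<in> Bor" "f \<in> Ind v \<chi>" for g f
      using that I.Ind_act[OF that(2) Bor_GL2[OF that(1)]] homD(4)[OF \<Phi>B that] homD(4)[OF \<phi> that(1) homD(1)[OF \<Phi>(1) that(2)]]
      by (simp add: \<eta>_def)
  qed (simp add: \<eta>_def)
  then have \<eta>: "\<eta> \<in> hom fscale GL2 (Ind v \<chi>) ind_act sc' V' act'"
    using I.hom_Bor_Ind_equivariant \<chi>(2-4) by blast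
  show ?thesis
  proof (rule homI)
    show "\<phi> (act g x) = act' g (\<phi> x)" if g: "g \<in> GL2" and x: "x \<in> V" for g x
    proof -
      obtain f where f: "f \<in> Ind v \<chi>" "x = \<Phi> f" using \<Phi>(2) x by (auto simp: bij_betw_def)
      have "\<phi> (act g x) = \<eta> (ind_act g f)"
        using homD(4)[OF \<Phi>(1) g f(1)] I.Ind_act[OF f(1) g] f(2) by (simp add: \<eta>_def)
      also have "\<dots> = act' g (\<phi> x)" using homD(4)[OF \<eta> g f(1)] f by (simp add: \<eta>_def)
      finally show ?thesis .
    qed
  qed (use homD[OF \<phi>] in auto)
qed

theorem mainTheorem1:
  fixes v :: "'f::field \<Rightarrow> int" and p :: nat
    and sc :: "'k::field \<Rightarrow> 'v::ab_group_add \<Rightarrow> 'v" and V :: "'v set"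
    and act :: "'f mat2 \<Rightarrow> 'v \<Rightarrow> 'v"
    and sc' :: "'k \<Rightarrow> 'w::ab_group_add \<Rightarrow> 'w" and V' :: "'w set"
    and act' :: "'f mat2 \<Rightarrow> 'w \<Rightarrow> 'w"
  assumes "nonarch_local_field v p"
    and "alg_closure_Fp p TYPE('k)"
    and "smooth_rep v sc V act"
    and "smooth_rep v sc' V' act'"
    and "irred sc GL2 V act"
    and "has_central_char sc V act"
  shows "(principal_series v sc V act \<longrightarrow> rep_length sc Bor V act 2)
    \<and> (\<not> principal_series v sc V act \<longrightarrow> irred sc Bor V act)
    \<and> bij_betw (restrict0 {f\<in>Ind v triv_char. f mone = 0})
        (hom fscale GL2 (Ind v (triv_char :: 'f \<Rightarrow> 'f \<Rightarrow> 'k)) ind_act sc' V' act')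
        (hom fscale Bor {f\<in>Ind v triv_char. f mone = 0} ind_act sc' V' act')
    \<and> (\<not> special_series v sc V act \<longrightarrow>
        hom sc Bor V act sc' V' act' = hom sc GL2 V act sc' V' act')"
proof -
  obtain \<pi> where \<pi>: "\<pi> \<noteq> 0" "v \<pi> = 1" using assms(1) unfolding nonarch_local_field_def by blast
  obtain \<omega> where \<omega>: "\<And>z x. z \<noteq> 0 \<Longrightarrow> x \<in> V \<Longrightarrow> act (z,0,0,z) x = sc (\<omega> z) x"
    using assms(6) unfolding has_central_char_def by blast
  interpret rep_pair v p \<pi> sc V act \<omega> sc' V' act'
    by unfold_locales (use assms \<pi> \<omega> in auto)
  have "smooth_charT v (triv_char :: 'f \<Rightarrow> 'f \<Rightarrow> 'k)"
    unfolding smooth_charT_def triv_char_def using zero_less_one by auto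
  then interpret T: ind_target v p \<pi> triv_char sc' V' act'
    by unfold_locales (use assms in auto)
  have "hom sc Bor V act sc' V' act' = hom sc GL2 V act sc' V' act'" if ns: "\<not> special_series v sc V act"
  proof
    show "hom sc GL2 V act sc' V' act' \<subseteq> hom sc Bor V act sc' V' act'"
      using hom_mono[OF Bor_subset_GL2] by blast
    show "hom sc Bor V act sc' V' act' \<subseteq> hom sc GL2 V act sc' V' act'"
    proof (cases "principal_series v sc V act")
      case True
      then show ?thesis
        using hom_Bor_principal_equivariant[OF gl2_rep_axioms B.gl2_rep_axioms] by blast
    next
      case False
      then show ?thesis using hom_Bor_equivariant[OF irred_Bor_of_not_principal[OF assms(5) False] ns] by blast
    qed
  qed
  then show ?thesis
    using principal_series_rep_length irred_Bor_of_not_principal[OF assms(5)] T.restrict0_bij by blast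
qed

end
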